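(* Let $k$ be a principal ideal domain, $n\geq 2$ an integer, $E\in GL_n(k)$, and let $Z$ be a (left) $\mathcal{B}(E)$-Galois object. Then there exist an integer $m\geq 2$ and an invertible matrix $F\in GL_m(k)$ such that $\operatorname{Tr}(F^{-1}F^t)=\operatorname{Tr}(E^{-1}E^t)$ and such that $Z$ is isomorphic to $\mathcal{B}(E,F)$ as a $\mathcal{B}(E)$-Galois object.
   Context: Let $k$ be a commutative ring; $\otimes=\otimes_k$; $M^t$ denotes the transpose of a matrix $M$. Galois objects. Let $H$ be a Hopf algebra over $k$ and $Z$ a left $H$-comodule algebra with coaction $\delta:Z\to H\otimes Z$. Its coinvariants are $Z^{co H}=\{z\in Z\mid \delta(z)=1\otimes z\}$. $Z$ is a (left) $H$-Galois object if $Z^{co H}=k$, the canonical map $\operatorname{can}:Z\otimes Z\to H\otimes Z$, $z\otimes z'\mapsto\delta(z)(1\otimes z')$, is bijective, and $Z$ is faithfully flat over $k$. An isomorphism of $H$-Galois objects is an isomorphism of left $H$-comodule algebras. The Hopf algebra $\mathcal{B}(E)$. For $E\in GL_n(k)$, $\mathcal{B}(E)$ is the $k$-algebra generated by $a_{ij}$, $1\leq i,j\leq n$, subject to the matrix relations $E^{-1}a^tEa=I_n=aE^{-1}a^tE$ where $a=(a_{ij})$. It is a Hopf algebra with $\Delta(a_{ij})=\sum_{l=1}^n a_{il}\otimes a_{lj}$, $\varepsilon(a_{ij})=\delta_{ij}$, $S(a)=E^{-1}a^tE$. The algebra $\mathcal{B}(E,F)$. For $E\in GL_n(k)$, $F\in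 GL_m(k)$, $\mathcal{B}(E,F)$ is the $k$-algebra generated by $z_{ij}$, $1\leq i\leq n$, $1\leq j\leq m$, subject to the matrix relations $F^{-1}z^tEz=I_m$ and $zF^{-1}z^tE=I_n$ where $z=(z_{ij})$. It is a left $\mathcal{B}(E)$-comodule algebra via $\delta(z_{ij})=\sum_{l=1}^n a_{il}\otimes z_{lj}$. *)

theory Defs
  imports
    "Jordan_Normal_Form.VS_Connect"
    "HOL-Algebra.QuotRing"
    "HOL-Algebra.Ring_Divisibility"
    "HOL-Library.Poly_Mapping"
begin

hide_const (open) Multiset.mult Polynomial.smult Modules.module Modules.module_hom
  Ring_Hom.ring_hom

text \<open>
  The base ring is a type \<open>'k\<close> of class \<^class>\<open>comm_ring_1\<close>, seen as a \<open>HOL-Algebra\<close> ring through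
  \<^term>\<open>class_ring\<close>.  Modules and algebras over it are \<^typ>\<open>('k, 'a) module\<close> records; for a record
  that is only meant to be a module, the fields \<^const>\<open>monoid.mult\<close> and \<^const>\<open>monoid.one\<close> are
  irrelevant.
\<close>

section \<open>Matrices\<close>

definition mat_inv :: "'k::comm_ring_1 mat \<Rightarrow> 'k mat" where
  "mat_inv A = (THE B. inverts_mat A B \<and> inverts_mat B A)"

definition mat_trace :: "'k::comm_ring_1 mat \<Rightarrow> 'k" where
  "mat_trace A = (\<Sum>i<dim_row A. A $$ (i, i))"


section \<open>Algebras over a commutative ring\<close>

definition k_algebra :: "('k::comm_ring_1, 'a, 'm) module_scheme \<Rightarrow> bool" where
  "k_algebra A \<longleftrightarrow> ring A \<and> module class_ring A \<and>
    (\<forall>c. \<forall>x\<in>carrier A. \<forall>y\<in>carrier A.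
       (c \<odot>\<^bsub>A\<^esub> x) \<otimes>\<^bsub>A\<^esub> y = c \<odot>\<^bsub>A\<^esub> (x \<otimes>\<^bsub>A\<^esub> y) \<and>
       x \<otimes>\<^bsub>A\<^esub> (c \<odot>\<^bsub>A\<^esub> y) = c \<odot>\<^bsub>A\<^esub> (x \<otimes>\<^bsub>A\<^esub> y))"

definition alg_hom ::
  "('k::comm_ring_1, 'a, 'm) module_scheme \<Rightarrow> ('k, 'b, 'n) module_scheme \<Rightarrow> ('a \<Rightarrow> 'b) set" where
  "alg_hom A B = ring_hom A B \<inter> module_hom class_ring A B"

definition base_algebra :: "('k::comm_ring_1, 'k) module" where
  "base_algebra =
    \<lparr>carrier = UNIV, mult = (*), one = 1, zero = 0, add = (+), smult = (*)\<rparr>"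

text \<open>
  The monoid algebra \<open>k[G]\<close>.  Its underlying module is the free module on \<^term>\<open>carrier G\<close>.
\<close>

definition monoid_algebra ::
  "('g, 'x) monoid_scheme \<Rightarrow> ('k::comm_ring_1, 'g \<Rightarrow>\<^sub>0 'k) module" where
  "monoid_algebra G =
    \<lparr>carrier = {p. Poly_Mapping.keys p \<subseteq> carrier G},
     mult = (\<lambda>p q. \<Sum>x\<in>Poly_Mapping.keys p. \<Sum>y\<in>Poly_Mapping.keys q.
       Poly_Mapping.single (x \<otimes>\<^bsub>G\<^esub> y) (Poly_Mapping.lookup p x * Poly_Mapping.lookup q y)),
     one = Poly_Mapping.single \<one>\<^bsub>G\<^esub> 1,
     zero = 0,
     add = (+),
     smult = (\<lambda>c. Poly_Mapping.map ((*) c))\<rparr>"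

text \<open>
  Quotient by a submodule \<open>I\<close>, with multiplication induced from \<open>A\<close> (meaningful if \<open>I\<close> is a
  two-sided ideal).
\<close>

definition quot_algebra ::
  "('k::comm_ring_1, 'a, 'm) module_scheme \<Rightarrow> 'a set \<Rightarrow> ('k, 'a set) module" where
  "quot_algebra A I =
    \<lparr>carrier = a_rcosets\<^bsub>A\<^esub> I, mult = rcoset_mult A I, one = I +>\<^bsub>A\<^esub> \<one>\<^bsub>A\<^esub>, zero = I,
     add = set_add A, smult = (\<lambda>c X. \<Union>x\<in>X. I +>\<^bsub>A\<^esub> (c \<odot>\<^bsub>A\<^esub> x))\<rparr>"

text \<open>
  A map \<open>b\<close> on a basis extends linearly to the free module; if the extension is constant on the
  cosets of a submodule, it descends to the quotient.
\<close>

definition lin_ext ::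
  "('k::comm_ring_1, 'p, 'm) module_scheme \<Rightarrow> ('g \<Rightarrow> 'p) \<Rightarrow> ('g \<Rightarrow>\<^sub>0 'k) \<Rightarrow> 'p" where
  "lin_ext P b p = (\<Oplus>\<^bsub>P\<^esub>x\<in>Poly_Mapping.keys p. Poly_Mapping.lookup p x \<odot>\<^bsub>P\<^esub> b x)"

definition coset_ext ::
  "('k::comm_ring_1, 'p, 'm) module_scheme \<Rightarrow> ('g \<Rightarrow> 'p) \<Rightarrow> ('g \<Rightarrow>\<^sub>0 'k) set \<Rightarrow> 'p" where
  "coset_ext P b C = the_elem (lin_ext P b ` C)"


section \<open>Tensor products\<close>

definition tensor_gens ::
  "('k::comm_ring_1, 'a, 'm) module_scheme \<Rightarrow> ('k, 'b, 'n) module_scheme \<Rightarrow> ('a \<times> 'b \<Rightarrow>\<^sub>0 'k) set"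
  where
  "tensor_gens M N =
    {Poly_Mapping.single (x \<oplus>\<^bsub>M\<^esub> x', y) 1 - Poly_Mapping.single (x, y) 1
       - Poly_Mapping.single (x', y) 1 | x x' y.
       x \<in> carrier M \<and> x' \<in> carrier M \<and> y \<in> carrier N} \<union>
    {Poly_Mapping.single (x, y \<oplus>\<^bsub>N\<^esub> y') 1 - Poly_Mapping.single (x, y) 1
       - Poly_Mapping.single (x, y') 1 | x y y'.
       x \<in> carrier M \<and> y \<in> carrier N \<and> y' \<in> carrier N} \<union>
    {Poly_Mapping.single (c \<odot>\<^bsub>M\<^esub> x, y) 1 - Poly_Mapping.single (x, y) c | c x y.
       x \<in> carrier M \<and> y \<in> carrier N} \<union>
    {Poly_Mapping.single (x, c \<odot>\<^bsub>N\<^esub> y) 1 - Poly_Mapping.single (x, y) c | c x y.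
       x \<in> carrier M \<and> y \<in> carrier N}"

definition tensor_rel ::
  "('k::comm_ring_1, 'a, 'm) module_scheme \<Rightarrow> ('k, 'b, 'n) module_scheme \<Rightarrow> ('a \<times> 'b \<Rightarrow>\<^sub>0 'k) set"
  where
  "tensor_rel M N =
    LinearCombinations.module.span class_ring (monoid_algebra (M \<times>\<times> N)) (tensor_gens M N)"

text \<open>
  For algebras \<open>M\<close> and \<open>N\<close> the span of the bilinearity relations is a two-sided ideal of
  \<open>k[M \<times> N]\<close>, and the induced product is \<open>(x \<otimes> y)(x' \<otimes> y') = xx' \<otimes> yy'\<close>.
\<close>

definition tensor ::
  "('k::comm_ring_1, 'a, 'm) module_scheme \<Rightarrow> ('k, 'b, 'n) module_scheme \<Rightarrow>
   ('k, ('a \<times> 'b \<Rightarrow>\<^sub>0 'k) set) module" where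
  "tensor M N = quot_algebra (monoid_algebra (M \<times>\<times> N)) (tensor_rel M N)"

definition pure_tensor ::
  "('k::comm_ring_1, 'a, 'm) module_scheme \<Rightarrow> ('k, 'b, 'n) module_scheme \<Rightarrow> 'a \<Rightarrow> 'b \<Rightarrow>
   ('a \<times> 'b \<Rightarrow>\<^sub>0 'k) set" where
  "pure_tensor M N x y =
    tensor_rel M N +>\<^bsub>(monoid_algebra (M \<times>\<times> N) :: ('k, 'a \<times> 'b \<Rightarrow>\<^sub>0 'k) module)\<^esub>
      Poly_Mapping.single (x, y) 1"

definition tensor_lift ::
  "('k::comm_ring_1, 'p, 'm) module_scheme \<Rightarrow> ('a \<Rightarrow> 'b \<Rightarrow> 'p) \<Rightarrow> ('a \<times> 'b \<Rightarrow>\<^sub>0 'k) set \<Rightarrow> 'p" where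
  "tensor_lift P b = coset_ext P (\<lambda>(x, y). b x y)"

definition tensor_map ::
  "('k::comm_ring_1, 'a, 'm) module_scheme \<Rightarrow> ('k, 'b, 'n) module_scheme \<Rightarrow>
   ('c \<Rightarrow> 'a) \<Rightarrow> ('d \<Rightarrow> 'b) \<Rightarrow> ('c \<times> 'd \<Rightarrow>\<^sub>0 'k) set \<Rightarrow> ('a \<times> 'b \<Rightarrow>\<^sub>0 'k) set" where
  "tensor_map M N f g = tensor_lift (tensor M N) (\<lambda>x y. pure_tensor M N (f x) (g y))"

text \<open>The associativity isomorphism \<open>(L \<otimes> M) \<otimes> N \<rightarrow> L \<otimes> (M \<otimes> N)\<close>.\<close>

definition tensor_assoc ::
  "('k::comm_ring_1, 'a, 'l) module_scheme \<Rightarrow> ('k, 'b, 'm) module_scheme \<Rightarrow>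
   ('k, 'c, 'n) module_scheme \<Rightarrow>
   (('a \<times> 'b \<Rightarrow>\<^sub>0 'k) set \<times> 'c \<Rightarrow>\<^sub>0 'k) set \<Rightarrow> ('a \<times> ('b \<times> 'c \<Rightarrow>\<^sub>0 'k) set \<Rightarrow>\<^sub>0 'k) set" where
  "tensor_assoc L M N =
    tensor_lift (tensor L (tensor M N))
      (\<lambda>u z. tensor_lift (tensor L (tensor M N))
         (\<lambda>x y. pure_tensor L (tensor M N) x (pure_tensor M N y z)) u)"


section \<open>Faithful flatness\<close>

definition exact_at ::
  "('k, 'a, 'l) module_scheme \<Rightarrow> ('k, 'b, 'm) module_scheme \<Rightarrow> ('k, 'c, 'n) module_scheme \<Rightarrow>
   ('a \<Rightarrow> 'b) \<Rightarrow> ('b \<Rightarrow> 'c) \<Rightarrow> bool" where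
  "exact_at L M N f g \<longleftrightarrow> f ` carrier L = {x \<in> carrier M. g x = \<zero>\<^bsub>N\<^esub>}"

text \<open>
  \<open>Z\<close> is faithfully flat iff a sequence \<open>L \<rightarrow> M \<rightarrow> N\<close> of modules is exact precisely when
  \<open>Z \<otimes> L \<rightarrow> Z \<otimes> M \<rightarrow> Z \<otimes> N\<close> is.  HOL cannot quantify over modules on all types inside a
  definition, so \<open>L\<close>, \<open>M\<close>, \<open>N\<close> range over the modules whose elements lie in one fixed type.
  This is no restriction: as \<^typ>\<open>'z list\<close> is infinite, the type contains an isomorphic copy
  of every finitely generated module (a quotient of a finite free module), and on these faithful
  flatness can be tested, by \<open>0 \<rightarrow> I \<rightarrow> k\<close> for finitely generated ideals \<open>I\<close> and
  \<open>0 \<rightarrow> k/m \<rightarrow> 0\<close> for maximal ideals \<open>m\<close>.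
\<close>

definition faithfully_flat :: "('k::comm_ring_1, 'z, 'm) module_scheme \<Rightarrow> bool" where
  "faithfully_flat Z \<longleftrightarrow>
    (\<forall>(L :: ('k, ('z list \<Rightarrow>\<^sub>0 'k) set) module) (M :: ('k, ('z list \<Rightarrow>\<^sub>0 'k) set) module)
      (N :: ('k, ('z list \<Rightarrow>\<^sub>0 'k) set) module) f g.
      module class_ring L \<and> module class_ring M \<and> module class_ring N \<and>
      f \<in> module_hom class_ring L M \<and> g \<in> module_hom class_ring M N \<longrightarrow>
      (exact_at L M N f g \<longleftrightarrow>
       exact_at (tensor Z L) (tensor Z M) (tensor Z N)
         (tensor_map Z M (\<lambda>z. z) f) (tensor_map Z N (\<lambda>z. z) g)))"


section \<open>Comodule algebras and Galois objects\<close>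

text \<open>
  The structure maps of a Hopf algebra that enter the notions below.  The antipode does not: it is
  determined by comultiplication and counit.
\<close>

record (overloaded) ('k::zero, 'h) hopf = "('k, 'h) module" +
  comult :: "'h \<Rightarrow> ('h \<times> 'h \<Rightarrow>\<^sub>0 'k) set"
  counit :: "'h \<Rightarrow> 'k"

definition comodule_algebra ::
  "('k::comm_ring_1, 'h, 'x) hopf_scheme \<Rightarrow> ('k, 'z, 'm) module_scheme \<Rightarrow>
   ('z \<Rightarrow> ('h \<times> 'z \<Rightarrow>\<^sub>0 'k) set) \<Rightarrow> bool" where
  "comodule_algebra H Z \<delta> \<longleftrightarrow>
    k_algebra Z \<and> \<delta> \<in> alg_hom Z (tensor H Z) \<and>
    (\<forall>z\<in>carrier Z. tensor_assoc H H Z (tensor_map (tensor H H) Z (comult H) (\<lambda>x. x) (\<delta> z))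
                   = tensor_map H (tensor H Z) (\<lambda>h. h) \<delta> (\<delta> z)) \<and>
    (\<forall>z\<in>carrier Z. tensor_lift Z (\<lambda>h x. counit H h \<odot>\<^bsub>Z\<^esub> x) (\<delta> z) = z)"

definition coinvariants ::
  "('k::comm_ring_1, 'h, 'x) hopf_scheme \<Rightarrow> ('k, 'z, 'm) module_scheme \<Rightarrow>
   ('z \<Rightarrow> ('h \<times> 'z \<Rightarrow>\<^sub>0 'k) set) \<Rightarrow> 'z set" where
  "coinvariants H Z \<delta> = {z \<in> carrier Z. \<delta> z = pure_tensor H Z \<one>\<^bsub>H\<^esub> z}"

definition canonical_map ::
  "('k::comm_ring_1, 'h, 'x) hopf_scheme \<Rightarrow> ('k, 'z, 'm) module_scheme \<Rightarrow>
   ('z \<Rightarrow> ('h \<times> 'z \<Rightarrow>\<^sub>0 'k) set) \<Rightarrow> ('z \<times> 'z \<Rightarrow>\<^sub>0 'k) set \<Rightarrow> ('h \<times> 'z \<Rightarrow>\<^sub>0 'k) set" where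
  "canonical_map H Z \<delta> =
    tensor_lift (tensor H Z) (\<lambda>z z'. \<delta> z \<otimes>\<^bsub>tensor H Z\<^esub> pure_tensor H Z \<one>\<^bsub>H\<^esub> z')"

text \<open>
  \<open>Z\<^sup>c\<^sup>o\<^sup>H = k\<close> means that the unit map \<open>k \<rightarrow> Z\<close> is a bijection onto the coinvariants.
\<close>

definition galois_object ::
  "('k::comm_ring_1, 'h, 'x) hopf_scheme \<Rightarrow> ('k, 'z, 'm) module_scheme \<Rightarrow>
   ('z \<Rightarrow> ('h \<times> 'z \<Rightarrow>\<^sub>0 'k) set) \<Rightarrow> bool" where
  "galois_object H Z \<delta> \<longleftrightarrow>
    comodule_algebra H Z \<delta> \<and>
    bij_betw (\<lambda>c. c \<odot>\<^bsub>Z\<^esub> \<one>\<^bsub>Z\<^esub>) UNIV (coinvariants H Z \<delta>) \<and>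
    bij_betw (canonical_map H Z \<delta>) (carrier (tensor Z Z)) (carrier (tensor H Z)) \<and>
    faithfully_flat Z"

definition comodule_algebra_iso ::
  "('k::comm_ring_1, 'h, 'x) hopf_scheme \<Rightarrow>
   ('k, 'z, 'm) module_scheme \<Rightarrow> ('z \<Rightarrow> ('h \<times> 'z \<Rightarrow>\<^sub>0 'k) set) \<Rightarrow>
   ('k, 'y, 'n) module_scheme \<Rightarrow> ('y \<Rightarrow> ('h \<times> 'y \<Rightarrow>\<^sub>0 'k) set) \<Rightarrow> ('z \<Rightarrow> 'y) set" where
  "comodule_algebra_iso H Z \<delta> Y \<gamma> =
    {\<phi> \<in> alg_hom Z Y. bij_betw \<phi> (carrier Z) (carrier Y) \<and>
      (\<forall>z\<in>carrier Z. \<gamma> (\<phi> z) = tensor_map H Y (\<lambda>h. h) \<phi> (\<delta> z))}"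


section \<open>Algebras given by generators and relations\<close>

definition free_algebra :: "'x set \<Rightarrow> ('k::comm_ring_1, 'x list \<Rightarrow>\<^sub>0 'k) module" where
  "free_algebra X = monoid_algebra \<lparr>carrier = lists X, mult = (@), one = []\<rparr>"

definition presented_algebra ::
  "'x set \<Rightarrow> ('x list \<Rightarrow>\<^sub>0 'k::comm_ring_1) set \<Rightarrow> ('k, ('x list \<Rightarrow>\<^sub>0 'k) set) module" where
  "presented_algebra X R = quot_algebra (free_algebra X)
     (Idl\<^bsub>(free_algebra X :: ('k, 'x list \<Rightarrow>\<^sub>0 'k) module)\<^esub> R)"

definition generator ::
  "'x set \<Rightarrow> ('x list \<Rightarrow>\<^sub>0 'k::comm_ring_1) set \<Rightarrow> 'x \<Rightarrow> ('x list \<Rightarrow>\<^sub>0 'k) set" where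
  "generator X R x =
     (Idl\<^bsub>(free_algebra X :: ('k, 'x list \<Rightarrow>\<^sub>0 'k) module)\<^esub> R)
       +>\<^bsub>(free_algebra X :: ('k, 'x list \<Rightarrow>\<^sub>0 'k) module)\<^esub> Poly_Mapping.single [x] 1"

text \<open>
  The algebra map out of a presented algebra that sends the generator \<open>x\<close> to \<open>v x\<close>, for a family
  \<open>v\<close> satisfying the relations.
\<close>

definition presented_hom ::
  "('k::comm_ring_1, 'a, 'm) module_scheme \<Rightarrow> ('x \<Rightarrow> 'a) \<Rightarrow> ('x list \<Rightarrow>\<^sub>0 'k) set \<Rightarrow> 'a" where
  "presented_hom A v = coset_ext A (\<lambda>w. foldr (\<lambda>x y. v x \<otimes>\<^bsub>A\<^esub> y) w \<one>\<^bsub>A\<^esub>)"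


section \<open>The algebras B(E, F) and the Hopf algebra B(E)\<close>

text \<open>
  The generator \<open>z\<^sub>i\<^sub>j\<close> is the one-letter word \<open>[(i, j)]\<close>, with indices starting from 0.
\<close>

definition B_gens :: "'k::comm_ring_1 mat \<Rightarrow> 'k mat \<Rightarrow> (nat \<times> nat) set" where
  "B_gens E F = {..<dim_row E} \<times> {..<dim_row F}"

text \<open>
  The entries of \<open>F\<^sup>-\<^sup>1 z\<^sup>t E z - I\<^sub>m\<close> and of \<open>z F\<^sup>-\<^sup>1 z\<^sup>t E - I\<^sub>n\<close>, written out.
\<close>

definition B_rels :: "'k::comm_ring_1 mat \<Rightarrow> 'k mat \<Rightarrow> ((nat \<times> nat) list \<Rightarrow>\<^sub>0 'k) set" where
  "B_rels E F = (let n = dim_row E; m = dim_row F; F' = mat_inv F in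
    {(\<Sum>p<m. \<Sum>q<n. \<Sum>r<n. Poly_Mapping.single [(q, p), (r, j)] (F' $$ (i, p) * E $$ (q, r)))
       - Poly_Mapping.single [] (if i = j then 1 else 0) | i j. i < m \<and> j < m} \<union>
    {(\<Sum>p<m. \<Sum>q<m. \<Sum>r<n. Poly_Mapping.single [(i, p), (r, q)] (F' $$ (p, q) * E $$ (r, j)))
       - Poly_Mapping.single [] (if i = j then 1 else 0) | i j. i < n \<and> j < n})"

definition B_algebra ::
  "'k::comm_ring_1 mat \<Rightarrow> 'k mat \<Rightarrow> ('k, ((nat \<times> nat) list \<Rightarrow>\<^sub>0 'k) set) module" where
  "B_algebra E F = presented_algebra (B_gens E F) (B_rels E F)"

definition B_gen ::
  "'k::comm_ring_1 mat \<Rightarrow> 'k mat \<Rightarrow> nat \<Rightarrow> nat \<Rightarrow> ((nat \<times> nat) list \<Rightarrow>\<^sub>0 'k) set" where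
  "B_gen E F i j = generator (B_gens E F) (B_rels E F) (i, j)"

text \<open>
  The defining relations of \<open>B(E)\<close> are literally those of \<open>B(E, E)\<close>.
\<close>

definition B_hopf ::
  "'k::comm_ring_1 mat \<Rightarrow> ('k, ((nat \<times> nat) list \<Rightarrow>\<^sub>0 'k) set) hopf" where
  "B_hopf E = module.extend (B_algebra E E)
     (hopf.fields
        (presented_hom (tensor (B_algebra E E) (B_algebra E E))
           (\<lambda>(i, j). \<Oplus>\<^bsub>tensor (B_algebra E E) (B_algebra E E)\<^esub>l\<in>{..<dim_row E}.
              pure_tensor (B_algebra E E) (B_algebra E E) (B_gen E E i l) (B_gen E E l j)))
        (presented_hom base_algebra (\<lambda>(i, j). if i = j then 1 else 0)))"

definition B_coaction ::
  "'k::comm_ring_1 mat \<Rightarrow> 'k mat \<Rightarrow> ((nat \<times> nat) list \<Rightarrow>\<^sub>0 'k) set \<Rightarrow>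
   (((nat \<times> nat) list \<Rightarrow>\<^sub>0 'k) set \<times> ((nat \<times> nat) list \<Rightarrow>\<^sub>0 'k) set \<Rightarrow>\<^sub>0 'k) set" where
  "B_coaction E F =
     presented_hom (tensor (B_hopf E) (B_algebra E F))
       (\<lambda>(i, j). \<Oplus>\<^bsub>tensor (B_hopf E) (B_algebra E F)\<^esub>l\<in>{..<dim_row E}.
          pure_tensor (B_hopf E) (B_algebra E F) (B_gen E E i l) (B_gen E F l j))"

end

theory Submission
  imports Defs "HOL-Library.Countable"
begin

text \<open>
  Write \<open>W\<close> for the module of columns \<open>x \<in> Z\<^sup>n\<close> with \<open>\<delta>(x\<^sub>i) = \<Sum>\<^sub>l a\<^sub>i\<^sub>l \<otimes> x\<^sub>l\<close>.  The preimages of the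
  \<open>a\<^sub>i\<^sub>l \<otimes> 1\<close> under the canonical map lie, by flatness, in the image of \<open>Z \<otimes> W\<close>, and they span
  \<open>Z\<^sup>n\<close> over \<open>Z\<close>; so \<open>Z \<otimes> W\<close> is isomorphic to \<open>Z\<^sup>n\<close>, and by faithful flatness \<open>W\<close> is finitely
  generated.  It is torsion-free, hence free, and a basis is an \<open>n \<times> m\<close> matrix \<open>z\<close> with a
  two-sided inverse \<open>y\<close> over \<open>Z\<close>.  The entries of \<open>z\<^sup>t E z\<close> are coinvariant, so they are scalars
  and form the matrix \<open>F\<close>; the rows of \<open>y E\<^sup>-\<^sup>1\<close> lie in \<open>W\<close>, and their coordinates form its inverse.

  Hence there is a map of comodule algebras \<open>g : B(E, F) \<rightarrow> Z\<close>.  The composite of \<open>g \<otimes> id\<close> with the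
  canonical map is bijective: its image contains \<open>h \<otimes> x\<close> for all words \<open>h\<close> in the \<open>a\<^sub>i\<^sub>j\<close>, and it
  has a left inverse built from the algebra map \<open>B(E) \<rightarrow> B(E, F) \<otimes> Z\<^sup>o\<^sup>p\<close> that sends \<open>a\<^sub>i\<^sub>j\<close> to
  \<open>\<Sum>\<^sub>k z\<^sub>i\<^sub>k \<otimes> y\<^sub>k\<^sub>j\<close>.  So \<open>g \<otimes> id\<close> is bijective, and by faithful flatness \<open>g\<close> is.
\<close>

section \<open>Modules over the base ring\<close>

locale k_module =
  fixes M :: "('k::comm_ring_1, 'a, 'm) module_scheme" (structure)
  assumes module: "module class_ring M"

sublocale k_module \<subseteq> abelian_group M
  using module by (rule module.axioms(2))

context k_module
begin

lemma smult_closed [simp, intro]: "x \<in> carrier M \<Longrightarrow> c \<odot> x \<in> carrier M"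
  using module.smult_closed[OF module, of c x] by simp

lemma smult_add_left: "x \<in> carrier M \<Longrightarrow> (c + d) \<odot> x = c \<odot> x \<oplus> d \<odot> x"
  using module.smult_l_distr[OF module, of c d x] by simp

lemma smult_add_right:
  "x \<in> carrier M \<Longrightarrow> y \<in> carrier M \<Longrightarrow> c \<odot> (x \<oplus> y) = c \<odot> x \<oplus> c \<odot> y"
  using module.smult_r_distr[OF module, of c x y] by simp

lemma smult_smult: "x \<in> carrier M \<Longrightarrow> c \<odot> (d \<odot> x) = (c * d) \<odot> x"
  using module.smult_assoc1[OF module, of c d x] by simp

lemma smult_1 [simp]: "x \<in> carrier M \<Longrightarrow> 1 \<odot> x = x"
  using module.smult_one[OF module, of x] by simp

lemma smult_0 [simp]: "x \<in> carrier M \<Longrightarrow> 0 \<odot> x = \<zero>"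
  using module.smult_l_null[OF module, of x] by simp

lemma smult_zero [simp]: "c \<odot> \<zero> = \<zero>"
  using module.smult_r_null[OF module, of c] by simp

lemma smult_uminus: "x \<in> carrier M \<Longrightarrow> c \<odot> (\<ominus> x) = \<ominus> (c \<odot> x)"
  using module.smult_r_minus[OF module, of c x] by simp

lemma smult_minus_one: "x \<in> carrier M \<Longrightarrow> (- 1) \<odot> x = \<ominus> x"
  by (metis add.inv_equality add.left_inverse add.m_comm smult_0 smult_1 smult_add_left
      smult_closed)

lemma finsum_smult:
  "finite A \<Longrightarrow> f \<in> A \<rightarrow> carrier M \<Longrightarrow> c \<odot> (\<Oplus>i\<in>A. f i) = (\<Oplus>i\<in>A. c \<odot> f i)"
  using module.finsum_smult_ldistr[OF module, of A c f] by simp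

lemma smult_sum_left:
  "finite A \<Longrightarrow> x \<in> carrier M \<Longrightarrow> sum c A \<odot> x = (\<Oplus>i\<in>A. c i \<odot> x)"
  by (induction A rule: finite_induct) (simp_all add: smult_add_left Pi_def)

lemma finsum_swap:
  assumes "finite A" "finite B" "\<And>i j. i \<in> A \<Longrightarrow> j \<in> B \<Longrightarrow> f i j \<in> carrier M"
  shows "(\<Oplus>i\<in>A. \<Oplus>j\<in>B. f i j) = (\<Oplus>j\<in>B. \<Oplus>i\<in>A. f i j)"
  using assms(1,3)
proof (induction A rule: finite_induct)
  case empty
  then show ?case by simp
next
  case (insert a A)
  have "(\<Oplus>i\<in>insert a A. \<Oplus>j\<in>B. f i j) = (\<Oplus>j\<in>B. f a j) \<oplus> (\<Oplus>j\<in>B. \<Oplus>i\<in>A. f i j)"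
    using insert by (subst finsum_insert) (auto intro!: finsum_closed)
  also have "\<dots> = (\<Oplus>j\<in>B. f a j \<oplus> (\<Oplus>i\<in>A. f i j))"
    using insert by (subst finsum_addf) (auto intro!: finsum_closed)
  also have "\<dots> = (\<Oplus>j\<in>B. \<Oplus>i\<in>insert a A. f i j)"
    using insert by (intro finsum_cong') (auto intro!: finsum_closed)
  finally show ?case .
qed

text \<open>The Kronecker delta is kept as a scalar because the matrix identities over an algebra
  have right-hand sides of the shape delta times the unit. Both orientations of the equation
  \<open>i = j\<close> occur, according to the side from which a unit matrix is multiplied.\<close>

lemma finsum_delta:
  assumes "finite A" "i \<in> A" "\<And>j. j \<in> A \<Longrightarrow> x j \<in> carrier M"
  shows "(\<Oplus>j\<in>A. (if i = j then 1 else 0) \<odot> x j) = x i"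
    and "(\<Oplus>j\<in>A. (if j = i then 1 else 0) \<odot> x j) = x i"
proof -
  have "(\<Oplus>j\<in>A. (if i = j then 1 else 0) \<odot> x j) = (\<Oplus>j\<in>A. if i = j then x j else \<zero>)"
    using assms by (intro finsum_cong') auto
  then show "(\<Oplus>j\<in>A. (if i = j then 1 else 0) \<odot> x j) = x i"
    using assms add.finprod_singleton[of i A x] by auto
  moreover have "(\<lambda>j. (if j = i then 1 else 0) \<odot> x j) = (\<lambda>j. (if i = j then 1 else 0) \<odot> x j)"
    by auto
  ultimately show "(\<Oplus>j\<in>A. (if j = i then 1 else 0) \<odot> x j) = x i"
    by simp
qed

lemma minus_eq_iff:
  assumes "x \<in> carrier M" "y \<in> carrier M"
  shows "x \<ominus> y = \<zero> \<longleftrightarrow> x = y"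
proof
  assume "x \<ominus> y = \<zero>"
  then have "(x \<oplus> \<ominus> y) \<oplus> y = \<zero> \<oplus> y" by (simp add: a_minus_def)
  then show "x = y" using assms by (simp add: a_assoc l_neg)
qed (use assms in \<open>simp add: a_minus_def r_neg\<close>)

lemma submodule_def':
  "LinearCombinations.submodule class_ring N M \<longleftrightarrow>
     N \<subseteq> carrier M \<and> \<zero> \<in> N \<and> (\<forall>x\<in>N. \<forall>y\<in>N. x \<oplus> y \<in> N) \<and> (\<forall>c. \<forall>x\<in>N. c \<odot> x \<in> N)"
  using module by (auto simp: LinearCombinations.submodule_def)

lemma submodule_k_module:
  "LinearCombinations.submodule class_ring N M \<Longrightarrow> k_module (M\<lparr>carrier := N\<rparr>)"
  using module.submodule_is_module[OF module] by (simp add: k_module_def)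

lemma submodule_uminus:
  "LinearCombinations.submodule class_ring N M \<Longrightarrow> x \<in> N \<Longrightarrow> \<ominus> x \<in> N"
  by (metis smult_minus_one submodule_def' subsetD)

lemma submodule_finsum:
  assumes "LinearCombinations.submodule class_ring N M" "finite A" "\<And>i. i \<in> A \<Longrightarrow> f i \<in> N"
  shows "(\<Oplus>i\<in>A. f i) \<in> N"
  using assms(2,3)
proof (induction A rule: finite_induct)
  case (insert x F)
  with assms(1) show ?case
    unfolding submodule_def' by (subst finsum_insert) auto
qed (use assms(1) in \<open>auto simp: submodule_def'\<close>)

text \<open>The operation \<open>finsum\<close> consults the carrier of the record, so shrinking the
  carrier gives a formally different sum. For terms in the submodule the two agree, which lets sums
  in \<open>W\<close> be read inside the ambient power of \<open>Z\<close>.\<close>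

lemma finsum_submodule:
  assumes "LinearCombinations.submodule class_ring N M" "finite A" "\<And>i. i \<in> A \<Longrightarrow> f i \<in> N"
  shows "finsum (M\<lparr>carrier := N\<rparr>) f A = finsum M f A"
  using assms(2,3)
proof (induction A rule: finite_induct)
  case empty
  interpret N: k_module "M\<lparr>carrier := N\<rparr>" by (rule submodule_k_module[OF assms(1)])
  show ?case using N.finsum_empty by simp
next
  case (insert x F)
  interpret N: k_module "M\<lparr>carrier := N\<rparr>" by (rule submodule_k_module[OF assms(1)])
  have "N \<subseteq> carrier M" using assms(1) by (simp add: submodule_def')
  then have "finsum M f (insert x F) = f x \<oplus> finsum M f F"
    using insert by (intro finsum_insert) auto
  then show ?case using insert N.finsum_insert[of F x f] by auto
qed

end

section \<open>Linear maps, kernels and images\<close>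

lemma module_hom_iff:
  "f \<in> module_hom class_ring M N \<longleftrightarrow>
    (\<forall>x\<in>carrier M. f x \<in> carrier N) \<and>
    (\<forall>x\<in>carrier M. \<forall>y\<in>carrier M. f (x \<oplus>\<^bsub>M\<^esub> y) = f x \<oplus>\<^bsub>N\<^esub> f y) \<and>
    (\<forall>c. \<forall>x\<in>carrier M. f (c \<odot>\<^bsub>M\<^esub> x) = c \<odot>\<^bsub>N\<^esub> f x)"
  by (auto simp: LinearCombinations.module_hom_def)

lemma module_homI:
  assumes "\<And>x. x \<in> carrier M \<Longrightarrow> f x \<in> carrier N"
    and "\<And>x y. x \<in> carrier M \<Longrightarrow> y \<in> carrier M \<Longrightarrow> f (x \<oplus>\<^bsub>M\<^esub> y) = f x \<oplus>\<^bsub>N\<^esub> f y"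
    and "\<And>c x. x \<in> carrier M \<Longrightarrow> f (c \<odot>\<^bsub>M\<^esub> x) = c \<odot>\<^bsub>N\<^esub> f x"
  shows "f \<in> module_hom class_ring M N"
  using assms by (auto simp: module_hom_iff)

lemma hom_closed: "f \<in> module_hom class_ring M N \<Longrightarrow> x \<in> carrier M \<Longrightarrow> f x \<in> carrier N"
  by (simp add: module_hom_iff)

lemma hom_add:
  "f \<in> module_hom class_ring M N \<Longrightarrow> x \<in> carrier M \<Longrightarrow> y \<in> carrier M \<Longrightarrow>
    f (x \<oplus>\<^bsub>M\<^esub> y) = f x \<oplus>\<^bsub>N\<^esub> f y"
  by (simp add: module_hom_iff)

lemma hom_smult:
  "f \<in> module_hom class_ring M N \<Longrightarrow> x \<in> carrier M \<Longrightarrow> f (c \<odot>\<^bsub>M\<^esub> x) = c \<odot>\<^bsub>N\<^esub> f x"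
  by (simp add: module_hom_iff)

lemma hom_zero:
  assumes "k_module M" "k_module N" "f \<in> module_hom class_ring M N"
  shows "f \<zero>\<^bsub>M\<^esub> = \<zero>\<^bsub>N\<^esub>"
proof -
  interpret M: k_module M by fact
  interpret N: k_module N by fact
  have "f (0 \<odot>\<^bsub>M\<^esub> \<zero>\<^bsub>M\<^esub>) = 0 \<odot>\<^bsub>N\<^esub> f \<zero>\<^bsub>M\<^esub>" using assms(3) by (simp add: hom_smult del: M.smult_zero M.smult_0)
  then show ?thesis using assms(3) by (simp add: hom_closed)
qed

lemma hom_uminus:
  assumes "k_module M" "k_module N" "f \<in> module_hom class_ring M N" "x \<in> carrier M"
  shows "f (\<ominus>\<^bsub>M\<^esub> x) = \<ominus>\<^bsub>N\<^esub> f x"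
  using assms by (metis hom_closed hom_smult k_module.smult_minus_one)

lemma hom_minus:
  assumes "k_module M" "k_module N" "f \<in> module_hom class_ring M N" "x \<in> carrier M" "y \<in> carrier M"
  shows "f (x \<ominus>\<^bsub>M\<^esub> y) = f x \<ominus>\<^bsub>N\<^esub> f y"
proof -
  interpret M: k_module M by fact
  show ?thesis using assms by (simp add: a_minus_def hom_add hom_uminus)
qed

lemma hom_finsum:
  assumes "k_module M" "k_module N" "f \<in> module_hom class_ring M N" "finite A"
    "\<And>i. i \<in> A \<Longrightarrow> g i \<in> carrier M"
  shows "f (\<Oplus>\<^bsub>M\<^esub>i\<in>A. g i) = (\<Oplus>\<^bsub>N\<^esub>i\<in>A. f (g i))"
proof -
  interpret M: k_module M by fact
  interpret N: k_module N by fact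
  show ?thesis
    using assms(4,5)
    by (induction A rule: finite_induct)
      (auto simp: hom_zero[OF assms(1-3)] hom_add[OF assms(3)] hom_closed[OF assms(3)] Pi_def)
qed

lemma hom_inj_iff:
  assumes "k_module M" "k_module N" "f \<in> module_hom class_ring M N"
  shows "inj_on f (carrier M) \<longleftrightarrow> (\<forall>x\<in>carrier M. f x = \<zero>\<^bsub>N\<^esub> \<longrightarrow> x = \<zero>\<^bsub>M\<^esub>)"
proof -
  interpret M: k_module M by fact
  interpret N: k_module N by fact
  show ?thesis
  proof
    assume "inj_on f (carrier M)"
    then show "\<forall>x\<in>carrier M. f x = \<zero>\<^bsub>N\<^esub> \<longrightarrow> x = \<zero>\<^bsub>M\<^esub>"
      using hom_zero[OF assms] by (metis M.zero_closed inj_onD)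
  next
    assume *: "\<forall>x\<in>carrier M. f x = \<zero>\<^bsub>N\<^esub> \<longrightarrow> x = \<zero>\<^bsub>M\<^esub>"
    show "inj_on f (carrier M)"
    proof (rule inj_onI)
      fix x y assume xy: "x \<in> carrier M" "y \<in> carrier M" "f x = f y"
      then have "f (x \<ominus>\<^bsub>M\<^esub> y) = \<zero>\<^bsub>N\<^esub>"
        using assms by (simp add: hom_minus N.minus_eq_iff hom_closed)
      then show "x = y" using * xy M.minus_eq_iff[of x y] by simp
    qed
  qed
qed

lemma hom_compose:
  "f \<in> module_hom class_ring L M \<Longrightarrow> g \<in> module_hom class_ring M N \<Longrightarrow>
    (\<lambda>x. g (f x)) \<in> module_hom class_ring L N"
  by (auto simp: module_hom_iff)

lemma hom_id: "(\<lambda>x. x) \<in> module_hom class_ring M M"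
  by (auto simp: module_hom_iff)

lemma hom_plus:
  assumes "k_module N" "f \<in> module_hom class_ring M N" "g \<in> module_hom class_ring M N"
  shows "(\<lambda>x. f x \<oplus>\<^bsub>N\<^esub> g x) \<in> module_hom class_ring M N"
proof -
  interpret N: k_module N by fact
  show ?thesis
    using assms(2,3) by (auto simp: module_hom_iff N.a_ac N.smult_add_right)
qed

lemma hom_scale:
  assumes "k_module N" "f \<in> module_hom class_ring M N"
  shows "(\<lambda>x. c \<odot>\<^bsub>N\<^esub> f x) \<in> module_hom class_ring M N"
proof -
  interpret N: k_module N by fact
  show ?thesis
    using assms(2)
    by (auto simp: module_hom_iff N.smult_smult N.smult_add_right mult.commute)
qed

lemma hom_sum:
  assumes "k_module N" "finite A" "\<And>i. i \<in> A \<Longrightarrow> f i \<in> module_hom class_ring M N"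
  shows "(\<lambda>x. \<Oplus>\<^bsub>N\<^esub>i\<in>A. f i x) \<in> module_hom class_ring M N"
proof -
  interpret N: k_module N by fact
  have [simp]: "f i x \<in> carrier N" if "i \<in> A" "x \<in> carrier M" for i x
    using assms(3)[OF that(1)] that(2) by (rule hom_closed)
  show ?thesis
  proof (rule module_homI)
    fix x y assume xy: "x \<in> carrier M" "y \<in> carrier M"
    have "(\<Oplus>\<^bsub>N\<^esub>i\<in>A. f i (x \<oplus>\<^bsub>M\<^esub> y)) = (\<Oplus>\<^bsub>N\<^esub>i\<in>A. f i x \<oplus>\<^bsub>N\<^esub> f i y)"
      using xy by (intro N.finsum_cong') (auto simp: hom_add[OF assms(3)])
    also have "\<dots> = (\<Oplus>\<^bsub>N\<^esub>i\<in>A. f i x) \<oplus>\<^bsub>N\<^esub> (\<Oplus>\<^bsub>N\<^esub>i\<in>A. f i y)"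
      using xy by (intro N.finsum_addf) auto
    finally show "(\<Oplus>\<^bsub>N\<^esub>i\<in>A. f i (x \<oplus>\<^bsub>M\<^esub> y)) = (\<Oplus>\<^bsub>N\<^esub>i\<in>A. f i x) \<oplus>\<^bsub>N\<^esub> (\<Oplus>\<^bsub>N\<^esub>i\<in>A. f i y)" .
  next
    fix c x assume x: "x \<in> carrier M"
    have "(\<Oplus>\<^bsub>N\<^esub>i\<in>A. f i (c \<odot>\<^bsub>M\<^esub> x)) = (\<Oplus>\<^bsub>N\<^esub>i\<in>A. c \<odot>\<^bsub>N\<^esub> f i x)"
      using x by (intro N.finsum_cong') (auto simp: hom_smult[OF assms(3)])
    then show "(\<Oplus>\<^bsub>N\<^esub>i\<in>A. f i (c \<odot>\<^bsub>M\<^esub> x)) = c \<odot>\<^bsub>N\<^esub> (\<Oplus>\<^bsub>N\<^esub>i\<in>A. f i x)"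
      using x assms(2) by (subst N.finsum_smult) auto
  qed (auto intro!: N.finsum_closed)
qed

lemma hom_kernel_submodule:
  assumes "k_module M" "k_module N" "f \<in> module_hom class_ring M N"
  shows "LinearCombinations.submodule class_ring {x \<in> carrier M. f x = \<zero>\<^bsub>N\<^esub>} M"
proof -
  interpret M: k_module M by fact
  interpret N: k_module N by fact
  show ?thesis
    using hom_zero[OF assms] assms(3)
    by (auto simp: M.submodule_def' hom_add hom_smult)
qed

lemma hom_image_submodule:
  assumes "k_module M" "k_module N" "f \<in> module_hom class_ring M N"
  shows "LinearCombinations.submodule class_ring (f ` carrier M) N"
proof -
  interpret M: k_module M by fact
  interpret N: k_module N by fact
  have "\<zero>\<^bsub>N\<^esub> \<in> f ` carrier M" using hom_zero[OF assms] by (metis M.zero_closed imageI)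
  moreover have "f x \<oplus>\<^bsub>N\<^esub> f y \<in> f ` carrier M" if "x \<in> carrier M" "y \<in> carrier M" for x y
    using that assms(3) by (metis M.a_closed hom_add imageI)
  moreover have "c \<odot>\<^bsub>N\<^esub> f x \<in> f ` carrier M" if "x \<in> carrier M" for c x
    using that assms(3) by (metis M.smult_closed hom_smult imageI)
  ultimately show ?thesis
    using assms(3) by (auto simp: N.submodule_def' hom_closed)
qed

text \<open>The laws are inherited along a map onto the new carrier that respects the operations; it
  need not be injective. One lemma thus covers quotients (the coset map), structures carried along
  an injection, and records that share the relevant fields (the identity).\<close>

lemma k_module_image:
  assumes "k_module M" and car: "carrier Q = f ` carrier M"
    and add: "\<And>x y. x \<in> carrier M \<Longrightarrow> y \<in> carrier M \<Longrightarrow> f x \<oplus>\<^bsub>Q\<^esub> f y = f (x \<oplus>\<^bsub>M\<^esub> y)"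
    and zero: "\<zero>\<^bsub>Q\<^esub> = f \<zero>\<^bsub>M\<^esub>"
    and smult: "\<And>c x. x \<in> carrier M \<Longrightarrow> c \<odot>\<^bsub>Q\<^esub> f x = f (c \<odot>\<^bsub>M\<^esub> x)"
  shows "k_module Q"
proof -
  interpret M: k_module M by fact
  have "abelian_group Q"
    by (rule abelian_groupI)
      (auto simp: car add zero M.a_ac intro!: bexI[of _ "\<ominus>\<^bsub>M\<^esub> _"] M.r_neg arg_cong[of _ _ f])
  then have "module class_ring Q"
    by (intro moduleI class_cring.cring_axioms)
      (auto simp: car add zero smult M.smult_add_left M.smult_add_right M.smult_smult)
  then show ?thesis by (simp add: k_module_def)
qed

section \<open>Algebras and algebra maps\<close>

locale k_alg = k_module A + ring A for A :: "('k::comm_ring_1, 'a, 'm) module_scheme" (structure) +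
  assumes smult_mult_left:
      "\<And>c x y. x \<in> carrier A \<Longrightarrow> y \<in> carrier A \<Longrightarrow> (c \<odot> x) \<otimes> y = c \<odot> (x \<otimes> y)"
    and smult_mult_right:
      "\<And>c x y. x \<in> carrier A \<Longrightarrow> y \<in> carrier A \<Longrightarrow> x \<otimes> (c \<odot> y) = c \<odot> (x \<otimes> y)"

lemma k_alg_iff: "k_alg A \<longleftrightarrow> k_algebra A"
  by (auto simp: k_alg_def k_alg_axioms_def k_algebra_def k_module_def)

lemma k_alg_k_module: "k_alg A \<Longrightarrow> k_module A"
  by (simp add: k_alg_def)

lemma k_alg_image:
  assumes "k_alg M" and car: "carrier Q = f ` carrier M"
    and add: "\<And>x y. x \<in> carrier M \<Longrightarrow> y \<in> carrier M \<Longrightarrow> f x \<oplus>\<^bsub>Q\<^esub> f y = f (x \<oplus>\<^bsub>M\<^esub> y)"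
    and zero: "\<zero>\<^bsub>Q\<^esub> = f \<zero>\<^bsub>M\<^esub>"
    and smult: "\<And>c x. x \<in> carrier M \<Longrightarrow> c \<odot>\<^bsub>Q\<^esub> f x = f (c \<odot>\<^bsub>M\<^esub> x)"
    and mult: "\<And>x y. x \<in> carrier M \<Longrightarrow> y \<in> carrier M \<Longrightarrow> f x \<otimes>\<^bsub>Q\<^esub> f y = f (x \<otimes>\<^bsub>M\<^esub> y)"
    and one: "\<one>\<^bsub>Q\<^esub> = f \<one>\<^bsub>M\<^esub>"
  shows "k_alg Q"
proof -
  interpret M: k_alg M by fact
  interpret Q: k_module Q
    by (rule k_module_image[OF k_alg_k_module[OF assms(1)] car add zero smult])
  have "monoid Q"
    by (rule monoidI) (auto simp: car mult one M.m_assoc)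
  then have "ring Q"
    using Q.abelian_group_axioms
    by (intro ringI) (auto simp: car add mult M.l_distr M.r_distr)
  then show ?thesis
    by (intro k_alg.intro Q.k_module_axioms k_alg_axioms.intro)
      (auto simp: car smult mult M.smult_mult_left M.smult_mult_right)
qed

lemma alg_hom_iff:
  "f \<in> alg_hom A B \<longleftrightarrow> f \<in> module_hom class_ring A B \<and>
    (\<forall>x\<in>carrier A. \<forall>y\<in>carrier A. f (x \<otimes>\<^bsub>A\<^esub> y) = f x \<otimes>\<^bsub>B\<^esub> f y) \<and> f \<one>\<^bsub>A\<^esub> = \<one>\<^bsub>B\<^esub>"
  by (auto simp: alg_hom_def module_hom_iff Ring.ring_hom_def)

lemma alg_hom_linear: "f \<in> alg_hom A B \<Longrightarrow> f \<in> module_hom class_ring A B"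
  by (simp add: alg_hom_iff)

lemma alg_hom_mult:
  "f \<in> alg_hom A B \<Longrightarrow> x \<in> carrier A \<Longrightarrow> y \<in> carrier A \<Longrightarrow> f (x \<otimes>\<^bsub>A\<^esub> y) = f x \<otimes>\<^bsub>B\<^esub> f y"
  by (simp add: alg_hom_iff)

lemma alg_hom_one: "f \<in> alg_hom A B \<Longrightarrow> f \<one>\<^bsub>A\<^esub> = \<one>\<^bsub>B\<^esub>"
  by (simp add: alg_hom_iff)

section \<open>Quotients\<close>

lemma (in k_module) submodule_abelian_subgroup:
  assumes "LinearCombinations.submodule class_ring I M"
  shows "abelian_subgroup I M"
proof (rule abelian_subgroupI3)
  show "additive_subgroup I M"
    using assms submodule_uminus[OF assms] unfolding submodule_def'
    by (intro additive_subgroup.intro add.subgroupI) (auto simp: a_inv_def)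
qed (rule abelian_group_axioms)

locale quotient = k_module A for A :: "('k::comm_ring_1, 'a, 'm) module_scheme" (structure) +
  fixes I
  assumes sub: "LinearCombinations.submodule class_ring I A"
begin

interpretation S: abelian_subgroup I A by (rule submodule_abelian_subgroup[OF sub])

lemma quot_carrier: "carrier (quot_algebra A I) = (+>) I ` carrier A"
  by (auto simp: quot_algebra_def A_RCOSETS_def' a_r_coset_def)

lemma quot_add:
  "x \<in> carrier A \<Longrightarrow> y \<in> carrier A \<Longrightarrow>
    (I +> x) \<oplus>\<^bsub>quot_algebra A I\<^esub> (I +> y) = I +> (x \<oplus> y)"
  by (simp add: quot_algebra_def S.a_rcos_sum)

lemma quot_zero: "\<zero>\<^bsub>quot_algebra A I\<^esub> = I +> \<zero>"
  using S.a_subset by (simp add: quot_algebra_def)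

lemma quot_eq_iff:
  assumes "x \<in> carrier A" "y \<in> carrier A"
  shows "I +> x = I +> y \<longleftrightarrow> x \<ominus> y \<in> I"
proof
  assume "I +> x = I +> y"
  then have "x \<in> I +> y" using S.a_rcos_self[OF assms(1)] by simp
  then show "x \<ominus> y \<in> I" using S.a_rcos_module[OF assms(2,1)] by (simp add: a_minus_def)
next
  assume "x \<ominus> y \<in> I"
  then have "x \<in> I +> y" using S.a_rcos_module[OF assms(2,1)] by (simp add: a_minus_def)
  then show "I +> x = I +> y"
    using a_repr_independence[OF _ assms(2) S.a_subgroup, of x] by simp
qed

text \<open>In the quotient record a multiple of a coset is a union over all its representatives.
  Since \<open>I\<close> is closed under scalars, every representative contributes the same
  coset.\<close>

lemma quot_smult:
  assumes "x \<in> carrier A"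
  shows "c \<odot>\<^bsub>quot_algebra A I\<^esub> (I +> x) = I +> (c \<odot> x)"
proof -
  have "I +> (c \<odot> y) = I +> (c \<odot> x)" if "y \<in> I +> x" for y
  proof -
    have y: "y \<in> carrier A" using that a_r_coset_subset_G[OF S.a_subset assms] by blast
    then have "y \<ominus> x \<in> I"
      using that S.a_rcos_module[OF assms y] by (simp add: a_minus_def)
    then have "c \<odot> (y \<ominus> x) \<in> I" using sub by (simp add: submodule_def')
    then show ?thesis using y assms
      by (simp add: quot_eq_iff a_minus_def smult_add_right smult_uminus)
  qed
  moreover have "x \<in> I +> x" using S.a_rcos_self assms by blast
  ultimately have "(\<Union>y\<in>I +> x. I +> (c \<odot> y)) = I +> (c \<odot> x)" by blast
  then show ?thesis by (simp add: quot_algebra_def)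
qed

lemma quot_module: "k_module (quot_algebra A I)"
  by (rule k_module_image[OF k_module_axioms quot_carrier quot_add quot_zero quot_smult]) auto

lemma proj_linear: "(+>) I \<in> module_hom class_ring A (quot_algebra A I)"
  by (rule module_homI) (simp_all add: quot_carrier quot_add quot_smult)

text \<open>This gives meaning to \<open>coset_ext\<close>, which reads off the only element of the
  image of a coset: a linear map that kills \<open>I\<close> is constant on cosets.\<close>

lemma the_elem_image_coset:
  assumes "k_module P" "g \<in> module_hom class_ring A P"
    and "\<And>y. y \<in> I \<Longrightarrow> g y = \<zero>\<^bsub>P\<^esub>"
    and "x \<in> carrier A"
  shows "the_elem (g ` (I +> x)) = g x"
proof -
  interpret P: k_module P by fact
  have "g y = g x" if y: "y \<in> I +> x" for y
  proof -
    obtain h where h: "h \<in> I" "y = h \<oplus> x" using y by (auto simp: a_r_coset_def')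
    then show ?thesis
      using assms S.a_subset by (auto simp: hom_add hom_closed subsetD)
  qed
  moreover have "x \<in> I +> x" using S.a_rcos_self assms by blast
  ultimately have "g ` (I +> x) = {g x}" by blast
  then show ?thesis by simp
qed

end

locale alg_quotient = k_alg A for A :: "('k::comm_ring_1, 'a, 'm) module_scheme" (structure) +
  fixes I
  assumes ideal: "ideal I A"
begin

text \<open>A ring ideal is closed under scalars because
  \<open>c \<odot> x = (c \<odot> \<one>) \<otimes> x\<close>.\<close>

lemma ideal_submodule: "LinearCombinations.submodule class_ring I A"
proof -
  interpret ideal I A by (rule ideal)
  have "c \<odot> x \<in> I" if "x \<in> I" for c x
  proof -
    have x: "x \<in> carrier A" using that by (rule Icarr)
    have "(c \<odot> \<one>) \<otimes> x \<in> I" using that x by (intro I_l_closed) auto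
    then show ?thesis using x by (simp add: smult_mult_left)
  qed
  then show ?thesis
    using a_subset by (auto simp: submodule_def')
qed

sublocale quotient A I
  by (intro quotient.intro quotient_axioms.intro k_module_axioms ideal_submodule)

lemma quot_mult:
  "x \<in> carrier A \<Longrightarrow> y \<in> carrier A \<Longrightarrow>
    (I +> x) \<otimes>\<^bsub>quot_algebra A I\<^esub> (I +> y) = I +> (x \<otimes> y)"
  by (simp add: quot_algebra_def ideal.rcoset_mult_add[OF ideal])

lemma quot_one: "\<one>\<^bsub>quot_algebra A I\<^esub> = I +> \<one>"
  by (simp add: quot_algebra_def)

lemma quot_alg: "k_alg (quot_algebra A I)"
  by (rule k_alg_image[OF k_alg_axioms quot_carrier quot_add quot_zero quot_smult quot_mult quot_one])
    auto

end

section \<open>Monoid algebras\<close>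

lemma monoid_algebra_simps [simp]:
  "carrier (monoid_algebra G) = {p. Poly_Mapping.keys p \<subseteq> carrier G}"
  "\<one>\<^bsub>monoid_algebra G\<^esub> = Poly_Mapping.single \<one>\<^bsub>G\<^esub> 1"
  "\<zero>\<^bsub>monoid_algebra G\<^esub> = 0"
  "p \<oplus>\<^bsub>monoid_algebra G\<^esub> q = p + q"
  "c \<odot>\<^bsub>monoid_algebra G\<^esub> p = Poly_Mapping.map ((*) c) p"
  by (simp_all add: monoid_algebra_def)

lemma lookup_scale [simp]:
  "Poly_Mapping.lookup (Poly_Mapping.map ((*) c) p) k = c * Poly_Mapping.lookup p (k :: 'g)"
  for c :: "'k::comm_ring_1"
  by transfer (simp add: when_def)

lemma keys_scale: "Poly_Mapping.keys (Poly_Mapping.map ((*) c) p) \<subseteq> Poly_Mapping.keys p"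
  for c :: "'k::comm_ring_1"
  by (auto simp: in_keys_iff)

lemma keys_add_subset:
  "Poly_Mapping.keys p \<subseteq> A \<Longrightarrow> Poly_Mapping.keys q \<subseteq> A \<Longrightarrow> Poly_Mapping.keys (p + q) \<subseteq> A"
  by (metis Poly_Mapping.keys_add Un_least order_trans)

lemma keys_minus_subset:
  "Poly_Mapping.keys p \<subseteq> A \<Longrightarrow> Poly_Mapping.keys q \<subseteq> A \<Longrightarrow> Poly_Mapping.keys (p - q) \<subseteq> A"
  for p q :: "'g \<Rightarrow>\<^sub>0 'k::comm_ring_1"
  by (auto simp: in_keys_iff lookup_minus subset_iff) (metis diff_0_right)

lemma keys_uminus [simp]: "Poly_Mapping.keys (- p) = Poly_Mapping.keys p"
  for p :: "'g \<Rightarrow>\<^sub>0 'k::comm_ring_1"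
  by (auto simp: in_keys_iff)

lemma k_module_monoid_algebra: "k_module (monoid_algebra G :: ('k::comm_ring_1, 'g \<Rightarrow>\<^sub>0 'k) module)"
proof -
  let ?A = "monoid_algebra G :: ('k, 'g \<Rightarrow>\<^sub>0 'k) module"
  have "abelian_group ?A"
  proof (rule abelian_groupI)
    fix x assume "x \<in> carrier ?A"
    then show "\<exists>y\<in>carrier ?A. y \<oplus>\<^bsub>?A\<^esub> x = \<zero>\<^bsub>?A\<^esub>"
      by (intro bexI[of _ "- x"]) auto
  qed (auto simp: keys_add_subset add_ac)
  then have "module class_ring ?A"
  proof (intro moduleI class_cring.cring_axioms)
    fix a x assume "x \<in> carrier ?A"
    then show "a \<odot>\<^bsub>?A\<^esub> x \<in> carrier ?A"
      using keys_scale[of a x] by auto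
  qed (auto intro!: poly_mapping_eqI simp: lookup_add algebra_simps)
  then show ?thesis by (simp add: k_module_def)
qed

interpretation MA: k_module "monoid_algebra G :: ('k::comm_ring_1, 'g \<Rightarrow>\<^sub>0 'k) module" for G
  by (rule k_module_monoid_algebra)

lemma monoid_algebra_uminus:
  assumes "p \<in> carrier (monoid_algebra G)"
  shows "\<ominus>\<^bsub>monoid_algebra G\<^esub> p = - p"
  by (rule MA.minus_equality) (use assms in auto)

lemma monoid_algebra_minus:
  assumes "q \<in> carrier (monoid_algebra G)"
  shows "p \<ominus>\<^bsub>monoid_algebra G\<^esub> q = p - q"
  using assms by (simp add: a_minus_def monoid_algebra_uminus)

lemma scale_single:
  "Poly_Mapping.map ((*) c) (Poly_Mapping.single x d) = Poly_Mapping.single x (c * d)"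
  for c :: "'k::comm_ring_1"
  by (rule poly_mapping_eqI) (simp add: lookup_single when_def)

text \<open>Induction on the size of the support, removing the monomial at one key. All later
  arguments that an identity may be checked on monomials go through this rule.\<close>

lemma monoid_algebra_induct [consumes 1, case_names zero step]:
  fixes p :: "'g \<Rightarrow>\<^sub>0 'k::comm_ring_1"
  assumes "Poly_Mapping.keys p \<subseteq> S" "Q 0"
    and "\<And>x c q. x \<in> S \<Longrightarrow> Poly_Mapping.keys q \<subseteq> S \<Longrightarrow> Q q \<Longrightarrow> Q (Poly_Mapping.single x c + q)"
  shows "Q p"
  using assms(1)
proof (induction "card (Poly_Mapping.keys p)" arbitrary: p)
  case 0
  then show ?case using assms(2) by simp
next
  case (Suc n)
  then obtain x where x: "x \<in> Poly_Mapping.keys p" by (metis card.empty all_not_in_conv nat.simps(3))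
  define q where "q = p - Poly_Mapping.single x (Poly_Mapping.lookup p x)"
  have k: "Poly_Mapping.keys q = Poly_Mapping.keys p - {x}"
    by (auto simp: q_def in_keys_iff lookup_minus lookup_single when_def split: if_splits)
  then have "Q q"
    using Suc x by (intro Suc(1)) auto
  then have "Q (Poly_Mapping.single x (Poly_Mapping.lookup p x) + q)"
    using Suc x k by (intro assms(3)) auto
  then show ?case by (simp add: q_def)
qed

text \<open>Coefficients may cancel, so the support of a sum can be smaller than the union of the
  supports. Summing over any finite set that contains the support makes additivity of
  \<open>lin_ext\<close> a termwise statement.\<close>

lemma lin_ext_superset:
  assumes "k_module P" "finite S" "Poly_Mapping.keys p \<subseteq> S" "\<And>x. x \<in> S \<Longrightarrow> b x \<in> carrier P"
  shows "lin_ext P b p = (\<Oplus>\<^bsub>P\<^esub>x\<in>S. Poly_Mapping.lookup p x \<odot>\<^bsub>P\<^esub> b x)"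
proof -
  interpret P: k_module P by fact
  show ?thesis
    unfolding lin_ext_def
    by (rule P.add.finprod_mono_neutral_cong_left)
      (use assms in \<open>auto simp: not_in_keys_iff_lookup_eq_zero\<close>)
qed

lemma lin_ext_hom:
  fixes P :: "('k::comm_ring_1, 'p, 'm) module_scheme" and G :: "('g, 'x) monoid_scheme"
  assumes "k_module P" "\<And>x. x \<in> carrier G \<Longrightarrow> b x \<in> carrier P"
  shows "lin_ext P b \<in> module_hom class_ring (monoid_algebra G) P"
proof (rule module_homI)
  interpret P: k_module P by fact
  fix p :: "'g \<Rightarrow>\<^sub>0 'k" assume p: "p \<in> carrier (monoid_algebra G)"
  then have b: "x \<in> Poly_Mapping.keys p \<Longrightarrow> b x \<in> carrier P" for x using assms(2) by auto
  then show "lin_ext P b p \<in> carrier P"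
    by (auto simp: lin_ext_def intro!: P.finsum_closed)
  show "lin_ext P b (c \<odot>\<^bsub>monoid_algebra G\<^esub> p) = c \<odot>\<^bsub>P\<^esub> lin_ext P b p" for c
  proof -
    have "lin_ext P b (Poly_Mapping.map ((*) c) p) =
        (\<Oplus>\<^bsub>P\<^esub>x\<in>Poly_Mapping.keys p. (c * Poly_Mapping.lookup p x) \<odot>\<^bsub>P\<^esub> b x)"
      using b keys_scale[of c p] by (subst lin_ext_superset[OF assms(1), of "Poly_Mapping.keys p"]) auto
    also have "\<dots> = (\<Oplus>\<^bsub>P\<^esub>x\<in>Poly_Mapping.keys p. c \<odot>\<^bsub>P\<^esub> (Poly_Mapping.lookup p x \<odot>\<^bsub>P\<^esub> b x))"
      using b by (intro P.finsum_cong') (auto simp: P.smult_smult)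
    also have "\<dots> = c \<odot>\<^bsub>P\<^esub> lin_ext P b p"
      unfolding lin_ext_def using b by (intro P.finsum_smult[symmetric]) auto
    finally show ?thesis by simp
  qed
  fix q :: "'g \<Rightarrow>\<^sub>0 'k" assume q: "q \<in> carrier (monoid_algebra G)"
  let ?S = "Poly_Mapping.keys p \<union> Poly_Mapping.keys q"
  have bS: "x \<in> ?S \<Longrightarrow> b x \<in> carrier P" for x using p q assms(2) by auto
  have "lin_ext P b (p + q) =
      (\<Oplus>\<^bsub>P\<^esub>x\<in>?S. (Poly_Mapping.lookup p x + Poly_Mapping.lookup q x) \<odot>\<^bsub>P\<^esub> b x)"
    using bS Poly_Mapping.keys_add[of p q]
    by (subst lin_ext_superset[OF assms(1), of ?S]) (auto simp: lookup_add)
  also have "\<dots> = (\<Oplus>\<^bsub>P\<^esub>x\<in>?S. Poly_Mapping.lookup p x \<odot>\<^bsub>P\<^esub> b x \<oplus>\<^bsub>P\<^esub> Poly_Mapping.lookup q x \<odot>\<^bsub>P\<^esub> b x)"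
    using bS by (intro P.finsum_cong') (auto simp: P.smult_add_left)
  also have "\<dots> = (\<Oplus>\<^bsub>P\<^esub>x\<in>?S. Poly_Mapping.lookup p x \<odot>\<^bsub>P\<^esub> b x) \<oplus>\<^bsub>P\<^esub>
      (\<Oplus>\<^bsub>P\<^esub>x\<in>?S. Poly_Mapping.lookup q x \<odot>\<^bsub>P\<^esub> b x)"
    using bS by (intro P.finsum_addf) auto
  also have "\<dots> = lin_ext P b p \<oplus>\<^bsub>P\<^esub> lin_ext P b q"
    using bS by (subst (1 2) lin_ext_superset[OF assms(1), of ?S]) auto
  finally show "lin_ext P b (p \<oplus>\<^bsub>monoid_algebra G\<^esub> q) = lin_ext P b p \<oplus>\<^bsub>P\<^esub> lin_ext P b q" by simp
qed

lemma lin_ext_single: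
  assumes "k_module P" "b x \<in> carrier P"
  shows "lin_ext P b (Poly_Mapping.single x c) = c \<odot>\<^bsub>P\<^esub> b x"
proof -
  interpret P: k_module P by fact
  show ?thesis
    using lin_ext_superset[OF assms(1), of "{x}" "Poly_Mapping.single x c" b] assms(2)
    by (auto split: if_splits simp: P.finsum_insert)
qed

lemma monoid_algebra_mult:
  "p \<otimes>\<^bsub>monoid_algebra G\<^esub> q =
    (\<Sum>x\<in>Poly_Mapping.keys p. \<Sum>y\<in>Poly_Mapping.keys q.
       Poly_Mapping.single (x \<otimes>\<^bsub>G\<^esub> y) (Poly_Mapping.lookup p x * Poly_Mapping.lookup q y))"
  by (simp add: monoid_algebra_def)

lemma monoid_algebra_distrib_right:
  "(p + q) \<otimes>\<^bsub>monoid_algebra G\<^esub> r = p \<otimes>\<^bsub>monoid_algebra G\<^esub> r + q \<otimes>\<^bsub>monoid_algebra G\<^esub> r"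
  unfolding monoid_algebra_mult
  by (rule setsum_keys_plus_distrib) (simp_all add: ring_distribs single_add sum.distrib)

lemma monoid_algebra_distrib_left:
  "r \<otimes>\<^bsub>monoid_algebra G\<^esub> (p + q) = r \<otimes>\<^bsub>monoid_algebra G\<^esub> p + r \<otimes>\<^bsub>monoid_algebra G\<^esub> q"
  unfolding monoid_algebra_mult
  by (subst (1 2 3) sum.swap, rule setsum_keys_plus_distrib)
    (simp_all add: ring_distribs single_add sum.distrib)

lemma monoid_algebra_mult_single [simp]:
  "Poly_Mapping.single x c \<otimes>\<^bsub>monoid_algebra G\<^esub> Poly_Mapping.single y d =
    Poly_Mapping.single (x \<otimes>\<^bsub>G\<^esub> y) (c * d)"
  unfolding monoid_algebra_mult by (cases "c = 0"; cases "d = 0") auto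

lemma monoid_algebra_mult_0 [simp]:
  "0 \<otimes>\<^bsub>monoid_algebra G\<^esub> p = 0" "p \<otimes>\<^bsub>monoid_algebra G\<^esub> 0 = 0"
  by (simp_all add: monoid_algebra_mult)

lemma scale_add:
  "Poly_Mapping.map ((*) c) (p + q) = Poly_Mapping.map ((*) c) p + Poly_Mapping.map ((*) c) q"
  for c :: "'k::comm_ring_1"
  by (rule poly_mapping_eqI) (simp add: lookup_add algebra_simps)

lemma scale_zero [simp]: "Poly_Mapping.map ((*) c) 0 = 0" for c :: "'k::comm_ring_1"
  by (rule poly_mapping_eqI) simp

lemma monoid_algebra_closed:
  assumes "monoid G" "Poly_Mapping.keys p \<subseteq> carrier G" "Poly_Mapping.keys q \<subseteq> carrier G"
  shows "Poly_Mapping.keys (p \<otimes>\<^bsub>monoid_algebra G\<^esub> q) \<subseteq> carrier G"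
proof -
  interpret monoid G by fact
  show ?thesis using assms(2)
  proof (induction rule: monoid_algebra_induct)
    case (step x c p)
    have "Poly_Mapping.keys (Poly_Mapping.single x c \<otimes>\<^bsub>monoid_algebra G\<^esub> q) \<subseteq> carrier G"
      using assms(3)
    proof (induction rule: monoid_algebra_induct)
      case (step y d q)
      have "Poly_Mapping.keys (Poly_Mapping.single (x \<otimes>\<^bsub>G\<^esub> y) (c * d)) \<subseteq> carrier G"
        using \<open>x \<in> carrier G\<close> \<open>y \<in> carrier G\<close> by auto
      with step.IH show ?case
        by (simp add: monoid_algebra_distrib_left keys_add_subset del: keys_single)
    qed simp
    with step.IH show ?case by (simp add: monoid_algebra_distrib_right keys_add_subset)
  qed simp
qed

text \<open>Every law is multilinear, so it reduces to monomials one argument at a time. For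
  associativity the stages are two monomials and a general element (\<open>assoc1\<close>), one
  monomial (\<open>assoc2\<close>), none (\<open>assoc\<close>).\<close>

lemma k_alg_monoid_algebra:
  assumes "monoid G"
  shows "k_alg (monoid_algebra G :: ('k::comm_ring_1, 'g \<Rightarrow>\<^sub>0 'k) module)"
proof -
  let ?A = "monoid_algebra G :: ('k, 'g \<Rightarrow>\<^sub>0 'k) module"
  interpret G: monoid G by fact
  note distr = monoid_algebra_distrib_left monoid_algebra_distrib_right
  have scale: "(c \<odot>\<^bsub>?A\<^esub> x) \<otimes>\<^bsub>?A\<^esub> y = c \<odot>\<^bsub>?A\<^esub> (x \<otimes>\<^bsub>?A\<^esub> y)"
    "x \<otimes>\<^bsub>?A\<^esub> (c \<odot>\<^bsub>?A\<^esub> y) = c \<odot>\<^bsub>?A\<^esub> (x \<otimes>\<^bsub>?A\<^esub> y)"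
    if "x \<in> carrier ?A" "y \<in> carrier ?A" for c x y
  proof -
    from that(1) have "Poly_Mapping.keys x \<subseteq> carrier G" by simp
    then have "(c \<odot>\<^bsub>?A\<^esub> x) \<otimes>\<^bsub>?A\<^esub> y = c \<odot>\<^bsub>?A\<^esub> (x \<otimes>\<^bsub>?A\<^esub> y) \<and>
      x \<otimes>\<^bsub>?A\<^esub> (c \<odot>\<^bsub>?A\<^esub> y) = c \<odot>\<^bsub>?A\<^esub> (x \<otimes>\<^bsub>?A\<^esub> y)"
    proof (induction rule: monoid_algebra_induct)
      case (step g d p)
      from that(2) have "Poly_Mapping.keys y \<subseteq> carrier G" by simp
      then have "Poly_Mapping.single g (c * d) \<otimes>\<^bsub>?A\<^esub> y =
            Poly_Mapping.map ((*) c) (Poly_Mapping.single g d \<otimes>\<^bsub>?A\<^esub> y) \<and>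
          Poly_Mapping.single g d \<otimes>\<^bsub>?A\<^esub> Poly_Mapping.map ((*) c) y =
            Poly_Mapping.map ((*) c) (Poly_Mapping.single g d \<otimes>\<^bsub>?A\<^esub> y)"
        by (induction rule: monoid_algebra_induct)
          (simp_all add: distr scale_add scale_single mult.assoc mult.left_commute[of d c])
      with step.IH show ?case by (simp add: distr scale_add scale_single)
    qed simp
    then show "(c \<odot>\<^bsub>?A\<^esub> x) \<otimes>\<^bsub>?A\<^esub> y = c \<odot>\<^bsub>?A\<^esub> (x \<otimes>\<^bsub>?A\<^esub> y)"
      "x \<otimes>\<^bsub>?A\<^esub> (c \<odot>\<^bsub>?A\<^esub> y) = c \<odot>\<^bsub>?A\<^esub> (x \<otimes>\<^bsub>?A\<^esub> y)"
      by blast+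
  qed
  have assoc1: "(Poly_Mapping.single g c \<otimes>\<^bsub>?A\<^esub> Poly_Mapping.single h d) \<otimes>\<^bsub>?A\<^esub> z =
      Poly_Mapping.single g c \<otimes>\<^bsub>?A\<^esub> (Poly_Mapping.single h d \<otimes>\<^bsub>?A\<^esub> z)"
    if "g \<in> carrier G" "h \<in> carrier G" "Poly_Mapping.keys z \<subseteq> carrier G" for g h c d z
    using that(3) by (induction rule: monoid_algebra_induct)
      (use that in \<open>simp_all add: distr G.m_assoc mult.assoc\<close>)
  have assoc2: "(Poly_Mapping.single g c \<otimes>\<^bsub>?A\<^esub> y) \<otimes>\<^bsub>?A\<^esub> z =
      Poly_Mapping.single g c \<otimes>\<^bsub>?A\<^esub> (y \<otimes>\<^bsub>?A\<^esub> z)"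
    if "g \<in> carrier G" "Poly_Mapping.keys y \<subseteq> carrier G" "Poly_Mapping.keys z \<subseteq> carrier G" for g c y z
    using that(2) by (induction rule: monoid_algebra_induct)
      (use that in \<open>simp_all add: distr assoc1 del: monoid_algebra_mult_single\<close>)
  have assoc: "(x \<otimes>\<^bsub>?A\<^esub> y) \<otimes>\<^bsub>?A\<^esub> z = x \<otimes>\<^bsub>?A\<^esub> (y \<otimes>\<^bsub>?A\<^esub> z)"
    if "Poly_Mapping.keys x \<subseteq> carrier G" "Poly_Mapping.keys y \<subseteq> carrier G"
      "Poly_Mapping.keys z \<subseteq> carrier G" for x y z
    using that(1) by (induction rule: monoid_algebra_induct)
      (use that in \<open>simp_all add: distr assoc2\<close>)
  have one: "Poly_Mapping.single \<one>\<^bsub>G\<^esub> 1 \<otimes>\<^bsub>?A\<^esub> x = x" "x \<otimes>\<^bsub>?A\<^esub> Poly_Mapping.single \<one>\<^bsub>G\<^esub> 1 = x"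
    if "Poly_Mapping.keys x \<subseteq> carrier G" for x
    using that by (induction rule: monoid_algebra_induct, simp_all add: distr)
  have "monoid ?A"
    by (rule monoidI) (auto simp: monoid_algebra_closed[OF assms] assoc one)
  then have "ring ?A"
    using MA.abelian_group_axioms by (intro ringI) (auto simp: distr)
  then show ?thesis
    by (intro k_alg.intro MA.k_module_axioms k_alg_axioms.intro scale) auto
qed

section \<open>Tensor products\<close>

definition bilinear ::
  "('k::comm_ring_1, 'a, 'm) module_scheme \<Rightarrow> ('k, 'b, 'n) module_scheme \<Rightarrow>
   ('k, 'p, 'o) module_scheme \<Rightarrow> ('a \<Rightarrow> 'b \<Rightarrow> 'p) \<Rightarrow> bool" where
  "bilinear M N P b \<longleftrightarrow>
    (\<forall>x\<in>carrier M. b x \<in> module_hom class_ring N P) \<and>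
    (\<forall>y\<in>carrier N. (\<lambda>x. b x y) \<in> module_hom class_ring M P)"

lemma bilinearI:
  assumes "\<And>x. x \<in> carrier M \<Longrightarrow> b x \<in> module_hom class_ring N P"
    and "\<And>y. y \<in> carrier N \<Longrightarrow> (\<lambda>x. b x y) \<in> module_hom class_ring M P"
  shows "bilinear M N P b"
  using assms by (simp add: bilinear_def)

lemma DirProd_simps [simp]:
  "carrier (M \<times>\<times> N) = carrier M \<times> carrier N"
  "(x, y) \<otimes>\<^bsub>M \<times>\<times> N\<^esub> (x', y') = (x \<otimes>\<^bsub>M\<^esub> x', y \<otimes>\<^bsub>N\<^esub> y')"
  "\<one>\<^bsub>M \<times>\<times> N\<^esub> = (\<one>\<^bsub>M\<^esub>, \<one>\<^bsub>N\<^esub>)"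
  by (simp_all add: DirProd_def)

locale two_modules = M: k_module M + N: k_module N
  for M :: "('k::comm_ring_1, 'a, 'm) module_scheme" and N :: "('k, 'b, 'n) module_scheme"
begin

lemma tensor_gens_subset: "tensor_gens M N \<subseteq> carrier (monoid_algebra (M \<times>\<times> N))"
proof
  fix p :: "'a \<times> 'b \<Rightarrow>\<^sub>0 'k" assume "p \<in> tensor_gens M N"
  then show "p \<in> carrier (monoid_algebra (M \<times>\<times> N))"
    unfolding tensor_gens_def by (auto intro!: keys_minus_subset simp del: keys_single del: subsetI)
      (auto split: if_splits)
qed

lemma tensor_rel_submodule:
  "LinearCombinations.submodule class_ring (tensor_rel M N) (monoid_algebra (M \<times>\<times> N))"
  unfolding tensor_rel_def
  by (rule module.span_is_submodule[OF MA.module tensor_gens_subset])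

lemma tensor_gens_rel: "p \<in> tensor_gens M N \<Longrightarrow> p \<in> tensor_rel M N"
  unfolding tensor_rel_def
  using module.in_own_span[OF MA.module tensor_gens_subset] by blast

lemma tensor_rel_least:
  assumes "tensor_gens M N \<subseteq> I" "LinearCombinations.submodule class_ring I (monoid_algebra (M \<times>\<times> N))"
  shows "tensor_rel M N \<subseteq> I"
  unfolding tensor_rel_def by (rule module.span_is_subset[OF MA.module assms])

sublocale Q: quotient "monoid_algebra (M \<times>\<times> N) :: ('k, 'a \<times> 'b \<Rightarrow>\<^sub>0 'k) module" "tensor_rel M N"
  by (intro quotient.intro quotient_axioms.intro MA.k_module_axioms tensor_rel_submodule)

lemma tensor_module: "k_module (tensor M N)"
  unfolding tensor_def by (rule Q.quot_module)

sublocale T: k_module "tensor M N" by (rule tensor_module)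

lemma proj_add:
  "p \<in> carrier (monoid_algebra (M \<times>\<times> N)) \<Longrightarrow> q \<in> carrier (monoid_algebra (M \<times>\<times> N)) \<Longrightarrow>
   tensor_rel M N +>\<^bsub>(monoid_algebra (M \<times>\<times> N) :: ('k, 'a \<times> 'b \<Rightarrow>\<^sub>0 'k) module)\<^esub> (p + q) =
    (tensor_rel M N +>\<^bsub>(monoid_algebra (M \<times>\<times> N) :: ('k, 'a \<times> 'b \<Rightarrow>\<^sub>0 'k) module)\<^esub> p)
     \<oplus>\<^bsub>tensor M N\<^esub>
    (tensor_rel M N +>\<^bsub>(monoid_algebra (M \<times>\<times> N) :: ('k, 'a \<times> 'b \<Rightarrow>\<^sub>0 'k) module)\<^esub> q)"
  unfolding tensor_def by (subst Q.quot_add) simp_all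

lemma proj_single:
  assumes "x \<in> carrier M" "y \<in> carrier N"
  shows "tensor_rel M N +>\<^bsub>(monoid_algebra (M \<times>\<times> N) :: ('k, 'a \<times> 'b \<Rightarrow>\<^sub>0 'k) module)\<^esub>
      Poly_Mapping.single (x, y) c = c \<odot>\<^bsub>tensor M N\<^esub> pure_tensor M N x y"
  unfolding tensor_def pure_tensor_def using assms
  by (subst Q.quot_smult) (auto simp: scale_single)

lemma pure_closed [simp, intro]:
  "x \<in> carrier M \<Longrightarrow> y \<in> carrier N \<Longrightarrow> pure_tensor M N x y \<in> carrier (tensor M N)"
  unfolding tensor_def pure_tensor_def Q.quot_carrier by auto

lemma proj_eq:
  assumes "p - q \<in> tensor_gens M N" "p \<in> carrier (monoid_algebra (M \<times>\<times> N))"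
    "q \<in> carrier (monoid_algebra (M \<times>\<times> N))"
  shows "tensor_rel M N +>\<^bsub>(monoid_algebra (M \<times>\<times> N) :: ('k, 'a \<times> 'b \<Rightarrow>\<^sub>0 'k) module)\<^esub> p =
    tensor_rel M N +>\<^bsub>(monoid_algebra (M \<times>\<times> N) :: ('k, 'a \<times> 'b \<Rightarrow>\<^sub>0 'k) module)\<^esub> q"
  using assms tensor_gens_rel[OF assms(1)]
  by (subst Q.quot_eq_iff) (auto simp: monoid_algebra_minus simp del: monoid_algebra_simps)

lemma pure_add_left:
  assumes "x \<in> carrier M" "x' \<in> carrier M" "y \<in> carrier N"
  shows "pure_tensor M N (x \<oplus>\<^bsub>M\<^esub> x') y =
    pure_tensor M N x y \<oplus>\<^bsub>tensor M N\<^esub> pure_tensor M N x' y"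
proof -
  have "Poly_Mapping.single (x \<oplus>\<^bsub>M\<^esub> x', y) 1 - (Poly_Mapping.single (x, y) 1
       + Poly_Mapping.single (x', y) 1) \<in> tensor_gens M N"
    unfolding tensor_gens_def diff_diff_add[symmetric] using assms by blast
  from proj_eq[OF this] show ?thesis
    using assms by (simp add: pure_tensor_def proj_add keys_add_subset)
qed

lemma pure_add_right:
  assumes "x \<in> carrier M" "y \<in> carrier N" "y' \<in> carrier N"
  shows "pure_tensor M N x (y \<oplus>\<^bsub>N\<^esub> y') =
    pure_tensor M N x y \<oplus>\<^bsub>tensor M N\<^esub> pure_tensor M N x y'"
proof -
  have "Poly_Mapping.single (x, y \<oplus>\<^bsub>N\<^esub> y') 1 - (Poly_Mapping.single (x, y) 1
       + Poly_Mapping.single (x, y') 1) \<in> tensor_gens M N"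
    unfolding tensor_gens_def diff_diff_add[symmetric] using assms by blast
  from proj_eq[OF this] show ?thesis
    using assms by (simp add: pure_tensor_def proj_add keys_add_subset)
qed

lemma pure_smult_left:
  assumes "x \<in> carrier M" "y \<in> carrier N"
  shows "pure_tensor M N (c \<odot>\<^bsub>M\<^esub> x) y = c \<odot>\<^bsub>tensor M N\<^esub> pure_tensor M N x y"
proof -
  have "Poly_Mapping.single (c \<odot>\<^bsub>M\<^esub> x, y) 1 - Poly_Mapping.single (x, y) c \<in> tensor_gens M N"
    unfolding tensor_gens_def using assms by blast
  from proj_eq[OF this] have "pure_tensor M N (c \<odot>\<^bsub>M\<^esub> x) (y) =
      tensor_rel M N +>\<^bsub>(monoid_algebra (M \<times>\<times> N) :: ('k, 'a \<times> 'b \<Rightarrow>\<^sub>0 'k) module)\<^esub>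
        Poly_Mapping.single (x, y) c"
    using assms by (simp add: pure_tensor_def)
  then show ?thesis using proj_single[OF assms, of c] by (rule trans)
qed

lemma pure_smult_right:
  assumes "x \<in> carrier M" "y \<in> carrier N"
  shows "pure_tensor M N x (c \<odot>\<^bsub>N\<^esub> y) = c \<odot>\<^bsub>tensor M N\<^esub> pure_tensor M N x y"
proof -
  have "Poly_Mapping.single (x, c \<odot>\<^bsub>N\<^esub> y) 1 - Poly_Mapping.single (x, y) c \<in> tensor_gens M N"
    unfolding tensor_gens_def using assms by blast
  from proj_eq[OF this] have "pure_tensor M N (x) (c \<odot>\<^bsub>N\<^esub> y) =
      tensor_rel M N +>\<^bsub>(monoid_algebra (M \<times>\<times> N) :: ('k, 'a \<times> 'b \<Rightarrow>\<^sub>0 'k) module)\<^esub>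
        Poly_Mapping.single (x, y) c"
    using assms by (simp add: pure_tensor_def)
  then show ?thesis using proj_single[OF assms, of c] by (rule trans)
qed

lemma pure_hom_left: "y \<in> carrier N \<Longrightarrow> (\<lambda>x. pure_tensor M N x y) \<in> module_hom class_ring M (tensor M N)"
  by (rule module_homI) (auto simp: pure_add_left pure_smult_left)

lemma pure_hom_right: "x \<in> carrier M \<Longrightarrow> pure_tensor M N x \<in> module_hom class_ring N (tensor M N)"
  by (rule module_homI) (auto simp: pure_add_right pure_smult_right)

lemma pure_bilinear: "bilinear M N (tensor M N) (pure_tensor M N)"
  by (intro bilinearI pure_hom_left pure_hom_right)

lemma pure_zero [simp]:
  "y \<in> carrier N \<Longrightarrow> pure_tensor M N \<zero>\<^bsub>M\<^esub> y = \<zero>\<^bsub>tensor M N\<^esub>"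
  "x \<in> carrier M \<Longrightarrow> pure_tensor M N x \<zero>\<^bsub>N\<^esub> = \<zero>\<^bsub>tensor M N\<^esub>"
  using hom_zero[OF M.k_module_axioms tensor_module pure_hom_left]
    hom_zero[OF N.k_module_axioms tensor_module pure_hom_right] by auto

text \<open>There is no case for zero or for scalars: zero is the pure tensor of two zeros, and a
  coefficient is absorbed into the left factor.\<close>

lemma tensor_induct [consumes 1, case_names pure add]:
  assumes "t \<in> carrier (tensor M N)"
    and pure: "\<And>x y. x \<in> carrier M \<Longrightarrow> y \<in> carrier N \<Longrightarrow> Q (pure_tensor M N x y)"
    and add: "\<And>s t. s \<in> carrier (tensor M N) \<Longrightarrow> t \<in> carrier (tensor M N) \<Longrightarrow> Q s \<Longrightarrow> Q t \<Longrightarrow>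
      Q (s \<oplus>\<^bsub>tensor M N\<^esub> t)"
  shows "Q t"
proof -
  let ?\<pi> = "\<lambda>p. tensor_rel M N +>\<^bsub>(monoid_algebra (M \<times>\<times> N) :: ('k, 'a \<times> 'b \<Rightarrow>\<^sub>0 'k) module)\<^esub> p"
  obtain p where p: "t = ?\<pi> p" "Poly_Mapping.keys p \<subseteq> carrier M \<times> carrier N"
    using assms(1) by (auto simp: tensor_def Q.quot_carrier)
  from p(2) have "Q (?\<pi> p)"
  proof (induction rule: monoid_algebra_induct)
    case zero
    have "?\<pi> 0 = \<zero>\<^bsub>tensor M N\<^esub>" by (simp add: tensor_def Q.quot_zero)
    then show ?case using pure[of "\<zero>\<^bsub>M\<^esub>" "\<zero>\<^bsub>N\<^esub>"] by simp
  next
    case (step xy c q)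
    obtain x y where xy: "xy = (x, y)" "x \<in> carrier M" "y \<in> carrier N" using step by auto
    have "?\<pi> (Poly_Mapping.single xy c + q) = pure_tensor M N (c \<odot>\<^bsub>M\<^esub> x) y \<oplus>\<^bsub>tensor M N\<^esub> ?\<pi> q"
      using step xy by (subst proj_add) (auto simp: proj_single pure_smult_left)
    moreover have "?\<pi> q \<in> carrier (tensor M N)"
      unfolding tensor_def Q.quot_carrier using step by auto
    ultimately show ?case using add pure xy step by auto
  qed
  then show ?thesis using p by simp
qed

text \<open>Nearly all identities between maps out of tensor products are obtained from this rule:
  linearity of both sides is assembled by composing linear maps, and what remains is a computation
  on pure tensors.\<close>

lemma tensor_hom_eq:
  assumes "f \<in> module_hom class_ring (tensor M N) P" "g \<in> module_hom class_ring (tensor M N) P"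
    and "\<And>x y. x \<in> carrier M \<Longrightarrow> y \<in> carrier N \<Longrightarrow> f (pure_tensor M N x y) = g (pure_tensor M N x y)"
    and "t \<in> carrier (tensor M N)"
  shows "f t = g t"
  using assms(4) by (induction rule: tensor_induct) (simp_all add: assms(3) hom_add[OF assms(1)] hom_add[OF assms(2)])

text \<open>Bilinearity says exactly that the four families of generators lie in the kernel of the
  linear extension. The kernel is a submodule, so it contains their span.\<close>

lemma lin_ext_kills_rel:
  assumes "k_module P" "bilinear M N P b" "p \<in> tensor_rel M N"
  shows "lin_ext P (\<lambda>(x, y). b x y) p = \<zero>\<^bsub>P\<^esub>"
proof -
  interpret P: k_module P by fact
  let ?b = "\<lambda>(x, y). b x y"
  let ?A = "monoid_algebra (M \<times>\<times> N) :: ('k, 'a \<times> 'b \<Rightarrow>\<^sub>0 'k) module"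
  have l: "\<And>y. y \<in> carrier N \<Longrightarrow> (\<lambda>x. b x y) \<in> module_hom class_ring M P"
    and r: "\<And>x. x \<in> carrier M \<Longrightarrow> b x \<in> module_hom class_ring N P"
    using assms(2) by (auto simp: bilinear_def)
  have b [simp]: "b x y \<in> carrier P" if "x \<in> carrier M" "y \<in> carrier N" for x y
    using r[OF that(1)] that(2) by (rule hom_closed)
  have h: "lin_ext P ?b \<in> module_hom class_ring ?A P"
    by (rule lin_ext_hom[OF assms(1)]) auto
  have s: "lin_ext P ?b (Poly_Mapping.single (x, y) c) = c \<odot>\<^bsub>P\<^esub> b x y"
    if "x \<in> carrier M" "y \<in> carrier N" for x y c
    using lin_ext_single[OF assms(1), of ?b "(x, y)"] that by simp
  have m: "lin_ext P ?b (p - q) = lin_ext P ?b p \<ominus>\<^bsub>P\<^esub> lin_ext P ?b q"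
    if "Poly_Mapping.keys p \<subseteq> carrier M \<times> carrier N" "Poly_Mapping.keys q \<subseteq> carrier M \<times> carrier N" for p q
    using hom_minus[OF MA.k_module_axioms assms(1) h, of p q] monoid_algebra_minus[of q "M \<times>\<times> N" p] that
    by simp
  have z: "(x \<oplus>\<^bsub>P\<^esub> y) \<ominus>\<^bsub>P\<^esub> x \<ominus>\<^bsub>P\<^esub> y = \<zero>\<^bsub>P\<^esub>" if "x \<in> carrier P" "y \<in> carrier P" for x y
    using that by (simp add: P.minus_eq_iff a_minus_def P.a_assoc)
      (metis P.a_inv_closed P.a_comm P.a_assoc P.r_neg P.r_zero)
  have "tensor_gens M N \<subseteq> {p \<in> carrier ?A. lin_ext P ?b p = \<zero>\<^bsub>P\<^esub>}"
  proof
    fix p :: "'a \<times> 'b \<Rightarrow>\<^sub>0 'k" assume p: "p \<in> tensor_gens M N"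
    then have "p \<in> carrier ?A" using tensor_gens_subset by blast
    moreover have "lin_ext P ?b p = \<zero>\<^bsub>P\<^esub>"
      using p unfolding tensor_gens_def
      by (auto simp: m s z hom_add[OF l] hom_add[OF r] hom_smult[OF l] hom_smult[OF r]
          P.minus_eq_iff keys_minus_subset)
    ultimately show "p \<in> {p \<in> carrier ?A. lin_ext P ?b p = \<zero>\<^bsub>P\<^esub>}" by simp
  qed
  then have "tensor_rel M N \<subseteq> {p \<in> carrier ?A. lin_ext P ?b p = \<zero>\<^bsub>P\<^esub>}"
    by (rule tensor_rel_least) (rule hom_kernel_submodule[OF MA.k_module_axioms assms(1) h])
  then show ?thesis using assms(3) by blast
qed

lemma tensor_lift_proj:
  assumes "k_module P" "bilinear M N P b" "p \<in> carrier (monoid_algebra (M \<times>\<times> N))"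
  shows "tensor_lift P b
      (tensor_rel M N +>\<^bsub>(monoid_algebra (M \<times>\<times> N) :: ('k, 'a \<times> 'b \<Rightarrow>\<^sub>0 'k) module)\<^esub> p) =
    lin_ext P (\<lambda>(x, y). b x y) p"
  unfolding tensor_lift_def coset_ext_def
proof (rule Q.the_elem_image_coset[OF assms(1) _ _ assms(3)])
  show "lin_ext P (\<lambda>(x, y). b x y) \<in> module_hom class_ring (monoid_algebra (M \<times>\<times> N)) P"
    using assms(2) by (intro lin_ext_hom[OF assms(1)]) (auto simp: bilinear_def intro: hom_closed)
qed (rule lin_ext_kills_rel[OF assms(1,2)])

lemma tensor_lift_pure:
  assumes "k_module P" "bilinear M N P b" "x \<in> carrier M" "y \<in> carrier N"
  shows "tensor_lift P b (pure_tensor M N x y) = b x y"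
proof -
  interpret P: k_module P by fact
  have "b x y \<in> carrier P" using assms by (auto simp: bilinear_def intro: hom_closed)
  then show ?thesis
    unfolding pure_tensor_def using assms(3,4)
    by (subst tensor_lift_proj[OF assms(1,2)]) (auto simp: lin_ext_single[OF assms(1)])
qed

lemma tensor_lift_hom:
  assumes "k_module P" "bilinear M N P b"
  shows "tensor_lift P b \<in> module_hom class_ring (tensor M N) P"
proof -
  let ?A = "monoid_algebra (M \<times>\<times> N) :: ('k, 'a \<times> 'b \<Rightarrow>\<^sub>0 'k) module"
  let ?\<pi> = "\<lambda>p. tensor_rel M N +>\<^bsub>?A\<^esub> p"
  have h: "lin_ext P (\<lambda>(x, y). b x y) \<in> module_hom class_ring ?A P"
    using assms(2) by (intro lin_ext_hom[OF assms(1)]) (auto simp: bilinear_def intro: hom_closed)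
  note eq = tensor_lift_proj[OF assms]
  have c: "carrier (tensor M N) = ?\<pi> ` carrier ?A"
    by (simp only: tensor_def Q.quot_carrier)
  show ?thesis
  proof (rule module_homI)
    fix s assume "s \<in> carrier (tensor M N)"
    then obtain p where p: "p \<in> carrier ?A" "s = ?\<pi> p" using c by blast
    show "tensor_lift P b s \<in> carrier P" using p hom_closed[OF h] by (simp only: eq)
    have "c \<odot>\<^bsub>tensor M N\<^esub> s = ?\<pi> (c \<odot>\<^bsub>?A\<^esub> p)" for c
      using p Q.quot_smult unfolding tensor_def by simp
    moreover have "c \<odot>\<^bsub>?A\<^esub> p \<in> carrier ?A" for c using p(1) by (rule MA.smult_closed)
    ultimately show "tensor_lift P b (c \<odot>\<^bsub>tensor M N\<^esub> s) = c \<odot>\<^bsub>P\<^esub> tensor_lift P b s" for c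
      using p hom_smult[OF h] by (simp only: eq)
    fix t assume "t \<in> carrier (tensor M N)"
    then obtain q where q: "q \<in> carrier ?A" "t = ?\<pi> q" using c by blast
    have "s \<oplus>\<^bsub>tensor M N\<^esub> t = ?\<pi> (p \<oplus>\<^bsub>?A\<^esub> q)"
      using p q Q.quot_add unfolding tensor_def by simp
    moreover have "p \<oplus>\<^bsub>?A\<^esub> q \<in> carrier ?A" using p(1) q(1) by (rule MA.a_closed)
    ultimately show "tensor_lift P b (s \<oplus>\<^bsub>tensor M N\<^esub> t) = tensor_lift P b s \<oplus>\<^bsub>P\<^esub> tensor_lift P b t"
      using p q hom_add[OF h] by (simp only: eq)
  qed
qed

end

section \<open>Functoriality, symmetry and associativity of the tensor product\<close>

lemma bilinear_compose:
  assumes "bilinear M N P b" "f \<in> module_hom class_ring L M" "g \<in> module_hom class_ring K N"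
  shows "bilinear L K P (\<lambda>x y. b (f x) (g y))"
  using assms by (auto simp: bilinear_def module_hom_iff)

lemma bilinear_flip: "bilinear M N P b \<Longrightarrow> bilinear N M P (\<lambda>x y. b y x)"
  by (auto simp: bilinear_def)

lemma bilinear_left: "bilinear M N P b \<Longrightarrow> y \<in> carrier N \<Longrightarrow> (\<lambda>x. b x y) \<in> module_hom class_ring M P"
  by (simp add: bilinear_def)

lemma bilinear_right: "bilinear M N P b \<Longrightarrow> x \<in> carrier M \<Longrightarrow> b x \<in> module_hom class_ring N P"
  by (simp add: bilinear_def)

lemma two_modulesI: "k_module M \<Longrightarrow> k_module N \<Longrightarrow> two_modules M N"
  by (simp add: two_modules_def)

lemma k_module_tensor: "k_module M \<Longrightarrow> k_module N \<Longrightarrow> k_module (tensor M N)"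
  by (rule two_modules.tensor_module) (rule two_modulesI)

lemma bilinear_pure: "k_module M \<Longrightarrow> k_module N \<Longrightarrow> bilinear M N (tensor M N) (pure_tensor M N)"
  by (rule two_modules.pure_bilinear) (rule two_modulesI)

lemma tensor_map_bilinear:
  assumes "k_module M" "k_module N"
    and "f \<in> module_hom class_ring L M" "g \<in> module_hom class_ring K N"
  shows "bilinear L K (tensor M N) (\<lambda>x y. pure_tensor M N (f x) (g y))"
  using bilinear_compose[OF bilinear_pure[OF assms(1,2)] assms(3,4)] .

lemma tensor_map_hom:
  assumes "k_module L" "k_module K" "k_module M" "k_module N"
    and "f \<in> module_hom class_ring L M" "g \<in> module_hom class_ring K N"
  shows "tensor_map M N f g \<in> module_hom class_ring (tensor L K) (tensor M N)"
  unfolding tensor_map_def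
  by (intro two_modules.tensor_lift_hom two_modulesI tensor_map_bilinear k_module_tensor assms)

lemma tensor_map_pure:
  assumes "k_module L" "k_module K" "k_module M" "k_module N"
    and "f \<in> module_hom class_ring L M" "g \<in> module_hom class_ring K N"
    and "x \<in> carrier L" "y \<in> carrier K"
  shows "tensor_map M N f g (pure_tensor L K x y) = pure_tensor M N (f x) (g y)"
  unfolding tensor_map_def
  by (intro two_modules.tensor_lift_pure two_modulesI tensor_map_bilinear k_module_tensor assms)

lemma tensor_hom_ext:
  assumes "k_module M" "k_module N"
    and "f \<in> module_hom class_ring (tensor M N) P" "g \<in> module_hom class_ring (tensor M N) P"
    and "\<And>x y. x \<in> carrier M \<Longrightarrow> y \<in> carrier N \<Longrightarrow> f (pure_tensor M N x y) = g (pure_tensor M N x y)"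
    and "t \<in> carrier (tensor M N)"
  shows "f t = g t"
  by (rule two_modules.tensor_hom_eq[OF two_modulesI[OF assms(1,2)] assms(3-6)])

lemma tensor_map_compose:
  assumes "k_module L" "k_module K" "k_module M" "k_module N" "k_module M'" "k_module N'"
    and "f \<in> module_hom class_ring L M" "g \<in> module_hom class_ring K N"
    and "f' \<in> module_hom class_ring M M'" "g' \<in> module_hom class_ring N N'"
    and "t \<in> carrier (tensor L K)"
  shows "tensor_map M' N' f' g' (tensor_map M N f g t) =
    tensor_map M' N' (\<lambda>x. f' (f x)) (\<lambda>y. g' (g y)) t"
proof (rule tensor_hom_ext[OF assms(1,2) _ _ _ assms(11)])
  show "(\<lambda>t. tensor_map M' N' f' g' (tensor_map M N f g t)) \<in>
      module_hom class_ring (tensor L K) (tensor M' N')"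
    by (rule hom_compose; rule tensor_map_hom; fact)
  have c: "(\<lambda>x. f' (f x)) \<in> module_hom class_ring L M'" "(\<lambda>y. g' (g y)) \<in> module_hom class_ring K N'"
    using assms hom_compose by blast+
  show "tensor_map M' N' (\<lambda>x. f' (f x)) (\<lambda>y. g' (g y)) \<in>
      module_hom class_ring (tensor L K) (tensor M' N')"
    by (rule tensor_map_hom; fact)
  fix x y assume "x \<in> carrier L" "y \<in> carrier K"
  then show "tensor_map M' N' f' g' (tensor_map M N f g (pure_tensor L K x y)) =
      tensor_map M' N' (\<lambda>x. f' (f x)) (\<lambda>y. g' (g y)) (pure_tensor L K x y)"
    using assms c by (simp add: tensor_map_pure[of L K] tensor_map_pure[of M N] hom_closed)
qed

lemma tensor_map_id:
  assumes "k_module M" "k_module N" "t \<in> carrier (tensor M N)"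
    and "\<And>x. x \<in> carrier M \<Longrightarrow> f x = x" "\<And>x. x \<in> carrier N \<Longrightarrow> g x = x"
  shows "tensor_map M N f g t = t"
proof -
  interpret M: k_module M by fact
  interpret N: k_module N by fact
  have f: "f \<in> module_hom class_ring M M" and g: "g \<in> module_hom class_ring N N"
    using assms(4,5) by (auto simp: module_hom_iff)
  show ?thesis
    by (rule tensor_hom_ext[OF assms(1,2) tensor_map_hom[OF assms(1,2,1,2) f g] hom_id _ assms(3)])
      (simp add: tensor_map_pure[OF assms(1,2,1,2) f g] assms(4,5))
qed

text \<open>The arguments of \<open>tensor_map\<close> are functions on whole types, but only their
  values on the carriers enter. This is needed where an inverse cancels on a carrier only.\<close>

lemma tensor_map_cong:
  assumes "k_module L" "k_module K" "k_module M" "k_module N"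
    and f: "f \<in> module_hom class_ring L M" and g: "g \<in> module_hom class_ring K N"
    and "\<And>x. x \<in> carrier L \<Longrightarrow> f' x = f x" "\<And>x. x \<in> carrier K \<Longrightarrow> g' x = g x"
    and "t \<in> carrier (tensor L K)"
  shows "tensor_map M N f' g' t = tensor_map M N f g t"
proof -
  interpret L: k_module L by fact
  interpret K: k_module K by fact
  have f': "f' \<in> module_hom class_ring L M" and g': "g' \<in> module_hom class_ring K N"
    using assms(7,8) f g by (auto simp: module_hom_iff)
  show ?thesis
    by (rule tensor_hom_ext[OF assms(1,2) tensor_map_hom[OF assms(1-4) f' g']
          tensor_map_hom[OF assms(1-4) f g] _ assms(9)])
      (simp add: tensor_map_pure[OF assms(1-4)] assms(7,8) f g f' g')
qed

text \<open>Faithful flatness tensors with \<open>Z\<close> on the left, while the coaction and the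
  canonical map carry \<open>Z\<close> on the right; the flip mediates between the two
  conventions.\<close>

definition tensor_swap ::
  "('k::comm_ring_1, 'a, 'm) module_scheme \<Rightarrow> ('k, 'b, 'n) module_scheme \<Rightarrow>
   ('a \<times> 'b \<Rightarrow>\<^sub>0 'k) set \<Rightarrow> ('b \<times> 'a \<Rightarrow>\<^sub>0 'k) set" where
  "tensor_swap M N = tensor_lift (tensor N M) (\<lambda>x y. pure_tensor N M y x)"

lemma tensor_swap_hom:
  assumes "k_module M" "k_module N"
  shows "tensor_swap M N \<in> module_hom class_ring (tensor M N) (tensor N M)"
  unfolding tensor_swap_def
  by (intro two_modules.tensor_lift_hom two_modulesI bilinear_flip[OF bilinear_pure] k_module_tensor assms)

lemma tensor_swap_pure:
  assumes "k_module M" "k_module N" "x \<in> carrier M" "y \<in> carrier N"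
  shows "tensor_swap M N (pure_tensor M N x y) = pure_tensor N M y x"
  unfolding tensor_swap_def
  by (rule two_modules.tensor_lift_pure[OF two_modulesI[OF assms(1,2)]
        k_module_tensor[OF assms(2,1)] bilinear_flip[OF bilinear_pure[OF assms(2,1)]] assms(3,4)])

lemma tensor_swap_swap:
  assumes "k_module M" "k_module N" "t \<in> carrier (tensor M N)"
  shows "tensor_swap N M (tensor_swap M N t) = t"
  by (rule tensor_hom_ext[OF assms(1,2) hom_compose[OF tensor_swap_hom[OF assms(1,2)]
          tensor_swap_hom[OF assms(2,1)]] hom_id _ assms(3)])
    (simp add: tensor_swap_pure assms)

text \<open>The associativity map is a lift nested in a lift. The outer one makes sense only once
  the value of the inner one is known to depend linearly on the last factor, and this is checked on
  pure tensors of the first two.\<close>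

lemma bilinear_tensor_assoc:
  assumes "k_module L" "k_module M" "k_module N"
  shows "bilinear (tensor L M) N (tensor L (tensor M N))
    (\<lambda>u z. tensor_lift (tensor L (tensor M N))
         (\<lambda>x y. pure_tensor L (tensor M N) x (pure_tensor M N y z)) u)"
proof -
  interpret LM: two_modules L M by (rule two_modulesI) fact+
  interpret MN: two_modules M N by (rule two_modulesI) fact+
  interpret T: two_modules L "tensor M N" by (rule two_modulesI) (fact | rule MN.tensor_module)+
  have b: "bilinear L M (tensor L (tensor M N))
      (\<lambda>x y. pure_tensor L (tensor M N) x (pure_tensor M N y z))" if "z \<in> carrier N" for z
    using bilinear_compose[OF T.pure_bilinear hom_id MN.pure_hom_left[OF that]] .
  note p = LM.tensor_lift_pure[OF T.tensor_module b]
  note h = LM.tensor_lift_hom[OF T.tensor_module b]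
  show ?thesis
  proof (rule bilinearI)
    fix u assume u: "u \<in> carrier (tensor L M)"
    show "(\<lambda>z. tensor_lift (tensor L (tensor M N))
         (\<lambda>x y. pure_tensor L (tensor M N) x (pure_tensor M N y z)) u) \<in>
      module_hom class_ring N (tensor L (tensor M N))"
    proof (rule module_homI)
      fix z z' assume z: "z \<in> carrier N" "z' \<in> carrier N"
      then have zz: "z \<oplus>\<^bsub>N\<^esub> z' \<in> carrier N" by simp
      show "tensor_lift (tensor L (tensor M N))
            (\<lambda>x y. pure_tensor L (tensor M N) x (pure_tensor M N y (z \<oplus>\<^bsub>N\<^esub> z'))) u =
         tensor_lift (tensor L (tensor M N)) (\<lambda>x y. pure_tensor L (tensor M N) x (pure_tensor M N y z)) u
          \<oplus>\<^bsub>tensor L (tensor M N)\<^esub>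
         tensor_lift (tensor L (tensor M N)) (\<lambda>x y. pure_tensor L (tensor M N) x (pure_tensor M N y z')) u"
        by (rule LM.tensor_hom_eq[OF h[OF zz] hom_plus[OF T.tensor_module h[OF z(1)] h[OF z(2)]] _ u])
          (simp add: p z MN.pure_add_right T.pure_add_right)
    next
      fix c z assume z: "z \<in> carrier N"
      then have cz: "c \<odot>\<^bsub>N\<^esub> z \<in> carrier N" by simp
      show "tensor_lift (tensor L (tensor M N))
            (\<lambda>x y. pure_tensor L (tensor M N) x (pure_tensor M N y (c \<odot>\<^bsub>N\<^esub> z))) u =
         c \<odot>\<^bsub>tensor L (tensor M N)\<^esub>
         tensor_lift (tensor L (tensor M N)) (\<lambda>x y. pure_tensor L (tensor M N) x (pure_tensor M N y z)) u"
        by (rule LM.tensor_hom_eq[OF h[OF cz] hom_scale[OF T.tensor_module h[OF z]] _ u])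
          (simp add: p z MN.pure_smult_right T.pure_smult_right)
    qed (rule hom_closed[OF h u])
  qed (rule h)
qed

lemma tensor_assoc_hom:
  assumes "k_module L" "k_module M" "k_module N"
  shows "tensor_assoc L M N \<in> module_hom class_ring (tensor (tensor L M) N) (tensor L (tensor M N))"
  unfolding tensor_assoc_def
  by (intro two_modules.tensor_lift_hom two_modulesI bilinear_tensor_assoc k_module_tensor assms)

lemma tensor_assoc_pure:
  assumes "k_module L" "k_module M" "k_module N" "x \<in> carrier L" "y \<in> carrier M" "z \<in> carrier N"
  shows "tensor_assoc L M N (pure_tensor (tensor L M) N (pure_tensor L M x y) z) =
    pure_tensor L (tensor M N) x (pure_tensor M N y z)"
proof -
  interpret LM: two_modules L M by (rule two_modulesI) fact+
  interpret MN: two_modules M N by (rule two_modulesI) fact+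
  interpret T: two_modules L "tensor M N" by (rule two_modulesI) (fact | rule MN.tensor_module)+
  interpret S: two_modules "tensor L M" N by (rule two_modulesI) (fact | rule LM.tensor_module)+
  have "bilinear L M (tensor L (tensor M N))
      (\<lambda>x y. pure_tensor L (tensor M N) x (pure_tensor M N y z))"
    using bilinear_compose[OF T.pure_bilinear hom_id MN.pure_hom_left[OF assms(6)]] .
  then show ?thesis
    unfolding tensor_assoc_def using assms
    by (simp add: S.tensor_lift_pure[OF T.tensor_module bilinear_tensor_assoc]
        LM.tensor_lift_pure[OF T.tensor_module])
qed

section \<open>Tensor products of algebras\<close>

lemma (in k_alg) mult_bilinear: "bilinear A A A (\<otimes>)"
  by (rule bilinearI; rule module_homI)
    (simp_all add: r_distr l_distr smult_mult_left smult_mult_right)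

lemma (in k_alg) mult_hom_left: "x \<in> carrier A \<Longrightarrow> (\<otimes>) x \<in> module_hom class_ring A A"
  using mult_bilinear by (rule bilinear_right)

lemma (in k_alg) mult_hom_right: "y \<in> carrier A \<Longrightarrow> (\<lambda>x. x \<otimes> y) \<in> module_hom class_ring A A"
  using mult_bilinear by (rule bilinear_left)

locale two_algs = A: k_alg A + B: k_alg B
  for A :: "('k::comm_ring_1, 'a, 'm) module_scheme" and B :: "('k, 'b, 'n) module_scheme"
begin

sublocale two_modules A B ..

abbreviation "P \<equiv> monoid_algebra (A \<times>\<times> B) :: ('k, 'a \<times> 'b \<Rightarrow>\<^sub>0 'k) module"

lemma monoid_prod: "monoid (A \<times>\<times> B)"
  by (intro DirProd_monoid A.monoid_axioms B.monoid_axioms)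

sublocale P: k_alg P
  by (rule k_alg_monoid_algebra[OF monoid_prod])

lemma proj_zero_iff: "p \<in> carrier P \<Longrightarrow> tensor_rel A B +>\<^bsub>P\<^esub> p = \<zero>\<^bsub>tensor A B\<^esub> \<longleftrightarrow> p \<in> tensor_rel A B"
  unfolding tensor_def Q.quot_zero
  by (subst Q.quot_eq_iff) (auto simp: monoid_algebra_minus)

text \<open>Multiplication by a monomial \<open>(u, v)\<close> upstairs corresponds downstairs to
  the tensor product of the multiplications by \<open>u\<close> and by \<open>v\<close>. That map
  exists by bilinearity alone, before any product on the tensor module is available.\<close>

lemma proj_mult_single_left:
  assumes "u \<in> carrier A" "v \<in> carrier B" "Poly_Mapping.keys p \<subseteq> carrier A \<times> carrier B"
  shows "tensor_rel A B +>\<^bsub>P\<^esub> (Poly_Mapping.single (u, v) d \<otimes>\<^bsub>P\<^esub> p) =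
    d \<odot>\<^bsub>tensor A B\<^esub> tensor_map A B ((\<otimes>\<^bsub>A\<^esub>) u) ((\<otimes>\<^bsub>B\<^esub>) v) (tensor_rel A B +>\<^bsub>P\<^esub> p)"
proof -
  note mods = A.k_module_axioms B.k_module_axioms
  have h: "tensor_map A B ((\<otimes>\<^bsub>A\<^esub>) u) ((\<otimes>\<^bsub>B\<^esub>) v) \<in> module_hom class_ring (tensor A B) (tensor A B)"
    by (intro tensor_map_hom mods A.mult_hom_left B.mult_hom_left assms)
  show ?thesis using assms(3)
  proof (induction rule: monoid_algebra_induct)
    case zero
    have "tensor_rel A B +>\<^bsub>P\<^esub> 0 = \<zero>\<^bsub>tensor A B\<^esub>" by (simp add: tensor_def Q.quot_zero)
    then show ?case by (simp add: hom_zero[OF tensor_module tensor_module h])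
  next
    case (step xy c q)
    obtain x y where xy: "xy = (x, y)" "x \<in> carrier A" "y \<in> carrier B" using step by auto
    have *: "Poly_Mapping.keys (Poly_Mapping.single (u, v) d \<otimes>\<^bsub>P\<^esub> q) \<subseteq> carrier A \<times> carrier B"
      using monoid_algebra_closed[OF monoid_prod, of "Poly_Mapping.single (u, v) d" q] assms step
      by (auto split: if_splits)
    have q: "tensor_rel A B +>\<^bsub>P\<^esub> q \<in> carrier (tensor A B)"
      unfolding tensor_def Q.quot_carrier using step by auto
    have "tensor_rel A B +>\<^bsub>P\<^esub> (Poly_Mapping.single (u, v) d \<otimes>\<^bsub>P\<^esub> (Poly_Mapping.single xy c + q)) =
      (d * c) \<odot>\<^bsub>tensor A B\<^esub> pure_tensor A B (u \<otimes>\<^bsub>A\<^esub> x) (v \<otimes>\<^bsub>B\<^esub> y) \<oplus>\<^bsub>tensor A B\<^esub>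
      d \<odot>\<^bsub>tensor A B\<^esub> tensor_map A B ((\<otimes>\<^bsub>A\<^esub>) u) ((\<otimes>\<^bsub>B\<^esub>) v) (tensor_rel A B +>\<^bsub>P\<^esub> q)"
      using xy assms * step.IH
      by (simp add: monoid_algebra_distrib_left proj_add proj_single)
    also have "\<dots> = d \<odot>\<^bsub>tensor A B\<^esub> tensor_map A B ((\<otimes>\<^bsub>A\<^esub>) u) ((\<otimes>\<^bsub>B\<^esub>) v)
        (tensor_rel A B +>\<^bsub>P\<^esub> (Poly_Mapping.single xy c + q))"
      using xy assms step.hyps q
      by (simp add: proj_add proj_single hom_add[OF h] hom_smult[OF h] hom_closed[OF h]
          tensor_map_pure[OF mods mods] A.mult_hom_left B.mult_hom_left T.smult_add_right T.smult_smult)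
    finally show ?case .
  qed
qed

lemma proj_mult_single_right:
  assumes "u \<in> carrier A" "v \<in> carrier B" "Poly_Mapping.keys p \<subseteq> carrier A \<times> carrier B"
  shows "tensor_rel A B +>\<^bsub>P\<^esub> (p \<otimes>\<^bsub>P\<^esub> Poly_Mapping.single (u, v) d) =
    d \<odot>\<^bsub>tensor A B\<^esub> tensor_map A B (\<lambda>x. x \<otimes>\<^bsub>A\<^esub> u) (\<lambda>y. y \<otimes>\<^bsub>B\<^esub> v) (tensor_rel A B +>\<^bsub>P\<^esub> p)"
proof -
  note mods = A.k_module_axioms B.k_module_axioms
  have h: "tensor_map A B (\<lambda>x. x \<otimes>\<^bsub>A\<^esub> u) (\<lambda>y. y \<otimes>\<^bsub>B\<^esub> v) \<in> module_hom class_ring (tensor A B) (tensor A B)"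
    by (intro tensor_map_hom mods A.mult_hom_right B.mult_hom_right assms)
  show ?thesis using assms(3)
  proof (induction rule: monoid_algebra_induct)
    case zero
    have "tensor_rel A B +>\<^bsub>P\<^esub> 0 = \<zero>\<^bsub>tensor A B\<^esub>" by (simp add: tensor_def Q.quot_zero)
    then show ?case by (simp add: hom_zero[OF tensor_module tensor_module h])
  next
    case (step xy c q)
    obtain x y where xy: "xy = (x, y)" "x \<in> carrier A" "y \<in> carrier B" using step by auto
    have *: "Poly_Mapping.keys (q \<otimes>\<^bsub>P\<^esub> Poly_Mapping.single (u, v) d) \<subseteq> carrier A \<times> carrier B"
      using monoid_algebra_closed[OF monoid_prod, of q "Poly_Mapping.single (u, v) d"] assms step
      by (auto split: if_splits)
    have q: "tensor_rel A B +>\<^bsub>P\<^esub> q \<in> carrier (tensor A B)"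
      unfolding tensor_def Q.quot_carrier using step by auto
    have "tensor_rel A B +>\<^bsub>P\<^esub> ((Poly_Mapping.single xy c + q) \<otimes>\<^bsub>P\<^esub> Poly_Mapping.single (u, v) d) =
      (d * c) \<odot>\<^bsub>tensor A B\<^esub> pure_tensor A B (x \<otimes>\<^bsub>A\<^esub> u) (y \<otimes>\<^bsub>B\<^esub> v) \<oplus>\<^bsub>tensor A B\<^esub>
      d \<odot>\<^bsub>tensor A B\<^esub> tensor_map A B (\<lambda>x. x \<otimes>\<^bsub>A\<^esub> u) (\<lambda>y. y \<otimes>\<^bsub>B\<^esub> v) (tensor_rel A B +>\<^bsub>P\<^esub> q)"
      using xy assms * step.IH
      by (simp add: monoid_algebra_distrib_right proj_add proj_single mult.commute)
    also have "\<dots> = d \<odot>\<^bsub>tensor A B\<^esub> tensor_map A B (\<lambda>x. x \<otimes>\<^bsub>A\<^esub> u) (\<lambda>y. y \<otimes>\<^bsub>B\<^esub> v)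
        (tensor_rel A B +>\<^bsub>P\<^esub> (Poly_Mapping.single xy c + q))"
      using xy assms step.hyps q
      by (simp add: proj_add proj_single hom_add[OF h] hom_smult[OF h] hom_closed[OF h]
          tensor_map_pure[OF mods mods] A.mult_hom_right B.mult_hom_right T.smult_add_right T.smult_smult)
    finally show ?case .
  qed
qed

text \<open>The relations are defined as a linear span, so stability under products needs an
  argument. An element of the span projects to zero, and by the two preceding lemmas its product
  with a monomial projects to a linear image of zero.\<close>

lemma tensor_rel_ideal: "ideal (tensor_rel A B) P"
proof (rule idealI)
  show "ring P" by (rule P.ring_axioms)
  show "subgroup (tensor_rel A B) (add_monoid P)"
    by (intro additive_subgroup.a_subgroup abelian_subgroup.axioms(1)
        MA.submodule_abelian_subgroup tensor_rel_submodule)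
next
  fix p q assume p: "p \<in> tensor_rel A B" and q: "q \<in> carrier P"
  have pc: "p \<in> carrier P" using p tensor_rel_submodule by (auto simp: MA.submodule_def')
  then have pz: "tensor_rel A B +>\<^bsub>P\<^esub> p = \<zero>\<^bsub>tensor A B\<^esub>" using p proj_zero_iff by blast
  note mods = A.k_module_axioms B.k_module_axioms
  have hl: "tensor_map A B ((\<otimes>\<^bsub>A\<^esub>) u) ((\<otimes>\<^bsub>B\<^esub>) v) \<in> module_hom class_ring (tensor A B) (tensor A B)"
    and hr: "tensor_map A B (\<lambda>x. x \<otimes>\<^bsub>A\<^esub> u) (\<lambda>y. y \<otimes>\<^bsub>B\<^esub> v) \<in> module_hom class_ring (tensor A B) (tensor A B)"
    if "u \<in> carrier A" "v \<in> carrier B" for u v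
    by (intro tensor_map_hom mods A.mult_hom_left B.mult_hom_left A.mult_hom_right B.mult_hom_right that)+
  have cl: "Poly_Mapping.keys (r \<otimes>\<^bsub>P\<^esub> s) \<subseteq> carrier A \<times> carrier B"
    if "Poly_Mapping.keys r \<subseteq> carrier A \<times> carrier B" "Poly_Mapping.keys s \<subseteq> carrier A \<times> carrier B" for r s
    using monoid_algebra_closed[OF monoid_prod] that by simp
  have "Poly_Mapping.keys q \<subseteq> carrier A \<times> carrier B" using q by simp
  then have "tensor_rel A B +>\<^bsub>P\<^esub> (q \<otimes>\<^bsub>P\<^esub> p) = \<zero>\<^bsub>tensor A B\<^esub> \<and>
      tensor_rel A B +>\<^bsub>P\<^esub> (p \<otimes>\<^bsub>P\<^esub> q) = \<zero>\<^bsub>tensor A B\<^esub>"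
  proof (induction rule: monoid_algebra_induct)
    case zero
    show ?case by (simp add: tensor_def Q.quot_zero)
  next
    case (step xy c q)
    obtain x y where xy: "xy = (x, y)" "x \<in> carrier A" "y \<in> carrier B" using step by auto
    have s: "Poly_Mapping.keys (Poly_Mapping.single (x, y) c) \<subseteq> carrier A \<times> carrier B"
      using xy by auto
    have "tensor_rel A B +>\<^bsub>P\<^esub> (Poly_Mapping.single (x, y) c \<otimes>\<^bsub>P\<^esub> p) = \<zero>\<^bsub>tensor A B\<^esub>"
      using proj_mult_single_left[OF xy(2,3), of p c] pc pz
        hom_zero[OF tensor_module tensor_module hl[OF xy(2,3)]] by simp
    moreover have "tensor_rel A B +>\<^bsub>P\<^esub> (p \<otimes>\<^bsub>P\<^esub> Poly_Mapping.single (x, y) c) = \<zero>\<^bsub>tensor A B\<^esub>"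
      using proj_mult_single_right[OF xy(2,3), of p c] pc pz
        hom_zero[OF tensor_module tensor_module hr[OF xy(2,3)]] by simp
    moreover have "Poly_Mapping.keys p \<subseteq> carrier A \<times> carrier B" using pc by simp
    ultimately show ?case
      using step s cl unfolding xy(1)
      by (simp add: monoid_algebra_distrib_left monoid_algebra_distrib_right proj_add del: keys_single)
  qed
  moreover have "q \<otimes>\<^bsub>P\<^esub> p \<in> carrier P" "p \<otimes>\<^bsub>P\<^esub> q \<in> carrier P" using pc q by (blast intro: P.m_closed)+
  ultimately show "q \<otimes>\<^bsub>P\<^esub> p \<in> tensor_rel A B" "p \<otimes>\<^bsub>P\<^esub> q \<in> tensor_rel A B"
    using proj_zero_iff by blast+
qed

sublocale AQ: alg_quotient P "tensor_rel A B"
  by (intro alg_quotient.intro alg_quotient_axioms.intro P.k_alg_axioms tensor_rel_ideal)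

lemma tensor_alg: "k_alg (tensor A B)"
  unfolding tensor_def by (rule AQ.quot_alg)

lemma pure_mult:
  assumes "x \<in> carrier A" "y \<in> carrier B" "x' \<in> carrier A" "y' \<in> carrier B"
  shows "pure_tensor A B x y \<otimes>\<^bsub>tensor A B\<^esub> pure_tensor A B x' y' =
    pure_tensor A B (x \<otimes>\<^bsub>A\<^esub> x') (y \<otimes>\<^bsub>B\<^esub> y')"
  unfolding tensor_def pure_tensor_def using assms
  by (subst AQ.quot_mult) auto

lemma tensor_one: "\<one>\<^bsub>tensor A B\<^esub> = pure_tensor A B \<one>\<^bsub>A\<^esub> \<one>\<^bsub>B\<^esub>"
  unfolding tensor_def pure_tensor_def by (subst AQ.quot_one) simp

end

section \<open>Algebras given by generators and relations\<close>

lemma monoid_words: "monoid \<lparr>carrier = lists X, mult = (@), one = []\<rparr>"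
  by (rule monoidI) auto

lemma k_alg_free_algebra: "k_alg (free_algebra X :: ('k::comm_ring_1, 'x list \<Rightarrow>\<^sub>0 'k) module)"
  unfolding free_algebra_def by (rule k_alg_monoid_algebra[OF monoid_words])

abbreviation word_eval :: "('k::comm_ring_1, 'a, 'm) module_scheme \<Rightarrow> ('x \<Rightarrow> 'a) \<Rightarrow> 'x list \<Rightarrow> 'a" where
  "word_eval A v \<equiv> (\<lambda>w. foldr (\<lambda>x y. v x \<otimes>\<^bsub>A\<^esub> y) w \<one>\<^bsub>A\<^esub>)"

context k_alg
begin

lemma word_eval_closed: "w \<in> lists X \<Longrightarrow> (\<And>x. x \<in> X \<Longrightarrow> v x \<in> carrier A) \<Longrightarrow> word_eval A v w \<in> carrier A"
  by (induction w) auto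

lemma word_eval_append:
  "w \<in> lists X \<Longrightarrow> w' \<in> lists X \<Longrightarrow> (\<And>x. x \<in> X \<Longrightarrow> v x \<in> carrier A) \<Longrightarrow>
    word_eval A v (w @ w') = word_eval A v w \<otimes> word_eval A v w'"
proof (induction w)
  case (Cons a w)
  then show ?case
    using word_eval_closed[of w X v] word_eval_closed[of w' X v] by (auto simp: m_assoc)
qed (use word_eval_closed[of w' X v] in auto)

text \<open>Existence half of the universal property of the free algebra. The product is compared
  first with a word on the left (\<open>m1\<close>), then in general by linearity in the left
  factor.\<close>

lemma eval_alg_hom:
  fixes X :: "'x set"
  assumes v: "\<And>x. x \<in> X \<Longrightarrow> v x \<in> carrier A"
  shows "lin_ext A (word_eval A v) \<in> alg_hom (free_algebra X) A"
proof -
  let ?W = "\<lparr>carrier = lists X, mult = (@), one = []\<rparr>"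
  let ?F = "monoid_algebra ?W :: ('k, 'x list \<Rightarrow>\<^sub>0 'k) module"
  let ?e = "lin_ext A (word_eval A v)"
  have ev: "word_eval A v w \<in> carrier A" if "w \<in> lists X" for w
    using that v by (rule word_eval_closed)
  have h: "?e \<in> module_hom class_ring ?F A"
    by (rule lin_ext_hom[OF k_module_axioms]) (simp add: ev)
  have s: "?e (Poly_Mapping.single w c) = c \<odot> word_eval A v w" if "w \<in> lists X" for w c
    by (rule lin_ext_single[where b = "word_eval A v", OF k_module_axioms ev[OF that]])
  note distr = monoid_algebra_distrib_left monoid_algebra_distrib_right
  have cl: "Poly_Mapping.keys (p \<otimes>\<^bsub>?F\<^esub> q) \<subseteq> lists X"
    if "Poly_Mapping.keys p \<subseteq> lists X" "Poly_Mapping.keys q \<subseteq> lists X"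
    for p q :: "'x list \<Rightarrow>\<^sub>0 'k"
    using monoid_algebra_closed[OF monoid_words, of p X q] that by simp
  have ad: "?e (p + q) = ?e p \<oplus> ?e q"
    if "Poly_Mapping.keys p \<subseteq> lists X" "Poly_Mapping.keys q \<subseteq> lists X" for p q
    using hom_add[OF h, of p q] that by simp
  have ec: "?e p \<in> carrier A" if "Poly_Mapping.keys p \<subseteq> lists X" for p
    using hom_closed[OF h, of p] that by simp
  have ks: "Poly_Mapping.keys (Poly_Mapping.single w c :: 'x list \<Rightarrow>\<^sub>0 'k) \<subseteq> lists X"
    if "w \<in> lists X" for w c using that by simp
  have m1: "?e (Poly_Mapping.single w c \<otimes>\<^bsub>?F\<^esub> q) = ?e (Poly_Mapping.single w c) \<otimes> ?e q"
    if "w \<in> lists X" "Poly_Mapping.keys q \<subseteq> lists X" for w c q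
    using that(2)
  proof (induction rule: monoid_algebra_induct)
    case zero
    then show ?case using that hom_zero[OF MA.k_module_axioms k_module_axioms h]
      by (simp add: s ev)
  next
    case (step w' d q)
    then show ?case using that
      by (simp add: distr ad ks cl s ev ec word_eval_append[OF _ _ v] smult_mult_left
          smult_mult_right smult_smult r_distr del: keys_single foldr_append)
        (simp add: ad ks s ev mult.commute del: keys_single)
  qed
  have "?e (p \<otimes>\<^bsub>?F\<^esub> q) = ?e p \<otimes> ?e q"
    if "Poly_Mapping.keys p \<subseteq> lists X" "Poly_Mapping.keys q \<subseteq> lists X" for p q
    using that(1)
  proof (induction rule: monoid_algebra_induct)
    case zero
    then show ?case using that hom_zero[OF MA.k_module_axioms k_module_axioms h]
      by (simp add: ec)
  next
    case (step w d p)
    then show ?case using that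
      by (simp add: distr ad ks cl m1 ec l_distr del: keys_single)
  qed
  moreover have "?e (Poly_Mapping.single [] 1) = \<one>" using s[of "[]" 1] by simp
  ultimately show ?thesis
    unfolding alg_hom_iff free_algebra_def using h by simp
qed

end

locale presentation =
  fixes X :: "'x set" and R :: "('x list \<Rightarrow>\<^sub>0 'k::comm_ring_1) set"
  assumes relations: "\<And>r. r \<in> R \<Longrightarrow> Poly_Mapping.keys r \<subseteq> lists X"
begin

abbreviation "FA \<equiv> free_algebra X :: ('k, 'x list \<Rightarrow>\<^sub>0 'k) module"

abbreviation "J \<equiv> Idl\<^bsub>FA\<^esub> R"

sublocale FA: k_alg FA by (rule k_alg_free_algebra)

lemma free_carrier: "carrier FA = {p. Poly_Mapping.keys p \<subseteq> lists X}"
  by (simp add: free_algebra_def)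

lemma relations_carrier: "R \<subseteq> carrier FA"
  using relations by (auto simp: free_carrier)

sublocale AQ: alg_quotient FA J
  by (intro alg_quotient.intro alg_quotient_axioms.intro FA.k_alg_axioms FA.genideal_ideal
      relations_carrier)

lemma presented_alg: "k_alg (presented_algebra X R)"
  unfolding presented_algebra_def by (rule AQ.quot_alg)

sublocale PA: k_alg "presented_algebra X R" by (rule presented_alg)

lemma proj_alg_hom: "(+>\<^bsub>FA\<^esub>) J \<in> alg_hom FA (presented_algebra X R)"
  unfolding alg_hom_iff presented_algebra_def
  using AQ.proj_linear by (simp add: AQ.quot_mult AQ.quot_one)

lemma generator_closed: "x \<in> X \<Longrightarrow> generator X R x \<in> carrier (presented_algebra X R)"
  unfolding generator_def presented_algebra_def AQ.quot_carrier by (auto simp: free_carrier)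

text \<open>Generators are appended on the right, hence the reverse induction on words. Zero has no
  case of its own, as it is \<open>0\<close> times the unit.\<close>

lemma presented_induct [consumes 1, case_names one mult add smult]:
  assumes "t \<in> carrier (presented_algebra X R)"
    and one: "Q \<one>\<^bsub>presented_algebra X R\<^esub>"
    and mult: "\<And>s x. s \<in> carrier (presented_algebra X R) \<Longrightarrow> x \<in> X \<Longrightarrow> Q s \<Longrightarrow>
      Q (s \<otimes>\<^bsub>presented_algebra X R\<^esub> generator X R x)"
    and add: "\<And>s t. s \<in> carrier (presented_algebra X R) \<Longrightarrow> t \<in> carrier (presented_algebra X R) \<Longrightarrow>
      Q s \<Longrightarrow> Q t \<Longrightarrow> Q (s \<oplus>\<^bsub>presented_algebra X R\<^esub> t)"
    and smult: "\<And>c s. s \<in> carrier (presented_algebra X R) \<Longrightarrow> Q s \<Longrightarrow> Q (c \<odot>\<^bsub>presented_algebra X R\<^esub> s)"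
  shows "Q t"
proof -
  let ?P = "presented_algebra X R"
  let ?\<pi> = "\<lambda>p. J +>\<^bsub>FA\<^esub> p"
  have h: "?\<pi> \<in> module_hom class_ring FA ?P" by (rule alg_hom_linear[OF proj_alg_hom])
  have word: "Q (?\<pi> (Poly_Mapping.single w 1))" if "w \<in> lists X" for w
    using that
  proof (induction w rule: rev_induct)
    case Nil
    then show ?case using one alg_hom_one[OF proj_alg_hom] by (simp add: free_algebra_def)
  next
    case (snoc x w)
    have "Poly_Mapping.single (w @ [x]) 1 =
        Poly_Mapping.single w 1 \<otimes>\<^bsub>FA\<^esub> (Poly_Mapping.single [x] 1 :: 'x list \<Rightarrow>\<^sub>0 'k)"
      by (simp add: free_algebra_def)
    moreover have "Poly_Mapping.single w 1 \<in> carrier FA" "Poly_Mapping.single [x] 1 \<in> carrier FA"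
      using snoc by (auto simp: free_carrier)
    ultimately have "?\<pi> (Poly_Mapping.single (w @ [x]) 1) =
        ?\<pi> (Poly_Mapping.single w 1) \<otimes>\<^bsub>?P\<^esub> generator X R x"
      using alg_hom_mult[OF proj_alg_hom] by (simp add: generator_def)
    moreover have "?\<pi> (Poly_Mapping.single w 1) \<in> carrier ?P"
      using h \<open>Poly_Mapping.single w 1 \<in> carrier FA\<close> by (rule hom_closed)
    ultimately show ?case using mult snoc by auto
  qed
  obtain p where p: "t = ?\<pi> p" "Poly_Mapping.keys p \<subseteq> lists X"
    using assms(1) by (auto simp: presented_algebra_def AQ.quot_carrier free_carrier)
  from p(2) have "Q (?\<pi> p)"
  proof (induction rule: monoid_algebra_induct)
    case zero
    have "?\<pi> 0 = \<zero>\<^bsub>?P\<^esub>"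
      using hom_zero[OF FA.k_module_axioms PA.k_module_axioms h] by (simp add: free_algebra_def)
    then show ?case using smult[OF PA.one_closed one, of 0] by simp
  next
    case (step w c q)
    have 1: "Poly_Mapping.single w 1 \<in> carrier FA" "q \<in> carrier FA"
      using step by (auto simp: free_carrier)
    have "Poly_Mapping.single w c + q = (c \<odot>\<^bsub>FA\<^esub> Poly_Mapping.single w 1) \<oplus>\<^bsub>FA\<^esub> q"
      by (simp add: free_algebra_def scale_single)
    then have "?\<pi> (Poly_Mapping.single w c + q) =
        c \<odot>\<^bsub>?P\<^esub> ?\<pi> (Poly_Mapping.single w 1) \<oplus>\<^bsub>?P\<^esub> ?\<pi> q"
      using 1 by (simp add: hom_add[OF h] hom_smult[OF h])
    then show ?case
      using add smult step word hom_closed[OF h 1(1)] hom_closed[OF h 1(2)] PA.smult_closed by simp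
  qed
  then show ?thesis using p by simp
qed

text \<open>Uniqueness half of the universal property: an algebra map on the free algebra is
  determined by the letters. Applied to the projection onto a quotient it also shows that the
  generators of the quotient satisfy its relations.\<close>

lemma free_alg_hom_eval:
  assumes "k_alg A" "g \<in> alg_hom FA A" "\<And>x. x \<in> X \<Longrightarrow> g (Poly_Mapping.single [x] 1) = v x"
    and "p \<in> carrier FA"
  shows "lin_ext A (word_eval A v) p = g p"
proof -
  interpret A: k_alg A by fact
  note h = alg_hom_linear[OF assms(2)]
  have v: "v x \<in> carrier A" if "x \<in> X" for x
    using hom_closed[OF h, of "Poly_Mapping.single [x] 1"] assms(3)[OF that] that
    by (auto simp: free_carrier)
  note e = A.eval_alg_hom[of X v, OF v]
  note eh = alg_hom_linear[OF e]
  have word: "g (Poly_Mapping.single w 1) = word_eval A v w" if "w \<in> lists X" for w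
    using that
  proof (induction w)
    case Nil
    then show ?case using alg_hom_one[OF assms(2)] by (simp add: free_algebra_def)
  next
    case (Cons x w)
    have "Poly_Mapping.single (x # w) 1 =
        Poly_Mapping.single [x] 1 \<otimes>\<^bsub>FA\<^esub> (Poly_Mapping.single w 1 :: 'x list \<Rightarrow>\<^sub>0 'k)"
      by (simp add: free_algebra_def)
    moreover have "Poly_Mapping.single w 1 \<in> carrier FA" "Poly_Mapping.single [x] 1 \<in> carrier FA"
      using Cons by (auto simp: free_carrier)
    ultimately show ?case
      using Cons assms(3) by (simp add: alg_hom_mult[OF assms(2)])
  qed
  have "Poly_Mapping.keys p \<subseteq> lists X" using assms(4) by (simp add: free_carrier)
  then show ?thesis
  proof (induction rule: monoid_algebra_induct)
    case zero
    show ?case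
      using hom_zero[OF FA.k_module_axioms A.k_module_axioms h]
        hom_zero[OF FA.k_module_axioms A.k_module_axioms eh] by (simp add: free_algebra_def)
  next
    case (step w c q)
    have 1: "Poly_Mapping.single w 1 \<in> carrier FA" "q \<in> carrier FA"
      using step by (auto simp: free_carrier)
    have 2: "Poly_Mapping.single w c + q = (c \<odot>\<^bsub>FA\<^esub> Poly_Mapping.single w 1) \<oplus>\<^bsub>FA\<^esub> q"
      by (simp add: free_algebra_def scale_single)
    have "word_eval A v w \<in> carrier A" using step v by (intro A.word_eval_closed) auto
    then have "lin_ext A (word_eval A v) (Poly_Mapping.single w 1) = word_eval A v w"
      using lin_ext_single[OF A.k_module_axioms, of "word_eval A v" w 1] by simp
    then show ?case
      unfolding 2 using 1 step by (simp add: hom_add[OF h] hom_smult[OF h] hom_add[OF eh]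
          hom_smult[OF eh] word)
  qed
qed

text \<open>The existence of \<open>g\<close> stands in for a verification of the relations for
  \<open>v\<close>. This is how the raw \<open>presented_hom\<close> terms in the definitions of the
  comultiplication and of the coaction are recognised as known algebra maps.\<close>

lemma presented_hom_unique:
  assumes "k_alg A" "g \<in> alg_hom (presented_algebra X R) A"
    and "\<And>x. x \<in> X \<Longrightarrow> g (generator X R x) = v x" "t \<in> carrier (presented_algebra X R)"
  shows "presented_hom A v t = g t"
proof -
  interpret A: k_alg A by fact
  note ph = alg_hom_linear[OF proj_alg_hom]
  have gp: "(\<lambda>p. g (J +>\<^bsub>FA\<^esub> p)) \<in> alg_hom FA A"
    using proj_alg_hom assms(2) by (auto simp: alg_hom_iff module_hom_iff)
  have gh: "(\<lambda>p. g (J +>\<^bsub>FA\<^esub> p)) \<in> module_hom class_ring FA A" by (rule alg_hom_linear[OF gp])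
  have eq: "lin_ext A (word_eval A v) p = g (J +>\<^bsub>FA\<^esub> p)" if "p \<in> carrier FA" for p
    using free_alg_hom_eval[OF assms(1) gp _ that] assms(3) by (simp add: generator_def)
  have lh: "lin_ext A (word_eval A v) \<in> module_hom class_ring FA A"
    using gh eq by (auto simp: module_hom_iff)
  obtain p where p: "t = J +>\<^bsub>FA\<^esub> p" "p \<in> carrier FA"
    using assms(4) by (auto simp: presented_algebra_def AQ.quot_carrier)
  have "presented_hom A v t = lin_ext A (word_eval A v) p"
    unfolding presented_hom_def coset_ext_def p(1)
  proof (rule AQ.the_elem_image_coset[OF A.k_module_axioms lh _ p(2)])
    fix y assume y: "y \<in> J"
    then have yc: "y \<in> carrier FA" using AQ.ideal by (meson ideal.Icarr)
    have "J +>\<^bsub>FA\<^esub> y = J +>\<^bsub>FA\<^esub> \<zero>\<^bsub>FA\<^esub>"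
      using y yc by (subst AQ.quot_eq_iff) (auto simp: a_minus_def)
    then show "lin_ext A (word_eval A v) y = \<zero>\<^bsub>A\<^esub>"
      using eq[OF yc] hom_zero[OF FA.k_module_axioms A.k_module_axioms gh] by simp
  qed
  then show ?thesis using eq p by simp
qed

text \<open>The evaluation at \<open>v\<close> is a ring map on the free algebra, so its kernel is
  an ideal; containing \<open>R\<close>, it contains the ideal generated by \<open>R\<close>, and
  the evaluation descends.\<close>

lemma presented_hom:
  assumes "k_alg A" "\<And>x. x \<in> X \<Longrightarrow> v x \<in> carrier A"
    and "\<And>r. r \<in> R \<Longrightarrow> lin_ext A (word_eval A v) r = \<zero>\<^bsub>A\<^esub>"
  shows "presented_hom A v \<in> alg_hom (presented_algebra X R) A"
    and "\<And>x. x \<in> X \<Longrightarrow> presented_hom A v (generator X R x) = v x"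
proof -
  interpret A: k_alg A by fact
  let ?e = "lin_ext A (word_eval A v)"
  note e = A.eval_alg_hom[of X v, OF assms(2)]
  note eh = alg_hom_linear[OF e]
  interpret E: ring_hom_ring FA A ?e
    by (intro ring_hom_ringI2 FA.ring_axioms A.ring_axioms) (use e in \<open>simp add: alg_hom_def\<close>)
  have "R \<subseteq> a_kernel FA A ?e"
    unfolding a_kernel_def' using assms(3) relations_carrier by blast
  then have "J \<subseteq> a_kernel FA A ?e"
    by (rule FA.genideal_minimal[OF E.kernel_is_ideal])
  then have k: "?e y = \<zero>\<^bsub>A\<^esub>" if "y \<in> J" for y
    using that unfolding a_kernel_def' by blast
  have eq: "presented_hom A v (J +>\<^bsub>FA\<^esub> p) = ?e p" if "p \<in> carrier FA" for p
    unfolding presented_hom_def coset_ext_def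
    by (rule AQ.the_elem_image_coset[OF A.k_module_axioms eh k that])
  have car: "carrier (presented_algebra X R) = (+>\<^bsub>FA\<^esub>) J ` carrier FA"
    by (simp add: presented_algebra_def AQ.quot_carrier)
  note ph = alg_hom_linear[OF proj_alg_hom]
  show "presented_hom A v \<in> alg_hom (presented_algebra X R) A"
    unfolding alg_hom_iff
  proof (intro conjI ballI module_homI)
    fix s assume "s \<in> carrier (presented_algebra X R)"
    then obtain p where p: "p \<in> carrier FA" "s = J +>\<^bsub>FA\<^esub> p" using car by blast
    show "presented_hom A v s \<in> carrier A" using p hom_closed[OF eh] by (simp add: eq)
    show "presented_hom A v (c \<odot>\<^bsub>presented_algebra X R\<^esub> s) = c \<odot>\<^bsub>A\<^esub> presented_hom A v s" for c
      using p by (simp add: eq hom_smult[OF eh] hom_smult[OF ph, symmetric])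
    fix t assume "t \<in> carrier (presented_algebra X R)"
    then obtain q where q: "q \<in> carrier FA" "t = J +>\<^bsub>FA\<^esub> q" using car by blast
    show "presented_hom A v (s \<oplus>\<^bsub>presented_algebra X R\<^esub> t) = presented_hom A v s \<oplus>\<^bsub>A\<^esub> presented_hom A v t"
      using p q by (simp add: eq hom_add[OF eh] hom_add[OF ph, symmetric])
    show "presented_hom A v (s \<otimes>\<^bsub>presented_algebra X R\<^esub> t) = presented_hom A v s \<otimes>\<^bsub>A\<^esub> presented_hom A v t"
      using p q by (simp add: eq alg_hom_mult[OF e] alg_hom_mult[OF proj_alg_hom, symmetric])
  next
    show "presented_hom A v \<one>\<^bsub>presented_algebra X R\<^esub> = \<one>\<^bsub>A\<^esub>"
      using eq[OF FA.one_closed] alg_hom_one[OF e] alg_hom_one[OF proj_alg_hom] by simp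
  qed
  show "presented_hom A v (generator X R x) = v x" if "x \<in> X" for x
  proof -
    have "Poly_Mapping.single [x] 1 \<in> carrier FA" using that by (auto simp: free_carrier)
    then show ?thesis
      unfolding generator_def using assms(2)[OF that] that
      by (subst eq) (auto simp: lin_ext_single[OF A.k_module_axioms])
  qed
qed

end

section \<open>Faithful flatness\<close>

text \<open>Exactness at the middle term is transported by bijections on the first two terms. On the
  third term only the fibre over zero is involved, so an injection that preserves zero is
  enough.\<close>

lemma exact_at_iso:
  assumes "bij_betw \<alpha> (carrier L) (carrier L')" "bij_betw \<beta> (carrier M) (carrier M')"
    and "inj_on \<gamma> (carrier N)" "\<gamma> \<zero>\<^bsub>N\<^esub> = \<zero>\<^bsub>N'\<^esub>" "\<zero>\<^bsub>N\<^esub> \<in> carrier N"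
    and "\<And>x. x \<in> carrier L \<Longrightarrow> f x \<in> carrier M" "\<And>x. x \<in> carrier M \<Longrightarrow> g x \<in> carrier N"
    and "\<And>x. x \<in> carrier L \<Longrightarrow> f' (\<alpha> x) = \<beta> (f x)"
    and "\<And>x. x \<in> carrier M \<Longrightarrow> g' (\<beta> x) = \<gamma> (g x)"
  shows "exact_at L M N f g \<longleftrightarrow> exact_at L' M' N' f' g'"
proof -
  have "f' ` carrier L' = \<beta> ` (f ` carrier L)"
    using assms(1,8) by (force simp: bij_betw_def image_image)
  moreover have "{x \<in> carrier M'. g' x = \<zero>\<^bsub>N'\<^esub>} = \<beta> ` {x \<in> carrier M. g x = \<zero>\<^bsub>N\<^esub>}"
  proof -
    have "g' (\<beta> x) = \<zero>\<^bsub>N'\<^esub> \<longleftrightarrow> g x = \<zero>\<^bsub>N\<^esub>" if "x \<in> carrier M" for x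
      using assms(3-5,7,9) that by (metis inj_onD)
    moreover have "carrier M' = \<beta> ` carrier M" using assms(2) by (simp add: bij_betw_def)
    ultimately show ?thesis by auto
  qed
  moreover have "\<beta> ` (f ` carrier L) = \<beta> ` {x \<in> carrier M. g x = \<zero>\<^bsub>N\<^esub>} \<longleftrightarrow>
      f ` carrier L = {x \<in> carrier M. g x = \<zero>\<^bsub>N\<^esub>}"
    using assms(2,6) by (intro inj_on_image_eq_iff[of \<beta> "carrier M"]) (auto simp: bij_betw_def)
  ultimately show ?thesis by (auto simp: exact_at_def)
qed

definition transport ::
  "('a \<Rightarrow> 'b) \<Rightarrow> ('k, 'a, 'm) module_scheme \<Rightarrow> ('k, 'b) module" where
  "transport e M = \<lparr>carrier = e ` carrier M, mult = \<lambda>x y. x, one = e \<zero>\<^bsub>M\<^esub>, zero = e \<zero>\<^bsub>M\<^esub>,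
     add = (\<lambda>x y. e (inv_into (carrier M) e x \<oplus>\<^bsub>M\<^esub> inv_into (carrier M) e y)),
     smult = (\<lambda>c x. e (c \<odot>\<^bsub>M\<^esub> inv_into (carrier M) e x))\<rparr>"

lemma transport:
  assumes "k_module M" "inj_on e (carrier M)"
  shows transport_module: "k_module (transport e M)"
    and transport_hom: "e \<in> module_hom class_ring M (transport e M)"
    and transport_inv: "inv_into (carrier M) e \<in> module_hom class_ring (transport e M) M"
    and transport_inv1: "\<And>x. x \<in> carrier M \<Longrightarrow> inv_into (carrier M) e (e x) = x"
    and transport_inv2: "\<And>x. x \<in> carrier (transport e M) \<Longrightarrow> e (inv_into (carrier M) e x) = x"
proof -
  interpret M: k_module M by fact
  show inv1: "\<And>x. x \<in> carrier M \<Longrightarrow> inv_into (carrier M) e (e x) = x"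
    using assms(2) by simp
  show "k_module (transport e M)"
    by (rule k_module_image[OF assms(1), of _ e]) (simp_all add: transport_def inv1)
  show "e \<in> module_hom class_ring M (transport e M)"
    by (rule module_homI) (simp_all add: transport_def inv1)
  show "inv_into (carrier M) e \<in> module_hom class_ring (transport e M) M"
    by (rule module_homI) (auto simp: transport_def inv1)
  show "\<And>x. x \<in> carrier (transport e M) \<Longrightarrow> e (inv_into (carrier M) e x) = x"
    by (auto simp: transport_def inv1)
qed

lemma tensor_map_bij:
  assumes "k_module Z" "k_module M" "k_module N"
    and f: "f \<in> module_hom class_ring M N" and g: "g \<in> module_hom class_ring N M"
    and "\<And>x. x \<in> carrier M \<Longrightarrow> g (f x) = x" "\<And>x. x \<in> carrier N \<Longrightarrow> f (g x) = x"
  shows "bij_betw (tensor_map Z N (\<lambda>z. z) f) (carrier (tensor Z M)) (carrier (tensor Z N))"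
proof (rule bij_betwI[where g = "tensor_map Z M (\<lambda>z. z) g"])
  note hf = tensor_map_hom[OF assms(1,2,1,3) hom_id f]
  note hg = tensor_map_hom[OF assms(1,3,1,2) hom_id g]
  show "tensor_map Z N (\<lambda>z. z) f \<in> carrier (tensor Z M) \<rightarrow> carrier (tensor Z N)"
    using hom_closed[OF hf] by blast
  show "tensor_map Z M (\<lambda>z. z) g \<in> carrier (tensor Z N) \<rightarrow> carrier (tensor Z M)"
    using hom_closed[OF hg] by blast
  show "tensor_map Z M (\<lambda>z. z) g (tensor_map Z N (\<lambda>z. z) f t) = t" if "t \<in> carrier (tensor Z M)" for t
    using tensor_map_compose[OF assms(1,2,1,3,1,2) hom_id f hom_id g that]
      tensor_map_id[OF assms(1,2) that] assms(6) by simp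
  show "tensor_map Z N (\<lambda>z. z) f (tensor_map Z M (\<lambda>z. z) g t) = t" if "t \<in> carrier (tensor Z N)" for t
    using tensor_map_compose[OF assms(1,3,1,2,1,3) hom_id g hom_id f that]
      tensor_map_id[OF assms(1,3) that] assms(7) by simp
qed

text \<open>
  The type of the modules in the definition of faithful flatness is no restriction for modules
  that embed into it as sets: transport the structure along the injection.
\<close>

lemma faithfully_flat_exact:
  fixes Z :: "('k::comm_ring_1, 'z, 'm) module_scheme"
    and eL :: "'a \<Rightarrow> ('z list \<Rightarrow>\<^sub>0 'k) set"
    and eM :: "'b \<Rightarrow> ('z list \<Rightarrow>\<^sub>0 'k) set"
    and eN :: "'c \<Rightarrow> ('z list \<Rightarrow>\<^sub>0 'k) set"
  assumes ff: "faithfully_flat Z" and Z: "k_module Z"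
    and L: "k_module L" and M: "k_module M" and N: "k_module N"
    and eL: "inj_on eL (carrier L)" and eM: "inj_on eM (carrier M)" and eN: "inj_on eN (carrier N)"
    and f: "f \<in> module_hom class_ring L M" and g: "g \<in> module_hom class_ring M N"
  shows "exact_at L M N f g \<longleftrightarrow>
       exact_at (tensor Z L) (tensor Z M) (tensor Z N)
         (tensor_map Z M (\<lambda>z. z) f) (tensor_map Z N (\<lambda>z. z) g)"
proof -
  let ?L = "transport eL L" and ?M = "transport eM M" and ?N = "transport eN N"
  let ?dL = "inv_into (carrier L) eL" and ?dM = "inv_into (carrier M) eM"
    and ?dN = "inv_into (carrier N) eN"
  let ?f = "\<lambda>x. eM (f (?dL x))" and ?g = "\<lambda>x. eN (g (?dM x))"
  note tL = transport[OF L eL] and tM = transport[OF M eM] and tN = transport[OF N eN]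
  have f': "?f \<in> module_hom class_ring ?L ?M"
    using hom_compose[OF hom_compose[OF tL(3) f] tM(2)] .
  have g': "?g \<in> module_hom class_ring ?M ?N"
    using hom_compose[OF hom_compose[OF tM(3) g] tN(2)] .
  interpret L: k_module L by fact
  interpret M: k_module M by fact
  interpret N: k_module N by fact
  interpret Z: k_module Z by fact
  interpret ZN: k_module "tensor Z N" by (rule k_module_tensor[OF Z N])
  have bij: "bij_betw e (carrier M) (carrier (transport e M))" if "inj_on e (carrier M)" for e and M
    using that by (auto simp: transport_def bij_betw_def)
  have "exact_at L M N f g \<longleftrightarrow> exact_at ?L ?M ?N ?f ?g"
  proof (rule exact_at_iso[where \<alpha> = eL and \<beta> = eM and \<gamma> = eN])
    show "eN \<zero>\<^bsub>N\<^esub> = \<zero>\<^bsub>?N\<^esub>" by (simp add: transport_def)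
  qed (use bij eL eM eN tL(4) tM(4) hom_closed[OF f] hom_closed[OF g] in auto)
  also have "\<dots> \<longleftrightarrow> exact_at (tensor Z ?L) (tensor Z ?M) (tensor Z ?N)
         (tensor_map Z ?M (\<lambda>z. z) ?f) (tensor_map Z ?N (\<lambda>z. z) ?g)"
    using ff f' g' tL(1) tM(1) tN(1) unfolding faithfully_flat_def k_module_def by blast
  also have "\<dots> \<longleftrightarrow> exact_at (tensor Z L) (tensor Z M) (tensor Z N)
         (tensor_map Z M (\<lambda>z. z) f) (tensor_map Z N (\<lambda>z. z) g)"
  proof (rule exact_at_iso[symmetric, where \<alpha> = "tensor_map Z ?L (\<lambda>z. z) eL"
        and \<beta> = "tensor_map Z ?M (\<lambda>z. z) eM" and \<gamma> = "tensor_map Z ?N (\<lambda>z. z) eN"])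
    show "bij_betw (tensor_map Z ?L (\<lambda>z. z) eL) (carrier (tensor Z L)) (carrier (tensor Z ?L))"
      by (rule tensor_map_bij[OF Z L tL(1,2,3)]) (use tL in auto)
    show "bij_betw (tensor_map Z ?M (\<lambda>z. z) eM) (carrier (tensor Z M)) (carrier (tensor Z ?M))"
      by (rule tensor_map_bij[OF Z M tM(1,2,3)]) (use tM in auto)
    have "bij_betw (tensor_map Z ?N (\<lambda>z. z) eN) (carrier (tensor Z N)) (carrier (tensor Z ?N))"
      by (rule tensor_map_bij[OF Z N tN(1,2,3)]) (use tN in auto)
    then show "inj_on (tensor_map Z ?N (\<lambda>z. z) eN) (carrier (tensor Z N))"
      by (simp add: bij_betw_def)
    show "tensor_map Z ?N (\<lambda>z. z) eN \<zero>\<^bsub>tensor Z N\<^esub> = \<zero>\<^bsub>tensor Z ?N\<^esub>"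
      by (rule hom_zero[OF k_module_tensor k_module_tensor tensor_map_hom[OF Z N Z tN(1) hom_id tN(2)]])
        (fact Z N tN(1))+
    show "\<zero>\<^bsub>tensor Z N\<^esub> \<in> carrier (tensor Z N)" by simp
    show "tensor_map Z M (\<lambda>z. z) f t \<in> carrier (tensor Z M)" if "t \<in> carrier (tensor Z L)" for t
      using that by (rule hom_closed[OF tensor_map_hom[OF Z L Z M hom_id f]])
    show "tensor_map Z N (\<lambda>z. z) g t \<in> carrier (tensor Z N)" if "t \<in> carrier (tensor Z M)" for t
      using that by (rule hom_closed[OF tensor_map_hom[OF Z M Z N hom_id g]])
    show "tensor_map Z ?M (\<lambda>z. z) ?f (tensor_map Z ?L (\<lambda>z. z) eL t) =
        tensor_map Z ?M (\<lambda>z. z) eM (tensor_map Z M (\<lambda>z. z) f t)" if t: "t \<in> carrier (tensor Z L)" for t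
      unfolding tensor_map_compose[OF Z L Z tL(1) Z tM(1) hom_id tL(2) hom_id f' t]
        tensor_map_compose[OF Z L Z M Z tM(1) hom_id f hom_id tM(2) t]
      by (rule tensor_map_cong[OF Z L Z tM(1) hom_id hom_compose[OF f tM(2)] _ _ t])
        (simp_all add: tL(4))
    show "tensor_map Z ?N (\<lambda>z. z) ?g (tensor_map Z ?M (\<lambda>z. z) eM t) =
        tensor_map Z ?N (\<lambda>z. z) eN (tensor_map Z N (\<lambda>z. z) g t)" if t: "t \<in> carrier (tensor Z M)" for t
      unfolding tensor_map_compose[OF Z M Z tM(1) Z tN(1) hom_id tM(2) hom_id g' t]
        tensor_map_compose[OF Z M Z N Z tN(1) hom_id g hom_id tN(2) t]
      by (rule tensor_map_cong[OF Z M Z tN(1) hom_id hom_compose[OF g tN(2)] _ _ t])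
        (simp_all add: tM(4))
  qed
  finally show ?thesis .
qed

lemma zero_submodule:
  assumes "k_module M"
  shows "k_module (M\<lparr>carrier := {\<zero>\<^bsub>M\<^esub>}\<rparr>)"
proof -
  interpret M: k_module M by fact
  show ?thesis by (rule M.submodule_k_module) (auto simp: M.submodule_def')
qed

lemma tensor_zero_carrier:
  assumes Z: "k_module Z" and M: "k_module M" and "carrier M = {\<zero>\<^bsub>M\<^esub>}"
  shows "carrier (tensor Z M) = {\<zero>\<^bsub>tensor Z M\<^esub>}"
proof -
  interpret two_modules Z M using Z M by (rule two_modulesI)
  have "t = \<zero>\<^bsub>tensor Z M\<^esub>" if "t \<in> carrier (tensor Z M)" for t
    using that by (induction rule: tensor_induct) (use assms(3) in auto)
  then show ?thesis by auto
qed

text \<open>Injectivity is exactness of \<open>0 \<rightarrow> M \<rightarrow> N\<close> at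
  \<open>M\<close>. The zero module is taken to be \<open>M\<close> with its carrier cut down to
  zero, so the embedding of \<open>M\<close> serves for it as well.\<close>

lemma faithfully_flat_inj_iff:
  fixes Z :: "('k::comm_ring_1, 'z, 'm) module_scheme"
    and eM :: "'b \<Rightarrow> ('z list \<Rightarrow>\<^sub>0 'k) set"
    and eN :: "'c \<Rightarrow> ('z list \<Rightarrow>\<^sub>0 'k) set"
  assumes ff: "faithfully_flat Z" and Z: "k_module Z" and M: "k_module M" and N: "k_module N"
    and eM: "inj_on eM (carrier M)" and eN: "inj_on eN (carrier N)"
    and f: "f \<in> module_hom class_ring M N"
  shows "inj_on f (carrier M) \<longleftrightarrow> inj_on (tensor_map Z N (\<lambda>z. z) f) (carrier (tensor Z M))"
proof -
  interpret M: k_module M by fact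
  interpret N: k_module N by fact
  let ?O = "M\<lparr>carrier := {\<zero>\<^bsub>M\<^esub>}\<rparr>"
  note O = zero_submodule[OF M]
  interpret ZM: k_module "tensor Z M" by (rule k_module_tensor[OF Z M])
  interpret ZN: k_module "tensor Z N" by (rule k_module_tensor[OF Z N])
  have i: "(\<lambda>x. x) \<in> module_hom class_ring ?O M" by (auto simp: module_hom_iff)
  note hf = tensor_map_hom[OF Z M Z N hom_id f]
  have "inj_on f (carrier M) \<longleftrightarrow> exact_at ?O M N (\<lambda>x. x) f"
    using hom_zero[OF M N f] by (auto simp: hom_inj_iff[OF M N f] exact_at_def)
  also have "\<dots> \<longleftrightarrow> exact_at (tensor Z ?O) (tensor Z M) (tensor Z N)
         (tensor_map Z M (\<lambda>z. z) (\<lambda>x. x)) (tensor_map Z N (\<lambda>z. z) f)"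
    by (rule faithfully_flat_exact[OF ff Z O M N _ eM eN i f, of eM]) simp
  also have "\<dots> \<longleftrightarrow> {\<zero>\<^bsub>tensor Z M\<^esub>} =
      {x \<in> carrier (tensor Z M). tensor_map Z N (\<lambda>z. z) f x = \<zero>\<^bsub>tensor Z N\<^esub>}"
    unfolding exact_at_def
    using tensor_zero_carrier[OF Z O]
      hom_zero[OF k_module_tensor[OF Z O] ZM.k_module_axioms tensor_map_hom[OF Z O Z M hom_id i]]
    by simp
  also have "\<dots> \<longleftrightarrow> inj_on (tensor_map Z N (\<lambda>z. z) f) (carrier (tensor Z M))"
    using hom_zero[OF ZM.k_module_axioms ZN.k_module_axioms hf]
    by (auto simp: hom_inj_iff[OF ZM.k_module_axioms ZN.k_module_axioms hf])
  finally show ?thesis .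
qed

text \<open>Surjectivity is exactness of \<open>M \<rightarrow> N \<rightarrow> 0\<close> at
  \<open>N\<close>, with the zero module realised inside \<open>N\<close>.\<close>

lemma faithfully_flat_surj_iff:
  fixes Z :: "('k::comm_ring_1, 'z, 'm) module_scheme"
    and eM :: "'b \<Rightarrow> ('z list \<Rightarrow>\<^sub>0 'k) set"
    and eN :: "'c \<Rightarrow> ('z list \<Rightarrow>\<^sub>0 'k) set"
  assumes ff: "faithfully_flat Z" and Z: "k_module Z" and M: "k_module M" and N: "k_module N"
    and eM: "inj_on eM (carrier M)" and eN: "inj_on eN (carrier N)"
    and f: "f \<in> module_hom class_ring M N"
  shows "f ` carrier M = carrier N \<longleftrightarrow>
    tensor_map Z N (\<lambda>z. z) f ` carrier (tensor Z M) = carrier (tensor Z N)"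
proof -
  interpret N: k_module N by fact
  let ?O = "N\<lparr>carrier := {\<zero>\<^bsub>N\<^esub>}\<rparr>"
  note O = zero_submodule[OF N]
  interpret ZN: k_module "tensor Z N" by (rule k_module_tensor[OF Z N])
  have o: "(\<lambda>x. \<zero>\<^bsub>N\<^esub>) \<in> module_hom class_ring N ?O" by (auto simp: module_hom_iff)
  have "f ` carrier M = carrier N \<longleftrightarrow> exact_at M N ?O f (\<lambda>x. \<zero>\<^bsub>N\<^esub>)"
    by (simp add: exact_at_def)
  also have "\<dots> \<longleftrightarrow> exact_at (tensor Z M) (tensor Z N) (tensor Z ?O)
         (tensor_map Z N (\<lambda>z. z) f) (tensor_map Z ?O (\<lambda>z. z) (\<lambda>x. \<zero>\<^bsub>N\<^esub>))"
    by (rule faithfully_flat_exact[OF ff Z M N O eM eN _ f o, of eN]) simp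
  also have "\<dots> \<longleftrightarrow> tensor_map Z N (\<lambda>z. z) f ` carrier (tensor Z M) = carrier (tensor Z N)"
  proof -
    have "tensor_map Z ?O (\<lambda>z. z) (\<lambda>x. \<zero>\<^bsub>N\<^esub>) t = \<zero>\<^bsub>tensor Z ?O\<^esub>" if "t \<in> carrier (tensor Z N)" for t
      using hom_closed[OF tensor_map_hom[OF Z N Z O hom_id o] that] tensor_zero_carrier[OF Z O] by simp
    then show ?thesis by (auto simp: exact_at_def)
  qed
  finally show ?thesis .
qed

section \<open>Powers of a module\<close>

text \<open>Tuples are functions on the naturals that are fixed to zero from index \<open>n\<close>
  on, so that equality of tuples is equality of functions and coordinates need no bounds to stay in
  the carrier.\<close>

definition power_module :: "nat \<Rightarrow> ('k, 'a, 'm) module_scheme \<Rightarrow> ('k, nat \<Rightarrow> 'a) module" where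
  "power_module n M =
    \<lparr>carrier = {f. (\<forall>i<n. f i \<in> carrier M) \<and> (\<forall>i\<ge>n. f i = \<zero>\<^bsub>M\<^esub>)},
     mult = \<lambda>f g. f, one = \<lambda>i. \<zero>\<^bsub>M\<^esub>, zero = \<lambda>i. \<zero>\<^bsub>M\<^esub>, add = \<lambda>f g i. f i \<oplus>\<^bsub>M\<^esub> g i,
     smult = \<lambda>c f i. c \<odot>\<^bsub>M\<^esub> f i\<rparr>"

definition power_inj :: "('k, 'a, 'm) module_scheme \<Rightarrow> nat \<Rightarrow> 'a \<Rightarrow> nat \<Rightarrow> 'a" where
  "power_inj M i x = (\<lambda>j. if j = i then x else \<zero>\<^bsub>M\<^esub>)"

context k_module
begin

lemma power_simps [simp]:
  "\<zero>\<^bsub>power_module n M\<^esub> = (\<lambda>i. \<zero>)"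
  "f \<oplus>\<^bsub>power_module n M\<^esub> g = (\<lambda>i. f i \<oplus> g i)"
  "c \<odot>\<^bsub>power_module n M\<^esub> f = (\<lambda>i. c \<odot> f i)"
  by (simp_all add: power_module_def)

lemma power_carrier:
  "f \<in> carrier (power_module n M) \<longleftrightarrow> (\<forall>i. f i \<in> carrier M) \<and> (\<forall>i\<ge>n. f i = \<zero>)"
  by (auto simp: power_module_def) (metis linorder_not_less zero_closed)

lemma power_closed: "f \<in> carrier (power_module n M) \<Longrightarrow> f i \<in> carrier M"
  by (simp add: power_carrier)

lemma k_module_power: "k_module (power_module n M)"
proof -
  have "abelian_group (power_module n M)"
  proof (rule abelian_groupI)
    fix f assume "f \<in> carrier (power_module n M)"
    then show "\<exists>g\<in>carrier (power_module n M). g \<oplus>\<^bsub>power_module n M\<^esub> f = \<zero>\<^bsub>power_module n M\<^esub>"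
      by (intro bexI[of _ "\<lambda>i. \<ominus> f i"]) (auto simp: power_carrier l_neg)
  qed (auto simp: power_carrier a_ac)
  then have "module class_ring (power_module n M)"
    by (intro moduleI class_cring.cring_axioms)
      (auto simp: power_carrier smult_add_left smult_add_right smult_smult)
  then show ?thesis by (simp add: k_module_def)
qed

lemma power_proj_hom: "(\<lambda>f. f i) \<in> module_hom class_ring (power_module n M) M"
  by (rule module_homI) (auto simp: power_carrier)

lemma power_inj_hom: "i < n \<Longrightarrow> power_inj M i \<in> module_hom class_ring M (power_module n M)"
  by (rule module_homI) (auto simp: power_carrier power_inj_def)

lemma power_sum_apply:
  assumes "finite A" "\<And>a. a \<in> A \<Longrightarrow> f a \<in> carrier (power_module n M)"
  shows "(\<Oplus>\<^bsub>power_module n M\<^esub>a\<in>A. f a) i = (\<Oplus>a\<in>A. f a i)"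
  by (rule hom_finsum[OF k_module_power k_module_axioms power_proj_hom assms])

lemma power_decompose:
  assumes "f \<in> carrier (power_module n M)"
  shows "(\<Oplus>\<^bsub>power_module n M\<^esub>i\<in>{..<n}. power_inj M i (f i)) = f"
proof
  fix j
  have c: "power_inj M i (f i) \<in> carrier (power_module n M)" if "i \<in> {..<n}" for i
    using that assms by (auto simp: power_carrier power_inj_def)
  have "(\<Oplus>\<^bsub>power_module n M\<^esub>i\<in>{..<n}. power_inj M i (f i)) j = (\<Oplus>i\<in>{..<n}. power_inj M i (f i) j)"
    by (rule power_sum_apply) (use c in auto)
  also have "\<dots> = f j"
  proof (cases "j < n")
    case True
    then show ?thesis
      using add.finprod_singleton[of j "{..<n}" f] assms
      by (simp add: power_inj_def power_carrier)
  next
    case False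
    then have "(\<Oplus>i\<in>{..<n}. power_inj M i (f i) j) = (\<Oplus>i\<in>{..<n}. \<zero>)"
      by (intro finsum_cong') (auto simp: power_inj_def)
    then show ?thesis using False assms by (simp add: power_carrier)
  qed
  finally show "(\<Oplus>\<^bsub>power_module n M\<^esub>i\<in>{..<n}. power_inj M i (f i)) j = f j" .
qed

text \<open>Tensoring commutes with finite direct sums, in the form that the identity is the sum
  over \<open>i\<close> of the \<open>i\<close>-th projection followed by the \<open>i\<close>-th
  injection.\<close>

lemma tensor_power_decompose:
  assumes Z: "k_module Z" and t: "t \<in> carrier (tensor Z (power_module n M))"
  shows "(\<Oplus>\<^bsub>tensor Z (power_module n M)\<^esub>i\<in>{..<n}. tensor_map Z (power_module n M) (\<lambda>z. z) (power_inj M i)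
      (tensor_map Z M (\<lambda>z. z) (\<lambda>f. f i) t)) = t"
proof -
  let ?P = "power_module n M"
  note P = k_module_power[of n] and M = k_module_axioms
  interpret two_modules Z ?P using Z P by (rule two_modulesI)
  have h: "(\<lambda>t. tensor_map Z ?P (\<lambda>z. z) (power_inj M i) (tensor_map Z M (\<lambda>z. z) (\<lambda>f. f i) t))
      \<in> module_hom class_ring (tensor Z ?P) (tensor Z ?P)" if "i < n" for i
    using hom_compose[OF tensor_map_hom[OF Z P Z M hom_id power_proj_hom]
        tensor_map_hom[OF Z M Z P hom_id power_inj_hom[OF that]]] .
  have s: "(\<lambda>t. (\<Oplus>\<^bsub>tensor Z ?P\<^esub>i\<in>{..<n}. tensor_map Z ?P (\<lambda>z. z) (power_inj M i)
      (tensor_map Z M (\<lambda>z. z) (\<lambda>f. f i) t))) \<in> module_hom class_ring (tensor Z ?P) (tensor Z ?P)"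
    by (rule hom_sum[OF tensor_module]) (use h in auto)
  show ?thesis
  proof (rule tensor_hom_eq[OF s hom_id _ t])
    fix x y assume xy: "x \<in> carrier Z" "y \<in> carrier ?P"
    then have yi: "y i \<in> carrier M" for i by (simp add: power_carrier)
    have "(\<Oplus>\<^bsub>tensor Z ?P\<^esub>i\<in>{..<n}. tensor_map Z ?P (\<lambda>z. z) (power_inj M i)
        (tensor_map Z M (\<lambda>z. z) (\<lambda>f. f i) (pure_tensor Z ?P x y))) =
      (\<Oplus>\<^bsub>tensor Z ?P\<^esub>i\<in>{..<n}. pure_tensor Z ?P x (power_inj M i (y i)))"
      using xy yi
      by (intro T.finsum_cong')
        (auto simp: tensor_map_pure[OF Z P Z M hom_id power_proj_hom]
          tensor_map_pure[OF Z M Z P hom_id power_inj_hom] intro!: pure_closed hom_closed[OF power_inj_hom])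
    also have "\<dots> = pure_tensor Z ?P x (\<Oplus>\<^bsub>?P\<^esub>i\<in>{..<n}. power_inj M i (y i))"
      using yi by (intro hom_finsum[OF P tensor_module pure_hom_right[OF xy(1)], symmetric])
        (auto intro: hom_closed[OF power_inj_hom])
    finally show "(\<Oplus>\<^bsub>tensor Z ?P\<^esub>i\<in>{..<n}. tensor_map Z ?P (\<lambda>z. z) (power_inj M i)
        (tensor_map Z M (\<lambda>z. z) (\<lambda>f. f i) (pure_tensor Z ?P x y))) = pure_tensor Z ?P x y"
      using power_decompose[OF xy(2)] by simp
  qed
qed

lemma tensor_power_eqI:
  assumes Z: "k_module Z" and "t \<in> carrier (tensor Z (power_module n M))"
    "t' \<in> carrier (tensor Z (power_module n M))"
    and "\<And>i. i < n \<Longrightarrow> tensor_map Z M (\<lambda>z. z) (\<lambda>f. f i) t = tensor_map Z M (\<lambda>z. z) (\<lambda>f. f i) t'"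
  shows "t = t'"
proof -
  let ?P = "power_module n M"
  note P = k_module_power[of n] and M = k_module_axioms
  interpret two_modules Z ?P using Z P by (rule two_modulesI)
  have "(\<Oplus>\<^bsub>tensor Z ?P\<^esub>i\<in>{..<n}. tensor_map Z ?P (\<lambda>z. z) (power_inj M i)
        (tensor_map Z M (\<lambda>z. z) (\<lambda>f. f i) t)) =
      (\<Oplus>\<^bsub>tensor Z ?P\<^esub>i\<in>{..<n}. tensor_map Z ?P (\<lambda>z. z) (power_inj M i)
        (tensor_map Z M (\<lambda>z. z) (\<lambda>f. f i) t'))"
    using assms
    by (intro T.finsum_cong')
      (auto intro!: hom_closed[OF tensor_map_hom[OF Z M Z P hom_id power_inj_hom]]
        hom_closed[OF tensor_map_hom[OF Z P Z M hom_id power_proj_hom]])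
  then show ?thesis using assms by (simp add: tensor_power_decompose)
qed

end

section \<open>Embeddings into the reference type\<close>

text \<open>The map of free modules induced by a map of bases. For an injective \<open>g\<close> it
  is injective, and it is used to inject quotients of free modules, whose elements are sets of such
  functions, into the reference type.\<close>

definition map_keys :: "('g \<Rightarrow> 'h) \<Rightarrow> ('g \<Rightarrow>\<^sub>0 'k::comm_monoid_add) \<Rightarrow> ('h \<Rightarrow>\<^sub>0 'k)" where
  "map_keys g p = (\<Sum>k\<in>Poly_Mapping.keys p. Poly_Mapping.single (g k) (Poly_Mapping.lookup p k))"

lemma lookup_map_keys:
  assumes "inj g"
  shows "Poly_Mapping.lookup (map_keys g p) (g k) = Poly_Mapping.lookup p k"
proof -
  have "Poly_Mapping.lookup (map_keys g p) (g k) =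
      (\<Sum>l\<in>Poly_Mapping.keys p. if l = k then Poly_Mapping.lookup p k else 0)"
    unfolding map_keys_def lookup_sum
    by (intro sum.cong) (auto simp: lookup_single when_def inj_eq[OF assms])
  then show ?thesis by (simp add: in_keys_iff)
qed

lemma lookup_map_keys_notin:
  assumes "w \<notin> range g"
  shows "Poly_Mapping.lookup (map_keys g p) w = 0"
  unfolding map_keys_def lookup_sum
  by (intro sum.neutral) (use assms in \<open>auto simp: lookup_single when_def\<close>)

lemma inj_map_keys: "inj g \<Longrightarrow> inj (map_keys g)"
  by (rule injI) (metis lookup_map_keys poly_mapping_eqI)

lemma inj_image_map_keys: "inj g \<Longrightarrow> inj ((`) (map_keys g))"
  by (rule injI) (simp add: inj_image_eq_iff[OF inj_map_keys])

text \<open>Lists over any type have arbitrary lengths, and lengths alone suffice to code a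
  countable type.\<close>

lemma inj_words:
  "inj (\<lambda>w :: 'x::countable. replicate (to_nat w) (undefined :: 'z))"
  by (rule injI) (metis length_replicate from_nat_to_nat)

section \<open>Matrices over an algebra\<close>

lemma inverts_mat_carrier:
  assumes "E \<in> carrier_mat n n" "inverts_mat E B" "inverts_mat B E"
  shows "B \<in> carrier_mat n n"
proof -
  have "dim_col (E * B) = dim_col (1\<^sub>m n)" "dim_col (B * E) = dim_col (1\<^sub>m (dim_row B))"
    using assms by (simp_all add: inverts_mat_def)
  then show ?thesis using assms(1) by (intro carrier_matI) simp_all
qed

text \<open>The inverse is a definite description, so it has the expected properties only after
  uniqueness of the two-sided inverse, \<open>C = C E B = B\<close>.\<close>

lemma mat_inv:
  assumes "E \<in> carrier_mat n n" "invertible_mat E"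
  shows mat_inv_carrier: "mat_inv E \<in> carrier_mat n n"
    and mat_inv_right: "E * mat_inv E = 1\<^sub>m n"
    and mat_inv_left: "mat_inv E * E = 1\<^sub>m n"
proof -
  obtain B where B: "inverts_mat E B" "inverts_mat B E"
    using assms(2) by (auto simp: invertible_mat_def)
  have Bc: "B \<in> carrier_mat n n"
    using inverts_mat_carrier[OF assms(1)] B by blast
  have "mat_inv E = B"
    unfolding mat_inv_def
  proof (rule the_equality)
    fix C assume C: "inverts_mat E C \<and> inverts_mat C E"
    have Cc: "C \<in> carrier_mat n n"
      using inverts_mat_carrier[OF assms(1)] C by blast
    have "C = C * (E * B)" using B C assms(1) Bc Cc by (auto simp: inverts_mat_def)
    also have "\<dots> = (C * E) * B" using assms(1) Bc Cc by (metis assoc_mult_mat)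
    also have "\<dots> = B" using C assms(1) Bc Cc by (auto simp: inverts_mat_def)
    finally show "C = B" .
  qed (use B in simp)
  then show "mat_inv E \<in> carrier_mat n n" "E * mat_inv E = 1\<^sub>m n" "mat_inv E * E = 1\<^sub>m n"
    using B Bc assms(1) by (auto simp: inverts_mat_def)
qed

lemma mat_prod_entry:
  assumes "A \<in> carrier_mat n n" "B \<in> carrier_mat n n" "A * B = 1\<^sub>m n" "i < n" "j < n"
  shows "(\<Sum>l<n. A $$ (i, l) * B $$ (l, j)) = (if i = j then 1 else 0)"
proof -
  have "(A * B) $$ (i, j) = (\<Sum>l<n. A $$ (i, l) * B $$ (l, j))"
    using assms(1,2,4,5) by (simp add: scalar_prod_def atLeast0LessThan)
  then show ?thesis using assms(3-5) by (metis index_one_mat(1))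
qed

context k_module
begin

text \<open>For scalar matrices with \<open>D C = 1\<close>, the equation \<open>C x = y\<close>
  between vectors over a module gives \<open>x = D y\<close>. All passages of \<open>E\<close>,
  \<open>F\<close> and their inverses from one side of an equation to the other use this.\<close>

lemma scalar_matrix_cancel:
  fixes n :: nat
  assumes inv: "\<And>i j. i < n \<Longrightarrow> j < n \<Longrightarrow> (\<Sum>l<n. D i l * C l j) = (if i = j then 1 else 0)"
    and eq: "\<And>i. i < n \<Longrightarrow> (\<Oplus>l\<in>{..<n}. C i l \<odot> x l) = y i"
    and x: "\<And>i. x i \<in> carrier M" and i: "i < n"
  shows "x i = (\<Oplus>l\<in>{..<n}. D i l \<odot> y l)"
proof -
  have "(\<Oplus>l\<in>{..<n}. D i l \<odot> y l) = (\<Oplus>l\<in>{..<n}. D i l \<odot> (\<Oplus>k\<in>{..<n}. C l k \<odot> x k))"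
    using x eq by (intro finsum_cong') (auto intro!: finsum_closed simp flip: eq)
  also have "\<dots> = (\<Oplus>l\<in>{..<n}. \<Oplus>k\<in>{..<n}. (D i l * C l k) \<odot> x k)"
    using x by (subst finsum_smult) (auto simp: smult_smult)
  also have "\<dots> = (\<Oplus>k\<in>{..<n}. \<Oplus>l\<in>{..<n}. (D i l * C l k) \<odot> x k)"
    using x by (intro finsum_swap) auto
  also have "\<dots> = (\<Oplus>k\<in>{..<n}. (if i = k then 1 else 0) \<odot> x k)"
    using x i inv by (intro finsum_cong') (auto simp flip: smult_sum_left)
  also have "\<dots> = x i"
    using x i by (intro finsum_delta) auto
  finally show ?thesis by simp
qed

end

context k_alg
begin

text \<open>In matrix notation \<open>z\<^sup>t e z = f\<close>, that is, \<open>z\<close> carries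
  the bilinear form \<open>e\<close> to the form \<open>f\<close>. Both defining relations of
  \<open>B(E, F)\<close> have this shape: the first for \<open>z\<close> with \<open>E\<close> and
  \<open>F\<close>, the second for the transpose of \<open>z\<close> with the inverse
  matrices.\<close>

definition form_rel :: "nat \<Rightarrow> nat \<Rightarrow> (nat \<Rightarrow> nat \<Rightarrow> 'k) \<Rightarrow> (nat \<Rightarrow> nat \<Rightarrow> 'k) \<Rightarrow> (nat \<Rightarrow> nat \<Rightarrow> 'a) \<Rightarrow> bool"
  where "form_rel n m e f z \<longleftrightarrow>
    (\<forall>i<m. \<forall>j<m. (\<Oplus>q\<in>{..<n}. \<Oplus>r\<in>{..<n}. e q r \<odot> (z q i \<otimes> z r j)) = f i j \<odot> \<one>)"

lemma mult_finsum_left: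
  "finite S \<Longrightarrow> x \<in> carrier A \<Longrightarrow> (\<And>i. i \<in> S \<Longrightarrow> f i \<in> carrier A) \<Longrightarrow>
    x \<otimes> (\<Oplus>i\<in>S. f i) = (\<Oplus>i\<in>S. x \<otimes> f i)"
  by (rule finsum_rdistr) auto

lemma mult_finsum_right:
  "finite S \<Longrightarrow> x \<in> carrier A \<Longrightarrow> (\<And>i. i \<in> S \<Longrightarrow> f i \<in> carrier A) \<Longrightarrow>
    (\<Oplus>i\<in>S. f i) \<otimes> x = (\<Oplus>i\<in>S. f i \<otimes> x)"
  by (rule finsum_ldistr) auto

text \<open>From \<open>u\<^sup>t e u = f\<close> one gets
  \<open>(u v)\<^sup>t e (u v) = v\<^sup>t f v\<close>. Over a noncommutative algebra this requires
  the entries of \<open>u\<close> to commute with those of \<open>v\<close>. It is separate from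
  \<open>form_rel_compose\<close> because it is also applied where \<open>v\<^sup>t f v\<close> is
  not yet known to be scalar.\<close>

lemma form_compose:
  assumes u: "\<And>i j. u i j \<in> carrier A" and v: "\<And>i j. v i j \<in> carrier A"
    and comm: "\<And>i j k l. u i j \<otimes> v k l = v k l \<otimes> u i j"
    and ru: "form_rel n m e f u"
  shows "(\<Oplus>q\<in>{..<n}. \<Oplus>r\<in>{..<n}. e q r \<odot>
        ((\<Oplus>k\<in>{..<m}. u q k \<otimes> v k i) \<otimes> (\<Oplus>h\<in>{..<m}. u r h \<otimes> v h j))) =
      (\<Oplus>k\<in>{..<m}. \<Oplus>h\<in>{..<m}. f k h \<odot> (v k i \<otimes> v h j))"
proof -
  have prod: "(u q k \<otimes> v k i) \<otimes> (u r h \<otimes> v h j) = (u q k \<otimes> u r h) \<otimes> (v k i \<otimes> v h j)" for q r k h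
  proof -
    have "v k i \<otimes> (u r h \<otimes> v h j) = u r h \<otimes> (v k i \<otimes> v h j)"
      using u v comm[of r h k i] by (simp flip: m_assoc)
    then show ?thesis using u v by (simp add: m_assoc)
  qed
  have 1: "(\<Oplus>k\<in>{..<m}. u q k \<otimes> v k i) \<otimes> (\<Oplus>h\<in>{..<m}. u r h \<otimes> v h j) =
      (\<Oplus>k\<in>{..<m}. \<Oplus>h\<in>{..<m}. (u q k \<otimes> u r h) \<otimes> (v k i \<otimes> v h j))" for q r
    using u v by (simp add: mult_finsum_left mult_finsum_right Pi_def prod) (rule finsum_swap, auto)
  have "(\<Oplus>q\<in>{..<n}. \<Oplus>r\<in>{..<n}. e q r \<odot>
        ((\<Oplus>k\<in>{..<m}. u q k \<otimes> v k i) \<otimes> (\<Oplus>h\<in>{..<m}. u r h \<otimes> v h j))) =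
      (\<Oplus>q\<in>{..<n}. \<Oplus>r\<in>{..<n}. \<Oplus>k\<in>{..<m}. \<Oplus>h\<in>{..<m}. (e q r \<odot> (u q k \<otimes> u r h)) \<otimes> (v k i \<otimes> v h j))"
    unfolding 1 using u v
    by (intro finsum_cong') (auto intro!: finsum_closed finsum_cong' simp: finsum_smult smult_mult_left)
  \<comment> \<open>The sums over \<open>k\<close> and \<open>h\<close> are moved outward past those
    over \<open>q\<close> and \<open>r\<close>, so that the inner double sum becomes the form
    relation of \<open>u\<close>.\<close>
  also have "\<dots> = (\<Oplus>q\<in>{..<n}. \<Oplus>k\<in>{..<m}. \<Oplus>r\<in>{..<n}. \<Oplus>h\<in>{..<m}. (e q r \<odot> (u q k \<otimes> u r h)) \<otimes> (v k i \<otimes> v h j))"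
    using u v by (intro finsum_cong' finsum_swap) (auto intro!: finsum_closed)
  also have "\<dots> = (\<Oplus>k\<in>{..<m}. \<Oplus>q\<in>{..<n}. \<Oplus>r\<in>{..<n}. \<Oplus>h\<in>{..<m}. (e q r \<odot> (u q k \<otimes> u r h)) \<otimes> (v k i \<otimes> v h j))"
    using u v by (intro finsum_swap) (auto intro!: finsum_closed)
  also have "\<dots> = (\<Oplus>k\<in>{..<m}. \<Oplus>q\<in>{..<n}. \<Oplus>h\<in>{..<m}. \<Oplus>r\<in>{..<n}. (e q r \<odot> (u q k \<otimes> u r h)) \<otimes> (v k i \<otimes> v h j))"
    using u v by (intro finsum_cong' finsum_swap) (auto intro!: finsum_closed)
  also have "\<dots> = (\<Oplus>k\<in>{..<m}. \<Oplus>h\<in>{..<m}. \<Oplus>q\<in>{..<n}. \<Oplus>r\<in>{..<n}. (e q r \<odot> (u q k \<otimes> u r h)) \<otimes> (v k i \<otimes> v h j))"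
    using u v by (intro finsum_cong' finsum_swap) (auto intro!: finsum_closed)
  also have "\<dots> = (\<Oplus>k\<in>{..<m}. \<Oplus>h\<in>{..<m}.
      (\<Oplus>q\<in>{..<n}. \<Oplus>r\<in>{..<n}. e q r \<odot> (u q k \<otimes> u r h)) \<otimes> (v k i \<otimes> v h j))"
    using u v by (intro finsum_cong') (auto intro!: finsum_closed simp: mult_finsum_right)
  also have "\<dots> = (\<Oplus>k\<in>{..<m}. \<Oplus>h\<in>{..<m}. f k h \<odot> (v k i \<otimes> v h j))"
    using u v ru by (intro finsum_cong') (auto intro!: finsum_closed finsum_cong' simp: form_rel_def smult_mult_left)
  finally show ?thesis .
qed

lemma form_rel_compose:
  assumes u: "\<And>i j. u i j \<in> carrier A" and v: "\<And>i j. v i j \<in> carrier A"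
    and comm: "\<And>i j k l. u i j \<otimes> v k l = v k l \<otimes> u i j"
    and ru: "form_rel n m e f u" and rv: "form_rel m p f g v"
  shows "form_rel n p e g (\<lambda>i j. \<Oplus>k\<in>{..<m}. u i k \<otimes> v k j)"
  using rv form_compose[where u = u and v = v, OF u v comm ru] by (simp add: form_rel_def)

abbreviation "mprod n x y i j \<equiv> \<Oplus>l\<in>{..<n :: nat}. x i l \<otimes> y l j"

lemma mprod_assoc:
  assumes "\<And>i j. x i j \<in> carrier A" "\<And>i j. y i j \<in> carrier A" "\<And>i j. z i j \<in> carrier A"
  shows "mprod n (\<lambda>i j. mprod m x y i j) z i j = mprod m x (\<lambda>i j. mprod n y z i j) i j"
proof -
  have "mprod n (\<lambda>i j. mprod m x y i j) z i j = (\<Oplus>l\<in>{..<n}. \<Oplus>k\<in>{..<m}. x i k \<otimes> (y k l \<otimes> z l j))"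
    using assms by (simp add: mult_finsum_right m_assoc)
  also have "\<dots> = (\<Oplus>k\<in>{..<m}. \<Oplus>l\<in>{..<n}. x i k \<otimes> (y k l \<otimes> z l j))"
    using assms by (intro finsum_swap) auto
  also have "\<dots> = mprod m x (\<lambda>i j. mprod n y z i j) i j"
    using assms by (simp add: mult_finsum_left)
  finally show ?thesis .
qed

lemma mprod_cong:
  assumes "\<And>l. l < n \<Longrightarrow> x i l = x' i l" "\<And>l. l < n \<Longrightarrow> y l j = y' l j"
    and "\<And>i j. x' i j \<in> carrier A" "\<And>i j. y' i j \<in> carrier A"
  shows "mprod n x y i j = mprod n x' y' i j"
  using assms by (intro finsum_cong') auto

lemma mprod_id:
  assumes "\<And>i j. x i j \<in> carrier A" "i < n"
  shows "mprod n (\<lambda>i j. (if i = j then 1 else 0) \<odot> \<one>) x i j = x i j"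
    and "mprod n x (\<lambda>i j. (if i = j then 1 else 0) \<odot> \<one>) j i = x j i"
proof -
  have "mprod n (\<lambda>i j. (if i = j then 1 else 0) \<odot> \<one>) x i j =
      (\<Oplus>l\<in>{..<n}. (if i = l then 1 else 0) \<odot> x l j)"
    using assms by (intro finsum_cong') auto
  also have "\<dots> = x i j" using assms by (intro finsum_delta) auto
  finally show "mprod n (\<lambda>i j. (if i = j then 1 else 0) \<odot> \<one>) x i j = x i j" .
  have "mprod n x (\<lambda>i j. (if i = j then 1 else 0) \<odot> \<one>) j i =
      (\<Oplus>l\<in>{..<n}. (if l = i then 1 else 0) \<odot> x j l)"
    using assms by (intro finsum_cong') auto
  also have "\<dots> = x j i" using assms by (intro finsum_delta) auto
  finally show "mprod n x (\<lambda>i j. (if i = j then 1 else 0) \<odot> \<one>) j i = x j i" .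
qed

lemma form_rel_hom:
  assumes "k_alg B" "h \<in> alg_hom A B" "form_rel n m e f z" "\<And>i j. z i j \<in> carrier A"
  shows "k_alg.form_rel B n m e f (\<lambda>i j. h (z i j))"
proof -
  interpret B: k_alg B by fact
  note lin = alg_hom_linear[OF assms(2)]
  have "(\<Oplus>\<^bsub>B\<^esub>q\<in>{..<n}. \<Oplus>\<^bsub>B\<^esub>r\<in>{..<n}. e q r \<odot>\<^bsub>B\<^esub> (h (z q i) \<otimes>\<^bsub>B\<^esub> h (z r j))) =
      h (\<Oplus>q\<in>{..<n}. \<Oplus>r\<in>{..<n}. e q r \<odot> (z q i \<otimes> z r j))" for i j
    using assms(4)
    by (simp add: hom_finsum[OF k_module_axioms B.k_module_axioms lin] Pi_def finsum_closed
        hom_smult[OF lin] alg_hom_mult[OF assms(2)])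
  then show ?thesis
    using assms(3) by (simp add: form_rel_def B.form_rel_def hom_smult[OF lin] alg_hom_one[OF assms(2)])
qed

end

section \<open>The algebras B(E, F)\<close>

lemma lin_ext_sum:
  fixes G :: "('g, 'x) monoid_scheme"
  assumes "k_module P" "\<And>x. x \<in> carrier G \<Longrightarrow> b x \<in> carrier P" "finite S"
    and "\<And>i. i \<in> S \<Longrightarrow> Poly_Mapping.keys (f i) \<subseteq> carrier G"
  shows "lin_ext P b (\<Sum>i\<in>S. f i) = (\<Oplus>\<^bsub>P\<^esub>i\<in>S. lin_ext P b (f i))"
proof -
  interpret P: k_module P by fact
  have h: "lin_ext P b \<in> module_hom class_ring (monoid_algebra G) P"
    by (rule lin_ext_hom[OF assms(1,2)])
  have keys: "Poly_Mapping.keys (\<Sum>i\<in>T. f i) \<subseteq> carrier G" if "T \<subseteq> S" for T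
    using finite_subset[OF that assms(3)] that assms(4)
    by (induction T rule: finite_induct) (simp_all add: keys_add_subset)
  have c: "lin_ext P b p \<in> carrier P" if "Poly_Mapping.keys p \<subseteq> carrier G" for p
    using hom_closed[OF h, of p] that by simp
  have "lin_ext P b (\<Sum>i\<in>T. f i) = (\<Oplus>\<^bsub>P\<^esub>i\<in>T. lin_ext P b (f i))" if "T \<subseteq> S" for T
    using finite_subset[OF that assms(3)] that
  proof (induction T rule: finite_induct)
    case empty
    show ?case using hom_zero[OF k_module_monoid_algebra assms(1) h] by simp
  next
    case (insert x T)
    have fc: "lin_ext P b (f i) \<in> carrier P" if "i \<in> insert x T" for i
      using c assms(4) insert.prems that by blast
    have "lin_ext P b (f x + sum f T) = lin_ext P b (f x) \<oplus>\<^bsub>P\<^esub> lin_ext P b (sum f T)"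
      using hom_add[OF h, of "f x" "sum f T"] assms(4)[of x] keys[of T] insert.prems by simp
    also have "\<dots> = (\<Oplus>\<^bsub>P\<^esub>i\<in>insert x T. lin_ext P b (f i))"
      using insert fc by (subst P.finsum_insert) auto
    finally show ?case using insert by simp
  qed
  then show ?thesis by simp
qed

locale B_data =
  fixes n m :: nat and E F :: "'k::comm_ring_1 mat"
  assumes E: "E \<in> carrier_mat n n" "invertible_mat E"
    and F: "F \<in> carrier_mat m m" "invertible_mat F"
begin

lemma B_gens_eq: "B_gens E F = {..<n} \<times> {..<m}"
  using E F by (simp add: B_gens_def)

abbreviation "R1 i j \<equiv>
  (\<Sum>p<m. \<Sum>q<n. \<Sum>r<n. Poly_Mapping.single [(q, p), (r, j)] (mat_inv F $$ (i, p) * E $$ (q, r)))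
       - Poly_Mapping.single [] (if i = j then 1 else 0)"

abbreviation "R2 i j \<equiv>
  (\<Sum>p<m. \<Sum>q<m. \<Sum>r<n. Poly_Mapping.single [(i, p), (r, q)] (mat_inv F $$ (p, q) * E $$ (r, j)))
       - Poly_Mapping.single [] (if i = j then 1 else 0)"

lemma B_rels_eq:
  "B_rels E F = {R1 i j | i j. i < m \<and> j < m} \<union> {R2 i j | i j. i < n \<and> j < n}"
  using E F by (simp add: B_rels_def Let_def)

lemma keys_sum_subset:
  "finite S \<Longrightarrow> (\<And>i. i \<in> S \<Longrightarrow> Poly_Mapping.keys (f i) \<subseteq> T) \<Longrightarrow> Poly_Mapping.keys (sum f S) \<subseteq> T"
  by (induction S rule: finite_induct) (simp_all add: keys_add_subset)

sublocale presentation "B_gens E F" "B_rels E F"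
proof
  fix r assume "r \<in> B_rels E F"
  then show "Poly_Mapping.keys r \<subseteq> lists (B_gens E F)"
    unfolding B_rels_eq B_gens_eq
    by (auto intro!: keys_minus_subset keys_sum_subset simp del: keys_single del: subsetI)
      (auto split: if_splits)
qed

lemma B_algebra_alg: "k_alg (B_algebra E F)"
  unfolding B_algebra_def by (rule presented_alg)

lemma B_gen_closed: "i < n \<Longrightarrow> j < m \<Longrightarrow> B_gen E F i j \<in> carrier (B_algebra E F)"
  unfolding B_gen_def B_algebra_def by (rule generator_closed) (simp add: B_gens_eq)

lemma eval_R1:
  assumes "k_alg A" "\<And>i j. w i j \<in> carrier A" "i < m" "j < m"
  shows "lin_ext A (word_eval A (\<lambda>(i, j). w i j)) (R1 i j) =
    (\<Oplus>\<^bsub>A\<^esub>p\<in>{..<m}. mat_inv F $$ (i, p) \<odot>\<^bsub>A\<^esub>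
      (\<Oplus>\<^bsub>A\<^esub>q\<in>{..<n}. \<Oplus>\<^bsub>A\<^esub>r\<in>{..<n}. E $$ (q, r) \<odot>\<^bsub>A\<^esub> (w q p \<otimes>\<^bsub>A\<^esub> w r j)))
      \<ominus>\<^bsub>A\<^esub> (if i = j then 1 else 0) \<odot>\<^bsub>A\<^esub> \<one>\<^bsub>A\<^esub>"
proof -
  interpret A: k_alg A by fact
  let ?v = "\<lambda>(i, j). w i j"
  \<comment> \<open>The value of \<open>lin_ext\<close> does not depend on the monoid. As
    \<open>w\<close> is defined for all indices, words in all pairs of naturals may be used, which
    saves tracking which letters are generators.\<close>
  let ?G = "\<lparr>carrier = lists (UNIV :: (nat \<times> nat) set), mult = (@), one = []\<rparr>"
  have c: "x \<in> carrier ?G \<Longrightarrow> word_eval A ?v x \<in> carrier A" for x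
    using assms(2) by (intro A.word_eval_closed[of _ UNIV]) auto
  note h = lin_ext_hom[of A, where G = ?G and b = "word_eval A ?v", OF A.k_module_axioms c]
  note s = lin_ext_sum[of A, where G = ?G and b = "word_eval A ?v", OF A.k_module_axioms c]
  have "lin_ext A (word_eval A ?v) (R1 i j) =
      lin_ext A (word_eval A ?v) (\<Sum>p<m. \<Sum>q<n. \<Sum>r<n. Poly_Mapping.single [(q, p), (r, j)] (mat_inv F $$ (i, p) * E $$ (q, r)))
      \<ominus>\<^bsub>A\<^esub> lin_ext A (word_eval A ?v) (Poly_Mapping.single [] (if i = j then 1 else 0))"
    by (subst hom_minus[OF k_module_monoid_algebra A.k_module_axioms h, symmetric])
      (auto simp: monoid_algebra_minus simp del: monoid_algebra_simps(3-5))
  also have "lin_ext A (word_eval A ?v) (Poly_Mapping.single [] (if i = j then 1 else 0)) =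
      (if i = j then 1 else 0) \<odot>\<^bsub>A\<^esub> \<one>\<^bsub>A\<^esub>"
    using lin_ext_single[where b = "word_eval A ?v", OF A.k_module_axioms c, of "[]"] by simp
  also have "lin_ext A (word_eval A ?v) (\<Sum>p<m. \<Sum>q<n. \<Sum>r<n. Poly_Mapping.single [(q, p), (r, j)] (mat_inv F $$ (i, p) * E $$ (q, r)))
      = (\<Oplus>\<^bsub>A\<^esub>p\<in>{..<m}. \<Oplus>\<^bsub>A\<^esub>q\<in>{..<n}. \<Oplus>\<^bsub>A\<^esub>r\<in>{..<n}. (mat_inv F $$ (i, p) * E $$ (q, r)) \<odot>\<^bsub>A\<^esub> (w q p \<otimes>\<^bsub>A\<^esub> w r j))"
    using assms(2)
    by (simp add: s lin_ext_single[where b = "word_eval A ?v", OF A.k_module_axioms c])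
  also have "\<dots> = (\<Oplus>\<^bsub>A\<^esub>p\<in>{..<m}. mat_inv F $$ (i, p) \<odot>\<^bsub>A\<^esub>
      (\<Oplus>\<^bsub>A\<^esub>q\<in>{..<n}. \<Oplus>\<^bsub>A\<^esub>r\<in>{..<n}. E $$ (q, r) \<odot>\<^bsub>A\<^esub> (w q p \<otimes>\<^bsub>A\<^esub> w r j)))"
    using assms(2) by (simp add: A.finsum_smult A.smult_smult Pi_def A.finsum_closed)
  finally show ?thesis .
qed

lemma eval_R2:
  assumes "k_alg A" "\<And>i j. w i j \<in> carrier A" "i < n" "j < n"
  shows "lin_ext A (word_eval A (\<lambda>(i, j). w i j)) (R2 i j) =
    (\<Oplus>\<^bsub>A\<^esub>r\<in>{..<n}. E $$ (r, j) \<odot>\<^bsub>A\<^esub>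
      (\<Oplus>\<^bsub>A\<^esub>p\<in>{..<m}. \<Oplus>\<^bsub>A\<^esub>q\<in>{..<m}. mat_inv F $$ (p, q) \<odot>\<^bsub>A\<^esub> (w i p \<otimes>\<^bsub>A\<^esub> w r q)))
      \<ominus>\<^bsub>A\<^esub> (if i = j then 1 else 0) \<odot>\<^bsub>A\<^esub> \<one>\<^bsub>A\<^esub>"
proof -
  interpret A: k_alg A by fact
  let ?v = "\<lambda>(i, j). w i j"
  let ?G = "\<lparr>carrier = lists (UNIV :: (nat \<times> nat) set), mult = (@), one = []\<rparr>"
  have c: "x \<in> carrier ?G \<Longrightarrow> word_eval A ?v x \<in> carrier A" for x
    using assms(2) by (intro A.word_eval_closed[of _ UNIV]) auto
  note h = lin_ext_hom[of A, where G = ?G and b = "word_eval A ?v", OF A.k_module_axioms c]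
  note s = lin_ext_sum[of A, where G = ?G and b = "word_eval A ?v", OF A.k_module_axioms c]
  have "lin_ext A (word_eval A ?v) (R2 i j) =
      lin_ext A (word_eval A ?v) (\<Sum>p<m. \<Sum>q<m. \<Sum>r<n. Poly_Mapping.single [(i, p), (r, q)] (mat_inv F $$ (p, q) * E $$ (r, j)))
      \<ominus>\<^bsub>A\<^esub> lin_ext A (word_eval A ?v) (Poly_Mapping.single [] (if i = j then 1 else 0))"
    by (subst hom_minus[OF k_module_monoid_algebra A.k_module_axioms h, symmetric])
      (auto simp: monoid_algebra_minus simp del: monoid_algebra_simps(3-5))
  also have "lin_ext A (word_eval A ?v) (Poly_Mapping.single [] (if i = j then 1 else 0)) =
      (if i = j then 1 else 0) \<odot>\<^bsub>A\<^esub> \<one>\<^bsub>A\<^esub>"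
    using lin_ext_single[where b = "word_eval A ?v", OF A.k_module_axioms c, of "[]"] by simp
  also have "lin_ext A (word_eval A ?v) (\<Sum>p<m. \<Sum>q<m. \<Sum>r<n. Poly_Mapping.single [(i, p), (r, q)] (mat_inv F $$ (p, q) * E $$ (r, j)))
      = (\<Oplus>\<^bsub>A\<^esub>p\<in>{..<m}. \<Oplus>\<^bsub>A\<^esub>q\<in>{..<m}. \<Oplus>\<^bsub>A\<^esub>r\<in>{..<n}. (mat_inv F $$ (p, q) * E $$ (r, j)) \<odot>\<^bsub>A\<^esub> (w i p \<otimes>\<^bsub>A\<^esub> w r q))"
    using assms(2)
    by (simp add: s lin_ext_single[where b = "word_eval A ?v", OF A.k_module_axioms c])
  also have "\<dots> = (\<Oplus>\<^bsub>A\<^esub>p\<in>{..<m}. \<Oplus>\<^bsub>A\<^esub>r\<in>{..<n}. \<Oplus>\<^bsub>A\<^esub>q\<in>{..<m}. (mat_inv F $$ (p, q) * E $$ (r, j)) \<odot>\<^bsub>A\<^esub> (w i p \<otimes>\<^bsub>A\<^esub> w r q))"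
    using assms(2) by (intro A.finsum_cong' A.finsum_swap) (auto intro!: A.finsum_closed)
  also have "\<dots> = (\<Oplus>\<^bsub>A\<^esub>r\<in>{..<n}. \<Oplus>\<^bsub>A\<^esub>p\<in>{..<m}. \<Oplus>\<^bsub>A\<^esub>q\<in>{..<m}. (mat_inv F $$ (p, q) * E $$ (r, j)) \<odot>\<^bsub>A\<^esub> (w i p \<otimes>\<^bsub>A\<^esub> w r q))"
    using assms(2) by (intro A.finsum_swap) (auto intro!: A.finsum_closed)
  also have "\<dots> = (\<Oplus>\<^bsub>A\<^esub>r\<in>{..<n}. E $$ (r, j) \<odot>\<^bsub>A\<^esub>
      (\<Oplus>\<^bsub>A\<^esub>p\<in>{..<m}. \<Oplus>\<^bsub>A\<^esub>q\<in>{..<m}. mat_inv F $$ (p, q) \<odot>\<^bsub>A\<^esub> (w i p \<otimes>\<^bsub>A\<^esub> w r q)))"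
    using assms(2) by (simp add: A.finsum_smult A.smult_smult Pi_def A.finsum_closed mult.commute)
  finally show ?thesis .
qed

text \<open>The relation \<open>F\<^sup>-\<^sup>1 w\<^sup>t E w = 1\<close> is multiplied by
  \<open>F\<close> from the left, and \<open>w F\<^sup>-\<^sup>1 w\<^sup>t E = 1\<close> by the
  inverse of \<open>E\<close> from the right. The result is a pair of form relations, which compose,
  whereas the original relations do not visibly do so.\<close>

lemma relations_iff:
  assumes "k_alg A" "\<And>i j. w i j \<in> carrier A"
  shows "(\<forall>r\<in>B_rels E F. lin_ext A (word_eval A (\<lambda>(i, j). w i j)) r = \<zero>\<^bsub>A\<^esub>) \<longleftrightarrow>
    k_alg.form_rel A n m (\<lambda>i j. E $$ (i, j)) (\<lambda>i j. F $$ (i, j)) w \<and>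
    k_alg.form_rel A m n (\<lambda>i j. mat_inv F $$ (i, j)) (\<lambda>i j. mat_inv E $$ (i, j)) (\<lambda>i j. w j i)"
proof -
  interpret A: k_alg A by fact
  define X where "X p j = (\<Oplus>\<^bsub>A\<^esub>q\<in>{..<n}. \<Oplus>\<^bsub>A\<^esub>r\<in>{..<n}. E $$ (q, r) \<odot>\<^bsub>A\<^esub> (w q p \<otimes>\<^bsub>A\<^esub> w r j))" for p j
  define Y where "Y i r = (\<Oplus>\<^bsub>A\<^esub>p\<in>{..<m}. \<Oplus>\<^bsub>A\<^esub>q\<in>{..<m}. mat_inv F $$ (p, q) \<odot>\<^bsub>A\<^esub> (w i p \<otimes>\<^bsub>A\<^esub> w r q))" for i r
  have X: "X p j \<in> carrier A" for p j using assms(2) by (auto simp: X_def intro!: A.finsum_closed)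
  have Y: "Y i r \<in> carrier A" for i r using assms(2) by (auto simp: Y_def intro!: A.finsum_closed)
  note invE = mat_inv[OF E] and invF = mat_inv[OF F]
  have FF: "(\<Sum>l<m. F $$ (i, l) * mat_inv F $$ (l, j)) = (if i = j then 1 else 0)"
    "(\<Sum>l<m. mat_inv F $$ (i, l) * F $$ (l, j)) = (if i = j then 1 else 0)" if "i < m" "j < m" for i j
    using mat_prod_entry[OF F(1) invF(1,2) that] mat_prod_entry[OF invF(1) F(1) invF(3) that] by auto
  have EE: "(\<Sum>l<n. E $$ (i, l) * mat_inv E $$ (l, j)) = (if i = j then 1 else 0)"
    "(\<Sum>l<n. mat_inv E $$ (i, l) * E $$ (l, j)) = (if i = j then 1 else 0)" if "i < n" "j < n" for i j
    using mat_prod_entry[OF E(1) invE(1,2) that] mat_prod_entry[OF invE(1) E(1) invE(3) that] by auto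
  have 1: "(\<forall>i<m. \<forall>j<m. (\<Oplus>\<^bsub>A\<^esub>p\<in>{..<m}. mat_inv F $$ (i, p) \<odot>\<^bsub>A\<^esub> X p j) = (if i = j then 1 else 0) \<odot>\<^bsub>A\<^esub> \<one>\<^bsub>A\<^esub>)
    \<longleftrightarrow> (\<forall>i<m. \<forall>j<m. X i j = F $$ (i, j) \<odot>\<^bsub>A\<^esub> \<one>\<^bsub>A\<^esub>)"
  proof (intro iffI allI impI)
    fix i j assume *: "\<forall>i<m. \<forall>j<m. (\<Oplus>\<^bsub>A\<^esub>p\<in>{..<m}. mat_inv F $$ (i, p) \<odot>\<^bsub>A\<^esub> X p j) =
        (if i = j then 1 else 0) \<odot>\<^bsub>A\<^esub> \<one>\<^bsub>A\<^esub>" and ij: "i < m" "j < m"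
    have "X i j = (\<Oplus>\<^bsub>A\<^esub>l\<in>{..<m}. F $$ (i, l) \<odot>\<^bsub>A\<^esub> ((if l = j then 1 else 0) \<odot>\<^bsub>A\<^esub> \<one>\<^bsub>A\<^esub>))"
      by (rule A.scalar_matrix_cancel[where C = "\<lambda>i p. mat_inv F $$ (i, p)" and D = "\<lambda>i p. F $$ (i, p)"
            and x = "\<lambda>p. X p j"]) (use * ij X FF in auto)
    also have "\<dots> = (\<Oplus>\<^bsub>A\<^esub>l\<in>{..<m}. (if l = j then 1 else 0) \<odot>\<^bsub>A\<^esub> (F $$ (i, l) \<odot>\<^bsub>A\<^esub> \<one>\<^bsub>A\<^esub>))"
      by (intro A.finsum_cong') auto
    also have "\<dots> = F $$ (i, j) \<odot>\<^bsub>A\<^esub> \<one>\<^bsub>A\<^esub>" using ij by (intro A.finsum_delta) auto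
    finally show "X i j = F $$ (i, j) \<odot>\<^bsub>A\<^esub> \<one>\<^bsub>A\<^esub>" .
  next
    fix i j assume *: "\<forall>i<m. \<forall>j<m. X i j = F $$ (i, j) \<odot>\<^bsub>A\<^esub> \<one>\<^bsub>A\<^esub>" and ij: "i < m" "j < m"
    have "(\<Oplus>\<^bsub>A\<^esub>p\<in>{..<m}. mat_inv F $$ (i, p) \<odot>\<^bsub>A\<^esub> X p j) =
        (\<Oplus>\<^bsub>A\<^esub>p\<in>{..<m}. (mat_inv F $$ (i, p) * F $$ (p, j)) \<odot>\<^bsub>A\<^esub> \<one>\<^bsub>A\<^esub>)"
      using * ij by (intro A.finsum_cong') (auto simp: A.smult_smult)
    also have "\<dots> = (if i = j then 1 else 0) \<odot>\<^bsub>A\<^esub> \<one>\<^bsub>A\<^esub>"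
      using FF ij by (simp flip: A.smult_sum_left)
    finally show "(\<Oplus>\<^bsub>A\<^esub>p\<in>{..<m}. mat_inv F $$ (i, p) \<odot>\<^bsub>A\<^esub> X p j) = (if i = j then 1 else 0) \<odot>\<^bsub>A\<^esub> \<one>\<^bsub>A\<^esub>" .
  qed
  have 2: "(\<forall>i<n. \<forall>j<n. (\<Oplus>\<^bsub>A\<^esub>r\<in>{..<n}. E $$ (r, j) \<odot>\<^bsub>A\<^esub> Y i r) = (if i = j then 1 else 0) \<odot>\<^bsub>A\<^esub> \<one>\<^bsub>A\<^esub>)
    \<longleftrightarrow> (\<forall>i<n. \<forall>j<n. Y i j = mat_inv E $$ (i, j) \<odot>\<^bsub>A\<^esub> \<one>\<^bsub>A\<^esub>)"
  proof (intro iffI allI impI)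
    fix i j assume *: "\<forall>i<n. \<forall>j<n. (\<Oplus>\<^bsub>A\<^esub>r\<in>{..<n}. E $$ (r, j) \<odot>\<^bsub>A\<^esub> Y i r) =
        (if i = j then 1 else 0) \<odot>\<^bsub>A\<^esub> \<one>\<^bsub>A\<^esub>" and ij: "i < n" "j < n"
    \<comment> \<open>Here \<open>E\<close> stands on the right of \<open>Y\<close>, so the
      cancellation is carried out for the transposed matrices.\<close>
    have "(\<Sum>l<n. mat_inv E $$ (l, i) * E $$ (j, l)) = (if i = j then 1 else 0)" if "i < n" "j < n" for i j
      using EE(1)[OF that(2,1)] by (simp add: mult.commute eq_commute[of i j])
    then have "Y i j = (\<Oplus>\<^bsub>A\<^esub>l\<in>{..<n}. mat_inv E $$ (l, j) \<odot>\<^bsub>A\<^esub> ((if i = l then 1 else 0) \<odot>\<^bsub>A\<^esub> \<one>\<^bsub>A\<^esub>))"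
      by (intro A.scalar_matrix_cancel[where C = "\<lambda>i p. E $$ (p, i)" and D = "\<lambda>i p. mat_inv E $$ (p, i)"
            and x = "\<lambda>p. Y i p"]) (use * ij Y in auto)
    also have "\<dots> = (\<Oplus>\<^bsub>A\<^esub>l\<in>{..<n}. (if i = l then 1 else 0) \<odot>\<^bsub>A\<^esub> (mat_inv E $$ (l, j) \<odot>\<^bsub>A\<^esub> \<one>\<^bsub>A\<^esub>))"
      by (intro A.finsum_cong') auto
    also have "\<dots> = mat_inv E $$ (i, j) \<odot>\<^bsub>A\<^esub> \<one>\<^bsub>A\<^esub>" using ij by (intro A.finsum_delta) auto
    finally show "Y i j = mat_inv E $$ (i, j) \<odot>\<^bsub>A\<^esub> \<one>\<^bsub>A\<^esub>" .
  next
    fix i j assume *: "\<forall>i<n. \<forall>j<n. Y i j = mat_inv E $$ (i, j) \<odot>\<^bsub>A\<^esub> \<one>\<^bsub>A\<^esub>" and ij: "i < n" "j < n"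
    have "(\<Oplus>\<^bsub>A\<^esub>r\<in>{..<n}. E $$ (r, j) \<odot>\<^bsub>A\<^esub> Y i r) =
        (\<Oplus>\<^bsub>A\<^esub>r\<in>{..<n}. (mat_inv E $$ (i, r) * E $$ (r, j)) \<odot>\<^bsub>A\<^esub> \<one>\<^bsub>A\<^esub>)"
      using * ij by (intro A.finsum_cong') (auto simp: A.smult_smult mult.commute)
    also have "\<dots> = (if i = j then 1 else 0) \<odot>\<^bsub>A\<^esub> \<one>\<^bsub>A\<^esub>"
      using EE ij by (simp flip: A.smult_sum_left)
    finally show "(\<Oplus>\<^bsub>A\<^esub>r\<in>{..<n}. E $$ (r, j) \<odot>\<^bsub>A\<^esub> Y i r) = (if i = j then 1 else 0) \<odot>\<^bsub>A\<^esub> \<one>\<^bsub>A\<^esub>" .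
  qed
  have s1: "(\<Oplus>\<^bsub>A\<^esub>p\<in>{..<m}. mat_inv F $$ (i, p) \<odot>\<^bsub>A\<^esub> X p j) \<in> carrier A" for i j
    using X by (auto intro!: A.finsum_closed)
  have s2: "(\<Oplus>\<^bsub>A\<^esub>r\<in>{..<n}. E $$ (r, j) \<odot>\<^bsub>A\<^esub> Y i r) \<in> carrier A" for i j
    using Y by (auto intro!: A.finsum_closed)
  have "(\<forall>r\<in>B_rels E F. lin_ext A (word_eval A (\<lambda>(i, j). w i j)) r = \<zero>\<^bsub>A\<^esub>) \<longleftrightarrow>
      (\<forall>i<m. \<forall>j<m. lin_ext A (word_eval A (\<lambda>(i, j). w i j)) (R1 i j) = \<zero>\<^bsub>A\<^esub>) \<and>
      (\<forall>i<n. \<forall>j<n. lin_ext A (word_eval A (\<lambda>(i, j). w i j)) (R2 i j) = \<zero>\<^bsub>A\<^esub>)"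
    unfolding B_rels_eq by blast
  also have "\<dots> \<longleftrightarrow>
      (\<forall>i<m. \<forall>j<m. (\<Oplus>\<^bsub>A\<^esub>p\<in>{..<m}. mat_inv F $$ (i, p) \<odot>\<^bsub>A\<^esub> X p j) = (if i = j then 1 else 0) \<odot>\<^bsub>A\<^esub> \<one>\<^bsub>A\<^esub>) \<and>
      (\<forall>i<n. \<forall>j<n. (\<Oplus>\<^bsub>A\<^esub>r\<in>{..<n}. E $$ (r, j) \<odot>\<^bsub>A\<^esub> Y i r) = (if i = j then 1 else 0) \<odot>\<^bsub>A\<^esub> \<one>\<^bsub>A\<^esub>)"
    using eval_R1[OF assms] eval_R2[OF assms] s1 s2
    by (simp add: X_def[symmetric] Y_def[symmetric] A.minus_eq_iff)
  also have "\<dots> \<longleftrightarrow> (\<forall>i<m. \<forall>j<m. X i j = F $$ (i, j) \<odot>\<^bsub>A\<^esub> \<one>\<^bsub>A\<^esub>) \<and>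
      (\<forall>i<n. \<forall>j<n. Y i j = mat_inv E $$ (i, j) \<odot>\<^bsub>A\<^esub> \<one>\<^bsub>A\<^esub>)"
    unfolding 1 2 ..
  finally show ?thesis
    by (simp add: A.form_rel_def X_def Y_def)
qed

text \<open>The generators, extended by zero to all indices: membership in the carrier then holds
  without bounds, as the matrix lemmas require.\<close>

definition gen :: "nat \<Rightarrow> nat \<Rightarrow> ((nat \<times> nat) list \<Rightarrow>\<^sub>0 'k) set" where
  "gen i j = (if i < n \<and> j < m then B_gen E F i j else \<zero>\<^bsub>B_algebra E F\<^esub>)"

sublocale BA: k_alg "B_algebra E F" by (rule B_algebra_alg)

lemma gen_closed [simp]: "gen i j \<in> carrier (B_algebra E F)"
  by (simp add: gen_def B_gen_closed)

lemma gen_eq [simp]: "i < n \<Longrightarrow> j < m \<Longrightarrow> gen i j = B_gen E F i j"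
  by (simp add: gen_def)

text \<open>Evaluation at the generators is the projection of the free algebra onto its quotient,
  and the projection kills the relations.\<close>

lemma gen_relations:
  "BA.form_rel n m (\<lambda>i j. E $$ (i, j)) (\<lambda>i j. F $$ (i, j)) gen"
  "BA.form_rel m n (\<lambda>i j. mat_inv F $$ (i, j)) (\<lambda>i j. mat_inv E $$ (i, j)) (\<lambda>i j. gen j i)"
proof -
  have "lin_ext (B_algebra E F) (word_eval (B_algebra E F) (\<lambda>(i, j). gen i j)) r = \<zero>\<^bsub>B_algebra E F\<^esub>"
    if r: "r \<in> B_rels E F" for r
  proof -
    have rc: "r \<in> carrier FA" using r relations_carrier by blast
    have "lin_ext (B_algebra E F) (word_eval (B_algebra E F) (\<lambda>(i, j). gen i j)) r = J +>\<^bsub>FA\<^esub> r"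
      unfolding B_algebra_def
      by (rule free_alg_hom_eval[OF presented_alg proj_alg_hom _ rc])
        (auto simp: B_gens_eq gen_def B_gen_def generator_def)
    also have "\<dots> = J +>\<^bsub>FA\<^esub> \<zero>\<^bsub>FA\<^esub>"
      using rc FA.genideal_self[OF relations_carrier] r
      by (subst AQ.quot_eq_iff) (auto simp: a_minus_def)
    also have "\<dots> = \<zero>\<^bsub>B_algebra E F\<^esub>"
      by (simp add: B_algebra_def presented_algebra_def AQ.quot_zero)
    finally show ?thesis .
  qed
  then show "BA.form_rel n m (\<lambda>i j. E $$ (i, j)) (\<lambda>i j. F $$ (i, j)) gen"
  "BA.form_rel m n (\<lambda>i j. mat_inv F $$ (i, j)) (\<lambda>i j. mat_inv E $$ (i, j)) (\<lambda>i j. gen j i)"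
    using relations_iff[OF B_algebra_alg, of gen] by simp_all
qed

lemma B_hom:
  assumes "k_alg A" "\<And>i j. w i j \<in> carrier A"
    and "k_alg.form_rel A n m (\<lambda>i j. E $$ (i, j)) (\<lambda>i j. F $$ (i, j)) w"
    and "k_alg.form_rel A m n (\<lambda>i j. mat_inv F $$ (i, j)) (\<lambda>i j. mat_inv E $$ (i, j)) (\<lambda>i j. w j i)"
  shows "presented_hom A (\<lambda>(i, j). w i j) \<in> alg_hom (B_algebra E F) A"
    and "\<And>i j. i < n \<Longrightarrow> j < m \<Longrightarrow> presented_hom A (\<lambda>(i, j). w i j) (B_gen E F i j) = w i j"
proof -
  have "\<forall>r\<in>B_rels E F. lin_ext A (word_eval A (\<lambda>(i, j). w i j)) r = \<zero>\<^bsub>A\<^esub>"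
    using relations_iff[OF assms(1), of w, OF assms(2)] assms(3,4) by blast
  note * = presented_hom[OF assms(1), of "\<lambda>(i, j). w i j", OF _ bspec[OF this]]
  show "presented_hom A (\<lambda>(i, j). w i j) \<in> alg_hom (B_algebra E F) A"
    unfolding B_algebra_def by (rule *) (use assms(2) in auto)
  show "presented_hom A (\<lambda>(i, j). w i j) (B_gen E F i j) = w i j" if "i < n" "j < m" for i j
    unfolding B_gen_def using *(2)[of "(i, j)"] that assms(2) by (auto simp: B_gens_eq)
qed

lemma B_induct [consumes 1, case_names one mult add smult]:
  assumes "t \<in> carrier (B_algebra E F)"
    and "Q \<one>\<^bsub>B_algebra E F\<^esub>"
    and "\<And>s i j. s \<in> carrier (B_algebra E F) \<Longrightarrow> i < n \<Longrightarrow> j < m \<Longrightarrow> Q s \<Longrightarrow>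
      Q (s \<otimes>\<^bsub>B_algebra E F\<^esub> B_gen E F i j)"
    and "\<And>s t. s \<in> carrier (B_algebra E F) \<Longrightarrow> t \<in> carrier (B_algebra E F) \<Longrightarrow>
      Q s \<Longrightarrow> Q t \<Longrightarrow> Q (s \<oplus>\<^bsub>B_algebra E F\<^esub> t)"
    and "\<And>c s. s \<in> carrier (B_algebra E F) \<Longrightarrow> Q s \<Longrightarrow> Q (c \<odot>\<^bsub>B_algebra E F\<^esub> s)"
  shows "Q t"
proof -
  note a = assms[unfolded B_algebra_def B_gen_def]
  show ?thesis
    by (rule presented_induct[where Q = Q, OF a(1,2)]) (use a(3-) in \<open>auto simp: B_gens_eq\<close>)
qed

lemma B_presented_hom_unique:
  assumes "k_alg A" "g \<in> alg_hom (B_algebra E F) A"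
    and "\<And>i j. i < n \<Longrightarrow> j < m \<Longrightarrow> g (B_gen E F i j) = v (i, j)" "t \<in> carrier (B_algebra E F)"
  shows "presented_hom A v t = g t"
  by (rule presented_hom_unique[OF assms(1)])
    (use assms in \<open>auto simp: B_algebra_def B_gen_def B_gens_eq\<close>)

end

section \<open>The Hopf algebra B(E)\<close>

text \<open>The Hopf record and its underlying algebra have different record types. A tensor product
  reads only the fields listed here, so it may be formed with either.\<close>

lemma tensor_cong:
  assumes "carrier M = carrier M'" "add M = add M'" "Module.smult M = Module.smult M'"
    "monoid.mult M = monoid.mult M'" "\<one>\<^bsub>M\<^esub> = \<one>\<^bsub>M'\<^esub>"
    and "carrier N = carrier N'" "add N = add N'" "Module.smult N = Module.smult N'"
    "monoid.mult N = monoid.mult N'" "\<one>\<^bsub>N\<^esub> = \<one>\<^bsub>N'\<^esub>"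
  shows "tensor M N = tensor M' N'" and "pure_tensor M N = pure_tensor M' N'"
proof -
  have 1: "M \<times>\<times> N = M' \<times>\<times> N'" using assms by (simp add: DirProd_def)
  have 2: "tensor_gens M N = tensor_gens M' N'" unfolding tensor_gens_def assms ..
  show "tensor M N = tensor M' N'" "pure_tensor M N = pure_tensor M' N'"
    by (simp_all add: tensor_def tensor_rel_def 1 2 pure_tensor_def fun_eq_iff)
qed

lemma B_hopf_simps [simp]:
  "carrier (B_hopf E) = carrier (B_algebra E E)"
  "monoid.mult (B_hopf E) = monoid.mult (B_algebra E E)"
  "\<one>\<^bsub>B_hopf E\<^esub> = \<one>\<^bsub>B_algebra E E\<^esub>"
  "\<zero>\<^bsub>B_hopf E\<^esub> = \<zero>\<^bsub>B_algebra E E\<^esub>"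
  "add (B_hopf E) = add (B_algebra E E)"
  "Module.smult (B_hopf E) = Module.smult (B_algebra E E)"
  by (simp_all add: B_hopf_def module.extend_def hopf.fields_def)

lemma B_hopf_comult:
  "comult (B_hopf E) = presented_hom (tensor (B_algebra E E) (B_algebra E E))
           (\<lambda>(i, j). \<Oplus>\<^bsub>tensor (B_algebra E E) (B_algebra E E)\<^esub>l\<in>{..<dim_row E}.
              pure_tensor (B_algebra E E) (B_algebra E E) (B_gen E E i l) (B_gen E E l j))"
  by (simp add: B_hopf_def module.extend_def hopf.fields_def)

lemma B_hopf_counit:
  "counit (B_hopf E) = presented_hom base_algebra (\<lambda>(i, j). if i = j then 1 else 0)"
  by (simp add: B_hopf_def module.extend_def hopf.fields_def)

lemma tensor_B_hopf:
  "tensor (B_hopf E) N = tensor (B_algebra E E) N"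
  "tensor N (B_hopf E) = tensor N (B_algebra E E)"
  "pure_tensor (B_hopf E) N = pure_tensor (B_algebra E E) N"
  "pure_tensor N (B_hopf E) = pure_tensor N (B_algebra E E)"
  by (rule tensor_cong; simp)+

context two_algs
begin

sublocale TA: k_alg "tensor A B" by (rule tensor_alg)

lemma embed_left: "(\<lambda>x. pure_tensor A B x \<one>\<^bsub>B\<^esub>) \<in> alg_hom A (tensor A B)"
  unfolding alg_hom_iff by (simp add: pure_hom_left pure_mult tensor_one)

lemma embed_right: "pure_tensor A B \<one>\<^bsub>A\<^esub> \<in> alg_hom B (tensor A B)"
  unfolding alg_hom_iff by (simp add: pure_hom_right pure_mult tensor_one)

text \<open>The entries \<open>u \<otimes> 1\<close> commute with the entries
  \<open>1 \<otimes> v\<close>, so the relations compose although neither algebra is commutative.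
  This gives half of the relations needed for the comultiplication and for the map into the tensor
  product with the opposite algebra.\<close>

lemma form_rel_tensor:
  assumes u: "\<And>i j. u i j \<in> carrier A" and v: "\<And>i j. v i j \<in> carrier B"
    and "A.form_rel n m e f u" "B.form_rel m p f g v"
  shows "TA.form_rel n p e g (\<lambda>i j. \<Oplus>\<^bsub>tensor A B\<^esub>k\<in>{..<m}. pure_tensor A B (u i k) (v k j))"
proof -
  have "TA.form_rel n p e g (\<lambda>i j. \<Oplus>\<^bsub>tensor A B\<^esub>k\<in>{..<m}.
      pure_tensor A B (u i k) \<one>\<^bsub>B\<^esub> \<otimes>\<^bsub>tensor A B\<^esub> pure_tensor A B \<one>\<^bsub>A\<^esub> (v k j))"
    by (rule TA.form_rel_compose[OF _ _ _ A.form_rel_hom[OF tensor_alg embed_left assms(3)]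
          B.form_rel_hom[OF tensor_alg embed_right assms(4)]])
      (simp_all add: u v pure_mult)
  then show ?thesis by (simp add: u v pure_mult)
qed

text \<open>The other half: transposition reverses the order of the matrix product, so
  \<open>v\<close> is now the outer factor.\<close>

lemma form_rel_tensor_transpose:
  assumes u: "\<And>i j. u i j \<in> carrier A" and v: "\<And>i j. v i j \<in> carrier B"
    and "A.form_rel m n f e (\<lambda>i j. u j i)" "B.form_rel p m g f (\<lambda>i j. v j i)"
  shows "TA.form_rel p n g e (\<lambda>i j. \<Oplus>\<^bsub>tensor A B\<^esub>k\<in>{..<m}. pure_tensor A B (u j k) (v k i))"
proof -
  have "TA.form_rel p n g e (\<lambda>i j. \<Oplus>\<^bsub>tensor A B\<^esub>k\<in>{..<m}.
      pure_tensor A B \<one>\<^bsub>A\<^esub> (v k i) \<otimes>\<^bsub>tensor A B\<^esub> pure_tensor A B (u j k) \<one>\<^bsub>B\<^esub>)"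
    by (rule TA.form_rel_compose[OF _ _ _ B.form_rel_hom[OF tensor_alg embed_right assms(4)]
          A.form_rel_hom[OF tensor_alg embed_left assms(3)]])
      (simp_all add: u v pure_mult)
  then show ?thesis by (simp add: u v pure_mult)
qed

end

lemma base_algebra_simps [simp]:
  "carrier base_algebra = UNIV" "x \<otimes>\<^bsub>base_algebra\<^esub> y = x * y" "\<one>\<^bsub>base_algebra\<^esub> = 1"
  "\<zero>\<^bsub>base_algebra\<^esub> = 0" "x \<oplus>\<^bsub>base_algebra\<^esub> y = x + y" "c \<odot>\<^bsub>base_algebra\<^esub> x = c * x"
  by (simp_all add: base_algebra_def)

lemma base_algebra_alg: "k_alg (base_algebra :: ('k::comm_ring_1, 'k) module)"
proof -
  let ?B = "base_algebra :: ('k, 'k) module"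
  have "abelian_group ?B"
  proof (rule abelian_groupI)
    fix x :: 'k
    show "\<exists>y\<in>carrier ?B. y \<oplus>\<^bsub>?B\<^esub> x = \<zero>\<^bsub>?B\<^esub>" by (rule bexI[of _ "- x"]) simp_all
  qed (simp_all add: algebra_simps)
  moreover have "monoid ?B" by (rule monoidI) (simp_all add: algebra_simps)
  ultimately have "ring ?B" by (intro ringI) (simp_all add: algebra_simps)
  moreover have "module class_ring ?B"
    using \<open>abelian_group ?B\<close> by (intro moduleI class_cring.cring_axioms) (simp_all add: algebra_simps)
  ultimately show ?thesis by (simp add: k_alg_iff k_algebra_def algebra_simps)
qed

interpretation base: k_alg "base_algebra :: ('k::comm_ring_1, 'k) module"
  by (rule base_algebra_alg)

lemma base_finsum: "finite S \<Longrightarrow> finsum base_algebra f S = sum f S"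
  by (induction S rule: finite_induct) simp_all

text \<open>The unit matrix preserves every form, which is why the counit respects the
  relations.\<close>

lemma base_form_rel: "base.form_rel n n e e (\<lambda>i j. if i = j then 1 else 0)"
  unfolding base.form_rel_def
proof (intro allI impI)
  fix i j assume ij: "i < n" "j < n"
  have "(\<Oplus>\<^bsub>base_algebra\<^esub>q\<in>{..<n}. \<Oplus>\<^bsub>base_algebra\<^esub>r\<in>{..<n}.
      e q r \<odot>\<^bsub>base_algebra\<^esub> ((if q = i then 1 else 0) \<otimes>\<^bsub>base_algebra\<^esub> (if r = j then 1 else 0))) =
      (\<Sum>q<n. \<Sum>r<n. if q = i then if r = j then e q r else 0 else 0)"
    by (simp add: base_finsum) (intro sum.cong refl, simp)
  also have "\<dots> = (\<Sum>q<n. if q = i then \<Sum>r<n. if r = j then e q r else 0 else 0)"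
    by (intro sum.cong) auto
  also have "\<dots> = e i j" using ij by simp
  finally show "(\<Oplus>\<^bsub>base_algebra\<^esub>q\<in>{..<n}. \<Oplus>\<^bsub>base_algebra\<^esub>r\<in>{..<n}.
      e q r \<odot>\<^bsub>base_algebra\<^esub> ((if q = i then 1 else 0) \<otimes>\<^bsub>base_algebra\<^esub> (if r = j then 1 else 0))) =
      e i j \<odot>\<^bsub>base_algebra\<^esub> \<one>\<^bsub>base_algebra\<^esub>" by simp
qed

text \<open>If \<open>z\<close> carries the form \<open>e\<close> to \<open>f\<close>, then its
  inverse carries \<open>f\<close> back to \<open>e\<close> only when the products of entries are
  taken in the reverse order.\<close>

definition op_alg :: "('k, 'a, 'm) module_scheme \<Rightarrow> ('k, 'a, 'm) module_scheme" where
  "op_alg A = A\<lparr>mult := \<lambda>x y. y \<otimes>\<^bsub>A\<^esub> x\<rparr>"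

lemma op_alg_simps [simp]:
  "carrier (op_alg A) = carrier A" "x \<otimes>\<^bsub>op_alg A\<^esub> y = y \<otimes>\<^bsub>A\<^esub> x" "\<one>\<^bsub>op_alg A\<^esub> = \<one>\<^bsub>A\<^esub>"
  "\<zero>\<^bsub>op_alg A\<^esub> = \<zero>\<^bsub>A\<^esub>" "add (op_alg A) = add A" "Module.smult (op_alg A) = Module.smult A"
  by (simp_all add: op_alg_def)

lemma op_k_module:
  assumes "k_module A" shows "k_module (op_alg A)"
  by (rule k_module_image[OF assms, of _ "\<lambda>x. x"]) simp_all

lemma op_k_alg:
  assumes "k_alg A" shows "k_alg (op_alg A)"
proof -
  interpret A: k_alg A by fact
  interpret O: k_module "op_alg A" by (rule op_k_module[OF A.k_module_axioms])
  have "monoid (op_alg A)" by (rule monoidI) (simp_all add: A.m_assoc)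
  then have "ring (op_alg A)"
    using O.abelian_group_axioms by (intro ringI) (simp_all add: A.l_distr A.r_distr)
  then show ?thesis
    by (intro k_alg.intro O.k_module_axioms k_alg_axioms.intro)
      (simp_all add: A.smult_mult_left A.smult_mult_right)
qed

lemma op_finsum: "finsum (op_alg A) f S = finsum A f S"
  by (simp add: finsum_def finprod_def)

text \<open>The relations of a tensor product of modules do not involve multiplication. Hence
  \<open>M \<otimes> A\<^sup>o\<^sup>p\<close> and \<open>M \<otimes> A\<close> are the same module,
  and a map may start in one and end in the other.\<close>

lemma op_tensor:
  fixes M :: "('k::comm_ring_1, 'a, 'm) module_scheme" and A :: "('k, 'b, 'n) module_scheme"
  assumes "k_module M" "k_module A"
  shows op_tensor_carrier: "carrier (tensor M (op_alg A)) = carrier (tensor M A)"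
    and op_tensor_add: "add (tensor M (op_alg A)) = add (tensor M A)"
    and op_tensor_smult: "Module.smult (tensor M (op_alg A)) = Module.smult (tensor M A)"
    and op_tensor_pure: "pure_tensor M (op_alg A) = pure_tensor M A"
proof -
  let ?P = "monoid_algebra (M \<times>\<times> op_alg A) :: ('k, 'a \<times> 'b \<Rightarrow>\<^sub>0 'k) module"
  let ?Q = "monoid_algebra (M \<times>\<times> A) :: ('k, 'a \<times> 'b \<Rightarrow>\<^sub>0 'k) module"
  interpret P: two_modules M "op_alg A" using assms op_k_module by (intro two_modulesI)
  interpret Q: two_modules M A using assms by (intro two_modulesI)
  have gens: "tensor_gens M (op_alg A) = tensor_gens M A" by (simp add: tensor_gens_def)
  have ops: "add ?P = add ?Q" "carrier ?P = carrier ?Q" "Module.smult ?P = Module.smult ?Q"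
    "zero ?P = zero ?Q"
    by (simp_all add: monoid_algebra_def)
  have sub: "LinearCombinations.submodule class_ring I ?P \<longleftrightarrow>
      LinearCombinations.submodule class_ring I ?Q" for I
    by (simp add: MA.submodule_def')
  have rel: "tensor_rel M (op_alg A) = tensor_rel M A"
  proof
    show "tensor_rel M (op_alg A) \<subseteq> tensor_rel M A"
      using Q.tensor_gens_rel Q.tensor_rel_submodule
      by (intro P.tensor_rel_least) (auto simp: gens sub)
    show "tensor_rel M A \<subseteq> tensor_rel M (op_alg A)"
      using P.tensor_gens_rel P.tensor_rel_submodule
      by (intro Q.tensor_rel_least) (auto simp: gens sub)
  qed
  have coset: "I +>\<^bsub>?P\<^esub> x = I +>\<^bsub>?Q\<^esub> x" for I x
    by (simp add: a_r_coset_def' ops)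
  show "carrier (tensor M (op_alg A)) = carrier (tensor M A)"
    "add (tensor M (op_alg A)) = add (tensor M A)"
    "Module.smult (tensor M (op_alg A)) = Module.smult (tensor M A)"
    "pure_tensor M (op_alg A) = pure_tensor M A"
    by (simp_all only: tensor_def quot_algebra_def rel A_RCOSETS_def' coset a_r_coset_def' ops
        pure_tensor_def set_add_def' fun_eq_iff partial_object.simps ring.simps module.simps simp_thms)
qed

locale B_bialgebra =
  fixes n :: nat and E :: "'k::comm_ring_1 mat"
  assumes E: "E \<in> carrier_mat n n" "invertible_mat E"
begin

sublocale B: B_data n n E E by unfold_locales (rule E)+

sublocale BB: two_algs "B_algebra E E" "B_algebra E E" ..

lemma B_hopf_alg: "k_alg (B_hopf E)"
  by (rule k_alg_image[OF B.B_algebra_alg, of _ "\<lambda>x. x"]) simp_all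

text \<open>The product of two copies of the generating matrix, formed in the tensor square,
  satisfies the form relations, which yields an algebra map. The term in the definition of the Hopf
  record is then identified with it by uniqueness.\<close>

lemma comult_facts:
  shows comult_hom: "comult (B_hopf E) \<in> alg_hom (B_hopf E) (tensor (B_hopf E) (B_hopf E))"
    and comult_gen: "\<And>i j. i < n \<Longrightarrow> j < n \<Longrightarrow> comult (B_hopf E) (B.gen i j) =
      (\<Oplus>\<^bsub>tensor (B_hopf E) (B_hopf E)\<^esub>l\<in>{..<n}. pure_tensor (B_hopf E) (B_hopf E) (B.gen i l) (B.gen l j))"
proof -
  let ?T = "tensor (B_algebra E E) (B_algebra E E)"
  let ?w = "\<lambda>i j. \<Oplus>\<^bsub>?T\<^esub>l\<in>{..<n}. pure_tensor (B_algebra E E) (B_algebra E E) (B.gen i l) (B.gen l j)"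
  have w: "?w i j \<in> carrier ?T" for i j by (intro BB.T.finsum_closed) auto
  note h = B.B_hom[OF BB.tensor_alg, of ?w, OF w
      BB.form_rel_tensor[OF B.gen_closed B.gen_closed B.gen_relations(1) B.gen_relations(1)]
      BB.form_rel_tensor_transpose[OF B.gen_closed B.gen_closed B.gen_relations(2) B.gen_relations(2)]]
  have eq: "comult (B_hopf E) t = presented_hom ?T (\<lambda>(i, j). ?w i j) t"
    if "t \<in> carrier (B_algebra E E)" for t
    unfolding B_hopf_comult
  proof (rule B.B_presented_hom_unique[OF BB.tensor_alg h(1) _ that])
    fix i j assume ij: "i < n" "j < n"
    show "presented_hom ?T (\<lambda>(i, j). ?w i j) (B_gen E E i j) =
        (case (i, j) of (i, j) \<Rightarrow> \<Oplus>\<^bsub>?T\<^esub>l\<in>{..<dim_row E}.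
              pure_tensor (B_algebra E E) (B_algebra E E) (B_gen E E i l) (B_gen E E l j))"
      unfolding h(2)[OF ij] prod.case carrier_matD(1)[OF E(1)]
      using ij by (intro BB.T.finsum_cong') (simp_all add: B.B_gen_closed)
  qed
  show "comult (B_hopf E) \<in> alg_hom (B_hopf E) (tensor (B_hopf E) (B_hopf E))"
    using h(1) eq B.BA.a_closed B.BA.smult_closed B.BA.m_closed B.BA.one_closed by (simp add: tensor_B_hopf alg_hom_iff module_hom_iff)
  show "comult (B_hopf E) (B.gen i j) =
      (\<Oplus>\<^bsub>tensor (B_hopf E) (B_hopf E)\<^esub>l\<in>{..<n}. pure_tensor (B_hopf E) (B_hopf E) (B.gen i l) (B.gen l j))"
    if "i < n" "j < n" for i j
    unfolding eq[OF B.gen_closed] tensor_B_hopf using h(2)[OF that] that by simp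
qed

lemma counit_facts:
  shows counit_hom: "counit (B_hopf E) \<in> alg_hom (B_hopf E) base_algebra"
    and counit_gen: "\<And>i j. i < n \<Longrightarrow> j < n \<Longrightarrow> counit (B_hopf E) (B.gen i j) = (if i = j then 1 else 0)"
proof -
  let ?w = "\<lambda>i j. if i = j then 1 else (0 :: 'k)"
  have w: "(\<lambda>i j. ?w j i) = ?w" by (auto simp: fun_eq_iff)
  have r: "base.form_rel n n (\<lambda>i j. mat_inv E $$ (i, j)) (\<lambda>i j. mat_inv E $$ (i, j)) (\<lambda>i j. ?w j i)"
    unfolding w by (rule base_form_rel)
  note h = B.B_hom[OF base_algebra_alg, of ?w, OF _ base_form_rel r]
  show "counit (B_hopf E) \<in> alg_hom (B_hopf E) base_algebra"
    using h(1) unfolding B_hopf_counit by (simp add: alg_hom_iff module_hom_iff)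
  show "counit (B_hopf E) (B.gen i j) = (if i = j then 1 else 0)" if "i < n" "j < n" for i j
    using h(2) that unfolding B_hopf_counit by simp
qed

lemma B_hopf_form_rel:
  "k_alg.form_rel (B_hopf E) n n (\<lambda>i j. E $$ (i, j)) (\<lambda>i j. E $$ (i, j)) B.gen"
  "k_alg.form_rel (B_hopf E) n n (\<lambda>i j. mat_inv E $$ (i, j)) (\<lambda>i j. mat_inv E $$ (i, j)) (\<lambda>i j. B.gen j i)"
proof -
  have id: "(\<lambda>x. x) \<in> alg_hom (B_algebra E E) (B_hopf E)" by (simp add: alg_hom_iff module_hom_iff)
  show "k_alg.form_rel (B_hopf E) n n (\<lambda>i j. E $$ (i, j)) (\<lambda>i j. E $$ (i, j)) B.gen"
    "k_alg.form_rel (B_hopf E) n n (\<lambda>i j. mat_inv E $$ (i, j)) (\<lambda>i j. mat_inv E $$ (i, j)) (\<lambda>i j. B.gen j i)"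
    using B.BA.form_rel_hom[OF B_hopf_alg id B.gen_relations(1) B.gen_closed]
      B.BA.form_rel_hom[OF B_hopf_alg id B.gen_relations(2) B.gen_closed] by simp_all
qed

end

section \<open>Finitely generated torsion-free modules over a principal ideal domain\<close>

lemma pid_no_zero_divisors:
  assumes "principal_domain (class_ring :: 'k::comm_ring_1 ring)" "(a :: 'k) * b = 0"
  shows "a = 0 \<or> b = 0"
proof -
  interpret principal_domain "class_ring :: 'k ring" by fact
  show ?thesis using integral[of a b] assms(2) by simp
qed

lemma pid_nontrivial:
  assumes "principal_domain (class_ring :: 'k::comm_ring_1 ring)"
  shows "(1 :: 'k) \<noteq> 0"
proof -
  interpret principal_domain "class_ring :: 'k ring" by fact
  show ?thesis using one_not_zero by simp
qed

text \<open>The ideal generated by \<open>c\<close> and \<open>d\<close> is written as the set of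
  their combinations: membership of its generator \<open>g\<close> gives the coefficients,
  membership of \<open>c\<close> and \<open>d\<close> gives the quotients.\<close>

lemma pid_bezout:
  fixes c d :: "'k::comm_ring_1"
  assumes "principal_domain (class_ring :: 'k ring)"
  obtains g x y p q where "g = c * x + d * y" "c = g * p" "d = g * q"
proof -
  let ?R = "class_ring :: 'k ring"
  interpret principal_domain ?R by fact
  let ?I = "{c * x + d * y | x y. True}"
  have "ideal ?I ?R"
  proof (rule idealI)
    show "ring ?R" by (rule class_ring.ring_axioms)
    show "subgroup ?I (add_monoid ?R)"
    proof (rule add.subgroupI)
      show "?I \<subseteq> carrier ?R" by simp
      show "?I \<noteq> {}" by blast
      fix a assume "a \<in> ?I"
      then obtain x y where "a = c * x + d * y" by blast
      then have "- a = c * (- x) + d * (- y)" by simp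
      then show "\<ominus>\<^bsub>?R\<^esub> a \<in> ?I" unfolding class_ring_simps by blast
      fix b assume "b \<in> ?I"
      then obtain x' y' where "b = c * x' + d * y'" by blast
      with \<open>a = _\<close> have "a + b = c * (x + x') + d * (y + y')" by (simp add: algebra_simps)
      then show "a \<oplus>\<^bsub>?R\<^esub> b \<in> ?I" by auto
    qed
  next
    fix a r assume "a \<in> ?I"
    then obtain x y where "a = c * x + d * y" by blast
    then have "r * a = c * (r * x) + d * (r * y)" "a * r = c * (r * x) + d * (r * y)"
      by (simp_all add: algebra_simps)
    then have "r * a \<in> ?I" "a * r \<in> ?I" by blast+
    then show "r \<otimes>\<^bsub>?R\<^esub> a \<in> ?I" "a \<otimes>\<^bsub>?R\<^esub> r \<in> ?I" unfolding class_ring_simps .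
  qed
  then obtain g where g: "?I = PIdl\<^bsub>?R\<^esub> g" using exists_gen by blast
  have "g \<in> ?I" unfolding g cgenideal_def by (auto intro: exI[of _ 1])
  then obtain x y where "g = c * x + d * y" by blast
  moreover have "c = c * 1 + d * 0" "d = c * 0 + d * 1" by simp_all
  then have "c \<in> ?I" "d \<in> ?I" by blast+
  then have "c \<in> PIdl\<^bsub>?R\<^esub> g" "d \<in> PIdl\<^bsub>?R\<^esub> g" unfolding g by blast+
  then obtain p q where "c = g * p" "d = g * q"
    unfolding cgenideal_def by (auto simp: mult.commute)
  ultimately show ?thesis using that by blast
qed

context k_module
begin

abbreviation "kspan \<equiv> LinearCombinations.module.span class_ring M"

lemma kspan_submodule: "S \<subseteq> carrier M \<Longrightarrow> LinearCombinations.submodule class_ring (kspan S) M"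
  by (rule module.span_is_submodule[OF module])

lemma kspan_superset: "S \<subseteq> carrier M \<Longrightarrow> S \<subseteq> kspan S"
  by (rule module.in_own_span[OF module])

lemma kspan_least: "S \<subseteq> N \<Longrightarrow> LinearCombinations.submodule class_ring N M \<Longrightarrow> kspan S \<subseteq> N"
  by (rule module.span_is_subset[OF module])

lemma kspan_mono: "S \<subseteq> T \<Longrightarrow> T \<subseteq> carrier M \<Longrightarrow> kspan S \<subseteq> kspan T"
  using kspan_superset kspan_submodule by (intro kspan_least) auto

lemma kspan_finite:
  assumes "finite S" "S \<subseteq> carrier M" "x \<in> kspan S"
  shows "\<exists>c. x = (\<Oplus>v\<in>S. c v \<odot> v)"
  using module.finite_in_span[OF module assms] module.lincomb_def[OF module] by auto

text \<open>Lists instead of sets, because a base change may produce a vector that coincides with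
  another generator, and both must be kept.\<close>

fun lin_comb :: "'k list \<Rightarrow> 'a list \<Rightarrow> 'a" where
  "lin_comb (c # cs) (w # ws) = c \<odot> w \<oplus> lin_comb cs ws"
| "lin_comb _ _ = \<zero>"

lemma lin_comb_closed: "set ws \<subseteq> carrier M \<Longrightarrow> lin_comb cs ws \<in> carrier M"
  by (induction cs ws rule: lin_comb.induct) auto

text \<open>
  Base changes of determinant 1 on two generators at a time, given by Bezout coefficients, turn a
  nontrivial relation into one with a single nonzero coefficient.
\<close>

lemma reduce_generators:
  assumes pid: "principal_domain (class_ring :: 'k ring)"
    and tf: "\<And>c x. x \<in> carrier M \<Longrightarrow> c \<odot> x = \<zero> \<Longrightarrow> c \<noteq> 0 \<Longrightarrow> x = \<zero>"
  shows "length cs = length ws \<Longrightarrow> set ws \<subseteq> carrier M \<Longrightarrow> lin_comb cs ws = \<zero> \<Longrightarrow> \<exists>c\<in>set cs. c \<noteq> 0 \<Longrightarrow>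
    \<exists>us. set us \<subseteq> carrier M \<and> Suc (length us) = length ws \<and> set ws \<subseteq> kspan (set us)"
proof (induction "length ws" arbitrary: cs ws)
  case 0
  then show ?case by simp
next
  case (Suc k)
  have len: "length ws = Suc k" "length cs = Suc k" using Suc.hyps(2) Suc.prems(1) by simp_all
  obtain c cs' where c: "cs = c # cs'" "length cs' = k" using len(2) by (auto simp: length_Suc_conv)
  obtain w ws' where w: "ws = w # ws'" "length ws' = k" using len(1) by (auto simp: length_Suc_conv)
  have cw: "cs = c # cs'" "ws = w # ws'" "length cs' = length ws'" "length ws' = k" using c w by simp_all
  have w: "w \<in> carrier M" "set ws' \<subseteq> carrier M" using Suc.prems cw by auto
  show ?case
  proof (cases k)
    case 0
    \<comment> \<open>A single generator with a nonzero coefficient is zero by torsion-freeness, so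
      the empty list already generates.\<close>
    then have "w = \<zero>" using Suc.prems cw tf[of w c] w by auto
    moreover have "\<zero> \<in> kspan {}" using kspan_submodule[of "{}"] by (simp add: submodule_def')
    ultimately show ?thesis using cw 0 by (intro exI[of _ "[]"]) auto
  next
    case (Suc k')
    then have len': "length cs' = Suc k'" "length ws' = Suc k'" using cw by simp_all
    obtain d ds where d: "cs' = d # ds" "length ds = k'" using len'(1) by (auto simp: length_Suc_conv)
    obtain v vs where v: "ws' = v # vs" "length vs = k'" using len'(2) by (auto simp: length_Suc_conv)
    have dv: "cs' = d # ds" "ws' = v # vs" "length ds = length vs" using d v by simp_all
    have v: "v \<in> carrier M" "set vs \<subseteq> carrier M" using w dv by auto
    show ?thesis
    proof (cases "c = 0")
      case True
      \<comment> \<open>The relation does not involve \<open>w\<close>: it is a relation of the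
        tail, which is shortened by induction while \<open>w\<close> is kept.\<close>
      then have "lin_comb cs' ws' = \<zero>" using Suc.prems cw w lin_comb_closed by simp
      moreover have "\<exists>c\<in>set cs'. c \<noteq> 0" using Suc.prems cw True by auto
      ultimately obtain us where us: "set us \<subseteq> carrier M" "Suc (length us) = length ws'" "set ws' \<subseteq> kspan (set us)"
        using Suc.hyps(1)[of ws' cs'] cw w by auto
      have "kspan (set us) \<subseteq> kspan (set (w # us))" by (rule kspan_mono) (use us w in auto)
      moreover have "w \<in> kspan (set (w # us))" using kspan_superset[of "set (w # us)"] us w by auto
      ultimately show ?thesis using us w cw by (intro exI[of _ "w # us"]) auto
    next
      case False
      obtain g x y p q where b: "g = c * x + d * y" "c = g * p" "d = g * q"
        using pid_bezout[OF pid] by blast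
      have g0: "g \<noteq> 0" using False b(2) by (metis mult_zero_left)
      \<comment> \<open>Cancelling \<open>g\<close> gives \<open>p x + q y = 1\<close>, the
        determinant of the base change from \<open>w, v\<close> to \<open>w', v'\<close>; its
        inverse has again entries in the ring.\<close>
      have "g * (p * x + q * y) = (g * p) * x + (g * q) * y" by (simp add: algebra_simps)
      also have "\<dots> = g" unfolding b(2,3)[symmetric] by (rule b(1)[symmetric])
      finally have "g * (p * x + q * y - 1) = 0" by (simp add: right_diff_distrib)
      then have det: "p * x + q * y = 1" using g0 pid_no_zero_divisors[OF pid, of g] by (metis eq_iff_diff_eq_0)
      define w' where "w' = p \<odot> w \<oplus> q \<odot> v"
      define v' where "v' = (- y) \<odot> w \<oplus> x \<odot> v"
      have w'c: "w' \<in> carrier M" "v' \<in> carrier M" using w v by (auto simp: w'_def v'_def)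
      have comb: "s \<odot> w' \<oplus> t \<odot> v' = (s * p - t * y) \<odot> w \<oplus> (s * q + t * x) \<odot> v" for s t
      proof -
        have "s \<odot> w' \<oplus> t \<odot> v' = (s * p) \<odot> w \<oplus> (s * q) \<odot> v \<oplus> ((t * (- y)) \<odot> w \<oplus> (t * x) \<odot> v)"
          using w v by (simp add: w'_def v'_def smult_add_right smult_smult)
        also have "\<dots> = ((s * p) \<odot> w \<oplus> (t * (- y)) \<odot> w) \<oplus> ((s * q) \<odot> v \<oplus> (t * x) \<odot> v)"
          using w v by (simp add: a_ac)
        also have "\<dots> = (s * p - t * y) \<odot> w \<oplus> (s * q + t * x) \<odot> v"
          using w v by (simp flip: smult_add_left)
        finally show ?thesis .
      qed
      have ww: "w = x \<odot> w' \<oplus> (- q) \<odot> v'" and vv: "v = y \<odot> w' \<oplus> p \<odot> v'"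
        using comb[of x "- q"] comb[of y p] det w v by (simp_all add: mult.commute add.commute)
      \<comment> \<open>In the new generators the relation has no component along \<open>v'\<close>,
        since \<open>c w + d v = g w'\<close>. So \<open>v'\<close> is set aside and the induction
        hypothesis applies to the remaining ones, with the nonzero coefficient
        \<open>g\<close>.\<close>
      have "g \<odot> w' \<oplus> lin_comb ds vs = \<zero>"
      proof -
        have "g \<odot> w' = c \<odot> w \<oplus> d \<odot> v"
          using w v b(2,3) by (simp add: w'_def smult_add_right smult_smult)
        then show ?thesis using Suc.prems(3) cw dv w v lin_comb_closed by (simp add: a_assoc)
      qed
      then obtain us where us: "set us \<subseteq> carrier M" "Suc (length us) = length (w' # vs)"
          "set (w' # vs) \<subseteq> kspan (set us)"
        using Suc.hyps(1)[of "w' # vs" "g # ds"] cw dv w'c v g0 by auto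
      let ?U = "set (v' # us)"
      have U: "?U \<subseteq> carrier M" using us w'c by auto
      have sub: "kspan (set us) \<subseteq> kspan ?U" by (rule kspan_mono) (use U in auto)
      have w'U: "w' \<in> kspan ?U" "v' \<in> kspan ?U" using us sub kspan_superset[OF U] by auto
      then have "w \<in> kspan ?U" "v \<in> kspan ?U"
        using kspan_submodule[OF U] ww vv unfolding submodule_def' by metis+
      then show ?thesis using us sub cw dv U by (intro exI[of _ "v' # us"]) auto
    qed
  qed
qed

lemma finsum_lin_comb:
  assumes "distinct ws" "set ws \<subseteq> carrier M"
  shows "(\<Oplus>v\<in>set ws. c v \<odot> v) = lin_comb (map c ws) ws"
  using assms by (induction ws) (auto simp: Pi_def subset_iff)

text \<open>A generating set of least cardinality is a basis: a nontrivial relation among its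
  elements would, by the reduction above, give a generating list with one element less.\<close>

lemma torsion_free_basis:
  assumes pid: "principal_domain (class_ring :: 'k ring)"
    and tf: "\<And>c x. x \<in> carrier M \<Longrightarrow> c \<odot> x = \<zero> \<Longrightarrow> c \<noteq> 0 \<Longrightarrow> x = \<zero>"
    and fg: "finite S" "S \<subseteq> carrier M" "carrier M \<subseteq> kspan S"
  obtains m :: nat and w where "\<And>j. j < m \<Longrightarrow> w j \<in> carrier M"
    "\<And>x. x \<in> carrier M \<Longrightarrow> \<exists>c. x = (\<Oplus>j\<in>{..<m}. c j \<odot> w j)"
    "\<And>c j. (\<Oplus>j\<in>{..<m}. c j \<odot> w j) = \<zero> \<Longrightarrow> j < m \<Longrightarrow> c j = 0"
proof -
  let ?P = "\<lambda>B. finite B \<and> B \<subseteq> carrier M \<and> carrier M \<subseteq> kspan B"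
  obtain B where B: "?P B" and min: "\<And>C. ?P C \<Longrightarrow> card B \<le> card C"
    using exists_least_iff[of "\<lambda>k. \<exists>B. ?P B \<and> card B = k"] fg
    by (metis (mono_tags, lifting) linorder_not_less)
  have ind: "c v = 0" if rel: "(\<Oplus>v\<in>B. c v \<odot> v) = \<zero>" and v: "v \<in> B" for c v
  proof (rule ccontr)
    assume c: "c v \<noteq> 0"
    obtain ws where ws: "set ws = B" "distinct ws" using B finite_distinct_list by blast
    have "lin_comb (map c ws) ws = \<zero>" using finsum_lin_comb[OF ws(2), of c] ws B rel by simp
    moreover have "\<exists>d\<in>set (map c ws). d \<noteq> 0" using c v ws by auto
    ultimately have "\<exists>us. set us \<subseteq> carrier M \<and> Suc (length us) = length ws \<and> set ws \<subseteq> kspan (set us)"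
    proof (intro reduce_generators[where cs = "map c ws", OF pid])
      show "x = \<zero>" if "x \<in> carrier M" "c \<odot> x = \<zero>" "c \<noteq> 0" for c x
        using that by (rule tf)
      show "set ws \<subseteq> carrier M" using ws B by simp
    qed simp_all
    then obtain us where us: "set us \<subseteq> carrier M" "Suc (length us) = length ws" "set ws \<subseteq> kspan (set us)"
      by blast
    have "kspan B \<subseteq> kspan (set us)"
      by (rule kspan_least[OF _ kspan_submodule]) (use us ws in auto)
    then have "?P (set us)" using us B by auto
    then have "card B \<le> card (set us)" by (rule min)
    also have "\<dots> \<le> length us" by (rule card_length)
    also have "\<dots> < card B" using us ws distinct_card[OF ws(2)] by simp
    finally show False by simp
  qed
  obtain w where w: "bij_betw w {..<card B} B"
    using B ex_bij_betw_nat_finite[of B] by (auto simp: atLeast0LessThan)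
  then have img: "w ` {..<card B} = B" and inj: "inj_on w {..<card B}" by (auto simp: bij_betw_def)
  have re: "(\<Oplus>v\<in>B. f v \<odot> v) = (\<Oplus>j\<in>{..<card B}. f (w j) \<odot> w j)" for f
    using finsum_reindex[of "\<lambda>v. f v \<odot> v" w "{..<card B}"] img inj B by auto
  show ?thesis
  proof (rule that[of "card B" w])
    show "w j \<in> carrier M" if "j < card B" for j using that img B by auto
    show "\<exists>c. x = (\<Oplus>j\<in>{..<card B}. c j \<odot> w j)" if "x \<in> carrier M" for x
    proof -
      obtain c where "x = (\<Oplus>v\<in>B. c v \<odot> v)" using kspan_finite[of B x] B \<open>x \<in> carrier M\<close> by blast
      then show ?thesis by (auto simp: re)
    qed
    fix c j assume rel: "(\<Oplus>j\<in>{..<card B}. c j \<odot> w j) = \<zero>" and j: "j < card B"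
    let ?i = "inv_into {..<card B} w"
    have "(\<Oplus>v\<in>B. c (?i v) \<odot> v) = (\<Oplus>j\<in>{..<card B}. c j \<odot> w j)"
      unfolding re using img inj B by (intro finsum_cong') auto
    then have "c (?i (w j)) = 0" using rel j img by (intro ind) auto
    then show "c j = 0" using inj j by simp
  qed
qed

end

section \<open>Inverse pairs of matrices\<close>

text \<open>Over a commutative ring the adjugate replaces linear algebra over a field:
  \<open>det A det B = 1\<close> and \<open>A = det A adj(B)\<close>, and the latter is a right
  inverse of \<open>B\<close>.\<close>

lemma mat_left_inverse_right:
  fixes A B :: "'k::comm_ring_1 mat"
  assumes A: "A \<in> carrier_mat m m" and B: "B \<in> carrier_mat m m" and AB: "A * B = 1\<^sub>m m"
  shows "B * A = 1\<^sub>m m"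
proof -
  let ?C = "adj_mat B"
  have C: "?C \<in> carrier_mat m m" and BC: "B * ?C = det B \<cdot>\<^sub>m 1\<^sub>m m"
    using adj_mat[OF B] by auto
  have dets: "det A * det B = 1" using det_mult[OF A B] AB by simp
  have smult: "c \<cdot>\<^sub>m (d \<cdot>\<^sub>m X) = (c * d) \<cdot>\<^sub>m X" for c d and X :: "'k mat"
    by (rule eq_matI) (simp_all add: mult.assoc)
  have one: "1 \<cdot>\<^sub>m X = X" for X :: "'k mat" by (rule eq_matI) simp_all
  have "A = A * (det A \<cdot>\<^sub>m (B * ?C))"
    unfolding BC smult dets one using A by simp
  also have "\<dots> = det A \<cdot>\<^sub>m (A * (B * ?C))"
    by (rule mult_smult_distrib[OF A mult_carrier_mat[OF B C]])
  also have "A * (B * ?C) = ?C"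
    using A B C AB by (simp flip: assoc_mult_mat[of A m m B m ?C m])
  finally have "B * A = B * (det A \<cdot>\<^sub>m ?C)" by (rule arg_cong)
  also have "\<dots> = det A \<cdot>\<^sub>m (B * ?C)" by (rule mult_smult_distrib[OF B C])
  also have "\<dots> = 1\<^sub>m m" unfolding BC smult dets one ..
  finally show ?thesis .
qed

lemma sum_left_inverse_right:
  fixes f g :: "nat \<Rightarrow> nat \<Rightarrow> 'k::comm_ring_1"
  assumes "\<And>i j. i < m \<Longrightarrow> j < m \<Longrightarrow> (\<Sum>l<m. f i l * g l j) = (if i = j then 1 else 0)"
    and "i < m" "j < m"
  shows "(\<Sum>l<m. g i l * f l j) = (if i = j then 1 else 0)"
proof -
  let ?F = "mat m m (\<lambda>(i, j). f i j)" and ?G = "mat m m (\<lambda>(i, j). g i j)"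
  have "?F * ?G = 1\<^sub>m m"
  proof (rule eq_matI)
    fix i j assume "i < dim_row (1\<^sub>m m)" "j < dim_col (1\<^sub>m m)"
    then have ij: "i < m" "j < m" by simp_all
    then have "(?F * ?G) $$ (i, j) = (\<Sum>l<m. ?F $$ (i, l) * ?G $$ (l, j))"
      by (simp add: scalar_prod_def atLeast0LessThan)
    also have "\<dots> = (\<Sum>l<m. f i l * g l j)" by (rule sum.cong) (use ij in simp_all)
    also have "\<dots> = 1\<^sub>m m $$ (i, j)" unfolding assms(1)[OF ij] using ij by simp
    finally show "(?F * ?G) $$ (i, j) = 1\<^sub>m m $$ (i, j)" .
  qed simp_all
  then have "?G * ?F = 1\<^sub>m m" by (rule mat_left_inverse_right[OF mat_carrier mat_carrier])
  then have "(\<Sum>l<m. ?G $$ (i, l) * ?F $$ (l, j)) = (if i = j then 1 else 0)"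
    by (rule mat_prod_entry[OF mat_carrier mat_carrier _ assms(2,3)])
  moreover have "(\<Sum>l<m. ?G $$ (i, l) * ?F $$ (l, j)) = (\<Sum>l<m. g i l * f l j)"
    by (rule sum.cong) (use assms(2,3) in simp_all)
  ultimately show ?thesis by simp
qed

text \<open>For \<open>m = 0\<close> empty sums give \<open>e' = 0\<close>. For \<open>m = 1\<close>
  the matrix is a single column with \<open>z_i z_j\<close> a scalar multiple of the unit, namely
  \<open>f e'_ij\<close>. Then \<open>(z_i z_j) z_l = z_i (z_j z_l)\<close> says
  \<open>e'_ij z_l = e'_jl z_i\<close>, which is incompatible with \<open>e'\<close> being
  invertible of size at least two.\<close>

lemma B_matrix_rank_ge_2:
  fixes Z :: "('k::comm_ring_1, 'z, 'y) module_scheme"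
  assumes "k_alg Z" and inj: "\<And>c. c \<odot>\<^bsub>Z\<^esub> \<one>\<^bsub>Z\<^esub> = \<zero>\<^bsub>Z\<^esub> \<Longrightarrow> c = 0" and nontriv: "(1 :: 'k) \<noteq> 0"
    and n: "n \<ge> 2"
    and ee': "\<And>i j. i < n \<Longrightarrow> j < n \<Longrightarrow> (\<Sum>l<n. e i l * e' l j) = (if i = j then 1 else 0)"
    and ff': "\<And>i j. i < m \<Longrightarrow> j < m \<Longrightarrow> (\<Sum>l<m. f i l * f' l j) = (if i = j then 1 else 0)"
    and z: "\<And>i j. z i j \<in> carrier Z"
    and rel: "k_alg.form_rel Z m n f' e' (\<lambda>i j. z j i)"
  shows "m \<ge> 2"
proof (rule ccontr)
  interpret Z: k_alg Z by fact
  assume "\<not> m \<ge> 2"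
  then consider "m = 0" | "m = 1" by linarith
  then show False
  proof cases
    case 1
    have "e' i j = 0" if "i < n" "j < n" for i j
    proof -
      have "(\<Oplus>\<^bsub>Z\<^esub>q\<in>{..<m}. \<Oplus>\<^bsub>Z\<^esub>r\<in>{..<m}. f' q r \<odot>\<^bsub>Z\<^esub> (z i q \<otimes>\<^bsub>Z\<^esub> z j r)) = e' i j \<odot>\<^bsub>Z\<^esub> \<one>\<^bsub>Z\<^esub>"
        using rel that unfolding Z.form_rel_def by blast
      then show ?thesis using 1 by (intro inj) simp
    qed
    then have "(\<Sum>l<n. e 0 l * e' l 0) = 0" using n by (intro sum.neutral) auto
    then show False using ee'[of 0 0] n nontriv by simp
  next
    case 2
    let ?z = "\<lambda>i. z i 0"
    have ff: "f 0 0 * f' 0 0 = 1" using ff'[of 0 0] 2 by simp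
    have zz: "?z i \<otimes>\<^bsub>Z\<^esub> ?z j = (f 0 0 * e' i j) \<odot>\<^bsub>Z\<^esub> \<one>\<^bsub>Z\<^esub>" if "i < n" "j < n" for i j
    proof -
      have "f' 0 0 \<odot>\<^bsub>Z\<^esub> (?z i \<otimes>\<^bsub>Z\<^esub> ?z j) = e' i j \<odot>\<^bsub>Z\<^esub> \<one>\<^bsub>Z\<^esub>"
      proof -
        have "(\<Oplus>\<^bsub>Z\<^esub>q\<in>{..<Suc 0}. \<Oplus>\<^bsub>Z\<^esub>r\<in>{..<Suc 0}. f' q r \<odot>\<^bsub>Z\<^esub> (z i q \<otimes>\<^bsub>Z\<^esub> z j r)) = e' i j \<odot>\<^bsub>Z\<^esub> \<one>\<^bsub>Z\<^esub>"
          using rel that 2 unfolding Z.form_rel_def by simp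
        then show ?thesis using z by (simp add: lessThan_Suc Z.finsum_insert)
      qed
      then have "f 0 0 \<odot>\<^bsub>Z\<^esub> (f' 0 0 \<odot>\<^bsub>Z\<^esub> (?z i \<otimes>\<^bsub>Z\<^esub> ?z j)) = f 0 0 \<odot>\<^bsub>Z\<^esub> (e' i j \<odot>\<^bsub>Z\<^esub> \<one>\<^bsub>Z\<^esub>)"
        by simp
      then show ?thesis using z by (simp add: Z.smult_smult ff)
    qed
    have comm: "e' i j \<odot>\<^bsub>Z\<^esub> ?z l = e' j l \<odot>\<^bsub>Z\<^esub> ?z i" if "i < n" "j < n" "l < n" for i j l
    proof -
      have "(f 0 0 * e' i j) \<odot>\<^bsub>Z\<^esub> ?z l = (f 0 0 * e' j l) \<odot>\<^bsub>Z\<^esub> ?z i"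
        using Z.m_assoc[OF z z z, of i 0 j 0 l 0] that z
        by (simp add: zz Z.smult_mult_left Z.smult_mult_right)
      then have "f' 0 0 \<odot>\<^bsub>Z\<^esub> ((f 0 0 * e' i j) \<odot>\<^bsub>Z\<^esub> ?z l) = f' 0 0 \<odot>\<^bsub>Z\<^esub> ((f 0 0 * e' j l) \<odot>\<^bsub>Z\<^esub> ?z i)"
        by simp
      moreover have "f' 0 0 * (f 0 0 * c) = c" for c using ff by (metis mult.assoc mult.commute mult_1)
      ultimately show ?thesis using z by (simp add: Z.smult_smult)
    qed
    \<comment> \<open>The entries of \<open>e\<close> times the transpose of \<open>e'\<close>.
      Contracting \<open>comm\<close> with \<open>e\<close> over \<open>j\<close> produces this on
      the left and a Kronecker delta on the right.\<close>
    define c where "c p i = (\<Sum>j<n. e p j * e' i j)" for p i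
    have c: "c p i \<odot>\<^bsub>Z\<^esub> ?z l = (if p = l then 1 else 0) \<odot>\<^bsub>Z\<^esub> ?z i" if "p < n" "i < n" "l < n" for p i l
    proof -
      have "c p i \<odot>\<^bsub>Z\<^esub> ?z l = (\<Oplus>\<^bsub>Z\<^esub>j\<in>{..<n}. e p j \<odot>\<^bsub>Z\<^esub> (e' i j \<odot>\<^bsub>Z\<^esub> ?z l))"
        using z by (simp add: c_def Z.smult_sum_left Z.smult_smult)
      also have "\<dots> = (\<Oplus>\<^bsub>Z\<^esub>j\<in>{..<n}. e p j \<odot>\<^bsub>Z\<^esub> (e' j l \<odot>\<^bsub>Z\<^esub> ?z i))"
        using z that by (intro Z.finsum_cong') (auto simp: comm)
      also have "\<dots> = (\<Sum>j<n. e p j * e' j l) \<odot>\<^bsub>Z\<^esub> ?z i"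
        using z by (simp add: Z.smult_sum_left Z.smult_smult)
      finally show ?thesis using ee' that by simp
    qed
    have "e' i 1 = 0" if i: "i < n" for i
    proof -
      \<comment> \<open>Two distinct indices are at hand because \<open>n \<ge> 2\<close>: the
        scalar \<open>c 0 i\<close> carries \<open>z_0\<close> to \<open>z_i\<close> but kills
        \<open>z_1\<close>. Moving it across the product shows \<open>z_i z_1 = 0\<close>, so column
        1 of \<open>e'\<close> vanishes.\<close>
      have "?z i \<otimes>\<^bsub>Z\<^esub> ?z 1 = (c 0 i \<odot>\<^bsub>Z\<^esub> ?z 0) \<otimes>\<^bsub>Z\<^esub> ?z 1" using c[of 0 i 0] i n z by simp
      also have "\<dots> = ?z 0 \<otimes>\<^bsub>Z\<^esub> (c 0 i \<odot>\<^bsub>Z\<^esub> ?z 1)" using z by (simp add: Z.smult_mult_left Z.smult_mult_right)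
      also have "\<dots> = \<zero>\<^bsub>Z\<^esub>" using c[of 0 i 1] i n z by simp
      finally have "f 0 0 * e' i 1 = 0" using zz[of i 1] i n inj by simp
      then have "f' 0 0 * (f 0 0 * e' i 1) = 0" by simp
      then show ?thesis using ff by (metis mult.assoc mult.commute mult_1)
    qed
    then have "(\<Sum>l<n. e 1 l * e' l 1) = 0" by (intro sum.neutral) auto
    then show False using ee'[of 1 1] n nontriv by simp
  qed
qed

context k_alg
begin

lemma smult_finsum_swap:
  assumes "\<And>i j. x i j \<in> carrier A"
  shows "(\<Oplus>q\<in>{..<m :: nat}. c q \<odot> (\<Oplus>p\<in>{..<n :: nat}. d p \<odot> x p q)) =
    (\<Oplus>p\<in>{..<n}. d p \<odot> (\<Oplus>q\<in>{..<m}. c q \<odot> x p q))"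
proof -
  have "(\<Oplus>q\<in>{..<m}. c q \<odot> (\<Oplus>p\<in>{..<n}. d p \<odot> x p q)) = (\<Oplus>q\<in>{..<m}. \<Oplus>p\<in>{..<n}. (c q * d p) \<odot> x p q)"
    using assms by (simp add: finsum_smult smult_smult Pi_def)
  also have "\<dots> = (\<Oplus>p\<in>{..<n}. \<Oplus>q\<in>{..<m}. (c q * d p) \<odot> x p q)"
    using assms by (intro finsum_swap) auto
  also have "\<dots> = (\<Oplus>p\<in>{..<n}. d p \<odot> (\<Oplus>q\<in>{..<m}. c q \<odot> x p q))"
    using assms by (simp add: finsum_smult smult_smult Pi_def mult.commute)
  finally show ?thesis .
qed

lemma mprod_scalar_left:
  assumes "\<And>i j. x i j \<in> carrier A" "\<And>i. y i \<in> carrier A"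
  shows "(\<Oplus>k\<in>{..<m :: nat}. (\<Oplus>l\<in>{..<n :: nat}. c l \<odot> x l k) \<otimes> y k) =
    (\<Oplus>l\<in>{..<n}. c l \<odot> (\<Oplus>k\<in>{..<m}. x l k \<otimes> y k))"
proof -
  have "(\<Oplus>k\<in>{..<m}. (\<Oplus>l\<in>{..<n}. c l \<odot> x l k) \<otimes> y k) = (\<Oplus>k\<in>{..<m}. \<Oplus>l\<in>{..<n}. c l \<odot> (x l k \<otimes> y k))"
    using assms by (simp add: mult_finsum_right smult_mult_left)
  also have "\<dots> = (\<Oplus>l\<in>{..<n}. \<Oplus>k\<in>{..<m}. c l \<odot> (x l k \<otimes> y k))"
    using assms by (intro finsum_swap) auto
  also have "\<dots> = (\<Oplus>l\<in>{..<n}. c l \<odot> (\<Oplus>k\<in>{..<m}. x l k \<otimes> y k))"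
    using assms by (simp add: finsum_smult Pi_def)
  finally show ?thesis .
qed

lemma mprod_scalar_right:
  assumes "\<And>i. x i \<in> carrier A" "\<And>i j. y i j \<in> carrier A"
  shows "(\<Oplus>k\<in>{..<m :: nat}. x k \<otimes> (\<Oplus>l\<in>{..<n :: nat}. c l \<odot> y k l)) =
    (\<Oplus>l\<in>{..<n}. c l \<odot> (\<Oplus>k\<in>{..<m}. x k \<otimes> y k l))"
proof -
  have "(\<Oplus>k\<in>{..<m}. x k \<otimes> (\<Oplus>l\<in>{..<n}. c l \<odot> y k l)) = (\<Oplus>k\<in>{..<m}. \<Oplus>l\<in>{..<n}. c l \<odot> (x k \<otimes> y k l))"
    using assms by (simp add: mult_finsum_left smult_mult_right)
  also have "\<dots> = (\<Oplus>l\<in>{..<n}. \<Oplus>k\<in>{..<m}. c l \<odot> (x k \<otimes> y k l))"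
    using assms by (intro finsum_swap) auto
  also have "\<dots> = (\<Oplus>l\<in>{..<n}. c l \<odot> (\<Oplus>k\<in>{..<m}. x k \<otimes> y k l))"
    using assms by (simp add: finsum_smult Pi_def)
  finally show ?thesis .
qed

lemma bilinear_form_left:
  assumes "\<And>i. x i \<in> carrier A" "\<And>i. y i \<in> carrier A"
  shows "(\<Oplus>q\<in>{..<m :: nat}. \<Oplus>r\<in>{..<n :: nat}. c q r \<odot> (x q \<otimes> y r)) =
    (\<Oplus>q\<in>{..<m}. x q \<otimes> (\<Oplus>r\<in>{..<n}. c q r \<odot> y r))"
  using assms by (simp add: mult_finsum_left smult_mult_right)

lemma bilinear_form_right:
  assumes "\<And>i. x i \<in> carrier A" "\<And>i. y i \<in> carrier A"
  shows "(\<Oplus>q\<in>{..<m :: nat}. \<Oplus>r\<in>{..<n :: nat}. c q r \<odot> (x q \<otimes> y r)) =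
    (\<Oplus>r\<in>{..<n}. (\<Oplus>q\<in>{..<m}. c q r \<odot> x q) \<otimes> y r)"
proof -
  have "(\<Oplus>q\<in>{..<m}. \<Oplus>r\<in>{..<n}. c q r \<odot> (x q \<otimes> y r)) = (\<Oplus>r\<in>{..<n}. \<Oplus>q\<in>{..<m}. c q r \<odot> (x q \<otimes> y r))"
    using assms by (intro finsum_swap) auto
  then show ?thesis using assms by (simp add: mult_finsum_right smult_mult_left)
qed

lemma scalar_delta:
  assumes "i < (n :: nat)"
  shows "(\<Oplus>l\<in>{..<n}. c l \<odot> ((if i = l then 1 else 0) \<odot> \<one>)) = c i \<odot> \<one>"
    and "(\<Oplus>l\<in>{..<n}. c l \<odot> ((if l = i then 1 else 0) \<odot> \<one>)) = c i \<odot> \<one>"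
proof -
  have "(\<Oplus>l\<in>{..<n}. c l \<odot> ((if i = l then 1 else 0) \<odot> \<one>)) = (\<Oplus>l\<in>{..<n}. (if i = l then 1 else 0) \<odot> (c l \<odot> \<one>))"
    by (intro finsum_cong') auto
  then show "(\<Oplus>l\<in>{..<n}. c l \<odot> ((if i = l then 1 else 0) \<odot> \<one>)) = c i \<odot> \<one>"
    using assms by (simp add: finsum_delta(1))
  moreover have "(\<lambda>l. c l \<odot> ((if l = i then 1 else 0) \<odot> \<one>)) = (\<lambda>l. c l \<odot> ((if i = l then 1 else 0) \<odot> \<one>))"
    by auto
  ultimately show "(\<Oplus>l\<in>{..<n}. c l \<odot> ((if l = i then 1 else 0) \<odot> \<one>)) = c i \<odot> \<one>" by simp
qed

end

text \<open>In matrix notation \<open>y e' = f' z\<^sup>t\<close>, so \<open>y = f' z\<^sup>t e\<close>.\<close>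

locale inverse_pair = k_alg A
  for A :: "('k::comm_ring_1, 'a, 'x) module_scheme" (structure) +
  fixes n m :: nat and e e' f f' :: "nat \<Rightarrow> nat \<Rightarrow> 'k" and z y :: "nat \<Rightarrow> nat \<Rightarrow> 'a"
  assumes z [simp]: "\<And>i j. z i j \<in> carrier A" and y [simp]: "\<And>i j. y i j \<in> carrier A"
    and zy: "\<And>i l. i < n \<Longrightarrow> l < n \<Longrightarrow> (\<Oplus>j\<in>{..<m}. z i j \<otimes> y j l) = (if i = l then 1 else 0) \<odot> \<one>"
    and yz: "\<And>i l. i < m \<Longrightarrow> l < m \<Longrightarrow> (\<Oplus>j\<in>{..<n}. y i j \<otimes> z j l) = (if i = l then 1 else 0) \<odot> \<one>"
    and form: "form_rel n m e f z"
    and ye: "\<And>j p. j < m \<Longrightarrow> p < n \<Longrightarrow> (\<Oplus>k\<in>{..<n}. e' k p \<odot> y j k) = (\<Oplus>q\<in>{..<m}. f' j q \<odot> z p q)"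
    and ee': "\<And>i j. i < n \<Longrightarrow> j < n \<Longrightarrow> (\<Sum>l<n. e i l * e' l j) = (if i = j then 1 else 0)"
    and e'e: "\<And>i j. i < n \<Longrightarrow> j < n \<Longrightarrow> (\<Sum>l<n. e' i l * e l j) = (if i = j then 1 else 0)"
    and unit_inj: "\<And>c d. c \<odot> \<one> = d \<odot> \<one> \<Longrightarrow> c = d"
begin

lemma y_eq:
  assumes "j < m" "l < n"
  shows "y j l = (\<Oplus>p\<in>{..<n}. e p l \<odot> (\<Oplus>q\<in>{..<m}. f' j q \<odot> z p q))"
  by (rule scalar_matrix_cancel[where C = "\<lambda>p k. e' k p" and D = "\<lambda>l p. e p l" and x = "y j"])
    (use assms ye e'e in \<open>auto simp: mult.commute[of "e _ _"]\<close>)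

text \<open>\<open>1 = y z = f' z\<^sup>t e z = f' f\<close>, first as an identity between multiples
  of the unit of the algebra, then between scalars because the unit map is injective.\<close>

lemma f'f:
  assumes "j < m" "r < m"
  shows "(\<Sum>q<m. f' j q * f q r) = (if j = r then 1 else 0)"
proof (rule unit_inj)
  let ?x = "\<lambda>p. \<Oplus>q\<in>{..<m}. f' j q \<odot> z p q"
  have x: "?x p \<in> carrier A" for p by (intro finsum_closed) auto
  have "(if j = r then 1 else 0) \<odot> \<one> = (\<Oplus>l\<in>{..<n}. y j l \<otimes> z l r)" using yz assms by simp
  also have "\<dots> = (\<Oplus>l\<in>{..<n}. (\<Oplus>p\<in>{..<n}. e p l \<odot> ?x p) \<otimes> z l r)"
    using assms x by (intro finsum_cong') (auto simp: y_eq intro!: finsum_closed)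
  also have "\<dots> = (\<Oplus>p\<in>{..<n}. \<Oplus>l\<in>{..<n}. e p l \<odot> (?x p \<otimes> z l r))"
    by (rule bilinear_form_right[symmetric]) (use x in auto)
  also have "\<dots> = (\<Oplus>p\<in>{..<n}. ?x p \<otimes> (\<Oplus>l\<in>{..<n}. e p l \<odot> z l r))"
    by (rule bilinear_form_left) (use x in auto)
  also have "\<dots> = (\<Oplus>q\<in>{..<m}. f' j q \<odot> (\<Oplus>p\<in>{..<n}. z p q \<otimes> (\<Oplus>l\<in>{..<n}. e p l \<odot> z l r)))"
    by (rule mprod_scalar_left) (auto intro!: finsum_closed)
  also have "\<dots> = (\<Oplus>q\<in>{..<m}. f' j q \<odot> (f q r \<odot> \<one>))"
    using form assms by (intro finsum_cong') (auto simp: form_rel_def simp flip: bilinear_form_left)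
  also have "\<dots> = (\<Sum>q<m. f' j q * f q r) \<odot> \<one>" by (simp add: smult_sum_left smult_smult)
  finally show "(\<Sum>q<m. f' j q * f q r) \<odot> \<one> = (if j = r then 1 else 0) \<odot> \<one>" ..
qed

lemma ff': "i < m \<Longrightarrow> j < m \<Longrightarrow> (\<Sum>l<m. f i l * f' l j) = (if i = j then 1 else 0)"
  by (rule sum_left_inverse_right) (rule f'f)

text \<open>\<open>z f' z\<^sup>t = z y e' = e'\<close>, by \<open>f' z\<^sup>t = y e'\<close> and
  \<open>z y = 1\<close>.\<close>

lemma form_transpose: "form_rel m n f' e' (\<lambda>i j. z j i)"
  unfolding form_rel_def
proof (intro allI impI)
  fix i j assume ij: "i < n" "j < n"
  have "(\<Oplus>q\<in>{..<m}. \<Oplus>r\<in>{..<m}. f' q r \<odot> (z i q \<otimes> z j r)) =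
      (\<Oplus>q\<in>{..<m}. z i q \<otimes> (\<Oplus>r\<in>{..<m}. f' q r \<odot> z j r))"
    by (rule bilinear_form_left) auto
  also have "\<dots> = (\<Oplus>q\<in>{..<m}. z i q \<otimes> (\<Oplus>k\<in>{..<n}. e' k j \<odot> y q k))"
    using ij by (intro finsum_cong') (auto simp: ye intro!: finsum_closed)
  also have "\<dots> = (\<Oplus>k\<in>{..<n}. e' k j \<odot> (\<Oplus>q\<in>{..<m}. z i q \<otimes> y q k))"
    by (rule mprod_scalar_right) auto
  also have "\<dots> = (\<Oplus>k\<in>{..<n}. e' k j \<odot> ((if i = k then 1 else 0) \<odot> \<one>))"
    using ij by (intro finsum_cong') (auto simp: zy)
  also have "\<dots> = e' i j \<odot> \<one>" by (rule scalar_delta[OF ij(1)])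
  finally show "(\<Oplus>q\<in>{..<m}. \<Oplus>r\<in>{..<m}. f' q r \<odot> (z i q \<otimes> z j r)) = e' i j \<odot> \<one>" .
qed

text \<open>Both sides are the traces of the statement, written out in entries. They equal the sum
  of \<open>f'_jr e_qs z_qj z_sr\<close> over all four indices: summing over \<open>q, s\<close>
  first produces \<open>f\<close> by \<open>form\<close>, summing over \<open>j, r\<close> first
  produces \<open>e'\<close> by \<open>form_transpose\<close>.\<close>

lemma trace_eq: "(\<Sum>j<m. \<Sum>r<m. f' j r * f j r) = (\<Sum>q<n. \<Sum>s<n. e' q s * e q s)"
proof (rule unit_inj)
  let ?t = "\<lambda>j r q s. (f' j r * e q s) \<odot> (z q j \<otimes> z s r)"
  have "(\<Sum>j<m. \<Sum>r<m. f' j r * f j r) \<odot> \<one> = (\<Oplus>j\<in>{..<m}. \<Oplus>r\<in>{..<m}. f' j r \<odot> (f j r \<odot> \<one>))"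
    by (simp add: smult_sum_left smult_smult)
  also have "\<dots> = (\<Oplus>j\<in>{..<m}. \<Oplus>r\<in>{..<m}. \<Oplus>q\<in>{..<n}. \<Oplus>s\<in>{..<n}. ?t j r q s)"
  proof (intro finsum_cong')
    fix j r assume jr: "j \<in> {..<m}" "r \<in> {..<m}"
    then have "f j r \<odot> \<one> = (\<Oplus>q\<in>{..<n}. \<Oplus>s\<in>{..<n}. e q s \<odot> (z q j \<otimes> z s r))"
      using form by (simp add: form_rel_def)
    then show "f' j r \<odot> (f j r \<odot> \<one>) = (\<Oplus>q\<in>{..<n}. \<Oplus>s\<in>{..<n}. ?t j r q s)"
      by (simp add: finsum_smult smult_smult Pi_def finsum_closed)
  qed (auto intro!: finsum_closed)
  also have "\<dots> = (\<Oplus>j\<in>{..<m}. \<Oplus>q\<in>{..<n}. \<Oplus>r\<in>{..<m}. \<Oplus>s\<in>{..<n}. ?t j r q s)"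
    by (intro finsum_cong' finsum_swap) (auto intro!: finsum_closed)
  also have "\<dots> = (\<Oplus>q\<in>{..<n}. \<Oplus>j\<in>{..<m}. \<Oplus>r\<in>{..<m}. \<Oplus>s\<in>{..<n}. ?t j r q s)"
    by (intro finsum_swap) (auto intro!: finsum_closed)
  also have "\<dots> = (\<Oplus>q\<in>{..<n}. \<Oplus>j\<in>{..<m}. \<Oplus>s\<in>{..<n}. \<Oplus>r\<in>{..<m}. ?t j r q s)"
    by (intro finsum_cong' finsum_swap) (auto intro!: finsum_closed)
  also have "\<dots> = (\<Oplus>q\<in>{..<n}. \<Oplus>s\<in>{..<n}. \<Oplus>j\<in>{..<m}. \<Oplus>r\<in>{..<m}. ?t j r q s)"
    by (intro finsum_cong' finsum_swap) (auto intro!: finsum_closed)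
  also have "\<dots> = (\<Oplus>q\<in>{..<n}. \<Oplus>s\<in>{..<n}. e q s \<odot> (e' q s \<odot> \<one>))"
  proof (intro finsum_cong')
    fix q s assume qs: "q \<in> {..<n}" "s \<in> {..<n}"
    then have "e' q s \<odot> \<one> = (\<Oplus>j\<in>{..<m}. \<Oplus>r\<in>{..<m}. f' j r \<odot> (z q j \<otimes> z s r))"
      using form_transpose by (simp add: form_rel_def)
    then show "(\<Oplus>j\<in>{..<m}. \<Oplus>r\<in>{..<m}. ?t j r q s) = e q s \<odot> (e' q s \<odot> \<one>)"
      by (simp add: finsum_smult smult_smult Pi_def finsum_closed mult.commute)
  qed (auto intro!: finsum_closed)
  also have "\<dots> = (\<Sum>q<n. \<Sum>s<n. e' q s * e q s) \<odot> \<one>"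
    by (simp add: smult_sum_left smult_smult mult.commute)
  finally show "(\<Sum>j<m. \<Sum>r<m. f' j r * f j r) \<odot> \<one> = (\<Sum>q<n. \<Sum>s<n. e' q s * e q s) \<odot> \<one>" .
qed

text \<open>In matrix notation \<open>z\<^sup>t e = f y\<close>, which is
  \<open>y = f' z\<^sup>t e\<close> with \<open>f'\<close> cancelled.\<close>

lemma fy:
  assumes "q < m" "j < n"
  shows "(\<Oplus>p\<in>{..<n}. e p j \<odot> z p q) = (\<Oplus>r\<in>{..<m}. f q r \<odot> y r j)"
proof (rule scalar_matrix_cancel[where C = f' and D = f and x = "\<lambda>q. \<Oplus>p\<in>{..<n}. e p j \<odot> z p q"])
  show "(\<Oplus>q\<in>{..<m}. f' r q \<odot> (\<Oplus>p\<in>{..<n}. e p j \<odot> z p q)) = y r j" if "r < m" for r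
    unfolding y_eq[OF that assms(2)] by (rule smult_finsum_swap) simp
qed (use assms ff' in \<open>auto intro!: finsum_closed\<close>)

text \<open>With the product reversed, the entries of \<open>f y\<close> come together on the left.
  Replacing \<open>f y\<close> by \<open>z\<^sup>t e\<close> brings \<open>z\<close> next to
  \<open>y\<close>, and \<open>z y = 1\<close> leaves \<open>e\<close>.\<close>

lemma op_form: "k_alg.form_rel (op_alg A) m n f e y"
proof -
  interpret O: k_alg "op_alg A" by (rule op_k_alg) unfold_locales
  show ?thesis
    unfolding O.form_rel_def op_finsum op_alg_simps
  proof (intro allI impI)
    fix i j assume ij: "i < n" "j < n"
    have "(\<Oplus>q\<in>{..<m}. \<Oplus>r\<in>{..<m}. f q r \<odot> (y r j \<otimes> y q i)) =
        (\<Oplus>q\<in>{..<m}. (\<Oplus>r\<in>{..<m}. f q r \<odot> y r j) \<otimes> y q i)"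
      by (simp add: mult_finsum_right smult_mult_left)
    also have "\<dots> = (\<Oplus>q\<in>{..<m}. (\<Oplus>p\<in>{..<n}. e p j \<odot> z p q) \<otimes> y q i)"
      using ij by (intro finsum_cong') (auto simp: fy intro!: finsum_closed)
    also have "\<dots> = (\<Oplus>p\<in>{..<n}. e p j \<odot> (\<Oplus>q\<in>{..<m}. z p q \<otimes> y q i))"
      by (rule mprod_scalar_left) auto
    also have "\<dots> = (\<Oplus>p\<in>{..<n}. e p j \<odot> ((if p = i then 1 else 0) \<odot> \<one>))"
      using ij by (intro finsum_cong') (auto simp: zy)
    also have "\<dots> = e i j \<odot> \<one>" by (rule scalar_delta(2)[OF ij(1)])
    finally show "(\<Oplus>q\<in>{..<m}. \<Oplus>r\<in>{..<m}. f q r \<odot> (y r j \<otimes> y q i)) = e i j \<odot> \<one>" .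
  qed
qed

text \<open>Now \<open>y e'\<close> comes together on the right; it is replaced by
  \<open>f' z\<^sup>t\<close>, and \<open>y z = 1\<close> leaves \<open>f'\<close>.\<close>

lemma op_form_transpose: "k_alg.form_rel (op_alg A) n m e' f' (\<lambda>i j. y j i)"
proof -
  interpret O: k_alg "op_alg A" by (rule op_k_alg) unfold_locales
  show ?thesis
    unfolding O.form_rel_def op_finsum op_alg_simps
  proof (intro allI impI)
    fix i j assume ij: "i < m" "j < m"
    have "(\<Oplus>q\<in>{..<n}. \<Oplus>r\<in>{..<n}. e' q r \<odot> (y j r \<otimes> y i q)) =
        (\<Oplus>r\<in>{..<n}. \<Oplus>q\<in>{..<n}. e' q r \<odot> (y j r \<otimes> y i q))"
      by (intro finsum_swap) auto
    also have "\<dots> = (\<Oplus>r\<in>{..<n}. y j r \<otimes> (\<Oplus>q\<in>{..<n}. e' q r \<odot> y i q))"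
      by (rule bilinear_form_left) auto
    also have "\<dots> = (\<Oplus>r\<in>{..<n}. y j r \<otimes> (\<Oplus>s\<in>{..<m}. f' i s \<odot> z r s))"
      using ij by (intro finsum_cong') (auto simp: ye intro!: finsum_closed)
    also have "\<dots> = (\<Oplus>s\<in>{..<m}. f' i s \<odot> (\<Oplus>r\<in>{..<n}. y j r \<otimes> z r s))"
      by (rule mprod_scalar_right) auto
    also have "\<dots> = (\<Oplus>s\<in>{..<m}. f' i s \<odot> ((if j = s then 1 else 0) \<odot> \<one>))"
      using ij by (intro finsum_cong') (auto simp: yz)
    also have "\<dots> = f' i j \<odot> \<one>" by (rule scalar_delta[OF ij(2)])
    finally show "(\<Oplus>q\<in>{..<n}. \<Oplus>r\<in>{..<n}. e' q r \<odot> (y j r \<otimes> y i q)) = f' i j \<odot> \<one>" .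
  qed
qed

end

text \<open>The tuple becomes one finitely supported function: \<open>r\<close> represents an entry
  on pairs, and the pair \<open>(x, y)\<close> in coordinate \<open>i\<close> is written as a list
  of length \<open>i + 2\<close>. The length records the coordinate, so different coordinates have
  disjoint supports.\<close>

lemma inj_on_power_embed:
  fixes r :: "'u \<Rightarrow> ('z \<times> 'z \<Rightarrow>\<^sub>0 'k::comm_ring_1)"
  assumes "k_module M" "inj_on r (carrier M)"
  shows "inj_on (\<lambda>c. {\<Sum>i<n. map_keys (\<lambda>(x, y). x # y # replicate i undefined) (r (c i))} :: ('z list \<Rightarrow>\<^sub>0 'k) set)
    (carrier (power_module n M))"
proof (rule inj_onI)
  interpret M: k_module M by fact
  let ?code = "\<lambda>i (x, y). x # y # replicate i (undefined :: 'z)"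
  fix c d assume c: "c \<in> carrier (power_module n M)" and d: "d \<in> carrier (power_module n M)"
    and eq: "{\<Sum>i<n. map_keys (?code i) (r (c i))} = {\<Sum>i<n. map_keys (?code i) (r (d i))}"
  have inj: "inj (?code i)" for i by (rule injI) auto
  have lookup: "Poly_Mapping.lookup (\<Sum>i<n. map_keys (?code i) (r (c i))) (?code j k) =
      Poly_Mapping.lookup (r (c j)) k" if "j < n" for c j k
  proof -
    have "Poly_Mapping.lookup (map_keys (?code i) (r (c i))) (?code j k) =
        (if i = j then Poly_Mapping.lookup (r (c j)) k else 0)" for i
    proof (cases "i = j")
      case True
      then show ?thesis by (simp add: lookup_map_keys[OF inj])
    next
      case False
      then have "?code j k \<notin> range (?code i)"
        by (auto split: prod.splits)
      then show ?thesis using False by (subst lookup_map_keys_notin) simp_all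
    qed
    then show ?thesis using that by (simp add: lookup_sum)
  qed
  have "r (c j) = r (d j)" if "j < n" for j
    by (rule poly_mapping_eqI) (use lookup[OF that, of c] lookup[OF that, of d] eq in simp)
  then have "c j = d j" if "j < n" for j
    using that c d by (intro inj_onD[OF assms(2)]) (auto simp: M.power_carrier)
  then show "c = d"
    using c d by (auto simp: M.power_carrier fun_eq_iff) (metis linorder_not_less)
qed

text \<open>A tuple over the type of \<open>Z\<close> is itself a word of the reference type. The
  condition \<open>1 \<noteq> 0\<close> ensures that the monomial at this word remembers it.\<close>

lemma inj_on_power_embed_self:
  fixes M :: "('k::comm_ring_1, 'z, 'm) module_scheme"
  assumes "k_module M" "(1 :: 'k) \<noteq> 0"
  shows "inj_on (\<lambda>f. {Poly_Mapping.single (map f [0..<n]) 1} :: ('z list \<Rightarrow>\<^sub>0 'k) set)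
    (carrier (power_module n M))"
proof (rule inj_onI)
  interpret M: k_module M by fact
  fix f g assume f: "f \<in> carrier (power_module n M)" and g: "g \<in> carrier (power_module n M)"
    and eq: "{Poly_Mapping.single (map f [0..<n]) 1} = {Poly_Mapping.single (map g [0..<n]) (1 :: 'k)}"
  have "Poly_Mapping.keys (Poly_Mapping.single (map f [0..<n]) (1 :: 'k)) =
      Poly_Mapping.keys (Poly_Mapping.single (map g [0..<n]) (1 :: 'k))"
    using eq by simp
  then have "map f [0..<n] = map g [0..<n]" using assms(2) by simp
  then have "f i = g i" if "i < n" for i using that by auto
  then show "f = g"
    using f g by (auto simp: M.power_carrier fun_eq_iff) (metis linorder_not_less)
qed

section \<open>Tensoring differences and sums of maps, and a cyclic permutation of factors\<close>

lemma hom_diff: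
  assumes "k_module N" "f \<in> module_hom class_ring M N" "g \<in> module_hom class_ring M N"
  shows "(\<lambda>x. f x \<ominus>\<^bsub>N\<^esub> g x) \<in> module_hom class_ring M N"
proof -
  interpret N: k_module N by fact
  show ?thesis
    by (rule module_homI)
      (simp_all add: hom_closed[OF assms(2)] hom_closed[OF assms(3)] hom_add[OF assms(2)]
        hom_add[OF assms(3)] hom_smult[OF assms(2)] hom_smult[OF assms(3)] a_minus_def
        N.minus_add N.a_ac N.smult_add_right N.smult_uminus)
qed

lemma tensor_map_diff:
  assumes "k_module Z" "k_module M" "k_module N"
    and f: "f \<in> module_hom class_ring M N" and g: "g \<in> module_hom class_ring M N"
    and t: "t \<in> carrier (tensor Z M)"
  shows "tensor_map Z N (\<lambda>z. z) (\<lambda>x. f x \<ominus>\<^bsub>N\<^esub> g x) t =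
    tensor_map Z N (\<lambda>z. z) f t \<ominus>\<^bsub>tensor Z N\<^esub> tensor_map Z N (\<lambda>z. z) g t"
proof -
  interpret N: k_module N by fact
  interpret ZN: two_modules Z N using assms by (intro two_modulesI)
  note m = tensor_map_hom[OF assms(1,2,1,3) hom_id]
  note p = tensor_map_pure[OF assms(1,2,1,3) hom_id]
  show ?thesis
    by (rule tensor_hom_ext[OF assms(1,2) m[OF hom_diff[OF assms(3) f g]]
          hom_diff[OF ZN.tensor_module m[OF f] m[OF g]] _ t])
      (simp add: p f g hom_diff[OF assms(3) f g]
        hom_minus[OF assms(3) ZN.tensor_module ZN.pure_hom_right] hom_closed[OF f] hom_closed[OF g])
qed

lemma tensor_map_sum:
  assumes "k_module Z" "k_module M" "k_module N" "finite S"
    and f: "\<And>i. i \<in> S \<Longrightarrow> f i \<in> module_hom class_ring M N"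
    and t: "t \<in> carrier (tensor Z M)"
  shows "tensor_map Z N (\<lambda>z. z) (\<lambda>x. \<Oplus>\<^bsub>N\<^esub>i\<in>S. f i x) t =
    (\<Oplus>\<^bsub>tensor Z N\<^esub>i\<in>S. tensor_map Z N (\<lambda>z. z) (f i) t)"
proof -
  interpret N: k_module N by fact
  interpret ZN: two_modules Z N using assms by (intro two_modulesI)
  note m = tensor_map_hom[OF assms(1,2,1,3) hom_id]
  note p = tensor_map_pure[OF assms(1,2,1,3) hom_id]
  have s: "(\<lambda>x. \<Oplus>\<^bsub>N\<^esub>i\<in>S. f i x) \<in> module_hom class_ring M N"
    by (rule hom_sum[OF assms(3,4) f])
  have s': "(\<lambda>t. \<Oplus>\<^bsub>tensor Z N\<^esub>i\<in>S. tensor_map Z N (\<lambda>z. z) (f i) t) \<in>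
      module_hom class_ring (tensor Z M) (tensor Z N)"
    by (rule hom_sum[OF ZN.tensor_module assms(4) m[OF f]])
  show ?thesis
  proof (rule tensor_hom_ext[OF assms(1,2) m[OF s] s' _ t])
    fix x y assume xy: "x \<in> carrier Z" "y \<in> carrier M"
    have "tensor_map Z N (\<lambda>z. z) (\<lambda>x. \<Oplus>\<^bsub>N\<^esub>i\<in>S. f i x) (pure_tensor Z M x y) =
        pure_tensor Z N x (\<Oplus>\<^bsub>N\<^esub>i\<in>S. f i y)"
      using xy by (simp add: p s)
    also have "\<dots> = (\<Oplus>\<^bsub>tensor Z N\<^esub>i\<in>S. pure_tensor Z N x (f i y))"
      by (rule hom_finsum[OF assms(3) ZN.tensor_module ZN.pure_hom_right[OF xy(1)] assms(4)])
        (rule hom_closed[OF f xy(2)])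
    also have "\<dots> = (\<Oplus>\<^bsub>tensor Z N\<^esub>i\<in>S. tensor_map Z N (\<lambda>z. z) (f i) (pure_tensor Z M x y))"
      using xy hom_closed[OF f] by (intro ZN.T.finsum_cong') (auto simp: p f)
    finally show "tensor_map Z N (\<lambda>z. z) (\<lambda>x. \<Oplus>\<^bsub>N\<^esub>i\<in>S. f i x) (pure_tensor Z M x y) =
        (\<Oplus>\<^bsub>tensor Z N\<^esub>i\<in>S. tensor_map Z N (\<lambda>z. z) (f i) (pure_tensor Z M x y))" .
  qed
qed

text \<open>The map \<open>x \<otimes> (y \<otimes> z) \<mapsto> z \<otimes> (x \<otimes>
  y)\<close>. It inverts a flip followed by the associativity isomorphism, and serves to write down
  the inverse of \<open>Theta\<close>.\<close>

definition tensor_rot ::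
  "('k::comm_ring_1, 'a, 'l) module_scheme \<Rightarrow> ('k, 'b, 'm) module_scheme \<Rightarrow>
   ('k, 'c, 'n) module_scheme \<Rightarrow>
   ('a \<times> ('b \<times> 'c \<Rightarrow>\<^sub>0 'k) set \<Rightarrow>\<^sub>0 'k) set \<Rightarrow> ('c \<times> ('a \<times> 'b \<Rightarrow>\<^sub>0 'k) set \<Rightarrow>\<^sub>0 'k) set" where
  "tensor_rot L M N = tensor_lift (tensor N (tensor L M))
    (\<lambda>x t. tensor_map N (tensor L M) (\<lambda>z. z) (pure_tensor L M x) (tensor_swap M N t))"

lemma tensor_rot:
  assumes L: "k_module L" and M: "k_module M" and N: "k_module N"
  shows tensor_rot_hom:
      "tensor_rot L M N \<in> module_hom class_ring (tensor L (tensor M N)) (tensor N (tensor L M))"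
    and tensor_rot_pure: "\<And>x y z. x \<in> carrier L \<Longrightarrow> y \<in> carrier M \<Longrightarrow> z \<in> carrier N \<Longrightarrow>
      tensor_rot L M N (pure_tensor L (tensor M N) x (pure_tensor M N y z)) =
        pure_tensor N (tensor L M) z (pure_tensor L M x y)"
proof -
  interpret LM: two_modules L M using L M by (rule two_modulesI)
  interpret MN: two_modules M N using M N by (rule two_modulesI)
  interpret S: two_modules N "tensor L M" using N LM.tensor_module by (rule two_modulesI)
  interpret T: two_modules L "tensor M N" using L MN.tensor_module by (rule two_modulesI)
  let ?b = "\<lambda>x t. tensor_map N (tensor L M) (\<lambda>z. z) (pure_tensor L M x) (tensor_swap M N t)"
  have p: "?b x (pure_tensor M N y z) = pure_tensor N (tensor L M) z (pure_tensor L M x y)"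
    if "x \<in> carrier L" "y \<in> carrier M" "z \<in> carrier N" for x y z
    using that by (simp add: tensor_swap_pure[OF M N]
        tensor_map_pure[OF N M N LM.tensor_module hom_id LM.pure_hom_right])
  have h: "?b x \<in> module_hom class_ring (tensor M N) (tensor N (tensor L M))" if "x \<in> carrier L" for x
    using hom_compose[OF tensor_swap_hom[OF M N]
        tensor_map_hom[OF N M N LM.tensor_module hom_id LM.pure_hom_right[OF that]]] .
  have b: "bilinear L (tensor M N) (tensor N (tensor L M)) ?b"
  proof (rule bilinearI[OF h])
    fix t assume t: "t \<in> carrier (tensor M N)"
    show "(\<lambda>x. ?b x t) \<in> module_hom class_ring L (tensor N (tensor L M))"
    proof (rule module_homI)
      fix x y assume xy: "x \<in> carrier L" "y \<in> carrier L"
      show "?b (x \<oplus>\<^bsub>L\<^esub> y) t = ?b x t \<oplus>\<^bsub>tensor N (tensor L M)\<^esub> ?b y t"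
        by (rule MN.tensor_hom_eq[OF h hom_plus[OF S.tensor_module h h] _ t])
          (simp_all add: xy p LM.pure_add_left S.pure_add_right)
    next
      fix c x assume x: "x \<in> carrier L"
      show "?b (c \<odot>\<^bsub>L\<^esub> x) t = c \<odot>\<^bsub>tensor N (tensor L M)\<^esub> ?b x t"
        by (rule MN.tensor_hom_eq[OF h hom_scale[OF S.tensor_module h] _ t])
          (simp_all add: x p LM.pure_smult_left S.pure_smult_right)
    qed (rule hom_closed[OF h t])
  qed
  show "tensor_rot L M N \<in> module_hom class_ring (tensor L (tensor M N)) (tensor N (tensor L M))"
    unfolding tensor_rot_def by (rule T.tensor_lift_hom[OF S.tensor_module b])
  show "tensor_rot L M N (pure_tensor L (tensor M N) x (pure_tensor M N y z)) =
        pure_tensor N (tensor L M) z (pure_tensor L M x y)"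
    if "x \<in> carrier L" "y \<in> carrier M" "z \<in> carrier N" for x y z
    unfolding tensor_rot_def using that by (simp add: T.tensor_lift_pure[OF S.tensor_module b] p)
qed

section \<open>Galois objects\<close>

text \<open>What the construction of \<open>W\<close> uses of \<open>B(E)\<close> and its Hopf
  structure: a matrix \<open>a\<close> on which comultiplication and counit are the usual matrix
  ones and which preserves an invertible form \<open>e\<close>. That the entries of \<open>a\<close>
  generate \<open>H\<close> is added only in \<open>comparison\<close>.\<close>

locale galois =
  fixes H :: "('k::comm_ring_1, 'h, 'x) hopf_scheme"
    and Z :: "('k, 'z, 'y) module_scheme"
    and \<delta> :: "'z \<Rightarrow> ('h \<times> 'z \<Rightarrow>\<^sub>0 'k) set"
    and n :: nat and e e' :: "nat \<Rightarrow> nat \<Rightarrow> 'k" and a :: "nat \<Rightarrow> nat \<Rightarrow> 'h"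
  assumes pid: "principal_domain (class_ring :: 'k ring)"
    and H_alg: "k_alg H"
    and a_closed [simp]: "\<And>i j. a i j \<in> carrier H"
    and a_rel: "k_alg.form_rel H n n e e a"
    and inverse: "\<And>i j. i < n \<Longrightarrow> j < n \<Longrightarrow> (\<Sum>l<n. e i l * e' l j) = (if i = j then 1 else 0)"
      "\<And>i j. i < n \<Longrightarrow> j < n \<Longrightarrow> (\<Sum>l<n. e' i l * e l j) = (if i = j then 1 else 0)"
    and comult_hom: "comult H \<in> module_hom class_ring H (tensor H H)"
    and comult_a: "\<And>i j. i < n \<Longrightarrow> j < n \<Longrightarrow>
      comult H (a i j) = (\<Oplus>\<^bsub>tensor H H\<^esub>l\<in>{..<n}. pure_tensor H H (a i l) (a l j))"
    and counit_hom: "counit H \<in> module_hom class_ring H base_algebra"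
    and counit_a: "\<And>i j. i < n \<Longrightarrow> j < n \<Longrightarrow> counit H (a i j) = (if i = j then 1 else 0)"
    and galois: "galois_object H Z \<delta>"
begin

lemma nontrivial: "(1 :: 'k) \<noteq> 0"
  by (rule pid_nontrivial[OF pid])

lemma Z_alg: "k_alg Z"
  using galois by (simp add: galois_object_def comodule_algebra_def k_alg_iff)

sublocale H: k_alg H by (rule H_alg)
sublocale Z: k_alg Z by (rule Z_alg)
sublocale HZ: two_algs H Z ..
sublocale ZZ: two_algs Z Z ..
sublocale HH: two_algs H H ..
sublocale HHZ: two_modules H "tensor H Z" ..
sublocale ZHZ: two_modules Z "tensor H Z" ..
sublocale HZZ: two_modules H "tensor Z Z" ..
sublocale Zn: k_module "power_module n Z" by (rule Z.k_module_power)
sublocale ZZn: two_modules Z "power_module n Z" ..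
sublocale HZn: k_module "power_module n (tensor H Z)" by (rule HZ.T.k_module_power)

abbreviation "HZ \<equiv> tensor H Z"
abbreviation "ZZ \<equiv> tensor Z Z"
abbreviation "Zn \<equiv> power_module n Z"
abbreviation "can \<equiv> canonical_map H Z \<delta>"

section \<open>The canonical map and its inverse\<close>

lemma ff: "faithfully_flat Z"
  using galois by (simp add: galois_object_def)

lemma coaction: "\<delta> \<in> alg_hom Z HZ"
  using galois by (simp add: galois_object_def comodule_algebra_def)

lemma coaction_hom: "\<delta> \<in> module_hom class_ring Z HZ"
  by (rule alg_hom_linear[OF coaction])

lemma coaction_closed [simp]: "z \<in> carrier Z \<Longrightarrow> \<delta> z \<in> carrier HZ"
  by (rule hom_closed[OF coaction_hom])

lemma coassoc:
  "z \<in> carrier Z \<Longrightarrow> tensor_assoc H H Z (tensor_map (tensor H H) Z (comult H) (\<lambda>x. x) (\<delta> z))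
                   = tensor_map H HZ (\<lambda>h. h) \<delta> (\<delta> z)"
  using galois by (simp add: galois_object_def comodule_algebra_def)

lemma can_bilinear: "bilinear Z Z HZ (\<lambda>z z'. \<delta> z \<otimes>\<^bsub>HZ\<^esub> pure_tensor H Z \<one>\<^bsub>H\<^esub> z')"
  by (rule bilinear_compose[OF HZ.TA.mult_bilinear coaction_hom HZ.pure_hom_right]) simp

lemma can_hom: "can \<in> module_hom class_ring ZZ HZ"
  unfolding canonical_map_def by (rule ZZ.tensor_lift_hom[OF HZ.tensor_module can_bilinear])

lemma can_pure: "x \<in> carrier Z \<Longrightarrow> y \<in> carrier Z \<Longrightarrow>
    can (pure_tensor Z Z x y) = \<delta> x \<otimes>\<^bsub>HZ\<^esub> pure_tensor H Z \<one>\<^bsub>H\<^esub> y"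
  unfolding canonical_map_def by (rule ZZ.tensor_lift_pure[OF HZ.tensor_module can_bilinear])

lemma can_bij: "bij_betw can (carrier ZZ) (carrier HZ)"
  using galois by (simp add: galois_object_def)

lemma can_inj: "s \<in> carrier ZZ \<Longrightarrow> t \<in> carrier ZZ \<Longrightarrow> can s = can t \<Longrightarrow> s = t"
  using can_bij by (meson bij_betw_def inj_onD)

definition "ican = inv_into (carrier ZZ) can"

lemma can_ican: "u \<in> carrier HZ \<Longrightarrow> can (ican u) = u"
  using can_bij by (simp add: ican_def bij_betw_def f_inv_into_f)

lemma ican_closed [simp]: "u \<in> carrier HZ \<Longrightarrow> ican u \<in> carrier ZZ"
  using can_bij by (metis ican_def bij_betw_def inv_into_into)

lemma ican_can: "t \<in> carrier ZZ \<Longrightarrow> ican (can t) = t"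
  using can_bij by (simp add: ican_def bij_betw_def)

lemma ican_hom: "ican \<in> module_hom class_ring HZ ZZ"
  by (rule module_homI, simp)
    (rule can_inj; simp add: can_ican hom_add[OF can_hom] hom_smult[OF can_hom])+

lemma right_mult_hom: "y \<in> carrier Z \<Longrightarrow>
    (\<lambda>u. u \<otimes>\<^bsub>HZ\<^esub> pure_tensor H Z \<one>\<^bsub>H\<^esub> y) \<in> module_hom class_ring HZ HZ"
  by (rule HZ.TA.mult_hom_right) simp

abbreviation "ZZ_right y \<equiv> tensor_map Z Z (\<lambda>z. z) (\<lambda>z. z \<otimes>\<^bsub>Z\<^esub> y)"

lemma ZZ_right_hom: "y \<in> carrier Z \<Longrightarrow> ZZ_right y \<in> module_hom class_ring ZZ ZZ"
  by (intro tensor_map_hom Z.k_module_axioms hom_id Z.mult_hom_right)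

text \<open>The canonical map is linear for right multiplication on the second factor. Hence its
  inverse is known on \<open>h \<otimes> y\<close> as soon as it is known on
  \<open>h \<otimes> 1\<close>.\<close>

lemma can_right:
  assumes "t \<in> carrier ZZ" "y \<in> carrier Z"
  shows "can (ZZ_right y t) = can t \<otimes>\<^bsub>HZ\<^esub> pure_tensor H Z \<one>\<^bsub>H\<^esub> y"
proof (rule ZZ.tensor_hom_eq[OF hom_compose[OF ZZ_right_hom[OF assms(2)] can_hom]
      hom_compose[OF can_hom right_mult_hom[OF assms(2)]] _ assms(1)])
  fix z z' assume z: "z \<in> carrier Z" "z' \<in> carrier Z"
  note zz = Z.k_module_axioms
  show "can (ZZ_right y (pure_tensor Z Z z z')) =
      can (pure_tensor Z Z z z') \<otimes>\<^bsub>HZ\<^esub> pure_tensor H Z \<one>\<^bsub>H\<^esub> y"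
    using z assms(2)
    by (simp add: tensor_map_pure[OF zz zz zz zz hom_id Z.mult_hom_right] can_pure
        HZ.TA.m_assoc HZ.pure_mult)
qed

text \<open>The translation map evaluated at the matrix coefficients.\<close>

definition "tau i l = ican (pure_tensor H Z (a i l) \<one>\<^bsub>Z\<^esub>)"

lemma tau_closed [simp]: "tau i l \<in> carrier ZZ"
  by (simp add: tau_def)

lemma can_tau: "can (tau i l) = pure_tensor H Z (a i l) \<one>\<^bsub>Z\<^esub>"
  by (simp add: tau_def can_ican)

abbreviation "mu \<equiv> tensor_lift Z (\<lambda>x y. x \<otimes>\<^bsub>Z\<^esub> y)"

lemma mu_hom: "mu \<in> module_hom class_ring ZZ Z"
  by (rule ZZ.tensor_lift_hom[OF Z.k_module_axioms Z.mult_bilinear])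

lemma mu_pure: "x \<in> carrier Z \<Longrightarrow> y \<in> carrier Z \<Longrightarrow> mu (pure_tensor Z Z x y) = x \<otimes>\<^bsub>Z\<^esub> y"
  by (rule ZZ.tensor_lift_pure[OF Z.k_module_axioms Z.mult_bilinear])

lemma smult_bilinear: "bilinear base_algebra Z Z (Module.smult Z)"
  by (rule bilinearI; rule module_homI)
    (simp_all add: Z.smult_add_left Z.smult_add_right Z.smult_smult mult.commute)

abbreviation "counit_map \<equiv> tensor_lift Z (\<lambda>h x. counit H h \<odot>\<^bsub>Z\<^esub> x)"

lemma counit_bilinear: "bilinear H Z Z (\<lambda>h x. counit H h \<odot>\<^bsub>Z\<^esub> x)"
  by (rule bilinear_compose[OF smult_bilinear counit_hom hom_id])

lemma counit_map_hom: "counit_map \<in> module_hom class_ring HZ Z"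
  by (rule HZ.tensor_lift_hom[OF Z.k_module_axioms counit_bilinear])

lemma counit_map_pure: "h \<in> carrier H \<Longrightarrow> x \<in> carrier Z \<Longrightarrow>
    counit_map (pure_tensor H Z h x) = counit H h \<odot>\<^bsub>Z\<^esub> x"
  by (rule HZ.tensor_lift_pure[OF Z.k_module_axioms counit_bilinear])

lemma counit_law: "z \<in> carrier Z \<Longrightarrow> counit_map (\<delta> z) = z"
  using galois by (simp add: galois_object_def comodule_algebra_def)

lemma counit_map_right:
  assumes "u \<in> carrier HZ" "y \<in> carrier Z"
  shows "counit_map (u \<otimes>\<^bsub>HZ\<^esub> pure_tensor H Z \<one>\<^bsub>H\<^esub> y) = counit_map u \<otimes>\<^bsub>Z\<^esub> y"
  by (rule HZ.tensor_hom_eq[OF hom_compose[OF right_mult_hom[OF assms(2)] counit_map_hom]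
      hom_compose[OF counit_map_hom Z.mult_hom_right[OF assms(2)]] _ assms(1)])
    (simp add: assms(2) HZ.pure_mult counit_map_pure Z.smult_mult_left)

text \<open>By the counit axiom, applying the counit to the factor \<open>H\<close> undoes the
  coaction inside \<open>can\<close>. For the translation map this means that multiplying its two
  components gives the counit.\<close>

lemma mu_counit:
  assumes "t \<in> carrier ZZ"
  shows "mu t = counit_map (can t)"
  by (rule ZZ.tensor_hom_eq[OF mu_hom hom_compose[OF can_hom counit_map_hom] _ assms])
    (simp add: mu_pure can_pure counit_map_right counit_law)

lemma mu_tau: "i < n \<Longrightarrow> l < n \<Longrightarrow> mu (tau i l) = (if i = l then 1 else 0) \<odot>\<^bsub>Z\<^esub> \<one>\<^bsub>Z\<^esub>"
  by (simp add: mu_counit can_tau counit_map_pure counit_a)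

subsection \<open>The comodule equation for the translation map\<close>

abbreviation "HHZ \<equiv> tensor H (tensor H Z)"

text \<open>The isomorphism \<open>y \<otimes> (h \<otimes> x) \<mapsto> h \<otimes> can (x
  \<otimes> y)\<close>. It moves the equation satisfied by the translation map into
  \<open>H \<otimes> H \<otimes> Z\<close>, where it is an instance of coassociativity.\<close>

abbreviation "Theta t \<equiv>
  tensor_map H HZ (\<lambda>h. h) can (tensor_assoc H Z Z (tensor_swap Z HZ t))"

lemma Theta_hom: "(\<lambda>t. Theta t) \<in> module_hom class_ring (tensor Z HZ) HHZ"
  by (intro hom_compose[OF hom_compose[OF tensor_swap_hom tensor_assoc_hom] tensor_map_hom]
      hom_id can_hom H.k_module_axioms Z.k_module_axioms HZ.T.k_module_axioms ZZ.T.k_module_axioms)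

lemma Theta_pure:
  assumes "y \<in> carrier Z" "h \<in> carrier H" "x \<in> carrier Z"
  shows "Theta (pure_tensor Z HZ y (pure_tensor H Z h x)) =
    pure_tensor H HZ h (can (pure_tensor Z Z x y))"
  using assms
  by (simp add: tensor_swap_pure[OF Z.k_module_axioms HZ.tensor_module]
      tensor_assoc_pure[OF H.k_module_axioms Z.k_module_axioms Z.k_module_axioms]
      tensor_map_pure[OF H.k_module_axioms ZZ.tensor_module H.k_module_axioms HZ.tensor_module hom_id can_hom])

text \<open>An explicit left inverse: apply the inverse canonical map to the last two factors, then
  rotate. It is verified on nested pure tensors, hence the two rounds of
  \<open>tensor_hom_eq\<close>.\<close>

lemma Theta_inj: "inj_on (\<lambda>t. Theta t) (carrier (tensor Z HZ))"
proof (rule inj_on_inverseI)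
  let ?Th' = "\<lambda>t. tensor_rot H Z Z (tensor_map H ZZ (\<lambda>h. h) ican t)"
  have h': "?Th' \<in> module_hom class_ring HHZ (tensor Z HZ)"
    by (intro hom_compose[OF tensor_map_hom tensor_rot_hom]
      hom_id ican_hom H.k_module_axioms Z.k_module_axioms HZ.T.k_module_axioms ZZ.T.k_module_axioms)
  note h = hom_compose[OF Theta_hom h']
  fix t assume t: "t \<in> carrier (tensor Z HZ)"
  show "?Th' (Theta t) = t"
  proof (rule ZHZ.tensor_hom_eq[OF h hom_id _ t])
    fix y u assume y: "y \<in> carrier Z" and u: "u \<in> carrier HZ"
    show "?Th' (Theta (pure_tensor Z HZ y u)) = pure_tensor Z HZ y u"
    proof (rule HZ.tensor_hom_eq[OF hom_compose[OF ZHZ.pure_hom_right[OF y] h]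
          ZHZ.pure_hom_right[OF y] _ u])
      fix k x assume kx: "k \<in> carrier H" "x \<in> carrier Z"
      show "?Th' (Theta (pure_tensor Z HZ y (pure_tensor H Z k x))) =
          pure_tensor Z HZ y (pure_tensor H Z k x)"
        using y kx hom_closed[OF can_hom]
        by (simp only: Theta_pure) (simp add: ican_can
          tensor_map_pure[OF H.k_module_axioms HZ.tensor_module H.k_module_axioms ZZ.tensor_module hom_id ican_hom]
          tensor_rot_pure[OF H.k_module_axioms Z.k_module_axioms Z.k_module_axioms])
    qed
  qed
qed

abbreviation "right3 y \<equiv> tensor_map H HZ (\<lambda>h. h) (\<lambda>u. u \<otimes>\<^bsub>HZ\<^esub> pure_tensor H Z \<one>\<^bsub>H\<^esub> y)"

lemma right3_hom: "y \<in> carrier Z \<Longrightarrow> right3 y \<in> module_hom class_ring HHZ HHZ"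
  by (intro tensor_map_hom H.k_module_axioms HZ.tensor_module hom_id right_mult_hom)

lemma Theta_right:
  assumes y: "y \<in> carrier Z" and u: "u \<in> carrier HZ"
  shows "Theta (pure_tensor Z HZ y u) = right3 y (tensor_map H HZ (\<lambda>h. h) \<delta> u)"
proof -
  note mods = H.k_module_axioms Z.k_module_axioms H.k_module_axioms HZ.tensor_module
  note mods' = H.k_module_axioms HZ.tensor_module H.k_module_axioms HZ.tensor_module
  show ?thesis
    by (rule HZ.tensor_hom_eq[OF hom_compose[OF ZHZ.pure_hom_right[OF y] Theta_hom]
        hom_compose[OF tensor_map_hom[OF mods hom_id coaction_hom] right3_hom[OF y]] _ u])
      (simp only: Theta_pure y tensor_map_pure[OF mods hom_id coaction_hom] can_pure
        tensor_map_pure[OF mods' hom_id right_mult_hom] coaction_closed)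
qed

abbreviation "Lam u \<equiv> tensor_assoc H H Z (tensor_map (tensor H H) Z (comult H) (\<lambda>x. x) u)"

lemma Lam_hom: "(\<lambda>u. Lam u) \<in> module_hom class_ring HZ HHZ"
  by (intro hom_compose[OF tensor_map_hom tensor_assoc_hom] comult_hom
      hom_id H.k_module_axioms Z.k_module_axioms HH.T.k_module_axioms)

lemma Lam_right:
  assumes y: "y \<in> carrier Z" and u: "u \<in> carrier HZ"
  shows "Lam (u \<otimes>\<^bsub>HZ\<^esub> pure_tensor H Z \<one>\<^bsub>H\<^esub> y) = right3 y (Lam u)"
proof (rule HZ.tensor_hom_eq[OF hom_compose[OF right_mult_hom[OF y] Lam_hom]
        hom_compose[OF Lam_hom right3_hom[OF y]] _ u])
  fix k x assume k: "k \<in> carrier H" and x: "x \<in> carrier Z"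
  interpret HHxZ: two_modules "tensor H H" Z ..
  note mods = H.k_module_axioms Z.k_module_axioms HH.tensor_module Z.k_module_axioms
  note mods' = H.k_module_axioms HZ.tensor_module H.k_module_axioms HZ.tensor_module
  note ah = tensor_assoc_hom[OF H.k_module_axioms H.k_module_axioms Z.k_module_axioms]
  note ap = tensor_assoc_pure[OF H.k_module_axioms H.k_module_axioms Z.k_module_axioms]
  have ck: "comult H k \<in> carrier (tensor H H)" using comult_hom k by (rule hom_closed)
  have "tensor_assoc H H Z (pure_tensor (tensor H H) Z d (x \<otimes>\<^bsub>Z\<^esub> y)) =
      right3 y (tensor_assoc H H Z (pure_tensor (tensor H H) Z d x))" if d: "d \<in> carrier (tensor H H)" for d
    by (rule HH.tensor_hom_eq[OF hom_compose[OF HHxZ.pure_hom_left ah]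
          hom_compose[OF hom_compose[OF HHxZ.pure_hom_left ah] right3_hom[OF y]] _ d])
      (use x y in \<open>simp_all add: ap tensor_map_pure[OF mods' hom_id right_mult_hom] HZ.pure_mult\<close>)
  then show "Lam (pure_tensor H Z k x \<otimes>\<^bsub>HZ\<^esub> pure_tensor H Z \<one>\<^bsub>H\<^esub> y) = right3 y (Lam (pure_tensor H Z k x))"
    using k x y ck by (simp add: HZ.pure_mult tensor_map_pure[OF mods comult_hom hom_id])
qed

text \<open>On \<open>x \<otimes> y\<close> the left side is
  \<open>(id \<otimes> \<delta>) (\<delta> x)\<close> multiplied by \<open>y\<close> in the last
  factor. Coassociativity turns this into the comultiplication applied to the first factor of
  \<open>\<delta> x (1 \<otimes> y) = can (x \<otimes> y)\<close>.\<close>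

lemma Theta_coaction:
  assumes t: "t \<in> carrier ZZ"
  shows "Theta (tensor_map Z HZ (\<lambda>z. z) \<delta> (tensor_swap Z Z t)) = Lam (can t)"
proof -
  note zz = Z.k_module_axioms Z.k_module_axioms
  note mods = zz Z.k_module_axioms HZ.tensor_module
  show ?thesis
    by (rule ZZ.tensor_hom_eq[OF hom_compose[OF hom_compose[OF tensor_swap_hom[OF zz]
            tensor_map_hom[OF mods hom_id coaction_hom]] Theta_hom] hom_compose[OF can_hom Lam_hom] _ t])
      (simp only: tensor_swap_pure[OF zz] tensor_map_pure[OF mods hom_id coaction_hom]
        Theta_right coaction_closed can_pure Lam_right coassoc)
qed

lemma Theta_scalar:
  assumes h: "h \<in> carrier H" and t: "t \<in> carrier ZZ"
  shows "Theta (tensor_map Z HZ (\<lambda>z. z) (pure_tensor H Z h) (tensor_swap Z Z t)) = pure_tensor H HZ h (can t)"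
proof -
  note zz = Z.k_module_axioms Z.k_module_axioms
  note mods = zz Z.k_module_axioms HZ.tensor_module
  show ?thesis
    by (rule ZZ.tensor_hom_eq[OF hom_compose[OF hom_compose[OF tensor_swap_hom[OF zz]
            tensor_map_hom[OF mods hom_id HZ.pure_hom_right[OF h]]] Theta_hom]
          hom_compose[OF can_hom HHZ.pure_hom_right[OF h]] _ t])
      (simp only: tensor_swap_pure[OF zz] tensor_map_pure[OF mods hom_id HZ.pure_hom_right[OF h]]
        Theta_pure h)
qed

text \<open>After the flip, the first components of the translation elements \<open>tau i l\<close>
  satisfy, for fixed \<open>l\<close>, the equation that defines \<open>W\<close>. Applying the
  injective map \<open>Theta\<close> reduces this to the comultiplication rule for
  \<open>a i l\<close>.\<close>

lemma tau_comodule: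
  assumes il: "i < n" "l < n"
  shows "tensor_map Z HZ (\<lambda>z. z) \<delta> (tensor_swap Z Z (tau i l)) =
    (\<Oplus>\<^bsub>tensor Z HZ\<^esub>p\<in>{..<n}. tensor_map Z HZ (\<lambda>z. z) (pure_tensor H Z (a i p)) (tensor_swap Z Z (tau p l)))"
proof (rule inj_onD[OF Theta_inj])
  note zz = Z.k_module_axioms Z.k_module_axioms
  note mods = zz Z.k_module_axioms HZ.tensor_module
  have c1: "tensor_map Z HZ (\<lambda>z. z) f (tensor_swap Z Z t) \<in> carrier (tensor Z HZ)"
    if "f \<in> module_hom class_ring Z HZ" "t \<in> carrier ZZ" for f t
    by (rule hom_closed[OF hom_compose[OF tensor_swap_hom[OF zz] tensor_map_hom[OF mods hom_id that(1)]] that(2)])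
  show "tensor_map Z HZ (\<lambda>z. z) \<delta> (tensor_swap Z Z (tau i l)) \<in> carrier (tensor Z HZ)"
    by (rule c1[OF coaction_hom tau_closed])
  have c2: "tensor_map Z HZ (\<lambda>z. z) (pure_tensor H Z (a i p)) (tensor_swap Z Z (tau p l)) \<in> carrier (tensor Z HZ)" for p
    by (rule c1[OF HZ.pure_hom_right[OF a_closed] tau_closed])
  then show "(\<Oplus>\<^bsub>tensor Z HZ\<^esub>p\<in>{..<n}. tensor_map Z HZ (\<lambda>z. z) (pure_tensor H Z (a i p)) (tensor_swap Z Z (tau p l)))
      \<in> carrier (tensor Z HZ)"
    by (intro ZHZ.T.finsum_closed) auto
  interpret HHxZ: two_modules "tensor H H" Z ..
  note ap = tensor_assoc_pure[OF H.k_module_axioms H.k_module_axioms Z.k_module_axioms]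
  note ah = tensor_assoc_hom[OF H.k_module_axioms H.k_module_axioms Z.k_module_axioms]
  have "Theta (tensor_map Z HZ (\<lambda>z. z) \<delta> (tensor_swap Z Z (tau i l))) =
      tensor_assoc H H Z (pure_tensor (tensor H H) Z (comult H (a i l)) \<one>\<^bsub>Z\<^esub>)"
    by (simp add: Theta_coaction can_tau
        tensor_map_pure[OF H.k_module_axioms Z.k_module_axioms HH.tensor_module Z.k_module_axioms comult_hom hom_id])
  also have "\<dots> = (\<Oplus>\<^bsub>HHZ\<^esub>p\<in>{..<n}. tensor_assoc H H Z (pure_tensor (tensor H H) Z (pure_tensor H H (a i p) (a p l)) \<one>\<^bsub>Z\<^esub>))"
    unfolding comult_a[OF il]
    by (rule hom_finsum[OF HH.tensor_module HHZ.tensor_module hom_compose[OF HHxZ.pure_hom_left ah]]) auto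
  also have "\<dots> = (\<Oplus>\<^bsub>HHZ\<^esub>p\<in>{..<n}. Theta (tensor_map Z HZ (\<lambda>z. z) (pure_tensor H Z (a i p)) (tensor_swap Z Z (tau p l))))"
    by (intro HHZ.T.finsum_cong') (auto simp: ap Theta_scalar can_tau)
  also have "\<dots> = Theta (\<Oplus>\<^bsub>tensor Z HZ\<^esub>p\<in>{..<n}. tensor_map Z HZ (\<lambda>z. z) (pure_tensor H Z (a i p)) (tensor_swap Z Z (tau p l)))"
    by (rule hom_finsum[OF ZHZ.tensor_module HHZ.tensor_module Theta_hom, symmetric]) (auto intro: c2)
  finally show "Theta (tensor_map Z HZ (\<lambda>z. z) \<delta> (tensor_swap Z Z (tau i l))) =
    Theta (\<Oplus>\<^bsub>tensor Z HZ\<^esub>p\<in>{..<n}. tensor_map Z HZ (\<lambda>z. z) (pure_tensor H Z (a i p)) (tensor_swap Z Z (tau p l)))" .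
qed

subsection \<open>The cotensor module\<close>

text \<open>\<open>W\<close> is the cotensor product of the fundamental comodule with \<open>Z\<close>, the value of the fibre functor
  attached to \<open>Z\<close>.\<close>

abbreviation "coeq_entry i x \<equiv> \<delta> (x i) \<ominus>\<^bsub>HZ\<^esub> (\<Oplus>\<^bsub>HZ\<^esub>l\<in>{..<n}. pure_tensor H Z (a i l) (x l))"

definition "coeq x = (\<lambda>i. if i < n then coeq_entry i x else \<zero>\<^bsub>HZ\<^esub>)"

definition "W = {x \<in> carrier Zn. \<forall>i<n. \<delta> (x i) = (\<Oplus>\<^bsub>HZ\<^esub>l\<in>{..<n}. pure_tensor H Z (a i l) (x l))}"

abbreviation "WM \<equiv> Zn\<lparr>carrier := W\<rparr>"

lemma Zn_closed [simp]: "x \<in> carrier Zn \<Longrightarrow> x i \<in> carrier Z"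
  by (rule Z.power_closed)

lemma entry_sum_hom:
  "(\<lambda>x. \<Oplus>\<^bsub>HZ\<^esub>l\<in>{..<n}. pure_tensor H Z (a i l) (x l)) \<in> module_hom class_ring Zn HZ"
  by (rule hom_sum[OF HZ.tensor_module _ hom_compose[OF Z.power_proj_hom HZ.pure_hom_right]]) simp_all

lemma coeq_entry_hom: "(\<lambda>x. coeq_entry i x) \<in> module_hom class_ring Zn HZ"
  by (rule hom_diff[OF HZ.tensor_module hom_compose[OF Z.power_proj_hom coaction_hom] entry_sum_hom])

lemma coeq_hom: "coeq \<in> module_hom class_ring Zn (power_module n HZ)"
  using coeq_entry_hom
  by (auto simp: module_hom_iff coeq_def HZ.T.power_carrier fun_eq_iff)

text \<open>The \<open>n\<close> equations are packed into a single linear map between powers, so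
  that \<open>W\<close> is the left end of an exact sequence to which flatness applies.\<close>

lemma W_kernel: "W = {x \<in> carrier Zn. coeq x = \<zero>\<^bsub>power_module n HZ\<^esub>}"
proof -
  have "coeq x = \<zero>\<^bsub>power_module n HZ\<^esub> \<longleftrightarrow>
      (\<forall>i<n. \<delta> (x i) = (\<Oplus>\<^bsub>HZ\<^esub>l\<in>{..<n}. pure_tensor H Z (a i l) (x l)))" if "x \<in> carrier Zn" for x
    using that by (auto simp: coeq_def fun_eq_iff HZ.T.minus_eq_iff hom_closed[OF entry_sum_hom])
  then show ?thesis unfolding W_def by blast
qed

lemma W_submodule: "LinearCombinations.submodule class_ring W Zn"
  unfolding W_kernel by (rule hom_kernel_submodule[OF Zn.k_module_axioms HZn.k_module_axioms coeq_hom])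

sublocale WM: k_module WM by (rule Zn.submodule_k_module[OF W_submodule])

lemma W_subset: "W \<subseteq> carrier Zn" by (auto simp: W_def)

lemma W_coaction: "x \<in> W \<Longrightarrow> i < n \<Longrightarrow> \<delta> (x i) = (\<Oplus>\<^bsub>HZ\<^esub>l\<in>{..<n}. pure_tensor H Z (a i l) (x l))"
  by (simp add: W_def)

lemma incl_hom: "V \<subseteq> carrier Zn \<Longrightarrow> (\<lambda>x. x) \<in> module_hom class_ring (Zn\<lparr>carrier := V\<rparr>) Zn"
  by (auto simp: module_hom_iff)

text \<open>The column with entries \<open>tau i l\<close>, regarded as an element of
  \<open>Z \<otimes> Z\<^sup>n\<close>: the second components of the translation elements act as
  coefficients, the first components form the vector.\<close>

definition "tau_col l = (\<Oplus>\<^bsub>tensor Z Zn\<^esub>i\<in>{..<n}. tensor_map Z Zn (\<lambda>z. z) (power_inj Z i) (tensor_swap Z Z (tau i l)))"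

lemma swap_closed [simp]: "t \<in> carrier ZZ \<Longrightarrow> tensor_swap Z Z t \<in> carrier ZZ"
  by (rule hom_closed[OF tensor_swap_hom[OF Z.k_module_axioms Z.k_module_axioms]])

lemma tau_col_summand:
  "i < n \<Longrightarrow> tensor_map Z Zn (\<lambda>z. z) (power_inj Z i) (tensor_swap Z Z (tau i l)) \<in> carrier (tensor Z Zn)"
  by (rule hom_closed[OF tensor_map_hom[OF Z.k_module_axioms Z.k_module_axioms Z.k_module_axioms
          Zn.k_module_axioms hom_id Z.power_inj_hom]]) auto

lemma tau_col_closed [simp]: "tau_col l \<in> carrier (tensor Z Zn)"
  unfolding tau_col_def by (rule ZZn.T.finsum_closed) (auto simp: tau_col_summand)

lemma proj_tau_col:
  assumes "i < n"
  shows "tensor_map Z Z (\<lambda>z. z) (\<lambda>f. f i) (tau_col l) = tensor_swap Z Z (tau i l)"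
proof -
  note zz = Z.k_module_axioms Z.k_module_axioms
  note mods = Z.k_module_axioms Zn.k_module_axioms zz
  note mods' = zz Z.k_module_axioms Zn.k_module_axioms
  have "tensor_map Z Z (\<lambda>z. z) (\<lambda>f. f i) (tau_col l) =
      (\<Oplus>\<^bsub>ZZ\<^esub>j\<in>{..<n}. tensor_map Z Z (\<lambda>z. z) (\<lambda>f. f i)
        (tensor_map Z Zn (\<lambda>z. z) (power_inj Z j) (tensor_swap Z Z (tau j l))))"
    unfolding tau_col_def
    by (rule hom_finsum[OF ZZn.tensor_module ZZ.tensor_module tensor_map_hom[OF mods hom_id Z.power_proj_hom]])
      (auto simp: tau_col_summand)
  also have "\<dots> = (\<Oplus>\<^bsub>ZZ\<^esub>j\<in>{..<n}. if i = j then tensor_swap Z Z (tau j l) else \<zero>\<^bsub>ZZ\<^esub>)"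
  proof (intro ZZ.T.finsum_cong')
    fix j assume "j \<in> {..<n}"
    then have "power_inj Z j \<in> module_hom class_ring Z Zn" using Z.power_inj_hom by auto
    note c = tensor_map_compose[OF mods' zz hom_id this hom_id Z.power_proj_hom[of i] swap_closed[OF tau_closed], of j l]
    show "tensor_map Z Z (\<lambda>z. z) (\<lambda>f. f i) (tensor_map Z Zn (\<lambda>z. z) (power_inj Z j) (tensor_swap Z Z (tau j l))) =
        (if i = j then tensor_swap Z Z (tau j l) else \<zero>\<^bsub>ZZ\<^esub>)"
    proof (cases "i = j")
      case True
      then show ?thesis unfolding c
        by (simp add: tensor_map_id[OF zz] power_inj_def)
    next
      case False
      have z: "(\<lambda>x. \<zero>\<^bsub>Z\<^esub>) \<in> module_hom class_ring Z Z" by (rule module_homI) simp_all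
      have "tensor_map Z Z (\<lambda>z. z) (\<lambda>x. \<zero>\<^bsub>Z\<^esub>) t = \<zero>\<^bsub>ZZ\<^esub>" if "t \<in> carrier ZZ" for t
        by (rule ZZ.tensor_hom_eq[OF tensor_map_hom[OF zz zz hom_id z] _ _ that, of "\<lambda>t. \<zero>\<^bsub>ZZ\<^esub>"])
          (auto simp: tensor_map_pure[OF zz zz hom_id z] intro!: module_homI)
      then show ?thesis unfolding c using False by (simp add: power_inj_def)
    qed
  qed auto
  also have "\<dots> = tensor_swap Z Z (tau i l)"
    using assms ZZ.T.add.finprod_singleton[of i "{..<n}" "\<lambda>j. tensor_swap Z Z (tau j l)"] by auto
  finally show ?thesis .
qed

text \<open>Coordinate by coordinate this is \<open>tau_comodule\<close>, once projections and maps
  are pulled through the tensor product.\<close>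

lemma coeq_tau_col:
  assumes "l < n"
  shows "tensor_map Z (power_module n HZ) (\<lambda>z. z) coeq (tau_col l) = \<zero>\<^bsub>tensor Z (power_module n HZ)\<^esub>"
proof -
  note Zm = Z.k_module_axioms and Znm = Zn.k_module_axioms and HZm = HZ.tensor_module
    and HZnm = HZn.k_module_axioms
  interpret ZHZn: two_modules Z "power_module n HZ" ..
  show ?thesis
  proof (rule HZ.T.tensor_power_eqI[OF Zm])
    show "tensor_map Z (power_module n HZ) (\<lambda>z. z) coeq (tau_col l) \<in> carrier (tensor Z (power_module n HZ))"
      by (rule hom_closed[OF tensor_map_hom[OF Zm Znm Zm HZnm hom_id coeq_hom] tau_col_closed])
    show "\<zero>\<^bsub>tensor Z (power_module n HZ)\<^esub> \<in> carrier (tensor Z (power_module n HZ))" by simp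
    fix i assume i: "i < n"
    have "tensor_map Z HZ (\<lambda>z. z) (\<lambda>f. f i) (tensor_map Z (power_module n HZ) (\<lambda>z. z) coeq (tau_col l)) =
        tensor_map Z HZ (\<lambda>z. z) (\<lambda>x. coeq_entry i x) (tau_col l)"
      using i by (simp add: coeq_def
          tensor_map_compose[OF Zm Znm Zm HZnm Zm HZm hom_id coeq_hom hom_id HZ.T.power_proj_hom])
    also have "\<dots> = tensor_map Z HZ (\<lambda>z. z) (\<lambda>x. \<delta> (x i)) (tau_col l) \<ominus>\<^bsub>tensor Z HZ\<^esub>
        tensor_map Z HZ (\<lambda>z. z) (\<lambda>x. \<Oplus>\<^bsub>HZ\<^esub>p\<in>{..<n}. pure_tensor H Z (a i p) (x p)) (tau_col l)"
      by (rule tensor_map_diff[OF Zm Znm HZm hom_compose[OF Z.power_proj_hom coaction_hom] entry_sum_hom tau_col_closed])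
    also have "tensor_map Z HZ (\<lambda>z. z) (\<lambda>x. \<delta> (x i)) (tau_col l) =
        tensor_map Z HZ (\<lambda>z. z) \<delta> (tensor_swap Z Z (tau i l))"
      unfolding proj_tau_col[OF i, symmetric]
      by (rule tensor_map_compose[OF Zm Znm Zm Zm Zm HZm hom_id Z.power_proj_hom hom_id coaction_hom
            tau_col_closed, symmetric])
    also have "tensor_map Z HZ (\<lambda>z. z) (\<lambda>x. \<Oplus>\<^bsub>HZ\<^esub>p\<in>{..<n}. pure_tensor H Z (a i p) (x p)) (tau_col l) =
        (\<Oplus>\<^bsub>tensor Z HZ\<^esub>p\<in>{..<n}. tensor_map Z HZ (\<lambda>z. z) (\<lambda>x. pure_tensor H Z (a i p) (x p)) (tau_col l))"
      by (rule tensor_map_sum[OF Zm Znm HZm _ hom_compose[OF Z.power_proj_hom HZ.pure_hom_right] tau_col_closed]) simp_all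
    also have "\<dots> = (\<Oplus>\<^bsub>tensor Z HZ\<^esub>p\<in>{..<n}. tensor_map Z HZ (\<lambda>z. z) (pure_tensor H Z (a i p)) (tensor_swap Z Z (tau p l)))"
    proof (intro ZHZ.T.finsum_cong')
      fix p assume "p \<in> {..<n}"
      then have p: "p < n" by simp
      show "tensor_map Z HZ (\<lambda>z. z) (\<lambda>x. pure_tensor H Z (a i p) (x p)) (tau_col l) =
          tensor_map Z HZ (\<lambda>z. z) (pure_tensor H Z (a i p)) (tensor_swap Z Z (tau p l))"
        unfolding proj_tau_col[OF p, symmetric]
        by (rule tensor_map_compose[OF Zm Znm Zm Zm Zm HZm hom_id Z.power_proj_hom hom_id
              HZ.pure_hom_right[OF a_closed] tau_col_closed, symmetric])
    qed (auto intro!: hom_closed[OF tensor_map_hom[OF Zm Zm Zm HZm hom_id HZ.pure_hom_right[OF a_closed]]])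
    also have "\<dots> = tensor_map Z HZ (\<lambda>z. z) \<delta> (tensor_swap Z Z (tau i l))"
      by (rule tau_comodule[OF i assms, symmetric])
    also have "\<dots> \<ominus>\<^bsub>tensor Z HZ\<^esub> \<dots> = \<zero>\<^bsub>tensor Z HZ\<^esub>"
      by (simp add: ZHZ.T.minus_eq_iff hom_closed[OF tensor_map_hom[OF Zm Zm Zm HZm hom_id coaction_hom]])
    also have "\<dots> = tensor_map Z HZ (\<lambda>z. z) (\<lambda>f. f i) \<zero>\<^bsub>tensor Z (power_module n HZ)\<^esub>"
      by (rule hom_zero[OF ZHZn.tensor_module ZHZ.tensor_module
            tensor_map_hom[OF Zm HZnm Zm HZm hom_id HZ.T.power_proj_hom], symmetric])
    finally show "tensor_map Z HZ (\<lambda>z. z) (\<lambda>f. f i) (tensor_map Z (power_module n HZ) (\<lambda>z. z) coeq (tau_col l)) =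
        tensor_map Z HZ (\<lambda>z. z) (\<lambda>f. f i) \<zero>\<^bsub>tensor Z (power_module n HZ)\<^esub>" .
  qed
qed

definition embed_Zn :: "(nat \<Rightarrow> 'z) \<Rightarrow> ('z list \<Rightarrow>\<^sub>0 'k) set" where
  "embed_Zn = (\<lambda>f. {Poly_Mapping.single (map f [0..<n]) 1})"

lemma embed_Zn: "V \<subseteq> carrier Zn \<Longrightarrow> inj_on embed_Zn V"
  unfolding embed_Zn_def
  by (rule inj_on_subset[OF inj_on_power_embed_self[OF Z.k_module_axioms nontrivial]])

text \<open>Since \<open>can\<close> is bijective, its inverse injects \<open>H \<otimes> Z\<close>
  into \<open>Z \<otimes> Z\<close>; choosing a representative of each class there gives finitely
  supported functions on pairs from the type of \<open>Z\<close>, to which the coding of tuples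
  applies.\<close>

lemma embed_HZn:
  "\<exists>emb :: (nat \<Rightarrow> ('h \<times> 'z \<Rightarrow>\<^sub>0 'k) set) \<Rightarrow> ('z list \<Rightarrow>\<^sub>0 'k) set. inj_on emb (carrier (power_module n HZ))"
proof -
  let ?P = "monoid_algebra (Z \<times>\<times> Z) :: ('k, 'z \<times> 'z \<Rightarrow>\<^sub>0 'k) module"
  let ?\<pi> = "(+>\<^bsub>?P\<^esub>) (tensor_rel Z Z)"
  have "carrier ZZ = ?\<pi> ` carrier ?P" unfolding tensor_def by (rule ZZ.Q.quot_carrier)
  then have "inj_on (inv_into (carrier ?P) ?\<pi>) (carrier ZZ)" by (simp add: inj_on_inv_into)
  moreover have "inj_on ican (carrier HZ)" by (metis inj_on_inverseI can_ican)
  moreover have "ican ` carrier HZ \<subseteq> carrier ZZ" by auto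
  ultimately have "inj_on (inv_into (carrier ?P) ?\<pi> \<circ> ican) (carrier HZ)"
    by (meson comp_inj_on inj_on_subset)
  from inj_on_power_embed[OF HZ.tensor_module this] show ?thesis by blast
qed

text \<open>\<open>W \<rightarrow> Z\<^sup>n \<rightarrow> (H \<otimes> Z)\<^sup>n\<close> is exact
  in the middle, hence so is its tensor product with \<open>Z\<close>, and \<open>tau_col l\<close>
  lies in the kernel of the tensored map.\<close>

lemma tau_col_in_W:
  assumes "l < n"
  shows "tau_col l \<in> tensor_map Z Zn (\<lambda>z. z) (\<lambda>x. x) ` carrier (tensor Z WM)"
proof -
  obtain emb :: "(nat \<Rightarrow> ('h \<times> 'z \<Rightarrow>\<^sub>0 'k) set) \<Rightarrow> ('z list \<Rightarrow>\<^sub>0 'k) set"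
    where emb: "inj_on emb (carrier (power_module n HZ))" using embed_HZn by blast
  have "exact_at WM Zn (power_module n HZ) (\<lambda>x. x) coeq"
    unfolding exact_at_def using W_kernel by simp
  then have "exact_at (tensor Z WM) (tensor Z Zn) (tensor Z (power_module n HZ))
      (tensor_map Z Zn (\<lambda>z. z) (\<lambda>x. x)) (tensor_map Z (power_module n HZ) (\<lambda>z. z) coeq)"
    using faithfully_flat_exact[OF ff Z.k_module_axioms WM.k_module_axioms Zn.k_module_axioms
        HZn.k_module_axioms _ embed_Zn emb incl_hom[OF W_subset] coeq_hom, of embed_Zn]
      embed_Zn[OF W_subset] by simp
  then show ?thesis
    unfolding exact_at_def using coeq_tau_col[OF assms] by simp
qed

subsection \<open>A basis of the cotensor module\<close>

text \<open>The tensor products \<open>Z \<otimes> V\<close> for different \<open>V\<close> have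
  unrelated elements; their images in \<open>Z \<otimes> Z\<^sup>n\<close> can be compared.\<close>

abbreviation "Img V \<equiv> tensor_map Z Zn (\<lambda>z. z) (\<lambda>x. x) ` carrier (tensor Z (Zn\<lparr>carrier := V\<rparr>))"

lemma Img_facts:
  assumes V: "LinearCombinations.submodule class_ring V Zn"
  shows Img_add: "\<And>s t. s \<in> Img V \<Longrightarrow> t \<in> Img V \<Longrightarrow> s \<oplus>\<^bsub>tensor Z Zn\<^esub> t \<in> Img V"
    and Img_pure: "\<And>z x. z \<in> carrier Z \<Longrightarrow> x \<in> V \<Longrightarrow> pure_tensor Z Zn z x \<in> Img V"
    and Img_induct: "\<And>t Q. t \<in> Img V \<Longrightarrow> (\<And>z x. z \<in> carrier Z \<Longrightarrow> x \<in> V \<Longrightarrow> Q (pure_tensor Z Zn z x)) \<Longrightarrow>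
      (\<And>s t. s \<in> carrier (tensor Z Zn) \<Longrightarrow> t \<in> carrier (tensor Z Zn) \<Longrightarrow> Q s \<Longrightarrow> Q t \<Longrightarrow>
        Q (s \<oplus>\<^bsub>tensor Z Zn\<^esub> t)) \<Longrightarrow> Q t"
proof -
  have VZ: "V \<subseteq> carrier Zn" using V by (simp add: Zn.submodule_def')
  interpret V: k_module "Zn\<lparr>carrier := V\<rparr>" by (rule Zn.submodule_k_module[OF V])
  interpret ZV: two_modules Z "Zn\<lparr>carrier := V\<rparr>" ..
  let ?j = "tensor_map Z Zn (\<lambda>z. z) (\<lambda>x. x)"
  note mods = Z.k_module_axioms V.k_module_axioms Z.k_module_axioms Zn.k_module_axioms
  note h = tensor_map_hom[OF mods hom_id incl_hom[OF VZ]]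
  note p = tensor_map_pure[OF mods hom_id incl_hom[OF VZ]]
  show "s \<oplus>\<^bsub>tensor Z Zn\<^esub> t \<in> Img V" if "s \<in> Img V" "t \<in> Img V" for s t
    using that hom_add[OF h, symmetric] by auto
  show pure: "pure_tensor Z Zn z x \<in> Img V" if "z \<in> carrier Z" "x \<in> V" for z x
  proof
    show "pure_tensor Z Zn z x = ?j (pure_tensor Z (Zn\<lparr>carrier := V\<rparr>) z x)"
      using p[of z x] that by simp
    show "pure_tensor Z (Zn\<lparr>carrier := V\<rparr>) z x \<in> carrier (tensor Z (Zn\<lparr>carrier := V\<rparr>))"
      using that by (intro ZV.pure_closed) simp_all
  qed
  show "Q t" if "t \<in> Img V" and Qp: "\<And>z x. z \<in> carrier Z \<Longrightarrow> x \<in> V \<Longrightarrow> Q (pure_tensor Z Zn z x)"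
    and Qa: "\<And>s t. s \<in> carrier (tensor Z Zn) \<Longrightarrow> t \<in> carrier (tensor Z Zn) \<Longrightarrow> Q s \<Longrightarrow> Q t \<Longrightarrow>
        Q (s \<oplus>\<^bsub>tensor Z Zn\<^esub> t)" for t Q
  proof -
    obtain s where s: "s \<in> carrier (tensor Z (Zn\<lparr>carrier := V\<rparr>))" "t = ?j s" using \<open>t \<in> Img V\<close> by blast
    from s(1) have "Q (?j s)"
    proof (induction rule: ZV.tensor_induct)
      case (pure x y)
      then show ?case using p[of x y] Qp by simp
    next
      case (add s t)
      then show ?case using Qa hom_closed[OF h] by (simp add: hom_add[OF h])
    qed
    then show ?thesis using s by simp
  qed
qed

lemma Img_mono:
  assumes V: "LinearCombinations.submodule class_ring V Zn" and V': "LinearCombinations.submodule class_ring V' Zn"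
    and "V \<subseteq> V'"
  shows "Img V \<subseteq> Img V'"
proof
  fix t assume "t \<in> Img V"
  then show "t \<in> Img V'"
    by (rule Img_induct[OF V]) (use assms Img_pure[OF V'] Img_add[OF V'] in auto)
qed

lemma Img_right:
  assumes V: "LinearCombinations.submodule class_ring V Zn" and t: "t \<in> Img V" and c: "c \<in> carrier Z"
  shows "tensor_map Z Zn (\<lambda>y. y \<otimes>\<^bsub>Z\<^esub> c) (\<lambda>x. x) t \<in> Img V"
proof -
  have VZ: "V \<subseteq> carrier Zn" using V by (simp add: Zn.submodule_def')
  note mods = Z.k_module_axioms Zn.k_module_axioms Z.k_module_axioms Zn.k_module_axioms
  note h = tensor_map_hom[OF mods Z.mult_hom_right[OF c] hom_id]
  note p = tensor_map_pure[OF mods Z.mult_hom_right[OF c] hom_id]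
  show ?thesis
    using t
  proof (rule Img_induct[OF V])
    fix z x assume "z \<in> carrier Z" "x \<in> V"
    then show "tensor_map Z Zn (\<lambda>y. y \<otimes>\<^bsub>Z\<^esub> c) (\<lambda>x. x) (pure_tensor Z Zn z x) \<in> Img V"
      using p[of z x] VZ c Img_pure[OF V, of "z \<otimes>\<^bsub>Z\<^esub> c" x] by auto
  next
    fix s t assume "s \<in> carrier (tensor Z Zn)" "t \<in> carrier (tensor Z Zn)"
      "tensor_map Z Zn (\<lambda>y. y \<otimes>\<^bsub>Z\<^esub> c) (\<lambda>x. x) s \<in> Img V" "tensor_map Z Zn (\<lambda>y. y \<otimes>\<^bsub>Z\<^esub> c) (\<lambda>x. x) t \<in> Img V"
    then show "tensor_map Z Zn (\<lambda>y. y \<otimes>\<^bsub>Z\<^esub> c) (\<lambda>x. x) (s \<oplus>\<^bsub>tensor Z Zn\<^esub> t) \<in> Img V"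
      using Img_add[OF V] by (simp only: hom_add[OF h])
  qed
qed

text \<open>An element of \<open>Z \<otimes> W\<close> is a finite sum of pure tensors, so it
  involves only finitely many elements of \<open>W\<close>; these are collected for all
  \<open>l < n\<close>.\<close>

lemma tau_col_finite:
  obtains S where "finite S" "S \<subseteq> W" "\<And>l. l < n \<Longrightarrow> tau_col l \<in> Img (Zn.kspan S)"
proof -
  have sub: "LinearCombinations.submodule class_ring (Zn.kspan S) Zn" if "S \<subseteq> W" for S
    using that W_subset by (intro Zn.kspan_submodule) auto
  have fin: "\<exists>S. finite S \<and> S \<subseteq> W \<and> t \<in> Img (Zn.kspan S)" if "t \<in> Img W" for t
    using that
  proof (rule Img_induct[OF W_submodule])
    fix z x assume zx: "z \<in> carrier Z" "x \<in> W"
    then have "x \<in> Zn.kspan {x}" using W_subset Zn.kspan_superset[of "{x}"] by auto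
    then show "\<exists>S. finite S \<and> S \<subseteq> W \<and> pure_tensor Z Zn z x \<in> Img (Zn.kspan S)"
      using zx Img_pure[OF sub, of "{x}" z x] by (intro exI[of _ "{x}"]) auto
  next
    fix s t assume "\<exists>S. finite S \<and> S \<subseteq> W \<and> s \<in> Img (Zn.kspan S)" "\<exists>S. finite S \<and> S \<subseteq> W \<and> t \<in> Img (Zn.kspan S)"
    then obtain S T where ST: "finite S" "S \<subseteq> W" "s \<in> Img (Zn.kspan S)" "finite T" "T \<subseteq> W" "t \<in> Img (Zn.kspan T)"
      by blast
    have U: "S \<union> T \<subseteq> W" "S \<union> T \<subseteq> carrier Zn" using ST W_subset by auto
    have "s \<in> Img (Zn.kspan (S \<union> T))" "t \<in> Img (Zn.kspan (S \<union> T))"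
      using ST U Img_mono[OF sub[OF ST(2)] sub[OF U(1)]] Img_mono[OF sub[OF ST(5)] sub[OF U(1)]]
        Zn.kspan_mono[of S "S \<union> T"] Zn.kspan_mono[of T "S \<union> T"] by blast+
    then show "\<exists>S. finite S \<and> S \<subseteq> W \<and> s \<oplus>\<^bsub>tensor Z Zn\<^esub> t \<in> Img (Zn.kspan S)"
      using ST U Img_add[OF sub[OF U(1)]] by (intro exI[of _ "S \<union> T"]) auto
  qed
  have "\<forall>l\<in>{..<n}. \<exists>S. finite S \<and> S \<subseteq> W \<and> tau_col l \<in> Img (Zn.kspan S)"
  proof
    fix l assume "l \<in> {..<n}"
    then have "tau_col l \<in> Img W" by (intro tau_col_in_W) simp
    then show "\<exists>S. finite S \<and> S \<subseteq> W \<and> tau_col l \<in> Img (Zn.kspan S)" by (rule fin)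
  qed
  then obtain S where S: "\<And>l. l < n \<Longrightarrow> finite (S l) \<and> S l \<subseteq> W \<and> tau_col l \<in> Img (Zn.kspan (S l))"
    by (metis lessThan_iff)
  let ?S = "\<Union>l<n. S l"
  have U: "?S \<subseteq> W" "?S \<subseteq> carrier Zn" using S W_subset by auto
  have "tau_col l \<in> Img (Zn.kspan ?S)" if "l < n" for l
  proof -
    have "Zn.kspan (S l) \<subseteq> Zn.kspan ?S" by (rule Zn.kspan_mono) (use that U in auto)
    then show ?thesis using S[OF that] Img_mono[OF sub sub[OF U(1)]] by blast
  qed
  then show ?thesis using that[of ?S] S U by auto
qed

text \<open>The canonical map sends the left side to \<open>\<delta> (x i) (1 \<otimes> z)\<close>,
  which for \<open>x\<close> in \<open>W\<close> is the sum of \<open>a i l \<otimes> x l z\<close>.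
  The same value arises on the right from \<open>can (tau i l) = a i l \<otimes> 1\<close>.\<close>

lemma W_tau:
  assumes x: "x \<in> W" and z: "z \<in> carrier Z" and i: "i < n"
  shows "pure_tensor Z Z (x i) z = (\<Oplus>\<^bsub>ZZ\<^esub>l\<in>{..<n}. ZZ_right (x l \<otimes>\<^bsub>Z\<^esub> z) (tau i l))"
proof (rule can_inj)
  have xc: "x l \<in> carrier Z" for l using x W_subset by auto
  have rc: "ZZ_right (x l \<otimes>\<^bsub>Z\<^esub> z) (tau i l) \<in> carrier ZZ" for l
    using xc z by (intro hom_closed[OF ZZ_right_hom]) auto
  show "pure_tensor Z Z (x i) z \<in> carrier ZZ" using xc z by auto
  show "(\<Oplus>\<^bsub>ZZ\<^esub>l\<in>{..<n}. ZZ_right (x l \<otimes>\<^bsub>Z\<^esub> z) (tau i l)) \<in> carrier ZZ"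
    using rc by (intro ZZ.T.finsum_closed) auto
  have "can (\<Oplus>\<^bsub>ZZ\<^esub>l\<in>{..<n}. ZZ_right (x l \<otimes>\<^bsub>Z\<^esub> z) (tau i l)) =
      (\<Oplus>\<^bsub>HZ\<^esub>l\<in>{..<n}. can (ZZ_right (x l \<otimes>\<^bsub>Z\<^esub> z) (tau i l)))"
    by (rule hom_finsum[OF ZZ.tensor_module HZ.tensor_module can_hom]) (auto simp: rc)
  also have "\<dots> = (\<Oplus>\<^bsub>HZ\<^esub>l\<in>{..<n}. pure_tensor H Z (a i l) (x l) \<otimes>\<^bsub>HZ\<^esub> pure_tensor H Z \<one>\<^bsub>H\<^esub> z)"
    using xc z by (intro HZ.T.finsum_cong') (auto simp: can_right can_tau HZ.pure_mult)
  also have "\<dots> = \<delta> (x i) \<otimes>\<^bsub>HZ\<^esub> pure_tensor H Z \<one>\<^bsub>H\<^esub> z"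
    unfolding W_coaction[OF x i] using xc z by (subst HZ.TA.mult_finsum_right) auto
  also have "\<dots> = can (pure_tensor Z Z (x i) z)" using xc z by (simp add: can_pure)
  finally show "can (pure_tensor Z Z (x i) z) = can (\<Oplus>\<^bsub>ZZ\<^esub>l\<in>{..<n}. ZZ_right (x l \<otimes>\<^bsub>Z\<^esub> z) (tau i l))" by simp
qed

abbreviation "Zn_right c \<equiv> tensor_map Z Zn (\<lambda>y. y \<otimes>\<^bsub>Z\<^esub> c) (\<lambda>x. x)"

lemma Zn_right_closed: "c \<in> carrier Z \<Longrightarrow> t \<in> carrier (tensor Z Zn) \<Longrightarrow> Zn_right c t \<in> carrier (tensor Z Zn)"
  by (rule hom_closed[OF tensor_map_hom[OF Z.k_module_axioms Zn.k_module_axioms Z.k_module_axioms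
          Zn.k_module_axioms Z.mult_hom_right hom_id]])

text \<open>The preceding identity for all coordinates at once: \<open>Z \<otimes> W\<close> is
  spanned by the \<open>n\<close> columns \<open>tau_col l\<close> when elements of \<open>Z\<close>
  act by multiplication on the first factor. This is where finiteness of \<open>W\<close> comes
  from.\<close>

lemma W_tau_col:
  assumes x: "x \<in> W" and z: "z \<in> carrier Z"
  shows "pure_tensor Z Zn z x = (\<Oplus>\<^bsub>tensor Z Zn\<^esub>l\<in>{..<n}. Zn_right (x l \<otimes>\<^bsub>Z\<^esub> z) (tau_col l))"
proof (rule Z.tensor_power_eqI[OF Z.k_module_axioms])
  note Zm = Z.k_module_axioms and Znm = Zn.k_module_axioms
  have xc: "x l \<in> carrier Z" and xZ: "x \<in> carrier Zn" for l using x W_subset by auto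
  have rc: "Zn_right (x l \<otimes>\<^bsub>Z\<^esub> z) (tau_col l) \<in> carrier (tensor Z Zn)" for l
    using xc z by (intro Zn_right_closed) auto
  show "pure_tensor Z Zn z x \<in> carrier (tensor Z Zn)" using z xZ by auto
  show "(\<Oplus>\<^bsub>tensor Z Zn\<^esub>l\<in>{..<n}. Zn_right (x l \<otimes>\<^bsub>Z\<^esub> z) (tau_col l)) \<in> carrier (tensor Z Zn)"
    using rc by (intro ZZn.T.finsum_closed) auto
  fix i assume i: "i < n"
  note zz = Zm Zm
  have sw: "tensor_swap Z Z (ZZ_right c t) = tensor_map Z Z (\<lambda>y. y \<otimes>\<^bsub>Z\<^esub> c) (\<lambda>x. x) (tensor_swap Z Z t)"
    if "c \<in> carrier Z" "t \<in> carrier ZZ" for c t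
    by (rule ZZ.tensor_hom_eq[OF hom_compose[OF ZZ_right_hom tensor_swap_hom[OF zz]]
          hom_compose[OF tensor_swap_hom[OF zz] tensor_map_hom[OF zz zz Z.mult_hom_right hom_id]] _ that(2)])
      (simp_all add: that(1) tensor_swap_pure[OF zz] tensor_map_pure[OF zz zz] hom_id Z.mult_hom_right)
  have c1: "tensor_map Z Z (\<lambda>z. z) (\<lambda>f. f i) (Zn_right c t) =
      tensor_map Z Z (\<lambda>y. y \<otimes>\<^bsub>Z\<^esub> c) (\<lambda>x. x) (tensor_map Z Z (\<lambda>z. z) (\<lambda>f. f i) t)"
    if "c \<in> carrier Z" "t \<in> carrier (tensor Z Zn)" for c t
    using tensor_map_compose[OF Zm Znm Zm Znm zz Z.mult_hom_right[OF that(1)] hom_id hom_id Z.power_proj_hom that(2)]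
      tensor_map_compose[OF Zm Znm zz zz hom_id Z.power_proj_hom Z.mult_hom_right[OF that(1)] hom_id that(2)]
    by simp
  have "tensor_map Z Z (\<lambda>z. z) (\<lambda>f. f i) (\<Oplus>\<^bsub>tensor Z Zn\<^esub>l\<in>{..<n}. Zn_right (x l \<otimes>\<^bsub>Z\<^esub> z) (tau_col l)) =
      (\<Oplus>\<^bsub>ZZ\<^esub>l\<in>{..<n}. tensor_map Z Z (\<lambda>z. z) (\<lambda>f. f i) (Zn_right (x l \<otimes>\<^bsub>Z\<^esub> z) (tau_col l)))"
    by (rule hom_finsum[OF ZZn.tensor_module ZZ.tensor_module tensor_map_hom[OF Zm Znm zz hom_id Z.power_proj_hom]])
      (auto simp: rc)
  also have "\<dots> = (\<Oplus>\<^bsub>ZZ\<^esub>l\<in>{..<n}. tensor_swap Z Z (ZZ_right (x l \<otimes>\<^bsub>Z\<^esub> z) (tau i l)))"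
    using xc z i
    by (intro ZZ.T.finsum_cong')
      (auto simp: c1 proj_tau_col sw[symmetric] intro!: swap_closed hom_closed[OF ZZ_right_hom])
  also have "\<dots> = tensor_swap Z Z (\<Oplus>\<^bsub>ZZ\<^esub>l\<in>{..<n}. ZZ_right (x l \<otimes>\<^bsub>Z\<^esub> z) (tau i l))"
    using xc z by (intro hom_finsum[OF ZZ.tensor_module ZZ.tensor_module tensor_swap_hom[OF zz], symmetric])
      (auto intro!: hom_closed[OF ZZ_right_hom])
  also have "\<dots> = tensor_swap Z Z (pure_tensor Z Z (x i) z)"
    using W_tau[OF x z i] by simp
  also have "\<dots> = tensor_map Z Z (\<lambda>z. z) (\<lambda>f. f i) (pure_tensor Z Zn z x)"
    using xc xZ z by (simp add: tensor_swap_pure[OF zz] tensor_map_pure[OF Zm Znm zz hom_id Z.power_proj_hom])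
  finally show "tensor_map Z Z (\<lambda>z. z) (\<lambda>f. f i) (pure_tensor Z Zn z x) =
      tensor_map Z Z (\<lambda>z. z) (\<lambda>f. f i) (\<Oplus>\<^bsub>tensor Z Zn\<^esub>l\<in>{..<n}. Zn_right (x l \<otimes>\<^bsub>Z\<^esub> z) (tau_col l))" by simp
qed

lemma incl_tensor_inj:
  assumes V: "LinearCombinations.submodule class_ring V Zn"
  shows "inj_on (tensor_map Z Zn (\<lambda>z. z) (\<lambda>x. x)) (carrier (tensor Z (Zn\<lparr>carrier := V\<rparr>)))"
proof -
  have VZ: "V \<subseteq> carrier Zn" using V by (simp add: Zn.submodule_def')
  have e: "inj_on embed_Zn (carrier (Zn\<lparr>carrier := V\<rparr>))" using embed_Zn[OF VZ] by simp
  show ?thesis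
    using faithfully_flat_inj_iff[OF ff Z.k_module_axioms Zn.submodule_k_module[OF V] Zn.k_module_axioms
        e embed_Zn[OF order_refl] incl_hom[OF VZ]] by simp
qed

text \<open>Let \<open>V\<close> be the span of the finitely many elements of \<open>W\<close> that
  occur in the columns \<open>tau_col l\<close>. Then \<open>Z \<otimes> V\<close> and
  \<open>Z \<otimes> W\<close> have the same image in \<open>Z \<otimes> Z\<^sup>n\<close>. As
  \<open>Z \<otimes> W\<close> injects there by flatness,
  \<open>Z \<otimes> V \<rightarrow> Z \<otimes> W\<close> is onto, and faithful flatness gives
  \<open>V = W\<close>.\<close>

lemma W_finitely_generated: obtains S where "finite S" "S \<subseteq> W" "W \<subseteq> Zn.kspan S"
proof -
  obtain S where S: "finite S" "S \<subseteq> W" "\<And>l. l < n \<Longrightarrow> tau_col l \<in> Img (Zn.kspan S)"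
    by (rule tau_col_finite) (rule that; blast)
  let ?V = "Zn.kspan S"
  have V: "LinearCombinations.submodule class_ring ?V Zn" using S W_subset by (intro Zn.kspan_submodule) auto
  have VZ: "?V \<subseteq> carrier Zn" using V by (simp add: Zn.submodule_def')
  have VW: "?V \<subseteq> W" by (rule Zn.kspan_least[OF S(2) W_submodule])
  interpret V: k_module "Zn\<lparr>carrier := ?V\<rparr>" by (rule Zn.submodule_k_module[OF V])
  note Zm = Z.k_module_axioms and Znm = Zn.k_module_axioms and Vm = V.k_module_axioms and Wm = WM.k_module_axioms
  have vw: "(\<lambda>x. x) \<in> module_hom class_ring (Zn\<lparr>carrier := ?V\<rparr>) WM" using VW by (auto simp: module_hom_iff)
  have Img: "pure_tensor Z Zn z x \<in> Img ?V" if x: "x \<in> W" and z: "z \<in> carrier Z" for x z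
  proof -
    have xc: "x l \<in> carrier Z" for l using x W_subset by auto
    have sub: "LinearCombinations.submodule class_ring (Img ?V) (tensor Z Zn)"
      by (rule hom_image_submodule[OF k_module_tensor[OF Zm Vm] ZZn.tensor_module
            tensor_map_hom[OF Zm Vm Zm Znm hom_id incl_hom[OF VZ]]])
    have "Zn_right (x l \<otimes>\<^bsub>Z\<^esub> z) (tau_col l) \<in> Img ?V" if "l < n" for l
      using xc z by (intro Img_right[OF V S(3)[OF that]]) auto
    then show ?thesis
      unfolding W_tau_col[OF x z] by (intro ZZn.T.submodule_finsum[OF sub]) auto
  qed
  have Im': "Img W \<subseteq> Img ?V"
  proof
    fix t assume "t \<in> Img W"
    then show "t \<in> Img ?V" by (rule Img_induct[OF W_submodule]) (use Img Img_add[OF V] in auto)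
  qed
  have "tensor_map Z WM (\<lambda>z. z) (\<lambda>x. x) ` carrier (tensor Z (Zn\<lparr>carrier := ?V\<rparr>)) = carrier (tensor Z WM)"
  proof
    note h = tensor_map_hom[OF Zm Vm Zm Wm hom_id vw]
    show "tensor_map Z WM (\<lambda>z. z) (\<lambda>x. x) ` carrier (tensor Z (Zn\<lparr>carrier := ?V\<rparr>)) \<subseteq> carrier (tensor Z WM)"
      using hom_closed[OF h] by blast
    show "carrier (tensor Z WM) \<subseteq> tensor_map Z WM (\<lambda>z. z) (\<lambda>x. x) ` carrier (tensor Z (Zn\<lparr>carrier := ?V\<rparr>))"
    proof
      fix t assume t: "t \<in> carrier (tensor Z WM)"
      then have "tensor_map Z Zn (\<lambda>z. z) (\<lambda>x. x) t \<in> Img ?V" using Im' by blast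
      then obtain s where s: "s \<in> carrier (tensor Z (Zn\<lparr>carrier := ?V\<rparr>))"
          "tensor_map Z Zn (\<lambda>z. z) (\<lambda>x. x) t = tensor_map Z Zn (\<lambda>z. z) (\<lambda>x. x) s"
        by blast
      have "tensor_map Z Zn (\<lambda>z. z) (\<lambda>x. x) t =
          tensor_map Z Zn (\<lambda>z. z) (\<lambda>x. x) (tensor_map Z WM (\<lambda>z. z) (\<lambda>x. x) s)"
        using tensor_map_compose[OF Zm Vm Zm Wm Zm Znm hom_id vw hom_id incl_hom[OF W_subset] s(1)] s(2) by simp
      then have "t = tensor_map Z WM (\<lambda>z. z) (\<lambda>x. x) s"
        by (rule inj_onD[OF incl_tensor_inj[OF W_submodule] _ t hom_closed[OF h s(1)]])
      then show "t \<in> tensor_map Z WM (\<lambda>z. z) (\<lambda>x. x) ` carrier (tensor Z (Zn\<lparr>carrier := ?V\<rparr>))"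
        using s(1) by blast
    qed
  qed
  moreover have "inj_on embed_Zn (carrier (Zn\<lparr>carrier := ?V\<rparr>))" "inj_on embed_Zn (carrier WM)"
    using embed_Zn[OF VZ] embed_Zn[OF W_subset] by simp_all
  ultimately have "(\<lambda>x. x) ` carrier (Zn\<lparr>carrier := ?V\<rparr>) = carrier WM"
    using faithfully_flat_surj_iff[OF ff Zm Vm Wm _ _ vw, of embed_Zn embed_Zn] by blast
  then show ?thesis using that[OF S(1,2)] by simp
qed

text \<open>Multiplication by \<open>c \<noteq> 0\<close> is injective on the domain
  \<open>k\<close>, so by flatness also on \<open>Z \<otimes> k\<close>. There it sends
  \<open>x \<otimes> 1\<close> to \<open>c x \<otimes> 1 = 0\<close>, and \<open>x\<close> is
  recovered from \<open>x \<otimes> 1\<close> by the scalar action.\<close>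

lemma Z_torsion_free:
  assumes x: "x \<in> carrier Z" and 0: "c \<odot>\<^bsub>Z\<^esub> x = \<zero>\<^bsub>Z\<^esub>" and c: "c \<noteq> 0"
  shows "x = \<zero>\<^bsub>Z\<^esub>"
proof -
  interpret ZB: two_modules Z "base_algebra :: ('k, 'k) module" ..
  let ?B = "base_algebra :: ('k, 'k) module"
  let ?m = "tensor_map Z ?B (\<lambda>z. z) ((*) c)"
  have inj: "inj_on ((*) c) (carrier ?B)"
  proof (rule inj_onI)
    fix p q :: 'k assume "c * p = c * q"
    then have "c * (p - q) = 0" by (simp add: algebra_simps)
    then show "p = q" using pid_no_zero_divisors[OF pid] c by fastforce
  qed
  have h: "(*) c \<in> module_hom class_ring ?B ?B" by (rule module_homI) (simp_all add: algebra_simps)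
  have "inj_on (\<lambda>d. {Poly_Mapping.single [] d} :: ('z list \<Rightarrow>\<^sub>0 'k) set) (carrier ?B)"
    by (rule inj_onI) (auto dest: injD[OF inj_single])
  then have "inj_on ?m (carrier (tensor Z ?B))"
    using faithfully_flat_inj_iff[OF ff Z.k_module_axioms base.k_module_axioms base.k_module_axioms _ _ h] inj
    by blast
  moreover have "?m (pure_tensor Z ?B x 1) = ?m \<zero>\<^bsub>tensor Z ?B\<^esub>"
  proof -
    note mods = Z.k_module_axioms base.k_module_axioms Z.k_module_axioms base.k_module_axioms
    have "?m (pure_tensor Z ?B x 1) = pure_tensor Z ?B x (c \<odot>\<^bsub>?B\<^esub> 1)"
      using x by (simp add: tensor_map_pure[OF mods hom_id h])
    also have "\<dots> = pure_tensor Z ?B (c \<odot>\<^bsub>Z\<^esub> x) 1"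
      using x by (subst ZB.pure_smult_right) (simp_all add: ZB.pure_smult_left)
    also have "\<dots> = \<zero>\<^bsub>tensor Z ?B\<^esub>" using 0 by simp
    also have "\<dots> = ?m \<zero>\<^bsub>tensor Z ?B\<^esub>"
      by (rule hom_zero[OF ZB.tensor_module ZB.tensor_module tensor_map_hom[OF mods hom_id h], symmetric])
    finally show ?thesis .
  qed
  moreover have "pure_tensor Z ?B x 1 \<in> carrier (tensor Z ?B)" using x by (intro ZB.pure_closed) simp_all
  ultimately have 1: "pure_tensor Z ?B x 1 = \<zero>\<^bsub>tensor Z ?B\<^esub>"
    by (rule inj_onD) (rule ZB.T.zero_closed)
  note b = bilinear_flip[OF smult_bilinear]
  have "x = tensor_lift Z (\<lambda>z d. d \<odot>\<^bsub>Z\<^esub> z) (pure_tensor Z ?B x 1)"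
    using x by (simp add: ZB.tensor_lift_pure[OF Z.k_module_axioms b])
  then show ?thesis
    unfolding 1 using hom_zero[OF ZB.tensor_module Z.k_module_axioms ZB.tensor_lift_hom[OF Z.k_module_axioms b]]
    by simp
qed

lemma W_basis:
  obtains m :: nat and w where "\<And>j. j < m \<Longrightarrow> w j \<in> W"
    "\<And>x. x \<in> W \<Longrightarrow> \<exists>c. x = (\<Oplus>\<^bsub>Zn\<^esub>j\<in>{..<m}. c j \<odot>\<^bsub>Zn\<^esub> w j)"
    "\<And>c j. (\<Oplus>\<^bsub>Zn\<^esub>j\<in>{..<m}. c j \<odot>\<^bsub>Zn\<^esub> w j) = \<zero>\<^bsub>Zn\<^esub> \<Longrightarrow> j < m \<Longrightarrow> c j = 0"
proof -
  obtain S where S: "finite S" "S \<subseteq> W" "W \<subseteq> Zn.kspan S" by (rule W_finitely_generated)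
  have tf: "x = \<zero>\<^bsub>WM\<^esub>" if x: "x \<in> carrier WM" and 0: "c \<odot>\<^bsub>WM\<^esub> x = \<zero>\<^bsub>WM\<^esub>" and c: "c \<noteq> 0" for c x
  proof -
    have "x i \<in> carrier Z" for i using x W_subset by auto
    moreover have "c \<odot>\<^bsub>Z\<^esub> x i = \<zero>\<^bsub>Z\<^esub>" for i using fun_cong[OF 0, of i] by simp
    ultimately show ?thesis using Z_torsion_free c by (auto simp: fun_eq_iff)
  qed
  have sum: "(\<Oplus>\<^bsub>WM\<^esub>i\<in>A. f i) = (\<Oplus>\<^bsub>Zn\<^esub>i\<in>A. f i)" if "finite A" "\<And>i. i \<in> A \<Longrightarrow> f i \<in> W" for f and A :: "nat set"
    using Zn.finsum_submodule[OF W_submodule that] by simp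
  have S': "S \<subseteq> carrier WM" using S(2) by simp
  have gen: "carrier WM \<subseteq> WM.kspan S"
  proof -
    \<comment> \<open>Spans are taken in \<open>WM\<close> by the basis theorem but were produced in
      \<open>Zn\<close>. A span formed in \<open>WM\<close> is a submodule of \<open>Zn\<close>, so
      it contains the span formed there.\<close>
    have "LinearCombinations.submodule class_ring (WM.kspan S) WM"
      using S by (intro WM.kspan_submodule) simp
    then have "LinearCombinations.submodule class_ring (WM.kspan S) Zn"
      using W_subset unfolding WM.submodule_def' Zn.submodule_def' by auto
    then have "Zn.kspan S \<subseteq> WM.kspan S"
      using S WM.kspan_superset[of S] by (intro Zn.kspan_least) auto
    then show ?thesis using S by simp
  qed
  show ?thesis
  proof (rule WM.torsion_free_basis[OF pid _ S(1) S' gen])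
    show "x = \<zero>\<^bsub>WM\<^esub>" if "x \<in> carrier WM" "c \<odot>\<^bsub>WM\<^esub> x = \<zero>\<^bsub>WM\<^esub>" "c \<noteq> 0" for c x
      using that by (rule tf)
    fix m :: nat and w
    assume mw: "\<And>j. j < m \<Longrightarrow> w j \<in> carrier WM"
      "\<And>x. x \<in> carrier WM \<Longrightarrow> \<exists>c. x = (\<Oplus>\<^bsub>WM\<^esub>j\<in>{..<m}. c j \<odot>\<^bsub>WM\<^esub> w j)"
      "\<And>c j. (\<Oplus>\<^bsub>WM\<^esub>j\<in>{..<m}. c j \<odot>\<^bsub>WM\<^esub> w j) = \<zero>\<^bsub>WM\<^esub> \<Longrightarrow> j < m \<Longrightarrow> c j = 0"
    have cw: "c j \<odot>\<^bsub>Zn\<^esub> w j \<in> W" if "j < m" for c j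
      using W_submodule mw(1)[OF that] unfolding Zn.submodule_def' by simp
    have sums: "(\<Oplus>\<^bsub>WM\<^esub>j\<in>{..<m}. c j \<odot>\<^bsub>WM\<^esub> w j) = (\<Oplus>\<^bsub>Zn\<^esub>j\<in>{..<m}. c j \<odot>\<^bsub>Zn\<^esub> w j)" for c
      using sum[of "{..<m}" "\<lambda>j. c j \<odot>\<^bsub>Zn\<^esub> w j"] cw by simp
    show thesis
    proof (rule that[of m w])
      show "w j \<in> W" if "j < m" for j using mw(1)[OF that] by simp
      show "\<exists>c. x = (\<Oplus>\<^bsub>Zn\<^esub>j\<in>{..<m}. c j \<odot>\<^bsub>Zn\<^esub> w j)" if "x \<in> W" for x
        using mw(2)[of x] that unfolding sums by simp
      show "c j = 0" if "(\<Oplus>\<^bsub>Zn\<^esub>j\<in>{..<m}. c j \<odot>\<^bsub>Zn\<^esub> w j) = \<zero>\<^bsub>Zn\<^esub>" "j < m" for c j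
        by (rule mw(3)[OF _ that(2)]) (unfold sums, simp only: that(1), simp)
    qed
  qed
qed

lemma scalar_inj: "c \<odot>\<^bsub>Z\<^esub> \<one>\<^bsub>Z\<^esub> = d \<odot>\<^bsub>Z\<^esub> \<one>\<^bsub>Z\<^esub> \<Longrightarrow> c = d"
  using galois by (auto simp: galois_object_def bij_betw_def dest: injD)

lemma coinvariant_scalar:
  assumes "x \<in> carrier Z" "\<delta> x = pure_tensor H Z \<one>\<^bsub>H\<^esub> x"
  shows "\<exists>c. x = c \<odot>\<^bsub>Z\<^esub> \<one>\<^bsub>Z\<^esub>"
proof -
  have "x \<in> coinvariants H Z \<delta>" using assms by (simp add: coinvariants_def)
  then show ?thesis using galois by (auto simp: galois_object_def bij_betw_def)
qed

text \<open>The three properties of a basis in one closed formula, so that a basis can be fixed as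
  the assumption of a context and instantiated afterwards.\<close>

definition "W_basis_family m w \<longleftrightarrow> (\<forall>j<m. w j \<in> W) \<and>
  (\<forall>x\<in>W. \<exists>c. x = (\<Oplus>\<^bsub>Zn\<^esub>j\<in>{..<m}. c j \<odot>\<^bsub>Zn\<^esub> w j)) \<and>
  (\<forall>c. (\<Oplus>\<^bsub>Zn\<^esub>j\<in>{..<m}. c j \<odot>\<^bsub>Zn\<^esub> w j) = \<zero>\<^bsub>Zn\<^esub> \<longrightarrow> (\<forall>j<m. c j = 0))"

context
  fixes m :: nat and w :: "nat \<Rightarrow> nat \<Rightarrow> 'z"
  assumes basis: "W_basis_family m w"
begin

lemma basis_in_W: "j < m \<Longrightarrow> w j \<in> W"
  using basis by (simp add: W_basis_family_def)

lemma basis_generates: "x \<in> W \<Longrightarrow> \<exists>c. x = (\<Oplus>\<^bsub>Zn\<^esub>j\<in>{..<m}. c j \<odot>\<^bsub>Zn\<^esub> w j)"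
  using basis unfolding W_basis_family_def by blast

lemma basis_independent: "(\<Oplus>\<^bsub>Zn\<^esub>j\<in>{..<m}. c j \<odot>\<^bsub>Zn\<^esub> w j) = \<zero>\<^bsub>Zn\<^esub> \<Longrightarrow> j < m \<Longrightarrow> c j = 0"
  using basis unfolding W_basis_family_def by blast

lemma w_Zn: "j < m \<Longrightarrow> w j \<in> carrier Zn"
  using basis_in_W W_subset by blast

text \<open>The matrix whose columns are the basis vectors: row index first, and zero beyond the
  last column so that all entries lie in \<open>Z\<close>.\<close>

definition "zm i j = (if j < m then w j i else \<zero>\<^bsub>Z\<^esub>)"

lemma zm_closed [simp]: "zm i j \<in> carrier Z"
  using w_Zn by (simp add: zm_def)

lemma zm_coaction: "i < n \<Longrightarrow> j < m \<Longrightarrow> \<delta> (zm i j) = (\<Oplus>\<^bsub>HZ\<^esub>l\<in>{..<n}. pure_tensor H Z (a i l) (zm l j))"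
  using W_coaction[OF basis_in_W, of j i] by (simp add: zm_def)

text \<open>The scalar coordinates of an element of \<open>W\<close> are moved across the tensor
  sign into the first factor, where they become coefficients in \<open>Z\<close>.\<close>

lemma Img_W_basis:
  assumes "t \<in> Img W"
  shows "\<exists>\<eta>. (\<forall>j. \<eta> j \<in> carrier Z) \<and> t = (\<Oplus>\<^bsub>tensor Z Zn\<^esub>j\<in>{..<m}. pure_tensor Z Zn (\<eta> j) (w j))"
  using assms
proof (rule Img_induct[OF W_submodule])
  fix z x assume z: "z \<in> carrier Z" and x: "x \<in> W"
  obtain c where c: "x = (\<Oplus>\<^bsub>Zn\<^esub>j\<in>{..<m}. c j \<odot>\<^bsub>Zn\<^esub> w j)" using basis_generates[OF x] by blast
  have "pure_tensor Z Zn z x = (\<Oplus>\<^bsub>tensor Z Zn\<^esub>j\<in>{..<m}. pure_tensor Z Zn z (c j \<odot>\<^bsub>Zn\<^esub> w j))"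
    unfolding c using w_Zn Zn.smult_closed
    by (intro hom_finsum[OF Zn.k_module_axioms ZZn.tensor_module ZZn.pure_hom_right[OF z]]) blast+
  also have "\<dots> = (\<Oplus>\<^bsub>tensor Z Zn\<^esub>j\<in>{..<m}. pure_tensor Z Zn (c j \<odot>\<^bsub>Z\<^esub> z) (w j))"
  proof (intro ZZn.T.finsum_cong')
    fix j assume "j \<in> {..<m}"
    then have wj: "w j \<in> carrier Zn" by (intro w_Zn) simp
    show "pure_tensor Z Zn z (c j \<odot>\<^bsub>Zn\<^esub> w j) = pure_tensor Z Zn (c j \<odot>\<^bsub>Z\<^esub> z) (w j)"
      unfolding ZZn.pure_smult_right[OF z wj] ZZn.pure_smult_left[OF z wj] ..
  qed (use z w_Zn in auto)
  finally show "\<exists>\<eta>. (\<forall>j. \<eta> j \<in> carrier Z) \<and> pure_tensor Z Zn z x = (\<Oplus>\<^bsub>tensor Z Zn\<^esub>j\<in>{..<m}. pure_tensor Z Zn (\<eta> j) (w j))"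
    using z by (intro exI[of _ "\<lambda>j. c j \<odot>\<^bsub>Z\<^esub> z"]) simp
next
  fix s t
  assume "\<exists>\<eta>. (\<forall>j. \<eta> j \<in> carrier Z) \<and> s = (\<Oplus>\<^bsub>tensor Z Zn\<^esub>j\<in>{..<m}. pure_tensor Z Zn (\<eta> j) (w j))"
    "\<exists>\<eta>. (\<forall>j. \<eta> j \<in> carrier Z) \<and> t = (\<Oplus>\<^bsub>tensor Z Zn\<^esub>j\<in>{..<m}. pure_tensor Z Zn (\<eta> j) (w j))"
  then obtain \<eta> \<theta> where eta: "\<forall>j. \<eta> j \<in> carrier Z" "s = (\<Oplus>\<^bsub>tensor Z Zn\<^esub>j\<in>{..<m}. pure_tensor Z Zn (\<eta> j) (w j))"
    and theta: "\<forall>j. \<theta> j \<in> carrier Z" "t = (\<Oplus>\<^bsub>tensor Z Zn\<^esub>j\<in>{..<m}. pure_tensor Z Zn (\<theta> j) (w j))"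
    by blast
  have "s \<oplus>\<^bsub>tensor Z Zn\<^esub> t = (\<Oplus>\<^bsub>tensor Z Zn\<^esub>j\<in>{..<m}. pure_tensor Z Zn (\<eta> j) (w j) \<oplus>\<^bsub>tensor Z Zn\<^esub> pure_tensor Z Zn (\<theta> j) (w j))"
    unfolding eta(2) theta(2) using eta(1) theta(1) w_Zn
    by (intro ZZn.T.finsum_addf[symmetric]) auto
  also have "\<dots> = (\<Oplus>\<^bsub>tensor Z Zn\<^esub>j\<in>{..<m}. pure_tensor Z Zn (\<eta> j \<oplus>\<^bsub>Z\<^esub> \<theta> j) (w j))"
  proof (intro ZZn.T.finsum_cong')
    fix j assume "j \<in> {..<m}"
    then show "pure_tensor Z Zn (\<eta> j) (w j) \<oplus>\<^bsub>tensor Z Zn\<^esub> pure_tensor Z Zn (\<theta> j) (w j) =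
        pure_tensor Z Zn (\<eta> j \<oplus>\<^bsub>Z\<^esub> \<theta> j) (w j)"
      using eta(1) theta(1) w_Zn by (intro ZZn.pure_add_left[symmetric]) auto
  qed (use eta(1) theta(1) w_Zn in auto)
  finally show "\<exists>\<eta>. (\<forall>j. \<eta> j \<in> carrier Z) \<and> s \<oplus>\<^bsub>tensor Z Zn\<^esub> t = (\<Oplus>\<^bsub>tensor Z Zn\<^esub>j\<in>{..<m}. pure_tensor Z Zn (\<eta> j) (w j))"
    using eta(1) theta(1) by (intro exI[of _ "\<lambda>j. \<eta> j \<oplus>\<^bsub>Z\<^esub> \<theta> j"]) auto
qed

text \<open>Writing \<open>tau_col l\<close> as the sum of \<open>\<eta> l j \<otimes> w j\<close>
  and taking the coordinate \<open>i\<close> gives \<open>tau i l\<close> as the sum of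
  \<open>z_ij \<otimes> \<eta> l j\<close>. Multiplying the two factors yields the counit of
  \<open>a i l\<close>, so the transpose of \<open>\<eta>\<close> is a right inverse of
  \<open>z\<close>.\<close>

lemma right_inverse_exists:
  obtains y where "\<And>j l. y j l \<in> carrier Z"
    "\<And>i l. i < n \<Longrightarrow> l < n \<Longrightarrow> (\<Oplus>\<^bsub>Z\<^esub>j\<in>{..<m}. zm i j \<otimes>\<^bsub>Z\<^esub> y j l) = (if i = l then 1 else 0) \<odot>\<^bsub>Z\<^esub> \<one>\<^bsub>Z\<^esub>"
proof -
  have "\<exists>\<eta>. (\<forall>j. \<eta> j \<in> carrier Z) \<and> (l < n \<longrightarrow> tau_col l = (\<Oplus>\<^bsub>tensor Z Zn\<^esub>j\<in>{..<m}. pure_tensor Z Zn (\<eta> j) (w j)))" for l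
  proof (cases "l < n")
    case True
    then show ?thesis using Img_W_basis[OF tau_col_in_W] by blast
  next
    case False
    then show ?thesis by (intro exI[of _ "\<lambda>j. \<zero>\<^bsub>Z\<^esub>"]) simp
  qed
  from choice[OF allI[OF this]] obtain \<eta> where eta0: "\<forall>l. (\<forall>j. \<eta> l j \<in> carrier Z) \<and>
      (l < n \<longrightarrow> tau_col l = (\<Oplus>\<^bsub>tensor Z Zn\<^esub>j\<in>{..<m}. pure_tensor Z Zn (\<eta> l j) (w j)))" ..
  have eta: "\<And>l j. \<eta> l j \<in> carrier Z"
    "\<And>l. l < n \<Longrightarrow> tau_col l = (\<Oplus>\<^bsub>tensor Z Zn\<^esub>j\<in>{..<m}. pure_tensor Z Zn (\<eta> l j) (w j))"
    using eta0 by blast+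
  have "(\<Oplus>\<^bsub>Z\<^esub>j\<in>{..<m}. zm i j \<otimes>\<^bsub>Z\<^esub> \<eta> l j) = (if i = l then 1 else 0) \<odot>\<^bsub>Z\<^esub> \<one>\<^bsub>Z\<^esub>" if il: "i < n" "l < n" for i l
  proof -
    note Zm = Z.k_module_axioms and Znm = Zn.k_module_axioms
    note ph = tensor_map_hom[OF Zm Znm Zm Zm hom_id Z.power_proj_hom]
    note pp = tensor_map_pure[OF Zm Znm Zm Zm hom_id Z.power_proj_hom]
    have "tensor_swap Z Z (tau i l) = tensor_map Z Z (\<lambda>z. z) (\<lambda>f. f i) (tau_col l)"
      using il by (simp add: proj_tau_col)
    also have "\<dots> = (\<Oplus>\<^bsub>ZZ\<^esub>j\<in>{..<m}. tensor_map Z Z (\<lambda>z. z) (\<lambda>f. f i) (pure_tensor Z Zn (\<eta> l j) (w j)))"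
      unfolding eta(2)[OF il(2)]
      by (rule hom_finsum[OF ZZn.tensor_module ZZ.tensor_module ph]) (use eta(1) w_Zn in auto)
    also have "\<dots> = (\<Oplus>\<^bsub>ZZ\<^esub>j\<in>{..<m}. pure_tensor Z Z (\<eta> l j) (zm i j))"
      using eta(1) w_Zn by (intro ZZ.T.finsum_cong') (auto simp: pp zm_def)
    finally have sw: "tensor_swap Z Z (tau i l) = (\<Oplus>\<^bsub>ZZ\<^esub>j\<in>{..<m}. pure_tensor Z Z (\<eta> l j) (zm i j))" .
    have "mu (tau i l) = mu (tensor_swap Z Z (tensor_swap Z Z (tau i l)))"
      by (simp add: tensor_swap_swap[OF Zm Zm])
    also have "\<dots> = (\<Oplus>\<^bsub>Z\<^esub>j\<in>{..<m}. mu (tensor_swap Z Z (pure_tensor Z Z (\<eta> l j) (zm i j))))"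
      unfolding sw
      by (rule hom_finsum[OF ZZ.tensor_module Zm hom_compose[OF tensor_swap_hom[OF Zm Zm] mu_hom]])
        (use eta(1) in auto)
    also have "\<dots> = (\<Oplus>\<^bsub>Z\<^esub>j\<in>{..<m}. zm i j \<otimes>\<^bsub>Z\<^esub> \<eta> l j)"
      using eta(1) by (simp add: tensor_swap_pure[OF Zm Zm] mu_pure)
    finally show ?thesis using mu_tau[OF il] by simp
  qed
  then show ?thesis using that[of "\<lambda>j l. \<eta> l j"] eta(1) by blast
qed

text \<open>Coordinates are chosen separately for each vector; independence of the basis makes them
  unique, and uniqueness makes the choice linear.\<close>

lemma coordinate_exists:
  assumes j: "j < m"
  obtains \<phi> where "\<phi> \<in> module_hom class_ring WM (base_algebra :: ('k, 'k) module)"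
    "\<And>i. i < m \<Longrightarrow> \<phi> (w i) = (if i = j then 1 else 0)"
proof -
  let ?s = "\<lambda>c. \<Oplus>\<^bsub>Zn\<^esub>j\<in>{..<m}. c j \<odot>\<^bsub>Zn\<^esub> w j"
  define co where "co x = (SOME c. x = ?s c)" for x
  have co: "x = ?s (co x)" if "x \<in> W" for x
    using basis_generates[OF that] unfolding co_def by (rule someI_ex)
  have cw: "c \<odot>\<^bsub>Zn\<^esub> w i \<in> carrier Zn" if "i < m" for c i using w_Zn[OF that] by (rule Zn.smult_closed)
  have sc: "?s c \<in> carrier Zn" for c using cw by (intro Zn.finsum_closed) auto
  have s_add: "?s c \<oplus>\<^bsub>Zn\<^esub> ?s d = ?s (\<lambda>i. c i + d i)" for c d
  proof -
    have "?s c \<oplus>\<^bsub>Zn\<^esub> ?s d = (\<Oplus>\<^bsub>Zn\<^esub>i\<in>{..<m}. c i \<odot>\<^bsub>Zn\<^esub> w i \<oplus>\<^bsub>Zn\<^esub> d i \<odot>\<^bsub>Zn\<^esub> w i)"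
      using cw by (intro Zn.finsum_addf[symmetric]) auto
    also have "\<dots> = ?s (\<lambda>i. c i + d i)"
    proof (intro Zn.finsum_cong')
      fix i assume "i \<in> {..<m}"
      then show "c i \<odot>\<^bsub>Zn\<^esub> w i \<oplus>\<^bsub>Zn\<^esub> d i \<odot>\<^bsub>Zn\<^esub> w i = (c i + d i) \<odot>\<^bsub>Zn\<^esub> w i"
        by (intro Zn.smult_add_left[symmetric] w_Zn) simp
    qed (use cw in auto)
    finally show ?thesis .
  qed
  have s_smult: "r \<odot>\<^bsub>Zn\<^esub> ?s c = ?s (\<lambda>i. r * c i)" for r c
  proof -
    have "r \<odot>\<^bsub>Zn\<^esub> ?s c = (\<Oplus>\<^bsub>Zn\<^esub>i\<in>{..<m}. r \<odot>\<^bsub>Zn\<^esub> (c i \<odot>\<^bsub>Zn\<^esub> w i))"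
      using cw by (intro Zn.finsum_smult) auto
    also have "\<dots> = ?s (\<lambda>i. r * c i)"
    proof (intro Zn.finsum_cong')
      fix i assume "i \<in> {..<m}"
      then show "r \<odot>\<^bsub>Zn\<^esub> (c i \<odot>\<^bsub>Zn\<^esub> w i) = (r * c i) \<odot>\<^bsub>Zn\<^esub> w i"
        by (intro Zn.smult_smult w_Zn) simp
    qed (use cw in auto)
    finally show ?thesis .
  qed
  have uniq: "c i = d i" if "?s c = ?s d" "i < m" for c d i
  proof -
    have "?s (\<lambda>i. c i + (- 1) * d i) = ?s c \<oplus>\<^bsub>Zn\<^esub> (- 1) \<odot>\<^bsub>Zn\<^esub> ?s d" unfolding s_smult s_add ..
    also have "\<dots> = ?s d \<oplus>\<^bsub>Zn\<^esub> \<ominus>\<^bsub>Zn\<^esub> ?s d" using that(1) Zn.smult_minus_one[OF sc] by simp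
    also have "\<dots> = \<zero>\<^bsub>Zn\<^esub>" by (rule Zn.r_neg[OF sc])
    finally have "c i + (- 1) * d i = 0" using that(2) by (rule basis_independent)
    then show ?thesis by simp
  qed
  show ?thesis
  proof (rule that[of "\<lambda>x. co x j"])
    show "(\<lambda>x. co x j) \<in> module_hom class_ring WM base_algebra"
    proof (rule module_homI)
      fix x y assume "x \<in> carrier WM" "y \<in> carrier WM"
      then have x: "x \<in> W" and y: "y \<in> W" by simp_all
      then have xy: "x \<oplus>\<^bsub>Zn\<^esub> y \<in> W" using W_submodule unfolding Zn.submodule_def' by blast
      have "?s (co (x \<oplus>\<^bsub>Zn\<^esub> y)) = ?s (\<lambda>i. co x i + co y i)"
        unfolding s_add[symmetric] co[OF x, symmetric] co[OF y, symmetric] co[OF xy, symmetric] ..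
      then have "co (x \<oplus>\<^bsub>Zn\<^esub> y) j = co x j + co y j" by (rule uniq[OF _ j])
      then show "co (x \<oplus>\<^bsub>WM\<^esub> y) j = co x j \<oplus>\<^bsub>base_algebra\<^esub> co y j" by simp
    next
      fix r x assume "x \<in> carrier WM"
      then have x: "x \<in> W" by simp
      then have rx: "r \<odot>\<^bsub>Zn\<^esub> x \<in> W" using W_submodule unfolding Zn.submodule_def' by blast
      have "?s (co (r \<odot>\<^bsub>Zn\<^esub> x)) = ?s (\<lambda>i. r * co x i)"
        unfolding s_smult[symmetric] co[OF x, symmetric] co[OF rx, symmetric] ..
      then have "co (r \<odot>\<^bsub>Zn\<^esub> x) j = r * co x j" by (rule uniq[OF _ j])
      then show "co (r \<odot>\<^bsub>WM\<^esub> x) j = r \<odot>\<^bsub>base_algebra\<^esub> co x j" by simp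
    qed simp
    fix i assume i: "i < m"
    have "?s (\<lambda>k. if k = i then 1 else 0) = w i"
      by (rule Zn.finsum_delta(2)) (use i w_Zn in auto)
    also have "\<dots> = ?s (co (w i))" by (rule co[OF basis_in_W[OF i]])
    finally have "(if j = i then 1 else 0) = co (w i) j" by (rule uniq[OF _ j])
    then show "co (w i) j = (if i = j then 1 else 0)" by auto
  qed
qed

text \<open>If \<open>z \<zeta> = 0\<close>, then \<open>can\<close> sends the sum of
  \<open>z_ij \<otimes> \<zeta>_j\<close> to the sum of
  \<open>a_il \<otimes> (z \<zeta>)_l = 0\<close>, so the former vanishes in
  \<open>Z \<otimes> Z\<close> for every \<open>i\<close>. Hence the sum of
  \<open>\<zeta>_j \<otimes> w_j\<close> vanishes in \<open>Z \<otimes> Z\<^sup>n\<close>, by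
  flatness already in \<open>Z \<otimes> W\<close>, and a coordinate function on \<open>W\<close>
  extracts each \<open>\<zeta>_j\<close>.\<close>

lemma columns_independent:
  assumes zc: "\<And>j. \<zeta> j \<in> carrier Z"
    and zero: "\<And>i. i < n \<Longrightarrow> (\<Oplus>\<^bsub>Z\<^esub>j\<in>{..<m}. zm i j \<otimes>\<^bsub>Z\<^esub> \<zeta> j) = \<zero>\<^bsub>Z\<^esub>"
    and j: "j < m"
  shows "\<zeta> j = \<zero>\<^bsub>Z\<^esub>"
proof -
  note Zm = Z.k_module_axioms and Znm = Zn.k_module_axioms and Wm = WM.k_module_axioms
  interpret ZW: two_modules Z WM ..
  have zz: "(\<Oplus>\<^bsub>ZZ\<^esub>j\<in>{..<m}. pure_tensor Z Z (zm i j) (\<zeta> j)) = \<zero>\<^bsub>ZZ\<^esub>" if i: "i < n" for i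
  proof (rule can_inj)
    show "(\<Oplus>\<^bsub>ZZ\<^esub>j\<in>{..<m}. pure_tensor Z Z (zm i j) (\<zeta> j)) \<in> carrier ZZ"
      using zc by (intro ZZ.T.finsum_closed) auto
    have "can (\<Oplus>\<^bsub>ZZ\<^esub>j\<in>{..<m}. pure_tensor Z Z (zm i j) (\<zeta> j)) =
        (\<Oplus>\<^bsub>HZ\<^esub>j\<in>{..<m}. can (pure_tensor Z Z (zm i j) (\<zeta> j)))"
      using zc by (intro hom_finsum[OF ZZ.tensor_module HZ.tensor_module can_hom]) auto
    also have "\<dots> = (\<Oplus>\<^bsub>HZ\<^esub>j\<in>{..<m}. \<Oplus>\<^bsub>HZ\<^esub>l\<in>{..<n}. pure_tensor H Z (a i l) (zm l j \<otimes>\<^bsub>Z\<^esub> \<zeta> j))"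
      using zc i
      by (intro HZ.T.finsum_cong')
        (auto simp: can_pure zm_coaction HZ.TA.mult_finsum_right HZ.pure_mult intro!: HZ.T.finsum_closed)
    also have "\<dots> = (\<Oplus>\<^bsub>HZ\<^esub>l\<in>{..<n}. \<Oplus>\<^bsub>HZ\<^esub>j\<in>{..<m}. pure_tensor H Z (a i l) (zm l j \<otimes>\<^bsub>Z\<^esub> \<zeta> j))"
      using zc by (intro HZ.T.finsum_swap) auto
    also have "\<dots> = (\<Oplus>\<^bsub>HZ\<^esub>l\<in>{..<n}. pure_tensor H Z (a i l) (\<Oplus>\<^bsub>Z\<^esub>j\<in>{..<m}. zm l j \<otimes>\<^bsub>Z\<^esub> \<zeta> j))"
      using zc by (intro HZ.T.finsum_cong' hom_finsum[OF Zm HZ.tensor_module HZ.pure_hom_right, symmetric])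
        (auto intro!: Z.finsum_closed)
    also have "\<dots> = (\<Oplus>\<^bsub>HZ\<^esub>l\<in>{..<n}. \<zero>\<^bsub>HZ\<^esub>)"
      using zero by (intro HZ.T.finsum_cong') auto
    also have "\<dots> = can \<zero>\<^bsub>ZZ\<^esub>" using hom_zero[OF ZZ.tensor_module HZ.tensor_module can_hom] by simp
    finally show "can (\<Oplus>\<^bsub>ZZ\<^esub>j\<in>{..<m}. pure_tensor Z Z (zm i j) (\<zeta> j)) = can \<zero>\<^bsub>ZZ\<^esub>" .
  qed simp
  define s where "s = (\<Oplus>\<^bsub>tensor Z WM\<^esub>j\<in>{..<m}. pure_tensor Z WM (\<zeta> j) (w j))"
  have sj: "pure_tensor Z WM (\<zeta> j) (w j) \<in> carrier (tensor Z WM)" if "j < m" for j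
    using zc basis_in_W[OF that] by (intro ZW.pure_closed) simp_all
  have s: "s \<in> carrier (tensor Z WM)" unfolding s_def by (rule ZW.T.finsum_closed) (use sj in auto)
  let ?j = "tensor_map Z Zn (\<lambda>z. z) (\<lambda>x. x)"
  note jh = tensor_map_hom[OF Zm Wm Zm Znm hom_id incl_hom[OF W_subset]]
  note ph = tensor_map_hom[OF Zm Znm Zm Zm hom_id Z.power_proj_hom]
  have "?j s = ?j \<zero>\<^bsub>tensor Z WM\<^esub>"
  proof (rule Z.tensor_power_eqI[OF Zm])
    show "?j s \<in> carrier (tensor Z Zn)" "?j \<zero>\<^bsub>tensor Z WM\<^esub> \<in> carrier (tensor Z Zn)"
      using hom_closed[OF jh] s by auto
    fix i assume i: "i < n"
    have "tensor_map Z Z (\<lambda>z. z) (\<lambda>f. f i) (?j s) =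
        (\<Oplus>\<^bsub>ZZ\<^esub>j\<in>{..<m}. tensor_map Z Z (\<lambda>z. z) (\<lambda>f. f i) (?j (pure_tensor Z WM (\<zeta> j) (w j))))"
      unfolding s_def
      by (rule hom_finsum[OF ZW.tensor_module ZZ.tensor_module hom_compose[OF jh ph]]) (use sj in auto)
    also have "\<dots> = (\<Oplus>\<^bsub>ZZ\<^esub>j\<in>{..<m}. tensor_swap Z Z (pure_tensor Z Z (zm i j) (\<zeta> j)))"
      using zc basis_in_W w_Zn
      by (intro ZZ.T.finsum_cong')
        (auto simp: tensor_map_pure[OF Zm Wm Zm Znm hom_id incl_hom[OF W_subset]]
          tensor_map_pure[OF Zm Znm Zm Zm hom_id Z.power_proj_hom] tensor_swap_pure[OF Zm Zm] zm_def)
    also have "\<dots> = tensor_swap Z Z (\<Oplus>\<^bsub>ZZ\<^esub>j\<in>{..<m}. pure_tensor Z Z (zm i j) (\<zeta> j))"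
      using zc by (intro hom_finsum[OF ZZ.tensor_module ZZ.tensor_module tensor_swap_hom[OF Zm Zm], symmetric]) auto
    also have "\<dots> = \<zero>\<^bsub>ZZ\<^esub>"
      unfolding zz[OF i] by (rule hom_zero[OF ZZ.tensor_module ZZ.tensor_module tensor_swap_hom[OF Zm Zm]])
    also have "\<dots> = tensor_map Z Z (\<lambda>z. z) (\<lambda>f. f i) (?j \<zero>\<^bsub>tensor Z WM\<^esub>)"
      by (rule hom_zero[OF ZW.tensor_module ZZ.tensor_module hom_compose[OF jh ph], symmetric])
    finally show "tensor_map Z Z (\<lambda>z. z) (\<lambda>f. f i) (?j s) =
        tensor_map Z Z (\<lambda>z. z) (\<lambda>f. f i) (?j \<zero>\<^bsub>tensor Z WM\<^esub>)" .
  qed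
  then have s0: "s = \<zero>\<^bsub>tensor Z WM\<^esub>"
    by (rule inj_onD[OF incl_tensor_inj[OF W_submodule] _ s ZW.T.zero_closed])
  obtain \<phi> where phi: "\<phi> \<in> module_hom class_ring WM (base_algebra :: ('k, 'k) module)"
    "\<And>i. i < m \<Longrightarrow> \<phi> (w i) = (if i = j then 1 else 0)" by (rule coordinate_exists[OF j]) (rule that, assumption, simp)
  have b: "bilinear Z WM Z (\<lambda>z x. \<phi> x \<odot>\<^bsub>Z\<^esub> z)"
    using bilinear_flip[OF bilinear_compose[OF smult_bilinear phi(1) hom_id]] .
  let ?l = "tensor_lift Z (\<lambda>z x. \<phi> x \<odot>\<^bsub>Z\<^esub> z)"
  have "?l s = (\<Oplus>\<^bsub>Z\<^esub>i\<in>{..<m}. ?l (pure_tensor Z WM (\<zeta> i) (w i)))"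
    unfolding s_def by (rule hom_finsum[OF ZW.tensor_module Zm ZW.tensor_lift_hom[OF Zm b]]) (use sj in auto)
  also have "\<dots> = (\<Oplus>\<^bsub>Z\<^esub>i\<in>{..<m}. (if i = j then 1 else 0) \<odot>\<^bsub>Z\<^esub> \<zeta> i)"
    using zc basis_in_W by (intro Z.finsum_cong') (auto simp: ZW.tensor_lift_pure[OF Zm b] phi(2))
  also have "\<dots> = \<zeta> j" using j zc by (intro Z.finsum_delta) auto
  finally show ?thesis
    unfolding s0 using hom_zero[OF ZW.tensor_module Zm ZW.tensor_lift_hom[OF Zm b]] by simp
qed

end

text \<open>The results about \<open>W\<close>, restated as identities for a matrix over
  \<open>Z\<close>; from here on neither \<open>W\<close> nor flatness is needed to find the
  forms.\<close>

lemma galois_basis: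
  obtains m :: nat and z y :: "nat \<Rightarrow> nat \<Rightarrow> 'z" where
    "\<And>i j. z i j \<in> carrier Z" "\<And>i j. y i j \<in> carrier Z"
    "\<And>i j. i < n \<Longrightarrow> j < m \<Longrightarrow> \<delta> (z i j) = (\<Oplus>\<^bsub>HZ\<^esub>l\<in>{..<n}. pure_tensor H Z (a i l) (z l j))"
    "\<And>i l. i < n \<Longrightarrow> l < n \<Longrightarrow> (\<Oplus>\<^bsub>Z\<^esub>j\<in>{..<m}. z i j \<otimes>\<^bsub>Z\<^esub> y j l) = (if i = l then 1 else 0) \<odot>\<^bsub>Z\<^esub> \<one>\<^bsub>Z\<^esub>"
    "\<And>\<zeta> j. (\<And>j. \<zeta> j \<in> carrier Z) \<Longrightarrow> (\<And>i. i < n \<Longrightarrow> (\<Oplus>\<^bsub>Z\<^esub>j\<in>{..<m}. z i j \<otimes>\<^bsub>Z\<^esub> \<zeta> j) = \<zero>\<^bsub>Z\<^esub>) \<Longrightarrow>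
      j < m \<Longrightarrow> \<zeta> j = \<zero>\<^bsub>Z\<^esub>"
    "\<And>x. (\<And>i. x i \<in> carrier Z) \<Longrightarrow>
      (\<And>i. i < n \<Longrightarrow> \<delta> (x i) = (\<Oplus>\<^bsub>HZ\<^esub>l\<in>{..<n}. pure_tensor H Z (a i l) (x l))) \<Longrightarrow>
      \<exists>c. \<forall>i<n. x i = (\<Oplus>\<^bsub>Z\<^esub>j\<in>{..<m}. c j \<odot>\<^bsub>Z\<^esub> z i j)"
proof -
  obtain m :: nat and w where w: "W_basis_family m w"
    by (rule W_basis) (unfold W_basis_family_def, blast)
  let ?z = "zm m w"
  note zc = zm_closed[OF w]
  obtain y where y: "\<And>j l. y j l \<in> carrier Z"
    "\<And>i l. i < n \<Longrightarrow> l < n \<Longrightarrow> (\<Oplus>\<^bsub>Z\<^esub>j\<in>{..<m}. ?z i j \<otimes>\<^bsub>Z\<^esub> y j l) = (if i = l then 1 else 0) \<odot>\<^bsub>Z\<^esub> \<one>\<^bsub>Z\<^esub>"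
    by (rule right_inverse_exists[OF w]) (assumption | rule that)+
  show ?thesis
  proof (rule that[of ?z y m])
    show "\<zeta> j = \<zero>\<^bsub>Z\<^esub>" if "\<And>j. \<zeta> j \<in> carrier Z"
      "\<And>i. i < n \<Longrightarrow> (\<Oplus>\<^bsub>Z\<^esub>j\<in>{..<m}. ?z i j \<otimes>\<^bsub>Z\<^esub> \<zeta> j) = \<zero>\<^bsub>Z\<^esub>" "j < m" for \<zeta> j
      by (rule columns_independent[OF w that])
    fix x :: "nat \<Rightarrow> 'z"
    assume x: "\<And>i. x i \<in> carrier Z"
      "\<And>i. i < n \<Longrightarrow> \<delta> (x i) = (\<Oplus>\<^bsub>HZ\<^esub>l\<in>{..<n}. pure_tensor H Z (a i l) (x l))"
    define x' where "x' = (\<lambda>i. if i < n then x i else \<zero>\<^bsub>Z\<^esub>)"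
    have "x' \<in> carrier Zn" using x(1) by (simp add: x'_def Z.power_carrier)
    moreover have "\<delta> (x' i) = (\<Oplus>\<^bsub>HZ\<^esub>l\<in>{..<n}. pure_tensor H Z (a i l) (x' l))" if "i < n" for i
    proof -
      have "\<delta> (x' i) = (\<Oplus>\<^bsub>HZ\<^esub>l\<in>{..<n}. pure_tensor H Z (a i l) (x l))"
        using x(2) that by (simp add: x'_def)
      also have "\<dots> = (\<Oplus>\<^bsub>HZ\<^esub>l\<in>{..<n}. pure_tensor H Z (a i l) (x' l))"
        by (intro HZ.T.finsum_cong') (simp_all add: x'_def x(1))
      finally show ?thesis .
    qed
    ultimately have "x' \<in> W" by (simp add: W_def)
    from basis_generates[OF w this] obtain c where c: "x' = (\<Oplus>\<^bsub>Zn\<^esub>j\<in>{..<m}. c j \<odot>\<^bsub>Zn\<^esub> w j)" ..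
    have "x i = (\<Oplus>\<^bsub>Z\<^esub>j\<in>{..<m}. c j \<odot>\<^bsub>Z\<^esub> ?z i j)" if "i < n" for i
    proof -
      have "x i = (\<Oplus>\<^bsub>Zn\<^esub>j\<in>{..<m}. c j \<odot>\<^bsub>Zn\<^esub> w j) i"
        using that unfolding c[symmetric] by (simp add: x'_def)
      also have "\<dots> = (\<Oplus>\<^bsub>Z\<^esub>j\<in>{..<m}. (c j \<odot>\<^bsub>Zn\<^esub> w j) i)"
        by (rule Z.power_sum_apply) (use w_Zn[OF w] Zn.smult_closed in blast)+
      also have "\<dots> = (\<Oplus>\<^bsub>Z\<^esub>j\<in>{..<m}. c j \<odot>\<^bsub>Z\<^esub> ?z i j)"
        using w_Zn[OF w] by (intro Z.finsum_cong') (auto simp: zm_def[OF w] zm_closed[OF w])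
      finally show ?thesis .
    qed
    then show "\<exists>c. \<forall>i<n. x i = (\<Oplus>\<^bsub>Z\<^esub>j\<in>{..<m}. c j \<odot>\<^bsub>Z\<^esub> ?z i j)" by blast
  qed (use zc y zm_coaction[OF w] in auto)
qed

subsection \<open>The form on the basis\<close>

lemma left_inverse_from_right:
  fixes z y :: "nat \<Rightarrow> nat \<Rightarrow> 'z"
  assumes z: "\<And>i j. z i j \<in> carrier Z" and y: "\<And>i j. y i j \<in> carrier Z"
    and zy: "\<And>i l. i < n \<Longrightarrow> l < n \<Longrightarrow> (\<Oplus>\<^bsub>Z\<^esub>j\<in>{..<m}. z i j \<otimes>\<^bsub>Z\<^esub> y j l) = (if i = l then 1 else 0) \<odot>\<^bsub>Z\<^esub> \<one>\<^bsub>Z\<^esub>"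
    and indep: "\<And>\<zeta> j. (\<And>j. \<zeta> j \<in> carrier Z) \<Longrightarrow> (\<And>i. i < n \<Longrightarrow> (\<Oplus>\<^bsub>Z\<^esub>j\<in>{..<m}. z i j \<otimes>\<^bsub>Z\<^esub> \<zeta> j) = \<zero>\<^bsub>Z\<^esub>) \<Longrightarrow>
      j < m \<Longrightarrow> \<zeta> j = \<zero>\<^bsub>Z\<^esub>"
    and jp: "j < m" "p < m"
  shows "(\<Oplus>\<^bsub>Z\<^esub>l\<in>{..<n}. y j l \<otimes>\<^bsub>Z\<^esub> z l p) = (if j = p then 1 else 0) \<odot>\<^bsub>Z\<^esub> \<one>\<^bsub>Z\<^esub>"
proof -
  define P where "P j = (\<Oplus>\<^bsub>Z\<^esub>l\<in>{..<n}. y j l \<otimes>\<^bsub>Z\<^esub> z l p)" for j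
  define d where "d j = (if j = p then 1 else 0) \<odot>\<^bsub>Z\<^esub> \<one>\<^bsub>Z\<^esub>" for j
  have P: "P j \<in> carrier Z" for j unfolding P_def by (rule Z.finsum_closed) (use y z in auto)
  have d: "d j \<in> carrier Z" for j by (simp add: d_def)
  have "P j \<ominus>\<^bsub>Z\<^esub> d j = \<zero>\<^bsub>Z\<^esub>"
  proof (rule indep[of "\<lambda>j. P j \<ominus>\<^bsub>Z\<^esub> d j"])
    fix i assume i: "i < n"
    have "(\<Oplus>\<^bsub>Z\<^esub>j\<in>{..<m}. z i j \<otimes>\<^bsub>Z\<^esub> P j) =
        (\<Oplus>\<^bsub>Z\<^esub>l\<in>{..<n}. (\<Oplus>\<^bsub>Z\<^esub>j\<in>{..<m}. z i j \<otimes>\<^bsub>Z\<^esub> y j l) \<otimes>\<^bsub>Z\<^esub> z l p)"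
      unfolding P_def by (rule Z.mprod_assoc[where x = z and y = y and z = z, OF z y z, symmetric])
    also have "\<dots> = (\<Oplus>\<^bsub>Z\<^esub>l\<in>{..<n}. ((if i = l then 1 else 0) \<odot>\<^bsub>Z\<^esub> \<one>\<^bsub>Z\<^esub>) \<otimes>\<^bsub>Z\<^esub> z l p)"
      using i z by (intro Z.finsum_cong') (auto simp: zy)
    also have "\<dots> = z i p" by (rule Z.mprod_id(1)[where x = z, OF z i])
    finally have zP: "(\<Oplus>\<^bsub>Z\<^esub>j\<in>{..<m}. z i j \<otimes>\<^bsub>Z\<^esub> P j) = z i p" .
    have zd: "(\<Oplus>\<^bsub>Z\<^esub>j\<in>{..<m}. z i j \<otimes>\<^bsub>Z\<^esub> d j) = z i p"
      unfolding d_def by (rule Z.mprod_id(2)[where x = z, OF z jp(2)])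
    have "(\<Oplus>\<^bsub>Z\<^esub>j\<in>{..<m}. z i j \<otimes>\<^bsub>Z\<^esub> (P j \<ominus>\<^bsub>Z\<^esub> d j)) =
        (\<Oplus>\<^bsub>Z\<^esub>j\<in>{..<m}. z i j \<otimes>\<^bsub>Z\<^esub> P j \<oplus>\<^bsub>Z\<^esub> (- 1) \<odot>\<^bsub>Z\<^esub> (z i j \<otimes>\<^bsub>Z\<^esub> d j))"
      using z P d by (intro Z.finsum_cong')
        (auto simp: a_minus_def Z.r_distr Z.smult_mult_right simp flip: Z.smult_minus_one)
    also have "\<dots> = z i p \<oplus>\<^bsub>Z\<^esub> (- 1) \<odot>\<^bsub>Z\<^esub> z i p"
      using z P d by (simp add: Z.finsum_addf Pi_def zP zd flip: Z.finsum_smult)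
    also have "\<dots> = \<zero>\<^bsub>Z\<^esub>" using z by (simp add: Z.smult_minus_one Z.r_neg)
    finally show "(\<Oplus>\<^bsub>Z\<^esub>j\<in>{..<m}. z i j \<otimes>\<^bsub>Z\<^esub> (P j \<ominus>\<^bsub>Z\<^esub> d j)) = \<zero>\<^bsub>Z\<^esub>" .
  qed (use P d jp in auto)
  then show ?thesis using Z.minus_eq_iff[OF P d] by (simp add: P_def d_def)
qed

text \<open>Since \<open>\<delta>\<close> acts on \<open>z\<close> as multiplication by
  \<open>a\<close>, it sends \<open>z\<^sup>t e z\<close> to
  \<open>z\<^sup>t (a\<^sup>t e a) z\<close>, and \<open>a\<^sup>t e a = e\<close>. So the entries
  are coinvariant, and coinvariants are scalars.\<close>

lemma form_scalar:
  fixes z :: "nat \<Rightarrow> nat \<Rightarrow> 'z"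
  assumes z: "\<And>i j. z i j \<in> carrier Z"
    and coact: "\<And>i j. i < n \<Longrightarrow> j < m \<Longrightarrow> \<delta> (z i j) = (\<Oplus>\<^bsub>HZ\<^esub>l\<in>{..<n}. pure_tensor H Z (a i l) (z l j))"
  obtains f where "Z.form_rel n m e f z"
proof -
  define X where "X j r = (\<Oplus>\<^bsub>Z\<^esub>q\<in>{..<n}. \<Oplus>\<^bsub>Z\<^esub>s\<in>{..<n}. e q s \<odot>\<^bsub>Z\<^esub> (z q j \<otimes>\<^bsub>Z\<^esub> z s r))" for j r
  have Xc: "X j r \<in> carrier Z" for j r unfolding X_def using z by (intro Z.finsum_closed) auto
  let ?u = "\<lambda>i j. pure_tensor H Z (a i j) \<one>\<^bsub>Z\<^esub>" and ?v = "\<lambda>i j. pure_tensor H Z \<one>\<^bsub>H\<^esub> (z i j)"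
  note sums = hom_finsum[OF Z.k_module_axioms HZ.tensor_module] Z.finsum_closed Pi_def z
  have "\<exists>c. X j r = c \<odot>\<^bsub>Z\<^esub> \<one>\<^bsub>Z\<^esub>" if jr: "j < m" "r < m" for j r
  proof (rule coinvariant_scalar[OF Xc])
    have D: "\<delta> (z q i) = (\<Oplus>\<^bsub>HZ\<^esub>k\<in>{..<n}. ?u q k \<otimes>\<^bsub>HZ\<^esub> ?v k i)" if "q < n" "i < m" for q i
      using coact[OF that] z by (simp add: HZ.pure_mult)
    have "\<delta> (X j r) = (\<Oplus>\<^bsub>HZ\<^esub>q\<in>{..<n}. \<Oplus>\<^bsub>HZ\<^esub>s\<in>{..<n}. e q s \<odot>\<^bsub>HZ\<^esub> (\<delta> (z q j) \<otimes>\<^bsub>HZ\<^esub> \<delta> (z s r)))"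
      unfolding X_def by (simp add: sums coaction_hom hom_smult[OF coaction_hom] alg_hom_mult[OF coaction])
    also have "\<dots> = (\<Oplus>\<^bsub>HZ\<^esub>q\<in>{..<n}. \<Oplus>\<^bsub>HZ\<^esub>s\<in>{..<n}. e q s \<odot>\<^bsub>HZ\<^esub>
        ((\<Oplus>\<^bsub>HZ\<^esub>k\<in>{..<n}. ?u q k \<otimes>\<^bsub>HZ\<^esub> ?v k j) \<otimes>\<^bsub>HZ\<^esub> (\<Oplus>\<^bsub>HZ\<^esub>h\<in>{..<n}. ?u s h \<otimes>\<^bsub>HZ\<^esub> ?v h r)))"
    proof (intro HZ.T.finsum_cong' refl)
      fix q s assume "q \<in> {..<n}" "s \<in> {..<n}"
      then show "e q s \<odot>\<^bsub>HZ\<^esub> (\<delta> (z q j) \<otimes>\<^bsub>HZ\<^esub> \<delta> (z s r)) = e q s \<odot>\<^bsub>HZ\<^esub>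
        ((\<Oplus>\<^bsub>HZ\<^esub>k\<in>{..<n}. ?u q k \<otimes>\<^bsub>HZ\<^esub> ?v k j) \<otimes>\<^bsub>HZ\<^esub> (\<Oplus>\<^bsub>HZ\<^esub>h\<in>{..<n}. ?u s h \<otimes>\<^bsub>HZ\<^esub> ?v h r))"
        using jr by (simp only: D lessThan_iff)
    qed (use z in \<open>auto intro!: HZ.T.finsum_closed HZ.T.smult_closed HZ.TA.m_closed\<close>)
    also have "\<dots> = (\<Oplus>\<^bsub>HZ\<^esub>k\<in>{..<n}. \<Oplus>\<^bsub>HZ\<^esub>h\<in>{..<n}. e k h \<odot>\<^bsub>HZ\<^esub> (?v k j \<otimes>\<^bsub>HZ\<^esub> ?v h r))"
      by (rule HZ.TA.form_compose[where u = ?u and v = ?v,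
            OF _ _ _ H.form_rel_hom[OF HZ.tensor_alg HZ.embed_left a_rel a_closed]])
        (simp_all add: z HZ.pure_mult)
    also have "\<dots> = pure_tensor H Z \<one>\<^bsub>H\<^esub> (X j r)"
      unfolding X_def
      by (simp add: sums HZ.pure_hom_right hom_smult[OF HZ.pure_hom_right] alg_hom_mult[OF HZ.embed_right])
    finally show "\<delta> (X j r) = pure_tensor H Z \<one>\<^bsub>H\<^esub> (X j r)" .
  qed
  then obtain f where "X j r = f j r \<odot>\<^bsub>Z\<^esub> \<one>\<^bsub>Z\<^esub>" if "j < m" "r < m" for j r
    by metis
  then show ?thesis using that[of f] by (simp add: Z.form_rel_def X_def)
qed

text \<open>The entries of \<open>S(a) = E\<^sup>-\<^sup>1 a\<^sup>t E\<close>; the antipode itself is not part of the data of \<open>H\<close>.\<close>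

definition "antipode_entry l k = (\<Oplus>\<^bsub>H\<^esub>p\<in>{..<n}. e' l p \<odot>\<^bsub>H\<^esub> (\<Oplus>\<^bsub>H\<^esub>q\<in>{..<n}. e q k \<odot>\<^bsub>H\<^esub> a q p))"

lemma antipode_entry_closed [simp]: "antipode_entry l k \<in> carrier H"
  unfolding antipode_entry_def by (auto intro!: H.finsum_closed)

text \<open>With \<open>S = e' a\<^sup>t e\<close>:
  \<open>S a = e' (a\<^sup>t e a) = e' e = 1\<close>.\<close>

lemma antipode_left:
  assumes "l < n" "h < n"
  shows "(\<Oplus>\<^bsub>H\<^esub>k\<in>{..<n}. antipode_entry l k \<otimes>\<^bsub>H\<^esub> a k h) = (if l = h then 1 else 0) \<odot>\<^bsub>H\<^esub> \<one>\<^bsub>H\<^esub>"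
proof -
  have "(\<Oplus>\<^bsub>H\<^esub>k\<in>{..<n}. antipode_entry l k \<otimes>\<^bsub>H\<^esub> a k h) =
      (\<Oplus>\<^bsub>H\<^esub>p\<in>{..<n}. e' l p \<odot>\<^bsub>H\<^esub> (\<Oplus>\<^bsub>H\<^esub>k\<in>{..<n}. (\<Oplus>\<^bsub>H\<^esub>q\<in>{..<n}. e q k \<odot>\<^bsub>H\<^esub> a q p) \<otimes>\<^bsub>H\<^esub> a k h))"
    unfolding antipode_entry_def by (rule H.mprod_scalar_left) (auto intro!: H.finsum_closed)
  also have "\<dots> = (\<Oplus>\<^bsub>H\<^esub>p\<in>{..<n}. e' l p \<odot>\<^bsub>H\<^esub> (e p h \<odot>\<^bsub>H\<^esub> \<one>\<^bsub>H\<^esub>))"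
    using a_rel assms
    by (intro H.finsum_cong') (auto simp: H.form_rel_def simp flip: H.bilinear_form_right)
  also have "\<dots> = (\<Sum>p<n. e' l p * e p h) \<odot>\<^bsub>H\<^esub> \<one>\<^bsub>H\<^esub>" by (simp add: H.smult_sum_left H.smult_smult)
  finally show ?thesis using inverse(2)[OF assms] by simp
qed

text \<open>In matrix notation \<open>S e' = e' a\<^sup>t\<close>: the factor \<open>e\<close> at
  the right end of \<open>S = e' a\<^sup>t e\<close> cancels against \<open>e'\<close>. Multiplying
  by \<open>e'\<close> thus turns the action through \<open>S\<close> into one through
  \<open>a\<close>.\<close>

lemma antipode_twist:
  assumes "p < n"
  shows "(\<Oplus>\<^bsub>H\<^esub>k\<in>{..<n}. e' k p \<odot>\<^bsub>H\<^esub> antipode_entry l k) = (\<Oplus>\<^bsub>H\<^esub>s\<in>{..<n}. e' l s \<odot>\<^bsub>H\<^esub> a p s)"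
proof -
  let ?X = "\<lambda>s k. \<Oplus>\<^bsub>H\<^esub>q\<in>{..<n}. e q k \<odot>\<^bsub>H\<^esub> a q s"
  have a: "(\<Oplus>\<^bsub>H\<^esub>k\<in>{..<n}. e' k p \<odot>\<^bsub>H\<^esub> ?X s k) = a p s" for s
    by (rule H.scalar_matrix_cancel[where C = "\<lambda>k q. e q k" and D = "\<lambda>p k. e' k p" and x = "\<lambda>q. a q s", symmetric])
      (use assms inverse(1) in \<open>auto simp: mult.commute[of "e' _ _"]\<close>)
  have "(\<Oplus>\<^bsub>H\<^esub>k\<in>{..<n}. e' k p \<odot>\<^bsub>H\<^esub> antipode_entry l k) =
      (\<Oplus>\<^bsub>H\<^esub>s\<in>{..<n}. e' l s \<odot>\<^bsub>H\<^esub> (\<Oplus>\<^bsub>H\<^esub>k\<in>{..<n}. e' k p \<odot>\<^bsub>H\<^esub> ?X s k))"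
    unfolding antipode_entry_def by (rule H.smult_finsum_swap) (auto intro!: H.finsum_closed)
  then show ?thesis unfolding a .
qed

text \<open>Over \<open>H \<otimes> Z\<close>, the matrix \<open>\<delta> y\<close> is a right
  inverse of \<open>\<delta> z = a z\<close> because \<open>\<delta>\<close> is multiplicative, and
  \<open>y S\<close> is a left inverse by \<open>S a = 1\<close> and \<open>y z = 1\<close>. A left
  and a right inverse coincide.\<close>

lemma coaction_inverse:
  fixes z y :: "nat \<Rightarrow> nat \<Rightarrow> 'z"
  assumes z: "\<And>i j. z i j \<in> carrier Z" and y: "\<And>i j. y i j \<in> carrier Z"
    and coact: "\<And>i j. i < n \<Longrightarrow> j < m \<Longrightarrow> \<delta> (z i j) = (\<Oplus>\<^bsub>HZ\<^esub>l\<in>{..<n}. pure_tensor H Z (a i l) (z l j))"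
    and zy: "\<And>i l. i < n \<Longrightarrow> l < n \<Longrightarrow> (\<Oplus>\<^bsub>Z\<^esub>j\<in>{..<m}. z i j \<otimes>\<^bsub>Z\<^esub> y j l) = (if i = l then 1 else 0) \<odot>\<^bsub>Z\<^esub> \<one>\<^bsub>Z\<^esub>"
    and yz: "\<And>i l. i < m \<Longrightarrow> l < m \<Longrightarrow> (\<Oplus>\<^bsub>Z\<^esub>j\<in>{..<n}. y i j \<otimes>\<^bsub>Z\<^esub> z j l) = (if i = l then 1 else 0) \<odot>\<^bsub>Z\<^esub> \<one>\<^bsub>Z\<^esub>"
    and jk: "j < m" "k < n"
  shows "\<delta> (y j k) = (\<Oplus>\<^bsub>HZ\<^esub>l\<in>{..<n}. pure_tensor H Z (antipode_entry l k) (y j l))"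
proof -
  let ?mp = "\<lambda>n x y i j. \<Oplus>\<^bsub>HZ\<^esub>l\<in>{..<n :: nat}. x i l \<otimes>\<^bsub>HZ\<^esub> y l j"
  let ?I = "\<lambda>i j :: nat. (if i = j then 1 else 0) \<odot>\<^bsub>HZ\<^esub> \<one>\<^bsub>HZ\<^esub>"
  define U where "U i j = pure_tensor H Z (a i j) \<one>\<^bsub>Z\<^esub>" for i j
  define S where "S i j = pure_tensor H Z (antipode_entry i j) \<one>\<^bsub>Z\<^esub>" for i j
  define V where "V i j = pure_tensor H Z \<one>\<^bsub>H\<^esub> (z i j)" for i j
  define Y where "Y i j = pure_tensor H Z \<one>\<^bsub>H\<^esub> (y i j)" for i j
  have U: "U i j \<in> carrier HZ" and S: "S i j \<in> carrier HZ" and V: "V i j \<in> carrier HZ"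
    and Y: "Y i j \<in> carrier HZ" for i j
    using z y by (simp_all add: U_def S_def V_def Y_def)
  have mpc: "?mp r x x' i j \<in> carrier HZ" if "\<And>i j. x i j \<in> carrier HZ" "\<And>i j. x' i j \<in> carrier HZ" for r x x' i j
    using that by (intro HZ.T.finsum_closed) auto
  have D: "\<delta> (z i p) = ?mp n U V i p" if "i < n" "p < m" for i p
    using coact[OF that] z by (simp add: HZ.pure_mult U_def V_def)
  have SU: "?mp n S U l h = ?I l h" if "l < n" "h < n" for l h
  proof -
    have "?mp n S U l h = pure_tensor H Z (\<Oplus>\<^bsub>H\<^esub>k\<in>{..<n}. antipode_entry l k \<otimes>\<^bsub>H\<^esub> a k h) \<one>\<^bsub>Z\<^esub>"
      unfolding S_def U_def
      by (simp add: hom_finsum[OF H.k_module_axioms HZ.tensor_module HZ.pure_hom_left] HZ.pure_mult)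
    then show ?thesis unfolding antipode_left[OF that] by (simp add: HZ.pure_smult_left HZ.tensor_one)
  qed
  have YV: "?mp n Y V i p = ?I i p" if "i < m" "p < m" for i p
  proof -
    have "?mp n Y V i p = pure_tensor H Z \<one>\<^bsub>H\<^esub> (\<Oplus>\<^bsub>Z\<^esub>k\<in>{..<n}. y i k \<otimes>\<^bsub>Z\<^esub> z k p)"
      unfolding Y_def V_def using y z
      by (simp add: hom_finsum[OF Z.k_module_axioms HZ.tensor_module HZ.pure_hom_right] HZ.pure_mult)
    then show ?thesis unfolding yz[OF that] by (simp add: HZ.pure_smult_right HZ.tensor_one)
  qed
  have Dy: "?mp m (\<lambda>i j. \<delta> (z i j)) (\<lambda>i j. \<delta> (y i j)) i l = ?I i l" if "i < n" "l < n" for i l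
  proof -
    have "?mp m (\<lambda>i j. \<delta> (z i j)) (\<lambda>i j. \<delta> (y i j)) i l = \<delta> (\<Oplus>\<^bsub>Z\<^esub>k\<in>{..<m}. z i k \<otimes>\<^bsub>Z\<^esub> y k l)"
      using y z by (simp add: hom_finsum[OF Z.k_module_axioms HZ.tensor_module coaction_hom] alg_hom_mult[OF coaction])
    then show ?thesis unfolding zy[OF that] by (simp add: hom_smult[OF coaction_hom] alg_hom_one[OF coaction])
  qed
  define B where "B = (\<lambda>j k. ?mp n Y S j k)"
  have B: "B j k \<in> carrier HZ" for j k unfolding B_def by (rule mpc[OF Y S])
  have dz: "\<delta> (z i j) \<in> carrier HZ" and dy: "\<delta> (y i j) \<in> carrier HZ" for i j using z y by auto
  have BD: "?mp n B (\<lambda>i j. \<delta> (z i j)) i p = ?I i p" if ip: "i < m" "p < m" for i p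
  proof -
    have "?mp n B (\<lambda>i j. \<delta> (z i j)) i p = ?mp n B (\<lambda>i j. ?mp n U V i j) i p"
      by (rule HZ.TA.mprod_cong) (use ip D B mpc[OF U V] in auto)
    also have "\<dots> = ?mp n Y (\<lambda>i j. ?mp n S (\<lambda>i j. ?mp n U V i j) i j) i p"
      unfolding B_def by (rule HZ.TA.mprod_assoc[OF Y S mpc[OF U V]])
    also have "\<dots> = ?mp n Y V i p"
    proof (rule HZ.TA.mprod_cong)
      fix l assume l: "l < n"
      have "?mp n S (\<lambda>i j. ?mp n U V i j) l p = ?mp n (\<lambda>i j. ?mp n S U i j) V l p"
        by (rule HZ.TA.mprod_assoc[OF S U V, symmetric])
      also have "\<dots> = ?mp n ?I V l p"
        by (rule HZ.TA.mprod_cong) (use l SU V in auto)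
      also have "\<dots> = V l p" by (rule HZ.TA.mprod_id(1)[where x = V, OF V l])
      finally show "?mp n S (\<lambda>i j. ?mp n U V i j) l p = V l p" .
    qed (use Y V in auto)
    finally show ?thesis unfolding YV[OF ip] .
  qed
  have "\<delta> (y j k) = ?mp m ?I (\<lambda>i j. \<delta> (y i j)) j k"
    by (rule HZ.TA.mprod_id(1)[where x = "\<lambda>i j. \<delta> (y i j)", OF dy jk(1), symmetric])
  also have "\<dots> = ?mp m (\<lambda>i j. ?mp n B (\<lambda>i j. \<delta> (z i j)) i j) (\<lambda>i j. \<delta> (y i j)) j k"
    by (rule HZ.TA.mprod_cong) (use jk BD dy mpc[OF B dz] in auto)
  also have "\<dots> = ?mp n B (\<lambda>i j. ?mp m (\<lambda>i j. \<delta> (z i j)) (\<lambda>i j. \<delta> (y i j)) i j) j k"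
    by (rule HZ.TA.mprod_assoc[OF B dz dy])
  also have "\<dots> = ?mp n B ?I j k"
    by (rule HZ.TA.mprod_cong) (use jk Dy B in auto)
  also have "\<dots> = B j k" by (rule HZ.TA.mprod_id(2)[where x = B, OF B jk(2)])
  also have "\<dots> = (\<Oplus>\<^bsub>HZ\<^esub>l\<in>{..<n}. pure_tensor H Z (antipode_entry l k) (y j l))"
    using y by (simp add: B_def Y_def S_def HZ.pure_mult)
  finally show ?thesis .
qed

text \<open>\<open>\<delta> (y e') = y S e' = y e' a\<^sup>t\<close>. Read row by row, the transpose
  on \<open>a\<close> makes this the equation for membership in \<open>W\<close>.\<close>

lemma coaction_row:
  fixes y :: "nat \<Rightarrow> nat \<Rightarrow> 'z"
  assumes y: "\<And>i j. y i j \<in> carrier Z"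
    and coact: "\<And>k. k < n \<Longrightarrow> \<delta> (y j k) = (\<Oplus>\<^bsub>HZ\<^esub>l\<in>{..<n}. pure_tensor H Z (antipode_entry l k) (y j l))"
    and p: "p < n"
  shows "\<delta> (\<Oplus>\<^bsub>Z\<^esub>k\<in>{..<n}. e' k p \<odot>\<^bsub>Z\<^esub> y j k) =
    (\<Oplus>\<^bsub>HZ\<^esub>s\<in>{..<n}. pure_tensor H Z (a p s) (\<Oplus>\<^bsub>Z\<^esub>k\<in>{..<n}. e' k s \<odot>\<^bsub>Z\<^esub> y j k))"
proof -
  note hs = hom_finsum[OF Z.k_module_axioms HZ.tensor_module]
    hom_finsum[OF H.k_module_axioms HZ.tensor_module HZ.pure_hom_left]
  have "\<delta> (\<Oplus>\<^bsub>Z\<^esub>k\<in>{..<n}. e' k p \<odot>\<^bsub>Z\<^esub> y j k) = (\<Oplus>\<^bsub>HZ\<^esub>k\<in>{..<n}. e' k p \<odot>\<^bsub>HZ\<^esub> \<delta> (y j k))"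
    using y by (simp add: hs coaction_hom hom_smult[OF coaction_hom])
  also have "\<dots> = (\<Oplus>\<^bsub>HZ\<^esub>k\<in>{..<n}. e' k p \<odot>\<^bsub>HZ\<^esub> (\<Oplus>\<^bsub>HZ\<^esub>l\<in>{..<n}. pure_tensor H Z (antipode_entry l k) (y j l)))"
    by (intro HZ.T.finsum_cong') (use coact y in \<open>auto intro!: HZ.T.finsum_closed HZ.T.smult_closed\<close>)
  also have "\<dots> = (\<Oplus>\<^bsub>HZ\<^esub>k\<in>{..<n}. \<Oplus>\<^bsub>HZ\<^esub>l\<in>{..<n}. pure_tensor H Z (e' k p \<odot>\<^bsub>H\<^esub> antipode_entry l k) (y j l))"
    using y by (simp add: HZ.T.finsum_smult HZ.pure_smult_left Pi_def)
  also have "\<dots> = (\<Oplus>\<^bsub>HZ\<^esub>l\<in>{..<n}. \<Oplus>\<^bsub>HZ\<^esub>k\<in>{..<n}. pure_tensor H Z (e' k p \<odot>\<^bsub>H\<^esub> antipode_entry l k) (y j l))"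
    using y by (intro HZ.T.finsum_swap) auto
  also have "\<dots> = (\<Oplus>\<^bsub>HZ\<^esub>l\<in>{..<n}. pure_tensor H Z (\<Oplus>\<^bsub>H\<^esub>k\<in>{..<n}. e' k p \<odot>\<^bsub>H\<^esub> antipode_entry l k) (y j l))"
    using y by (simp add: hs)
  also have "\<dots> = (\<Oplus>\<^bsub>HZ\<^esub>l\<in>{..<n}. \<Oplus>\<^bsub>HZ\<^esub>s\<in>{..<n}. pure_tensor H Z (e' l s \<odot>\<^bsub>H\<^esub> a p s) (y j l))"
    unfolding antipode_twist[OF p] using y by (simp add: hs)
  also have "\<dots> = (\<Oplus>\<^bsub>HZ\<^esub>s\<in>{..<n}. \<Oplus>\<^bsub>HZ\<^esub>l\<in>{..<n}. pure_tensor H Z (e' l s \<odot>\<^bsub>H\<^esub> a p s) (y j l))"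
    using y by (intro HZ.T.finsum_swap) auto
  also have "\<dots> = (\<Oplus>\<^bsub>HZ\<^esub>s\<in>{..<n}. pure_tensor H Z (a p s) (\<Oplus>\<^bsub>Z\<^esub>k\<in>{..<n}. e' k s \<odot>\<^bsub>Z\<^esub> y j k))"
    using y by (simp add: hs HZ.pure_hom_right HZ.pure_smult_left HZ.pure_smult_right)
  finally show ?thesis .
qed

lemma inverse_pair_exists:
  obtains m f f' z y where "inverse_pair Z n m e e' f f' z y"
    "\<And>i j. i < n \<Longrightarrow> j < m \<Longrightarrow> \<delta> (z i j) = (\<Oplus>\<^bsub>HZ\<^esub>l\<in>{..<n}. pure_tensor H Z (a i l) (z l j))"
proof (rule galois_basis)
  fix m :: nat and z y :: "nat \<Rightarrow> nat \<Rightarrow> 'z"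
  assume z: "\<And>i j. z i j \<in> carrier Z" and y: "\<And>i j. y i j \<in> carrier Z"
    and coact: "\<And>i j. i < n \<Longrightarrow> j < m \<Longrightarrow> \<delta> (z i j) = (\<Oplus>\<^bsub>HZ\<^esub>l\<in>{..<n}. pure_tensor H Z (a i l) (z l j))"
    and zy: "\<And>i l. i < n \<Longrightarrow> l < n \<Longrightarrow> (\<Oplus>\<^bsub>Z\<^esub>j\<in>{..<m}. z i j \<otimes>\<^bsub>Z\<^esub> y j l) = (if i = l then 1 else 0) \<odot>\<^bsub>Z\<^esub> \<one>\<^bsub>Z\<^esub>"
    and indep: "\<And>\<zeta> j. (\<And>j. \<zeta> j \<in> carrier Z) \<Longrightarrow> (\<And>i. i < n \<Longrightarrow> (\<Oplus>\<^bsub>Z\<^esub>j\<in>{..<m}. z i j \<otimes>\<^bsub>Z\<^esub> \<zeta> j) = \<zero>\<^bsub>Z\<^esub>) \<Longrightarrow>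
      j < m \<Longrightarrow> \<zeta> j = \<zero>\<^bsub>Z\<^esub>"
    and gen: "\<And>x. (\<And>i. x i \<in> carrier Z) \<Longrightarrow>
      (\<And>i. i < n \<Longrightarrow> \<delta> (x i) = (\<Oplus>\<^bsub>HZ\<^esub>l\<in>{..<n}. pure_tensor H Z (a i l) (x l))) \<Longrightarrow>
      \<exists>c. \<forall>i<n. x i = (\<Oplus>\<^bsub>Z\<^esub>j\<in>{..<m}. c j \<odot>\<^bsub>Z\<^esub> z i j)"
  have yz: "(\<Oplus>\<^bsub>Z\<^esub>l\<in>{..<n}. y i l \<otimes>\<^bsub>Z\<^esub> z l j) = (if i = j then 1 else 0) \<odot>\<^bsub>Z\<^esub> \<one>\<^bsub>Z\<^esub>" if "i < m" "j < m" for i j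
  proof (rule left_inverse_from_right[where z = z and y = y and m = m, OF z y zy _ that])
    show "\<zeta> j = \<zero>\<^bsub>Z\<^esub>" if "\<And>j. \<zeta> j \<in> carrier Z"
      "\<And>i. i < n \<Longrightarrow> (\<Oplus>\<^bsub>Z\<^esub>j\<in>{..<m}. z i j \<otimes>\<^bsub>Z\<^esub> \<zeta> j) = \<zero>\<^bsub>Z\<^esub>" "j < m" for \<zeta> j
      using that by (rule indep)
  qed
  obtain f where f: "Z.form_rel n m e f z"
    by (rule form_scalar[where z = z and m = m, OF z coact])
  have "\<exists>c. \<forall>p<n. (\<Oplus>\<^bsub>Z\<^esub>k\<in>{..<n}. e' k p \<odot>\<^bsub>Z\<^esub> y j k) = (\<Oplus>\<^bsub>Z\<^esub>q\<in>{..<m}. c q \<odot>\<^bsub>Z\<^esub> z p q)" if j: "j < m" for j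
  proof (rule gen)
    show "(\<Oplus>\<^bsub>Z\<^esub>k\<in>{..<n}. e' k p \<odot>\<^bsub>Z\<^esub> y j k) \<in> carrier Z" for p using y by (intro Z.finsum_closed) auto
    show "\<delta> (\<Oplus>\<^bsub>Z\<^esub>k\<in>{..<n}. e' k p \<odot>\<^bsub>Z\<^esub> y j k) =
        (\<Oplus>\<^bsub>HZ\<^esub>s\<in>{..<n}. pure_tensor H Z (a p s) (\<Oplus>\<^bsub>Z\<^esub>k\<in>{..<n}. e' k s \<odot>\<^bsub>Z\<^esub> y j k))" if "p < n" for p
      by (rule coaction_row[where y = y, OF y coaction_inverse[where z = z and m = m, OF z y coact zy yz j] that])
  qed
  then obtain f' where f': "(\<Oplus>\<^bsub>Z\<^esub>k\<in>{..<n}. e' k p \<odot>\<^bsub>Z\<^esub> y j k) = (\<Oplus>\<^bsub>Z\<^esub>q\<in>{..<m}. f' j q \<odot>\<^bsub>Z\<^esub> z p q)"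
    if "j < m" "p < n" for j p by metis
  have "inverse_pair Z n m e e' f f' z y"
    by (rule inverse_pair.intro[OF Z_alg inverse_pair_axioms.intro])
      (rule z, rule y, rule zy, assumption+, rule yz, assumption+, rule f, rule f', assumption+,
        rule inverse(1), assumption+, rule inverse(2), assumption+, rule scalar_inj, assumption)
  then show thesis using coact by (rule that)
qed

end

section \<open>Comparison of algebras over a Galois object\<close>

text \<open>Multiplicativity is bilinear in the two arguments, so it is checked on pure tensors, one
  argument at a time.\<close>

lemma tensor_map_alg_hom:
  assumes "k_alg A" "k_alg B" "k_alg C" "k_alg D" and f: "f \<in> alg_hom A C" and g: "g \<in> alg_hom B D"
  shows "tensor_map C D f g \<in> alg_hom (tensor A B) (tensor C D)"
proof -
  interpret A: k_alg A by fact
  interpret B: k_alg B by fact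
  interpret C: k_alg C by fact
  interpret D: k_alg D by fact
  interpret AB: two_algs A B ..
  interpret CD: two_algs C D ..
  note mods = A.k_module_axioms B.k_module_axioms C.k_module_axioms D.k_module_axioms
  note fl = alg_hom_linear[OF f] and gl = alg_hom_linear[OF g]
  note h = tensor_map_hom[OF mods fl gl] and p = tensor_map_pure[OF mods fl gl]
  have fc: "f x \<in> carrier C" if "x \<in> carrier A" for x using hom_closed[OF fl that] .
  have gc: "g x \<in> carrier D" if "x \<in> carrier B" for x using hom_closed[OF gl that] .
  have 1: "tensor_map C D f g (pure_tensor A B x y \<otimes>\<^bsub>tensor A B\<^esub> t) =
      tensor_map C D f g (pure_tensor A B x y) \<otimes>\<^bsub>tensor C D\<^esub> tensor_map C D f g t"
    if xy: "x \<in> carrier A" "y \<in> carrier B" and t: "t \<in> carrier (tensor A B)" for x y t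
    by (rule AB.tensor_hom_eq[OF hom_compose[OF AB.TA.mult_hom_left[OF AB.pure_closed[OF xy]] h]
          hom_compose[OF h CD.TA.mult_hom_left] _ t])
      (simp_all add: xy p AB.pure_mult CD.pure_mult fc gc alg_hom_mult[OF f] alg_hom_mult[OF g])
  have 2: "tensor_map C D f g (s \<otimes>\<^bsub>tensor A B\<^esub> t) =
      tensor_map C D f g s \<otimes>\<^bsub>tensor C D\<^esub> tensor_map C D f g t"
    if s: "s \<in> carrier (tensor A B)" and t: "t \<in> carrier (tensor A B)" for s t
    by (rule AB.tensor_hom_eq[OF hom_compose[OF AB.TA.mult_hom_right[OF t] h]
          hom_compose[OF h CD.TA.mult_hom_right] _ s])
      (simp_all add: t 1 hom_closed[OF h])
  show ?thesis
    unfolding alg_hom_iff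
    by (simp add: h 2 AB.tensor_one CD.tensor_one p alg_hom_one[OF f] alg_hom_one[OF g])
qed

lemma alg_hom_compose:
  "f \<in> alg_hom A B \<Longrightarrow> g \<in> alg_hom B C \<Longrightarrow> (\<lambda>x. g (f x)) \<in> alg_hom A C"
  by (auto simp: alg_hom_iff hom_closed intro: hom_compose)

lemma alg_hom_inverse:
  assumes "k_alg A" "k_alg B" and f: "f \<in> alg_hom A B" and bij: "bij_betw f (carrier A) (carrier B)"
  shows "inv_into (carrier A) f \<in> alg_hom B A"
proof -
  interpret A: k_alg A by fact
  interpret B: k_alg B by fact
  note fl = alg_hom_linear[OF f]
  let ?g = "inv_into (carrier A) f"
  have fg: "f (?g x) = x" if "x \<in> carrier B" for x
    using that bij by (simp add: bij_betw_def f_inv_into_f)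
  have gf: "?g (f x) = x" if "x \<in> carrier A" for x
    using that bij by (simp add: bij_betw_def)
  have gc: "?g x \<in> carrier A" if "x \<in> carrier B" for x
    using that bij by (metis bij_betw_def inv_into_into)
  have add: "?g (x \<oplus>\<^bsub>B\<^esub> y) = ?g x \<oplus>\<^bsub>A\<^esub> ?g y" if "x \<in> carrier B" "y \<in> carrier B" for x y
    using gf[of "?g x \<oplus>\<^bsub>A\<^esub> ?g y"] that by (simp add: hom_add[OF fl] fg gc)
  have mult: "?g (x \<otimes>\<^bsub>B\<^esub> y) = ?g x \<otimes>\<^bsub>A\<^esub> ?g y" if "x \<in> carrier B" "y \<in> carrier B" for x y
    using gf[of "?g x \<otimes>\<^bsub>A\<^esub> ?g y"] that by (simp add: alg_hom_mult[OF f] fg gc)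
  have smult: "?g (c \<odot>\<^bsub>B\<^esub> x) = c \<odot>\<^bsub>A\<^esub> ?g x" if "x \<in> carrier B" for c x
    using gf[of "c \<odot>\<^bsub>A\<^esub> ?g x"] that by (simp add: hom_smult[OF fl] fg gc)
  have "?g \<one>\<^bsub>B\<^esub> = \<one>\<^bsub>A\<^esub>" using gf[OF A.one_closed] by (simp add: alg_hom_one[OF f])
  then show ?thesis by (simp add: alg_hom_iff module_hom_iff gc add mult smult)
qed

text \<open>Here \<open>A\<close> plays the role of \<open>B(E, F)\<close> with generators
  \<open>u\<close>, \<open>g\<close> is the comparison map \<open>u \<mapsto> z\<close>, and
  \<open>\<kappa>\<close> the map into \<open>A \<otimes> Z\<^sup>o\<^sup>p\<close>. The
  presentations of \<open>H\<close> and \<open>A\<close> are visible only through their induction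
  principles and through the existence of these maps.\<close>

locale comparison = galois H Z \<delta> n e e' a + A: k_alg A
  for H :: "('k::comm_ring_1, 'h, 'x) hopf_scheme" and Z :: "('k, 'z, 'y) module_scheme"
    and \<delta> n e e' a and A :: "('k, 'b, 'w) module_scheme" +
  fixes m :: nat and z y :: "nat \<Rightarrow> nat \<Rightarrow> 'z" and u :: "nat \<Rightarrow> nat \<Rightarrow> 'b"
    and g :: "'b \<Rightarrow> 'z" and \<kappa> :: "'h \<Rightarrow> ('b \<times> 'z \<Rightarrow>\<^sub>0 'k) set"
  assumes z [simp]: "\<And>i j. z i j \<in> carrier Z" and y [simp]: "\<And>i j. y i j \<in> carrier Z"
    and u [simp]: "\<And>i j. u i j \<in> carrier A"
    and zy: "\<And>i l. i < n \<Longrightarrow> l < n \<Longrightarrow> (\<Oplus>\<^bsub>Z\<^esub>j\<in>{..<m}. z i j \<otimes>\<^bsub>Z\<^esub> y j l) = (if i = l then 1 else 0) \<odot>\<^bsub>Z\<^esub> \<one>\<^bsub>Z\<^esub>"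
    and yz: "\<And>i l. i < m \<Longrightarrow> l < m \<Longrightarrow> (\<Oplus>\<^bsub>Z\<^esub>j\<in>{..<n}. y i j \<otimes>\<^bsub>Z\<^esub> z j l) = (if i = l then 1 else 0) \<odot>\<^bsub>Z\<^esub> \<one>\<^bsub>Z\<^esub>"
    and coact: "\<And>i j. i < n \<Longrightarrow> j < m \<Longrightarrow> \<delta> (z i j) = (\<Oplus>\<^bsub>HZ\<^esub>l\<in>{..<n}. pure_tensor H Z (a i l) (z l j))"
    and H_induct: "\<And>Q t. t \<in> carrier H \<Longrightarrow> Q \<one>\<^bsub>H\<^esub> \<Longrightarrow>
      (\<And>s i j. s \<in> carrier H \<Longrightarrow> i < n \<Longrightarrow> j < n \<Longrightarrow> Q s \<Longrightarrow> Q (s \<otimes>\<^bsub>H\<^esub> a i j)) \<Longrightarrow>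
      (\<And>s t. s \<in> carrier H \<Longrightarrow> t \<in> carrier H \<Longrightarrow> Q s \<Longrightarrow> Q t \<Longrightarrow> Q (s \<oplus>\<^bsub>H\<^esub> t)) \<Longrightarrow>
      (\<And>c s. s \<in> carrier H \<Longrightarrow> Q s \<Longrightarrow> Q (c \<odot>\<^bsub>H\<^esub> s)) \<Longrightarrow> Q t"
    and A_induct: "\<And>Q t. t \<in> carrier A \<Longrightarrow> Q \<one>\<^bsub>A\<^esub> \<Longrightarrow>
      (\<And>s i j. s \<in> carrier A \<Longrightarrow> i < n \<Longrightarrow> j < m \<Longrightarrow> Q s \<Longrightarrow> Q (s \<otimes>\<^bsub>A\<^esub> u i j)) \<Longrightarrow>
      (\<And>s t. s \<in> carrier A \<Longrightarrow> t \<in> carrier A \<Longrightarrow> Q s \<Longrightarrow> Q t \<Longrightarrow> Q (s \<oplus>\<^bsub>A\<^esub> t)) \<Longrightarrow>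
      (\<And>c s. s \<in> carrier A \<Longrightarrow> Q s \<Longrightarrow> Q (c \<odot>\<^bsub>A\<^esub> s)) \<Longrightarrow> Q t"
    and g: "g \<in> alg_hom A Z" and g_u: "\<And>i j. i < n \<Longrightarrow> j < m \<Longrightarrow> g (u i j) = z i j"
    and \<kappa>: "\<kappa> \<in> alg_hom H (tensor A (op_alg Z))"
    and \<kappa>_a: "\<And>i j. i < n \<Longrightarrow> j < n \<Longrightarrow>
      \<kappa> (a i j) = (\<Oplus>\<^bsub>tensor A (op_alg Z)\<^esub>k\<in>{..<m}. pure_tensor A (op_alg Z) (u i k) (y k j))"
begin

sublocale AZ: two_algs A Z ..
sublocale O: k_alg "op_alg Z" by (rule op_k_alg[OF Z_alg])
sublocale AO: two_algs A "op_alg Z" ..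

lemma g_hom: "g \<in> module_hom class_ring A Z"
  by (rule alg_hom_linear[OF g])

lemma g_closed [simp]: "x \<in> carrier A \<Longrightarrow> g x \<in> carrier Z"
  by (rule hom_closed[OF g_hom])

definition "\<Phi> t = can (tensor_map Z Z g (\<lambda>z. z) t)"

lemma Phi_hom: "\<Phi> \<in> module_hom class_ring (tensor A Z) HZ"
  unfolding \<Phi>_def
  by (rule hom_compose[OF tensor_map_hom[OF A.k_module_axioms Z.k_module_axioms Z.k_module_axioms
          Z.k_module_axioms g_hom hom_id] can_hom])

lemma Phi_pure: "x \<in> carrier A \<Longrightarrow> w \<in> carrier Z \<Longrightarrow>
    \<Phi> (pure_tensor A Z x w) = \<delta> (g x) \<otimes>\<^bsub>HZ\<^esub> pure_tensor H Z \<one>\<^bsub>H\<^esub> w"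
  unfolding \<Phi>_def
  by (simp add: tensor_map_pure[OF A.k_module_axioms Z.k_module_axioms Z.k_module_axioms
        Z.k_module_axioms g_hom hom_id] can_pure)

abbreviation "I \<equiv> \<Phi> ` carrier (tensor A Z)"

lemma I_submodule: "LinearCombinations.submodule class_ring I HZ"
  by (rule hom_image_submodule[OF AZ.tensor_module HZ.tensor_module Phi_hom])

lemma I_add: "s \<in> I \<Longrightarrow> t \<in> I \<Longrightarrow> s \<oplus>\<^bsub>HZ\<^esub> t \<in> I"
  using I_submodule unfolding HZ.T.submodule_def' by blast

lemma I_smult: "s \<in> I \<Longrightarrow> c \<odot>\<^bsub>HZ\<^esub> s \<in> I"
  using I_submodule unfolding HZ.T.submodule_def' by blast

text \<open>\<open>\<Phi>\<close> carries left multiplication by \<open>s\<close> on the factor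
  \<open>A\<close> to left multiplication by \<open>\<delta> (g s)\<close>, as
  \<open>\<delta>\<close> and \<open>g\<close> are multiplicative.\<close>

lemma I_left_mult:
  assumes s: "s \<in> carrier A" and t: "t \<in> I"
  shows "\<delta> (g s) \<otimes>\<^bsub>HZ\<^esub> t \<in> I"
proof -
  obtain t' where t': "t' \<in> carrier (tensor A Z)" "t = \<Phi> t'" using t by blast
  note mods = A.k_module_axioms Z.k_module_axioms
  note mh = tensor_map_hom[OF mods mods A.mult_hom_left[OF s] hom_id]
  have "\<Phi> (tensor_map A Z ((\<otimes>\<^bsub>A\<^esub>) s) (\<lambda>z. z) t') = \<delta> (g s) \<otimes>\<^bsub>HZ\<^esub> \<Phi> t'"
    by (rule AZ.tensor_hom_eq[OF hom_compose[OF mh Phi_hom] hom_compose[OF Phi_hom HZ.TA.mult_hom_left] _ t'(1)])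
      (simp_all add: s Phi_pure tensor_map_pure[OF mods mods A.mult_hom_left[OF s] hom_id]
        alg_hom_mult[OF g] alg_hom_mult[OF coaction] HZ.TA.m_assoc)
  then show ?thesis using hom_closed[OF mh t'(1)] t'(2) by (metis imageI)
qed

text \<open>Multiplying \<open>\<delta> z = a z\<close> by \<open>h \<otimes> y w\<close> puts
  \<open>z y = 1\<close> into the second factor, so only \<open>a h \<otimes> w\<close> remains.
  This exhibits a generator times \<open>h\<close> as a combination of terms already
  reached.\<close>

lemma coefficient_left:
  assumes ij: "i < n" "j < n" and h: "h \<in> carrier H" and w: "w \<in> carrier Z"
  shows "(\<Oplus>\<^bsub>HZ\<^esub>k\<in>{..<m}. \<delta> (z i k) \<otimes>\<^bsub>HZ\<^esub> pure_tensor H Z h (y k j \<otimes>\<^bsub>Z\<^esub> w)) =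
    pure_tensor H Z (a i j \<otimes>\<^bsub>H\<^esub> h) w"
proof -
  have "(\<Oplus>\<^bsub>HZ\<^esub>k\<in>{..<m}. \<delta> (z i k) \<otimes>\<^bsub>HZ\<^esub> pure_tensor H Z h (y k j \<otimes>\<^bsub>Z\<^esub> w)) =
      (\<Oplus>\<^bsub>HZ\<^esub>k\<in>{..<m}. \<Oplus>\<^bsub>HZ\<^esub>l\<in>{..<n}. pure_tensor H Z (a i l \<otimes>\<^bsub>H\<^esub> h) ((z l k \<otimes>\<^bsub>Z\<^esub> y k j) \<otimes>\<^bsub>Z\<^esub> w))"
  proof (intro HZ.T.finsum_cong' refl)
    fix k assume "k \<in> {..<m}"
    then have k: "k < m" by simp
    show "\<delta> (z i k) \<otimes>\<^bsub>HZ\<^esub> pure_tensor H Z h (y k j \<otimes>\<^bsub>Z\<^esub> w) =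
        (\<Oplus>\<^bsub>HZ\<^esub>l\<in>{..<n}. pure_tensor H Z (a i l \<otimes>\<^bsub>H\<^esub> h) ((z l k \<otimes>\<^bsub>Z\<^esub> y k j) \<otimes>\<^bsub>Z\<^esub> w))"
      unfolding coact[OF ij(1) k] using h w
      by (simp add: HZ.TA.mult_finsum_right HZ.pure_mult Z.m_assoc)
  qed (use h w in \<open>auto intro!: HZ.T.finsum_closed\<close>)
  also have "\<dots> = (\<Oplus>\<^bsub>HZ\<^esub>l\<in>{..<n}. \<Oplus>\<^bsub>HZ\<^esub>k\<in>{..<m}. pure_tensor H Z (a i l \<otimes>\<^bsub>H\<^esub> h) ((z l k \<otimes>\<^bsub>Z\<^esub> y k j) \<otimes>\<^bsub>Z\<^esub> w))"
    using h w by (intro HZ.T.finsum_swap) auto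
  also have "\<dots> = (\<Oplus>\<^bsub>HZ\<^esub>l\<in>{..<n}. (if l = j then 1 else 0) \<odot>\<^bsub>HZ\<^esub> pure_tensor H Z (a i l \<otimes>\<^bsub>H\<^esub> h) w)"
  proof (intro HZ.T.finsum_cong' refl)
    fix l assume "l \<in> {..<n}"
    then have l: "l < n" by simp
    have "(\<Oplus>\<^bsub>HZ\<^esub>k\<in>{..<m}. pure_tensor H Z (a i l \<otimes>\<^bsub>H\<^esub> h) ((z l k \<otimes>\<^bsub>Z\<^esub> y k j) \<otimes>\<^bsub>Z\<^esub> w)) =
        pure_tensor H Z (a i l \<otimes>\<^bsub>H\<^esub> h) ((\<Oplus>\<^bsub>Z\<^esub>k\<in>{..<m}. z l k \<otimes>\<^bsub>Z\<^esub> y k j) \<otimes>\<^bsub>Z\<^esub> w)"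
      using h w
      by (simp add: Z.mult_finsum_right hom_finsum[OF Z.k_module_axioms HZ.tensor_module HZ.pure_hom_right])
    also have "\<dots> = (if l = j then 1 else 0) \<odot>\<^bsub>HZ\<^esub> pure_tensor H Z (a i l \<otimes>\<^bsub>H\<^esub> h) w"
      unfolding zy[OF l ij(2)] using h w by (simp add: Z.smult_mult_left HZ.pure_smult_right)
    finally show "(\<Oplus>\<^bsub>HZ\<^esub>k\<in>{..<m}. pure_tensor H Z (a i l \<otimes>\<^bsub>H\<^esub> h) ((z l k \<otimes>\<^bsub>Z\<^esub> y k j) \<otimes>\<^bsub>Z\<^esub> w)) =
        (if l = j then 1 else 0) \<odot>\<^bsub>HZ\<^esub> pure_tensor H Z (a i l \<otimes>\<^bsub>H\<^esub> h) w" .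
  qed (use h w in auto)
  also have "\<dots> = pure_tensor H Z (a i j \<otimes>\<^bsub>H\<^esub> h) w"
    using h w ij by (intro HZ.T.finsum_delta(2)) auto
  finally show ?thesis .
qed

text \<open>\<open>I\<close> is stable under left multiplication by \<open>\<delta> (g s)\<close> only, so the induction has to multiply
  the generators from the left.\<close>

lemma pure_in_I:
  assumes "h \<in> carrier H" "w \<in> carrier Z"
  shows "pure_tensor H Z h w \<in> I"
proof -
  define Q where "Q h \<longleftrightarrow> (\<forall>w\<in>carrier Z. pure_tensor H Z h w \<in> I)" for h
  have one: "Q \<one>\<^bsub>H\<^esub>"
    unfolding Q_def
  proof
    fix w assume w: "w \<in> carrier Z"
    have "\<Phi> (pure_tensor A Z \<one>\<^bsub>A\<^esub> w) = pure_tensor H Z \<one>\<^bsub>H\<^esub> w"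
      using w by (simp add: Phi_pure alg_hom_one[OF g] alg_hom_one[OF coaction])
    then show "pure_tensor H Z \<one>\<^bsub>H\<^esub> w \<in> I" using w by (metis AZ.pure_closed A.one_closed imageI)
  qed
  have gen: "Q (a i j \<otimes>\<^bsub>H\<^esub> h)" if "i < n" "j < n" "h \<in> carrier H" "Q h" for i j h
    unfolding Q_def
  proof
    fix w assume w: "w \<in> carrier Z"
    have "\<delta> (z i k) \<otimes>\<^bsub>HZ\<^esub> pure_tensor H Z h (y k j \<otimes>\<^bsub>Z\<^esub> w) \<in> I" if k: "k < m" for k
      using I_left_mult[OF u, of "pure_tensor H Z h (y k j \<otimes>\<^bsub>Z\<^esub> w)" i k] g_u[OF \<open>i < n\<close> k] \<open>Q h\<close> w
      by (simp add: Q_def)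
    then have "(\<Oplus>\<^bsub>HZ\<^esub>k\<in>{..<m}. \<delta> (z i k) \<otimes>\<^bsub>HZ\<^esub> pure_tensor H Z h (y k j \<otimes>\<^bsub>Z\<^esub> w)) \<in> I"
      by (intro HZ.T.submodule_finsum[OF I_submodule]) simp_all
    then show "pure_tensor H Z (a i j \<otimes>\<^bsub>H\<^esub> h) w \<in> I" unfolding coefficient_left[OF that(1-3) w] .
  qed
  have add: "Q (s \<oplus>\<^bsub>H\<^esub> t)" if "s \<in> carrier H" "t \<in> carrier H" "Q s" "Q t" for s t
    using that unfolding Q_def by (simp add: HZ.pure_add_left I_add)
  have smult: "Q (c \<odot>\<^bsub>H\<^esub> s)" if "s \<in> carrier H" "Q s" for c s
    using that unfolding Q_def by (simp add: HZ.pure_smult_left I_smult)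
  \<comment> \<open>The induction principle appends generators on the right. With an arbitrary
    \<open>h'\<close> behind \<open>h\<close>, an appended generator becomes one multiplied onto
    \<open>h'\<close> from the left.\<close>
  have "\<forall>h'\<in>carrier H. Q h' \<longrightarrow> Q (h \<otimes>\<^bsub>H\<^esub> h')"
  proof (rule H_induct[OF assms(1), where Q = "\<lambda>h. \<forall>h'\<in>carrier H. Q h' \<longrightarrow> Q (h \<otimes>\<^bsub>H\<^esub> h')"])
    fix s i j assume s: "s \<in> carrier H" and ij: "i < n" "j < n"
      and IH: "\<forall>h'\<in>carrier H. Q h' \<longrightarrow> Q (s \<otimes>\<^bsub>H\<^esub> h')"
    show "\<forall>h'\<in>carrier H. Q h' \<longrightarrow> Q ((s \<otimes>\<^bsub>H\<^esub> a i j) \<otimes>\<^bsub>H\<^esub> h')"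
      using IH gen[OF ij] s by (simp add: H.m_assoc)
  qed (simp_all add: H.l_distr H.smult_mult_left add smult)
  then have "Q (h \<otimes>\<^bsub>H\<^esub> \<one>\<^bsub>H\<^esub>)" using one by blast
  then show ?thesis using assms by (simp add: Q_def)
qed

lemma Phi_surj: "I = carrier HZ"
proof
  show "I \<subseteq> carrier HZ" using hom_closed[OF Phi_hom] by blast
  show "carrier HZ \<subseteq> I"
  proof
    fix t assume "t \<in> carrier HZ"
    then show "t \<in> I"
      by (induction rule: HZ.tensor_induct) (rule pure_in_I I_add; assumption)+
  qed
qed

abbreviation "AO \<equiv> tensor A (op_alg Z)"

lemma kappa_hom: "\<kappa> \<in> module_hom class_ring H AO"
  by (rule alg_hom_linear[OF \<kappa>])

lemma kappa_closed [simp]: "h \<in> carrier H \<Longrightarrow> \<kappa> h \<in> carrier AO"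
  by (rule hom_closed[OF kappa_hom])

lemma right_hom: "pure_tensor A (op_alg Z) \<one>\<^bsub>A\<^esub> \<in> module_hom class_ring Z AO"
  using AO.pure_hom_right[of "\<one>\<^bsub>A\<^esub>"] by (simp add: module_hom_iff)

lemma Psi_bilinear: "bilinear H Z AO (\<lambda>h w. pure_tensor A (op_alg Z) \<one>\<^bsub>A\<^esub> w \<otimes>\<^bsub>AO\<^esub> \<kappa> h)"
  by (rule bilinear_flip[OF bilinear_compose[OF AO.TA.mult_bilinear right_hom kappa_hom]])

text \<open>The candidate inverse of \<open>\<Phi>\<close>. As the second factor is opposite,
  \<open>w\<close> on the left multiplies the \<open>Z\<close>-components of
  \<open>\<kappa> h\<close> from the right in \<open>Z\<close>, matching
  \<open>1 \<otimes> w\<close> in the canonical map.\<close>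

definition "\<Psi> = tensor_lift AO (\<lambda>h w. pure_tensor A (op_alg Z) \<one>\<^bsub>A\<^esub> w \<otimes>\<^bsub>AO\<^esub> \<kappa> h)"

lemma Psi_hom: "\<Psi> \<in> module_hom class_ring HZ AO"
  unfolding \<Psi>_def by (rule HZ.tensor_lift_hom[OF AO.tensor_module Psi_bilinear])

lemma Psi_pure: "h \<in> carrier H \<Longrightarrow> w \<in> carrier Z \<Longrightarrow>
    \<Psi> (pure_tensor H Z h w) = pure_tensor A (op_alg Z) \<one>\<^bsub>A\<^esub> w \<otimes>\<^bsub>AO\<^esub> \<kappa> h"
  unfolding \<Psi>_def by (rule HZ.tensor_lift_pure[OF AO.tensor_module Psi_bilinear])

text \<open>A substitute for multiplicativity of \<open>\<Psi>\<close>: because products in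
  \<open>Z\<close> are reversed, a right factor \<open>h \<otimes> v\<close> acts on the value by
  \<open>v\<close> from the left and by \<open>\<kappa> h\<close> from the right.\<close>

lemma Psi_mult:
  assumes "t \<in> carrier HZ" and h: "h \<in> carrier H" and v: "v \<in> carrier Z"
  shows "\<Psi> (t \<otimes>\<^bsub>HZ\<^esub> pure_tensor H Z h v) =
    pure_tensor A (op_alg Z) \<one>\<^bsub>A\<^esub> v \<otimes>\<^bsub>AO\<^esub> (\<Psi> t \<otimes>\<^bsub>AO\<^esub> \<kappa> h)"
proof (rule HZ.tensor_hom_eq[OF hom_compose[OF HZ.TA.mult_hom_right Psi_hom]
      hom_compose[OF hom_compose[OF Psi_hom AO.TA.mult_hom_right] AO.TA.mult_hom_left] _ assms(1)])
  fix h' w assume hw: "h' \<in> carrier H" "w \<in> carrier Z"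
  have p: "pure_tensor A (op_alg Z) \<one>\<^bsub>A\<^esub> (w \<otimes>\<^bsub>Z\<^esub> v) =
      pure_tensor A (op_alg Z) \<one>\<^bsub>A\<^esub> v \<otimes>\<^bsub>AO\<^esub> pure_tensor A (op_alg Z) \<one>\<^bsub>A\<^esub> w"
    using hw v by (simp add: AO.pure_mult)
  show "\<Psi> (pure_tensor H Z h' w \<otimes>\<^bsub>HZ\<^esub> pure_tensor H Z h v) =
      pure_tensor A (op_alg Z) \<one>\<^bsub>A\<^esub> v \<otimes>\<^bsub>AO\<^esub> (\<Psi> (pure_tensor H Z h' w) \<otimes>\<^bsub>AO\<^esub> \<kappa> h)"
    using hw h v by (simp add: HZ.pure_mult Psi_pure p alg_hom_mult[OF \<kappa>] AO.TA.m_assoc)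
qed (use h v in simp_all)

text \<open>Expanding \<open>\<delta> (z i j)\<close> and \<open>\<kappa>\<close> gives the double
  sum of \<open>s u_ik \<otimes> y_kl z_lj\<close>; the sum over \<open>l\<close> is
  \<open>y z = 1\<close>, which leaves \<open>s u_ij \<otimes> 1\<close>.\<close>

lemma Psi_generator:
  assumes s: "s \<in> carrier A" and t: "t \<in> carrier HZ" "\<Psi> t = pure_tensor A (op_alg Z) s \<one>\<^bsub>Z\<^esub>"
    and ij: "i < n" "j < m"
  shows "\<Psi> (t \<otimes>\<^bsub>HZ\<^esub> \<delta> (z i j)) = pure_tensor A (op_alg Z) (s \<otimes>\<^bsub>A\<^esub> u i j) \<one>\<^bsub>Z\<^esub>"
proof -
  let ?p = "pure_tensor A (op_alg Z)"
  have "\<Psi> (t \<otimes>\<^bsub>HZ\<^esub> \<delta> (z i j)) = \<Psi> (\<Oplus>\<^bsub>HZ\<^esub>l\<in>{..<n}. t \<otimes>\<^bsub>HZ\<^esub> pure_tensor H Z (a i l) (z l j))"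
    unfolding coact[OF ij] using t(1) by (simp add: HZ.TA.mult_finsum_left)
  also have "\<dots> = (\<Oplus>\<^bsub>AO\<^esub>l\<in>{..<n}. \<Psi> (t \<otimes>\<^bsub>HZ\<^esub> pure_tensor H Z (a i l) (z l j)))"
    by (rule hom_finsum[OF HZ.tensor_module AO.tensor_module Psi_hom]) (use t(1) in auto)
  also have "\<dots> = (\<Oplus>\<^bsub>AO\<^esub>l\<in>{..<n}. \<Oplus>\<^bsub>AO\<^esub>k\<in>{..<m}. ?p (s \<otimes>\<^bsub>A\<^esub> u i k) (y k l \<otimes>\<^bsub>Z\<^esub> z l j))"
  proof (intro AO.T.finsum_cong' refl)
    fix l assume "l \<in> {..<n}"
    then have l: "l < n" by simp
    show "\<Psi> (t \<otimes>\<^bsub>HZ\<^esub> pure_tensor H Z (a i l) (z l j)) = (\<Oplus>\<^bsub>AO\<^esub>k\<in>{..<m}. ?p (s \<otimes>\<^bsub>A\<^esub> u i k) (y k l \<otimes>\<^bsub>Z\<^esub> z l j))"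
      using s t by (simp add: Psi_mult \<kappa>_a[OF ij(1) l] AO.TA.mult_finsum_left AO.pure_mult)
  qed (use s in \<open>auto intro!: AO.T.finsum_closed\<close>)
  also have "\<dots> = (\<Oplus>\<^bsub>AO\<^esub>k\<in>{..<m}. \<Oplus>\<^bsub>AO\<^esub>l\<in>{..<n}. ?p (s \<otimes>\<^bsub>A\<^esub> u i k) (y k l \<otimes>\<^bsub>Z\<^esub> z l j))"
    using s by (intro AO.T.finsum_swap) auto
  also have "\<dots> = (\<Oplus>\<^bsub>AO\<^esub>k\<in>{..<m}. (if k = j then 1 else 0) \<odot>\<^bsub>AO\<^esub> ?p (s \<otimes>\<^bsub>A\<^esub> u i k) \<one>\<^bsub>Z\<^esub>)"
  proof (intro AO.T.finsum_cong' refl)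
    fix k assume "k \<in> {..<m}"
    then have k: "k < m" by simp
    have "(\<Oplus>\<^bsub>AO\<^esub>l\<in>{..<n}. ?p (s \<otimes>\<^bsub>A\<^esub> u i k) (y k l \<otimes>\<^bsub>Z\<^esub> z l j)) =
        ?p (s \<otimes>\<^bsub>A\<^esub> u i k) (\<Oplus>\<^bsub>op_alg Z\<^esub>l\<in>{..<n}. y k l \<otimes>\<^bsub>Z\<^esub> z l j)"
      using s by (intro hom_finsum[OF O.k_module_axioms AO.tensor_module AO.pure_hom_right, symmetric]) auto
    also have "\<dots> = ?p (s \<otimes>\<^bsub>A\<^esub> u i k) ((if k = j then 1 else 0) \<odot>\<^bsub>op_alg Z\<^esub> \<one>\<^bsub>op_alg Z\<^esub>)"
      unfolding op_finsum yz[OF k ij(2)] by simp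
    also have "\<dots> = (if k = j then 1 else 0) \<odot>\<^bsub>AO\<^esub> ?p (s \<otimes>\<^bsub>A\<^esub> u i k) \<one>\<^bsub>op_alg Z\<^esub>"
      using s by (intro AO.pure_smult_right) auto
    finally show "(\<Oplus>\<^bsub>AO\<^esub>l\<in>{..<n}. ?p (s \<otimes>\<^bsub>A\<^esub> u i k) (y k l \<otimes>\<^bsub>Z\<^esub> z l j)) =
        (if k = j then 1 else 0) \<odot>\<^bsub>AO\<^esub> ?p (s \<otimes>\<^bsub>A\<^esub> u i k) \<one>\<^bsub>Z\<^esub>" by simp
  qed (use s in auto)
  also have "\<dots> = ?p (s \<otimes>\<^bsub>A\<^esub> u i j) \<one>\<^bsub>Z\<^esub>"
    using s ij by (intro AO.T.finsum_delta(2)) auto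
  finally show ?thesis .
qed

lemma Psi_coaction:
  assumes "x \<in> carrier A"
  shows "\<Psi> (\<delta> (g x)) = pure_tensor A (op_alg Z) x \<one>\<^bsub>Z\<^esub>"
proof (rule A_induct[OF assms, where Q = "\<lambda>x. \<Psi> (\<delta> (g x)) = pure_tensor A (op_alg Z) x \<one>\<^bsub>Z\<^esub>"])
  have "pure_tensor A (op_alg Z) \<one>\<^bsub>A\<^esub> \<one>\<^bsub>Z\<^esub> = \<one>\<^bsub>AO\<^esub>" by (simp add: AO.tensor_one)
  then show "\<Psi> (\<delta> (g \<one>\<^bsub>A\<^esub>)) = pure_tensor A (op_alg Z) \<one>\<^bsub>A\<^esub> \<one>\<^bsub>Z\<^esub>"
    by (simp add: alg_hom_one[OF g] alg_hom_one[OF coaction] HZ.tensor_one Psi_pure alg_hom_one[OF \<kappa>])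
next
  fix s i j assume s: "s \<in> carrier A" "\<Psi> (\<delta> (g s)) = pure_tensor A (op_alg Z) s \<one>\<^bsub>Z\<^esub>" and ij: "i < n" "j < m"
  then show "\<Psi> (\<delta> (g (s \<otimes>\<^bsub>A\<^esub> u i j))) = pure_tensor A (op_alg Z) (s \<otimes>\<^bsub>A\<^esub> u i j) \<one>\<^bsub>Z\<^esub>"
    using Psi_generator[OF s(1) _ s(2) ij]
    by (simp add: alg_hom_mult[OF g] alg_hom_mult[OF coaction] g_u[OF ij])
next
  fix s t assume "s \<in> carrier A" "t \<in> carrier A" "\<Psi> (\<delta> (g s)) = pure_tensor A (op_alg Z) s \<one>\<^bsub>Z\<^esub>"
    "\<Psi> (\<delta> (g t)) = pure_tensor A (op_alg Z) t \<one>\<^bsub>Z\<^esub>"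
  then show "\<Psi> (\<delta> (g (s \<oplus>\<^bsub>A\<^esub> t))) = pure_tensor A (op_alg Z) (s \<oplus>\<^bsub>A\<^esub> t) \<one>\<^bsub>Z\<^esub>"
    by (simp add: hom_add[OF g_hom] hom_add[OF coaction_hom] hom_add[OF Psi_hom] AO.pure_add_left)
next
  fix c s assume "s \<in> carrier A" "\<Psi> (\<delta> (g s)) = pure_tensor A (op_alg Z) s \<one>\<^bsub>Z\<^esub>"
  then show "\<Psi> (\<delta> (g (c \<odot>\<^bsub>A\<^esub> s))) = pure_tensor A (op_alg Z) (c \<odot>\<^bsub>A\<^esub> s) \<one>\<^bsub>Z\<^esub>"
    by (simp add: hom_smult[OF g_hom] hom_smult[OF coaction_hom] hom_smult[OF Psi_hom] AO.pure_smult_left)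
qed

text \<open>The composite lands in \<open>A \<otimes> Z\<^sup>o\<^sup>p\<close>, which has the same
  underlying module as \<open>A \<otimes> Z\<close>, so it can be compared with the identity on pure
  tensors.\<close>

lemma Psi_Phi:
  assumes "t \<in> carrier (tensor A Z)"
  shows "\<Psi> (\<Phi> t) = t"
proof (rule AZ.tensor_hom_eq[OF hom_compose[OF Phi_hom Psi_hom] _ _ assms])
  note op = op_tensor_carrier[OF A.k_module_axioms Z.k_module_axioms]
    op_tensor_add[OF A.k_module_axioms Z.k_module_axioms]
    op_tensor_smult[OF A.k_module_axioms Z.k_module_axioms]
  show "(\<lambda>t. t) \<in> module_hom class_ring (tensor A Z) AO"
    by (simp add: module_hom_iff op)
  fix x w assume xw: "x \<in> carrier A" "w \<in> carrier Z"
  have "\<Psi> (\<Phi> (pure_tensor A Z x w)) = pure_tensor A (op_alg Z) \<one>\<^bsub>A\<^esub> w \<otimes>\<^bsub>AO\<^esub>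
      (pure_tensor A (op_alg Z) x \<one>\<^bsub>Z\<^esub> \<otimes>\<^bsub>AO\<^esub> \<kappa> \<one>\<^bsub>H\<^esub>)"
    using xw by (simp add: Phi_pure Psi_mult Psi_coaction)
  also have "\<dots> = pure_tensor A (op_alg Z) x w"
    using xw by (simp add: alg_hom_one[OF \<kappa>] AO.pure_mult)
  finally show "\<Psi> (\<Phi> (pure_tensor A Z x w)) = pure_tensor A Z x w"
    by (simp only: op_tensor_pure[OF A.k_module_axioms Z.k_module_axioms])
qed

text \<open>\<open>\<Phi>\<close> is bijective and is \<open>can\<close> after
  \<open>g \<otimes> id\<close>, so \<open>g \<otimes> id\<close> is bijective. Two flips bring
  \<open>Z\<close> to the left, where faithful flatness expects it.\<close>

lemma tensor_g_bij:
  "bij_betw (tensor_map Z Z (\<lambda>z. z) g) (carrier (tensor Z A)) (carrier ZZ)"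
proof -
  note zz = Z.k_module_axioms Z.k_module_axioms
  note za = Z.k_module_axioms A.k_module_axioms and az = A.k_module_axioms Z.k_module_axioms
  let ?g = "tensor_map Z Z g (\<lambda>z. z)"
  note gh = tensor_map_hom[OF az zz g_hom hom_id]
  have inj: "inj_on ?g (carrier (tensor A Z))"
    by (rule inj_onI) (metis Psi_Phi \<Phi>_def)
  have surj: "\<exists>s\<in>carrier (tensor A Z). ?g s = t" if t: "t \<in> carrier ZZ" for t
  proof -
    have "can t \<in> I" unfolding Phi_surj by (rule hom_closed[OF can_hom t])
    then obtain s where s: "s \<in> carrier (tensor A Z)" "can t = \<Phi> s" by blast
    then have "?g s = t" using can_inj[OF hom_closed[OF gh s(1)] t] by (simp add: \<Phi>_def)
    then show ?thesis using s by blast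
  qed
  have sw: "tensor_map Z Z (\<lambda>z. z) g t = tensor_swap Z Z (?g (tensor_swap Z A t))"
    if "t \<in> carrier (tensor Z A)" for t
    by (rule tensor_hom_ext[OF za tensor_map_hom[OF za zz hom_id g_hom]
          hom_compose[OF hom_compose[OF tensor_swap_hom[OF za] gh] tensor_swap_hom[OF zz]] _ that])
      (simp add: tensor_map_pure[OF za zz hom_id g_hom] tensor_swap_pure[OF za] tensor_swap_pure[OF zz]
        tensor_map_pure[OF az zz g_hom hom_id])
  have swb: "bij_betw (tensor_swap M N) (carrier (tensor M N)) (carrier (tensor N M))"
    if "k_module M" "k_module N" for M :: "('k, 'p, 'q) module_scheme" and N :: "('k, 'r, 's) module_scheme"
    by (rule bij_betwI[where g = "tensor_swap N M"])
      (use hom_closed[OF tensor_swap_hom] tensor_swap_swap that in blast)+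
  have "bij_betw ?g (carrier (tensor A Z)) (carrier ZZ)"
    unfolding bij_betw_def using inj surj hom_closed[OF gh] by blast
  then have "bij_betw (tensor_swap Z Z \<circ> (?g \<circ> tensor_swap Z A)) (carrier (tensor Z A)) (carrier ZZ)"
    using bij_betw_trans[OF swb[OF za]] bij_betw_trans[OF _ swb[OF zz]] by blast
  then show ?thesis by (rule bij_betw_cong[THEN iffD1, rotated]) (simp add: sw)
qed

lemma g_bij:
  fixes emb :: "'b \<Rightarrow> ('z list \<Rightarrow>\<^sub>0 'k) set"
  assumes emb: "inj_on emb (carrier A)"
  shows "bij_betw g (carrier A) (carrier Z)"
proof -
  have embZ: "inj_on (\<lambda>x. {Poly_Mapping.single [x] 1} :: ('z list \<Rightarrow>\<^sub>0 'k) set) (carrier Z)"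
  proof (rule inj_onI)
    fix x x' assume "{Poly_Mapping.single [x] 1} = {Poly_Mapping.single [x'] (1 :: 'k)}"
    then have "Poly_Mapping.keys (Poly_Mapping.single [x] (1 :: 'k)) =
        Poly_Mapping.keys (Poly_Mapping.single [x'] (1 :: 'k))" by simp
    then show "x = x'" using nontrivial by simp
  qed
  show ?thesis
    using tensor_g_bij
      faithfully_flat_inj_iff[OF ff Z.k_module_axioms A.k_module_axioms Z.k_module_axioms emb embZ g_hom]
      faithfully_flat_surj_iff[OF ff Z.k_module_axioms A.k_module_axioms Z.k_module_axioms emb embZ g_hom]
    by (simp add: bij_betw_def)
qed

end

lemma mat_inv_eqI:
  assumes "A \<in> carrier_mat n n" "B \<in> carrier_mat n n" "A * B = 1\<^sub>m n" "B * A = 1\<^sub>m n"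
  shows "invertible_mat A" "mat_inv A = B"
proof -
  show inv: "invertible_mat A"
    using assms by (auto simp: invertible_mat_def inverts_mat_def)
  note A' = mat_inv[OF assms(1) inv]
  have "mat_inv A = mat_inv A * (A * B)" using assms A'(1) by simp
  also have "\<dots> = mat_inv A * A * B" using assms A'(1) by (simp add: assoc_mult_mat[of _ n n _ n _ n])
  finally show "mat_inv A = B" using assms A'(3) by simp
qed

lemma mat_trace_mult_transpose:
  assumes "A \<in> carrier_mat m m" "B \<in> carrier_mat m m"
  shows "mat_trace (A * transpose_mat B) = (\<Sum>i<m. \<Sum>j<m. A $$ (i, j) * B $$ (i, j))"
proof -
  have "(A * transpose_mat B) $$ (i, i) = (\<Sum>j<m. A $$ (i, j) * B $$ (i, j))" if "i < m" for i
    using assms that by (simp add: scalar_prod_def atLeast0LessThan)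
  then show ?thesis using assms by (simp add: mat_trace_def)
qed

lemma mat_of_inverse_entries:
  fixes f f' :: "nat \<Rightarrow> nat \<Rightarrow> 'k::comm_ring_1"
  assumes "\<And>i j. i < m \<Longrightarrow> j < m \<Longrightarrow> (\<Sum>l<m. f i l * f' l j) = (if i = j then 1 else 0)"
  shows "mat m m (\<lambda>(i, j). f i j) * mat m m (\<lambda>(i, j). f' i j) = 1\<^sub>m m"
proof (rule eq_matI)
  fix i j assume "i < dim_row (1\<^sub>m m :: 'k mat)" "j < dim_col (1\<^sub>m m :: 'k mat)"
  then have ij: "i < m" "j < m" by simp_all
  then have "(mat m m (\<lambda>(i, j). f i j) * mat m m (\<lambda>(i, j). f' i j)) $$ (i, j) = (\<Sum>l<m. f i l * f' l j)"
    by (simp add: scalar_prod_def atLeast0LessThan)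
  then show "(mat m m (\<lambda>(i, j). f i j) * mat m m (\<lambda>(i, j). f' i j)) $$ (i, j) = 1\<^sub>m m $$ (i, j)"
    using assms[OF ij] ij by simp
qed simp_all

text \<open>Only entries with indices below \<open>m\<close> matter, so the functions found above
  may be exchanged for the entries of an actual matrix and of its inverse.\<close>

lemma (in inverse_pair) inverse_pair_cong:
  assumes "\<And>i j. i < m \<Longrightarrow> j < m \<Longrightarrow> f i j = h i j" "\<And>i j. i < m \<Longrightarrow> j < m \<Longrightarrow> f' i j = h' i j"
  shows "inverse_pair A n m e e' h h' z y"
proof -
  have form': "form_rel n m e h z" using form assms(1) by (simp add: form_rel_def)
  have ye': "(\<Oplus>k\<in>{..<n}. e' k p \<odot> y j k) = (\<Oplus>q\<in>{..<m}. h' j q \<odot> z p q)" if "j < m" "p < n" for j p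
    unfolding ye[OF that] using assms(2)[OF that(1)] by (intro finsum_cong') auto
  show ?thesis
    by (rule inverse_pair.intro[OF k_alg_axioms inverse_pair_axioms.intro])
      (rule z, rule y, rule zy, assumption+, rule yz, assumption+, rule form', rule ye', assumption+,
        rule ee', assumption+, rule e'e, assumption+, rule unit_inj, assumption)
qed

context B_bialgebra
begin

lemma galois_B_hopf:
  fixes Z :: "('k, 'z, 'y) module_scheme"
  assumes "principal_domain (class_ring :: 'k ring)" "galois_object (B_hopf E) Z \<delta>"
  shows "galois (B_hopf E) Z \<delta> n (\<lambda>i j. E $$ (i, j)) (\<lambda>i j. mat_inv E $$ (i, j)) B.gen"
proof (rule galois.intro)
  note invE = mat_inv[OF E]
  show "k_alg.form_rel (B_hopf E) n n (\<lambda>i j. E $$ (i, j)) (\<lambda>i j. E $$ (i, j)) B.gen"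
    by (rule B_hopf_form_rel)
  show "(\<Sum>l<n. E $$ (i, l) * mat_inv E $$ (l, j)) = (if i = j then 1 else 0)" if "i < n" "j < n" for i j
    by (rule mat_prod_entry[OF E(1) invE(1,2) that])
  show "(\<Sum>l<n. mat_inv E $$ (i, l) * E $$ (l, j)) = (if i = j then 1 else 0)" if "i < n" "j < n" for i j
    by (rule mat_prod_entry[OF invE(1) E(1) invE(3) that])
  show "comult (B_hopf E) \<in> module_hom class_ring (B_hopf E) (tensor (B_hopf E) (B_hopf E))"
    by (rule alg_hom_linear[OF comult_hom])
  show "counit (B_hopf E) \<in> module_hom class_ring (B_hopf E) base_algebra"
    by (rule alg_hom_linear[OF counit_hom])
qed (use assms B_hopf_alg comult_gen counit_gen in \<open>simp_all del: B.gen_eq\<close>)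

text \<open>The isomorphism is the inverse of \<open>g\<close>. For colinearity, the coaction of
  \<open>Z\<close> is carried over to \<open>B(E, F)\<close>; the result is an algebra map with the
  prescribed values on generators, so by uniqueness it is \<open>B_coaction\<close>.\<close>

lemma galois_iso:
  fixes Z :: "('k, 'z, 'y) module_scheme"
  assumes gal: "galois (B_hopf E) Z \<delta> n (\<lambda>i j. E $$ (i, j)) (\<lambda>i j. mat_inv E $$ (i, j)) B.gen"
    and F: "F \<in> carrier_mat m m" "invertible_mat F"
    and pair: "inverse_pair Z n m (\<lambda>i j. E $$ (i, j)) (\<lambda>i j. mat_inv E $$ (i, j))
      (\<lambda>i j. F $$ (i, j)) (\<lambda>i j. mat_inv F $$ (i, j)) z y"
    and coact: "\<And>i j. i < n \<Longrightarrow> j < m \<Longrightarrow>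
      \<delta> (z i j) = (\<Oplus>\<^bsub>tensor (B_hopf E) Z\<^esub>l\<in>{..<n}. pure_tensor (B_hopf E) Z (B.gen i l) (z l j))"
  shows "\<exists>\<phi>. \<phi> \<in> comodule_algebra_iso (B_hopf E) Z \<delta> (B_algebra E F) (B_coaction E F)"
proof -
  interpret P: inverse_pair Z n m "\<lambda>i j. E $$ (i, j)" "\<lambda>i j. mat_inv E $$ (i, j)"
    "\<lambda>i j. F $$ (i, j)" "\<lambda>i j. mat_inv F $$ (i, j)" z y by (rule pair)
  interpret BF: B_data n m E F by unfold_locales (rule E F)+
  let ?A = "B_algebra E F" and ?O = "op_alg Z"
  interpret H: k_alg "B_hopf E" by (rule B_hopf_alg)
  interpret O: k_alg ?O by (rule op_k_alg[OF P.k_alg_axioms])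
  interpret AO: two_algs ?A ?O ..
  interpret HA: two_algs "B_hopf E" ?A ..
  interpret HZ: two_algs "B_hopf E" Z ..
  let ?g = "presented_hom Z (\<lambda>(i, j). z i j)"
  note g = BF.B_hom[where w = z, OF P.k_alg_axioms P.z P.form P.form_transpose]
  let ?k = "\<lambda>i j. \<Oplus>\<^bsub>tensor ?A ?O\<^esub>k\<in>{..<m}. pure_tensor ?A ?O (BF.gen i k) (y k j)"
  have yO: "y i j \<in> carrier ?O" for i j by simp
  have kc: "?k i j \<in> carrier (tensor ?A ?O)" for i j
    by (intro AO.T.finsum_closed) simp
  let ?\<kappa> = "presented_hom (tensor ?A ?O) (\<lambda>(i, j). ?k i j)"
  \<comment> \<open>The generators carry the form of \<open>E\<close> to that of \<open>F\<close>,
    and \<open>y\<close> over the opposite algebra carries \<open>F\<close> back to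
    \<open>E\<close>. Their product over the tensor product therefore satisfies the relations of
    \<open>B(E, E)\<close>.\<close>
  note k = B.B_hom[where w = ?k, OF AO.tensor_alg kc
      AO.form_rel_tensor[where u = BF.gen and v = y, OF BF.gen_closed yO BF.gen_relations(1) P.op_form]
      AO.form_rel_tensor_transpose[where u = BF.gen and v = y, OF BF.gen_closed yO BF.gen_relations(2)
        P.op_form_transpose]]
  have kappa: "?\<kappa> \<in> alg_hom (B_hopf E) (tensor ?A ?O)"
    using k(1) by (simp add: alg_hom_iff module_hom_iff)
  have "comparison (B_hopf E) Z \<delta> n (\<lambda>i j. E $$ (i, j)) (\<lambda>i j. mat_inv E $$ (i, j)) B.gen ?A m z y
      BF.gen ?g ?\<kappa>"
  proof (rule comparison.intro[OF gal BF.B_algebra_alg comparison_axioms.intro])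
    fix Q t
    assume t: "t \<in> carrier (B_hopf E)" and Q: "Q \<one>\<^bsub>B_hopf E\<^esub>"
      "\<And>s i j. s \<in> carrier (B_hopf E) \<Longrightarrow> i < n \<Longrightarrow> j < n \<Longrightarrow> Q s \<Longrightarrow> Q (s \<otimes>\<^bsub>B_hopf E\<^esub> B.gen i j)"
      "\<And>s t. s \<in> carrier (B_hopf E) \<Longrightarrow> t \<in> carrier (B_hopf E) \<Longrightarrow> Q s \<Longrightarrow> Q t \<Longrightarrow> Q (s \<oplus>\<^bsub>B_hopf E\<^esub> t)"
      "\<And>c s. s \<in> carrier (B_hopf E) \<Longrightarrow> Q s \<Longrightarrow> Q (c \<odot>\<^bsub>B_hopf E\<^esub> s)"
    show "Q t"
      by (rule B.B_induct[where Q = Q]) (use t Q B.gen_eq in \<open>simp_all only: B_hopf_simps\<close>)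
  next
    fix Q t
    assume t: "t \<in> carrier ?A" and Q: "Q \<one>\<^bsub>?A\<^esub>"
      "\<And>s i j. s \<in> carrier ?A \<Longrightarrow> i < n \<Longrightarrow> j < m \<Longrightarrow> Q s \<Longrightarrow> Q (s \<otimes>\<^bsub>?A\<^esub> BF.gen i j)"
      "\<And>s t. s \<in> carrier ?A \<Longrightarrow> t \<in> carrier ?A \<Longrightarrow> Q s \<Longrightarrow> Q t \<Longrightarrow> Q (s \<oplus>\<^bsub>?A\<^esub> t)"
      "\<And>c s. s \<in> carrier ?A \<Longrightarrow> Q s \<Longrightarrow> Q (c \<odot>\<^bsub>?A\<^esub> s)"
    show "Q t"
      by (rule BF.B_induct[where Q = Q]) (use t Q BF.gen_eq in simp_all)
  next
    show "?\<kappa> (B.gen i j) = ?k i j" if "i < n" "j < n" for i j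
      using k(2)[OF that] that by simp
  next
    show "?g (BF.gen i j) = z i j" if "i < n" "j < m" for i j
      using g(2)[OF that] that by simp
  qed (fact coact P.zy P.yz g(1) kappa | simp)+
  note comp = this
  \<comment> \<open>Elements of \<open>B(E, F)\<close> are sets of finitely supported functions on
    words in pairs of naturals. Renaming each word to a constant list whose length is its code
    places them in the reference type.\<close>
  define emb :: "((nat \<times> nat) list \<Rightarrow>\<^sub>0 'k) set \<Rightarrow> ('z list \<Rightarrow>\<^sub>0 'k) set"
    where "emb = (`) (map_keys (\<lambda>w. replicate (to_nat w) undefined))"
  have "inj emb" unfolding emb_def by (rule inj_image_map_keys[OF inj_words])
  then have "inj_on emb (carrier ?A)" by (rule inj_on_subset) simp
  from comparison.g_bij[OF comp this] have bij: "bij_betw ?g (carrier ?A) (carrier Z)" .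
  let ?\<phi> = "inv_into (carrier ?A) ?g"
  have phi: "?\<phi> \<in> alg_hom Z ?A"
    by (rule alg_hom_inverse[OF BF.B_algebra_alg P.k_alg_axioms g(1) bij])
  have phi_bij: "bij_betw ?\<phi> (carrier Z) (carrier ?A)" by (rule bij_betw_inv_into[OF bij])
  have phi_z: "?\<phi> (z i j) = B_gen E F i j" if "i < n" "j < m" for i j
    unfolding g(2)[OF that, symmetric]
    by (rule bij_betw_inv_into_left[OF bij BF.B_gen_closed[OF that]])
  have id: "(\<lambda>h. h) \<in> alg_hom (B_hopf E) (B_hopf E)" by (simp add: alg_hom_iff hom_id)
  note tm = tensor_map_alg_hom[OF B_hopf_alg P.k_alg_axioms B_hopf_alg BF.B_algebra_alg id phi]
  note mods = H.k_module_axioms P.k_module_axioms H.k_module_axioms BF.BA.k_module_axioms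
  let ?t = "tensor_map (B_hopf E) ?A (\<lambda>h. h) ?\<phi>"
  have comod: "B_coaction E F t = ?t (\<delta> (?g t))" if t: "t \<in> carrier ?A" for t
    unfolding B_coaction_def
  proof (rule BF.B_presented_hom_unique[OF HA.tensor_alg
        alg_hom_compose[OF g(1) alg_hom_compose[OF galois.coaction[OF gal] tm]] _ t])
    fix i j assume ij: "i < n" "j < m"
    have "?t (\<delta> (?g (B_gen E F i j))) = ?t (\<delta> (z i j))" unfolding g(2)[OF ij] ..
    also have "\<dots> = (\<Oplus>\<^bsub>tensor (B_hopf E) ?A\<^esub>l\<in>{..<n}. ?t (pure_tensor (B_hopf E) Z (B.gen i l) (z l j)))"
      unfolding coact[OF ij]
      by (rule hom_finsum[OF HZ.tensor_module HA.tensor_module alg_hom_linear[OF tm]]) simp_all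
    also have "\<dots> = (\<Oplus>\<^bsub>tensor (B_hopf E) ?A\<^esub>l\<in>{..<n}. pure_tensor (B_hopf E) ?A (B_gen E E i l) (B_gen E F l j))"
    proof (intro HA.T.finsum_cong' refl)
      fix l assume "l \<in> {..<n}"
      then have l: "l < n" by simp
      show "?t (pure_tensor (B_hopf E) Z (B.gen i l) (z l j)) =
          pure_tensor (B_hopf E) ?A (B_gen E E i l) (B_gen E F l j)"
        using ij l
        by (simp add: tensor_map_pure[OF mods hom_id alg_hom_linear[OF phi]] B.B_gen_closed phi_z)
    qed (use ij in \<open>simp add: B.B_gen_closed BF.B_gen_closed\<close>)
    finally show "?t (\<delta> (?g (B_gen E F i j))) = (case (i, j) of (i, j) \<Rightarrow>
        \<Oplus>\<^bsub>tensor (B_hopf E) ?A\<^esub>l\<in>{..<dim_row E}. pure_tensor (B_hopf E) ?A (B_gen E E i l) (B_gen E F l j))"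
      using E(1) by simp
  qed
  have "B_coaction E F (?\<phi> x) = ?t (\<delta> x)" if x: "x \<in> carrier Z" for x
    using comod[of "?\<phi> x"] bij_betw_inv_into_right[OF bij x] bij_betwE[OF phi_bij] x by simp
  then have "?\<phi> \<in> comodule_algebra_iso (B_hopf E) Z \<delta> ?A (B_coaction E F)"
    using phi phi_bij by (simp add: comodule_algebra_iso_def)
  then show ?thesis by blast
qed

end

theorem theorem4:
  fixes n :: nat
    and E :: "'k::comm_ring_1 mat"
    and Z :: "('k, 'z) module"
    and \<delta> :: "'z \<Rightarrow> (((nat \<times> nat) list \<Rightarrow>\<^sub>0 'k) set \<times> 'z \<Rightarrow>\<^sub>0 'k) set"
  assumes "principal_domain (class_ring :: 'k ring)"
    and "n \<ge> 2"
    and "E \<in> carrier_mat n n" and "invertible_mat E"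
    and "galois_object (B_hopf E) Z \<delta>"
  shows "\<exists>m F. m \<ge> 2 \<and> F \<in> carrier_mat m m \<and> invertible_mat F \<and>
    mat_trace (mat_inv F * transpose_mat F) = mat_trace (mat_inv E * transpose_mat E) \<and>
    (\<exists>\<phi>. \<phi> \<in> comodule_algebra_iso (B_hopf E) Z \<delta> (B_algebra E F) (B_coaction E F))"
proof -
  interpret B_bialgebra n E by unfold_locales (rule assms)+
  let ?e = "\<lambda>i j. E $$ (i, j)" and ?e' = "\<lambda>i j. mat_inv E $$ (i, j)"
  have gal: "galois (B_hopf E) Z \<delta> n ?e ?e' B.gen"
    by (rule galois_B_hopf[OF assms(1,5)])
  obtain m f f' z y where pair: "inverse_pair Z n m ?e ?e' f f' z y"
    and coact: "\<And>i j. i < n \<Longrightarrow> j < m \<Longrightarrow>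
      \<delta> (z i j) = (\<Oplus>\<^bsub>tensor (B_hopf E) Z\<^esub>l\<in>{..<n}. pure_tensor (B_hopf E) Z (B.gen i l) (z l j))"
  proof (rule galois.inverse_pair_exists[OF gal])
    fix m f f' z y
    assume "inverse_pair Z n m ?e ?e' f f' z y" "\<And>i j. i < n \<Longrightarrow> j < m \<Longrightarrow>
      \<delta> (z i j) = (\<Oplus>\<^bsub>tensor (B_hopf E) Z\<^esub>l\<in>{..<n}. pure_tensor (B_hopf E) Z (B.gen i l) (z l j))"
    then show thesis by (rule that)
  qed
  interpret P: inverse_pair Z n m ?e ?e' f f' z y by (rule pair)
  define F where "F = mat m m (\<lambda>(i, j). f i j)"
  define F' where "F' = mat m m (\<lambda>(i, j). f' i j)"
  have carrier: "F \<in> carrier_mat m m" "F' \<in> carrier_mat m m" by (simp_all add: F_def F'_def)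
  have "F * F' = 1\<^sub>m m" "F' * F = 1\<^sub>m m"
    unfolding F_def F'_def by (rule mat_of_inverse_entries; rule P.ff' P.f'f; assumption)+
  note inv = mat_inv_eqI[OF carrier this]
  have pair': "inverse_pair Z n m ?e ?e' (\<lambda>i j. F $$ (i, j)) (\<lambda>i j. mat_inv F $$ (i, j)) z y"
    unfolding inv(2) by (rule P.inverse_pair_cong) (simp_all add: F_def F'_def)
  have "m \<ge> 2"
  proof (rule B_matrix_rank_ge_2[OF P.k_alg_axioms _ galois.nontrivial[OF gal] assms(2) P.ee' P.ff' P.z P.form_transpose])
    show "c = 0" if "c \<odot>\<^bsub>Z\<^esub> \<one>\<^bsub>Z\<^esub> = \<zero>\<^bsub>Z\<^esub>" for c
      using P.unit_inj[of c 0] that by simp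
  qed
  moreover have "mat_trace (mat_inv F * transpose_mat F) = mat_trace (mat_inv E * transpose_mat E)"
    using P.trace_eq
    by (simp add: inv(2) mat_trace_mult_transpose[OF carrier(2,1)]
        mat_trace_mult_transpose[OF mat_inv_carrier[OF assms(3,4)] assms(3)])
      (simp add: F_def F'_def)
  ultimately show ?thesis
    using galois_iso[OF gal carrier(1) inv(1) pair' coact] carrier(1) inv(1) by blast
qed

end
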